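(* Let $\mathbb{K}$ be a field, $R$ a Frobenius-separable $\mathbb{K}$-algebra with idempotent Frobenius system $(\psi,e^{(1)}\otimes e^{(2)})$, $\Lambda$ a non-empty finite set, $X$ a finite set, $\deg\colon X\to G$ a map, and $\sigma=\{\sigma^{ab}_{cd}\}_{a,b,c,d\in X}$ a family in $M_\Lambda(R)$ such that $\sigma^{ab}_{cd}(\lambda)\in Z(R)$ for all $\lambda\in\Lambda$, $a,b,c,d\in X$, and such that $\lambda\deg(d)\deg(b)\neq\lambda\deg(c)\deg(a)$ implies $\sigma^{bd}_{ac}(\lambda)=0$. Let $A_\sigma$, $\mathfrak{A}(w_\sigma)$ be the weak bialgebras and $\Phi\colon\mathfrak{A}(w_\sigma)\to A_\sigma$ the homomorphism described in the context. If $\sigma$ is rigid, then the pair $(A_\sigma,\Phi)$ is the Hopf closure of $\mathfrak{A}(w_\sigma)$.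
   Context: Algebras are associative and unital, and algebra homomorphisms are unital. $Z(R)$ is the center of $R$. WEAK BIALGEBRAS. A weak bialgebra is a $\mathbb{K}$-algebra $B$ with a $\mathbb{K}$-coalgebra structure $\Delta(a)=a_{(1)}\otimes a_{(2)}$, $\varepsilon$ such that $\Delta(ab)=\Delta(a)\Delta(b)$; $(\Delta(1)\otimes1)(1\otimes\Delta(1))=1_{(1)}\otimes1_{(2)}\otimes1_{(3)}=(1\otimes\Delta(1))(\Delta(1)\otimes1)$; $\varepsilon(ab_{(1)})\varepsilon(b_{(2)}c)=\varepsilon(abc)=\varepsilon(ab_{(2)})\varepsilon(b_{(1)}c)$. A weak bialgebra homomorphism is a map that is both a $\mathbb{K}$-algebra and a $\mathbb{K}$-coalgebra homomorphism. Put $\varepsilon_s(a)=1_{(1)}\varepsilon(a1_{(2)})$, $\varepsilon_t(a)=\varepsilon(1_{(1)}a)1_{(2)}$. A weak Hopf algebra is a weak bialgebra $H$ with a $\mathbb{K}$-linear map $S\colon H\to H$ (antipode, unique if it exists) such that $S(h_{(1)})h_{(2)}=\varepsilon_s(h)$, $h_{(1)}S(h_{(2)})=\varepsilon_t(h)$, $S(h_{(1)})h_{(2)}S(h_{(3)})=S(h)$. ANTIPODE OF A HOMOMORPHISM. For a weak bialgebra $H$, a $\mathbb{K}$-algebra $A$ and a $\mathbb{K}$-algebra homomorphism $f^+\colon H\to A$, a $\mathbb{K}$-linear map $f^-\colon H\to A$ is an antipode of $f^+$ if, for the convolution product $(f\star g)(c)=f(c_{(1)})g(c_{(2)})$ on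 $\mathrm{Hom}_{\mathbb{K}}(H,A)$: $f^-\star f^+=f^+\circ\varepsilon_s$, $f^+\star f^-=f^+\circ\varepsilon_t$, $f^+\star f^-\star f^+=f^+$, $f^-\star f^+\star f^-=f^-$. (It is unique if it exists.) HOPF CLOSURE. A Hopf closure of a weak bialgebra $H$ is a pair $(\overline{H},\iota)$ of a weak Hopf algebra $\overline{H}$ and a weak bialgebra homomorphism $\iota\colon H\to\overline{H}$ such that for any weak bialgebra $B$ and any weak bialgebra homomorphism $f^+\colon H\to B$ with an antipode $f^-$, there exists a unique weak bialgebra homomorphism $F\colon\overline{H}\to B$ with $F\circ\iota=f^+$. ($\overline{H}$ is unique up to isomorphism if it exists.) FROBENIUS-SEPARABLE ALGEBRAS. A $\mathbb{K}$-algebra $L$ is Frobenius-separable with idempotent Frobenius system $(\psi,e^{(1)}\otimes e^{(2)})$ if $\psi\colon L\to\mathbb{K}$ is $\mathbb{K}$-linear, $e^{(1)}\otimes e^{(2)}\in L\otimes_{\mathbb{K}}L$ (implicit sum), $l=\psi(le^{(1)})e^{(2)}=e^{(1)}\psi(e^{(2)}l)$ for all $l\in L$, and $e^{(1)}e^{(2)}=1_L$. LEFT BIALGEBROIDS AND WEAK BIALGEBRAS. A left bialgebroid is $(A,L,s_L,t_L,\Delta_L,\pi_L)$ where $s_L\colon L\to A$, $t_L\colon L^{op}\to A$ are $\mathbb{K}$-algebra homomorphisms with commuting images, $A$ is an $(L,L)$-bimodule by $l\cdot a=s_L(l)a$, $a\cdot l=t_L(l)a$, and $(A,\Delta_L,\pi_L)$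 is a comonoid in $(L,L)$-bimodules such that, with $\Delta_L(a)=a_{[1]}\otimes a_{[2]}\in A\otimes_LA$: $a_{[1]}t_L(l)\otimes a_{[2]}=a_{[1]}\otimes a_{[2]}s_L(l)$, $\Delta_L$ is unital and multiplicative, $\pi_L(1_A)=1_L$, $\pi_L(as_L(\pi_L(b)))=\pi_L(ab)=\pi_L(at_L(\pi_L(b)))$. If $L$ has an idempotent Frobenius system $(\psi_L,e_L^{(1)}\otimes e_L^{(2)})$, then $A$ is a weak bialgebra with $\Delta(a)=t_L(e_L^{(1)})a_{[1]}\otimes s_L(e_L^{(2)})a_{[2]}$ and $\varepsilon=\psi_L\circ\pi_L$ (known). NOTATION. $M_\Lambda(R)$ is the $\mathbb{K}$-algebra of maps $\Lambda\to R$ (pointwise). $r_M$ is the constant map with value $r\in R$; $\delta_\lambda(\mu)=\delta_{\lambda,\mu}$. $M_\Lambda(R)$ carries the idempotent Frobenius system $f\mapsto\sum_{\lambda}\psi(f(\lambda))$, $\sum_{\lambda}e^{(1)}_M\delta_\lambda\otimes e^{(2)}_M\delta_\lambda$; with it, all left bialgebroids over $M_\Lambda(R)$ below are regarded as weak bialgebras. $G$ is the opposite group of the symmetric group on $\Lambda$, acting on the right on $\Lambda$ by $\lambda\alpha=\alpha(\lambda)$. $T_\alpha(f)(\lambda)=f(\lambda\alpha)$ for $\alpha\in G$, $f\in M_\Lambda(R)$. THE LEFT BIALGEBROID $A_\sigma$. Let $\Lambda X=(M_\Lambda(R)\otimes_{\mathbb{K}}M_\Lambda(R)^{op})\sqcup\{L_{ab}\}_{a,b\in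 X}\sqcup\{(L^{-1})_{ab}\}_{a,b\in X}$ and $\mathbb{K}\langle\Lambda X\rangle$ the free $\mathbb{K}$-algebra on it, with empty word $\emptyset$. $A_\sigma=\mathbb{K}\langle\Lambda X\rangle/I_\sigma$, $I_\sigma$ being the two-sided ideal generated by (write $1=1_{M_\Lambda(R)}$): (1) the elements identifying addition, scalar multiplication and multiplication of elements of $M_\Lambda(R)\otimes_{\mathbb{K}}M_\Lambda(R)^{op}$ in the free algebra with those in $M_\Lambda(R)\otimes_{\mathbb{K}}M_\Lambda(R)^{op}$; (2) $\sum_{c}L_{ac}(L^{-1})_{cb}-\delta_{a,b}\emptyset$, $\sum_{c}(L^{-1})_{ac}L_{cb}-\delta_{a,b}\emptyset$; (3) $(T_{\deg(a)}(f)\otimes1)L_{ab}-L_{ab}(f\otimes1)$, $(1\otimes T_{\deg(b)}(f))L_{ab}-L_{ab}(1\otimes f)$, $(f\otimes1)(L^{-1})_{ab}-(L^{-1})_{ab}(T_{\deg(b)}(f)\otimes1)$, $(1\otimes f)(L^{-1})_{ab}-(L^{-1})_{ab}(1\otimes T_{\deg(a)}(f))$; (4) $\sum_{x,y\in X}(\sigma^{xy}_{ac}\otimes1)L_{yd}L_{xb}-\sum_{x,y\in X}(1\otimes\sigma^{bd}_{xy})L_{cy}L_{ax}$; (5) $\emptyset-1\otimes1$; for all $a,b,c,d\in X$, $f\in M_\Lambda(R)$. It is a left bialgebroid over $M_\Lambda(R)$ with $s(f)=f\otimes1+I_\sigma$, $t(f)=1\otimes f+I_\sigma$; multiplicative comultiplication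 induced by $f\otimes g\mapsto s(f)\otimes t(g)$, $L_{ab}\mapsto\sum_cL_{ac}\otimes L_{cb}$, $(L^{-1})_{ab}\mapsto\sum_c(L^{-1})_{cb}\otimes(L^{-1})_{ac}$; and $\pi(a)=\chi(a)(1)$, where $\chi\colon A_\sigma\to\mathrm{End}_{\mathbb{K}}(M_\Lambda(R))$ is the algebra homomorphism with $\chi(f\otimes g)(h)=fhg$, $\chi(L_{ab})=\delta_{a,b}T_{\deg(a)}$, $\chi((L^{-1})_{ab})=\delta_{a,b}T_{\deg(a)^{-1}}$. RIGIDITY. $\sigma$ is rigid if for any $a,b\in X$ there exist $x_{ab},y_{ab}\in A_\sigma$ such that for all $a,b\in X$ (classes mod $I_\sigma$) $\sum_c(L^{-1})_{cb}x_{ac}=\sum_cx_{cb}(L^{-1})_{ac}=\sum_cL_{cb}y_{ac}=\sum_cy_{cb}L_{ac}=\delta_{a,b}1_{A_\sigma}$. THE LEFT BIALGEBROID $\mathfrak{A}(w_\sigma)$. Let $Q=\Lambda\times X$ with $\mathfrak{s}(\lambda,x)=\lambda$, $\mathfrak{t}(\lambda,x)=\lambda\deg(x)$; $Q^{(0)}=\Lambda$ (with $\mathfrak{s}=\mathfrak{t}=\mathrm{id}$), $Q^{(1)}=Q$, $Q^{(m)}=\{(q_1,\dots,q_m)\in Q^m\mid\mathfrak{t}(q_i)=\mathfrak{s}(q_{i+1})\}$ with $\mathfrak{s}(q)=\mathfrak{s}(q_1)$, $\mathfrak{t}(q)=\mathfrak{t}(q_m)$. Put $\mathbf{w}^{(\lambda,a),(\lambda',b)}_{(\mu,c),(\mu',d)}=\delta_{\lambda,\mu}\sigma^{ba}_{dc}(\lambda)$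 for $((\lambda,a),(\lambda',b)),((\mu,c),(\mu',d))\in Q^{(2)}$. $\mathfrak{G}(Q)$ is the $\mathbb{K}$-algebra with basis $\mathbf{e}^{p}_{q}$ ($p,q\in Q^{(m)}$, $m\ge0$), product $\mathbf{e}^{p}_{q}\mathbf{e}^{p'}_{q'}=\delta_{\mathfrak{t}(p),\mathfrak{s}(p')}\delta_{\mathfrak{t}(q),\mathfrak{s}(q')}\mathbf{e}^{pp'}_{qq'}$ (concatenation, elements of $\Lambda$ being trivial paths), unit $\sum_{\lambda,\mu}\mathbf{e}^{\lambda}_{\mu}$. $\mathfrak{A}(w_\sigma)=\mathfrak{H}(Q)/\mathfrak{I}_{\mathbf{w}}$ with $\mathfrak{H}(Q)=R\otimes_{\mathbb{K}}R^{op}\otimes_{\mathbb{K}}\mathfrak{G}(Q)$ and $\mathfrak{I}_{\mathbf{w}}$ the two-sided ideal generated by $\sum_{(x,y)\in Q^{(2)}}\mathbf{w}^{x,y}_{a,b}\otimes1_R\otimes\mathbf{e}^{x}_{c}\mathbf{e}^{y}_{d}-\sum_{(x,y)\in Q^{(2)}}1_R\otimes\mathbf{w}^{c,d}_{x,y}\otimes\mathbf{e}^{a}_{x}\mathbf{e}^{b}_{y}$, $(a,b),(c,d)\in Q^{(2)}$. It is a left bialgebroid over $M_\Lambda(R)$ with (classes mod $\mathfrak{I}_{\mathbf{w}}$) $s(f)=\sum_{\lambda,\mu}f(\lambda)\otimes1_R\otimes\mathbf{e}^{\lambda}_{\mu}$, $t(f)=\sum_{\lambda,\mu}1_R\otimes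 f(\lambda)\otimes\mathbf{e}^{\mu}_{\lambda}$, comultiplication $r\otimes r'\otimes\mathbf{e}^{p}_{q}\mapsto\sum_{u\in Q^{(m)}}(r\otimes1_R\otimes\mathbf{e}^{p}_{u})\otimes(1_R\otimes r'\otimes\mathbf{e}^{u}_{q})$, and $\pi(r\otimes r'\otimes\mathbf{e}^{p}_{q})=\delta_{p,q}(rr')_M\delta_{\mathfrak{s}(q)}$. THE MAP $\Phi$. $\Phi\colon\mathfrak{A}(w_\sigma)\to A_\sigma$ is the $\mathbb{K}$-algebra homomorphism with $\Phi(r\otimes r'\otimes\mathbf{e}^{p}_{q}+\mathfrak{I}_{\mathbf{w}})=(r_M\otimes r'_M)(\delta_{\mathfrak{s}(p)}\otimes\delta_{\mathfrak{s}(q)})L_{x_1y_1}\cdots L_{x_my_m}+I_\sigma$ for $p=((\lambda_i,x_i))_{i=1}^m$, $q=((\mu_i,y_i))_{i=1}^m\in Q^{(m)}$ (for $m=0$ the product of $L$'s is empty). *)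

theory Defs
  imports "HOL-Algebra.Module" "HOL-Algebra.QuotRing"
begin

section \<open>Algebras over a field and quotients\<close>

text \<open>The locale \<^locale>\<open>algebra\<close> of HOL-Algebra requires commutativity; the algebras here are
  associative and unital, but not commutative.\<close>

locale k_algebra = module K A + K?: field K + A?: ring A
  for K :: "('k, 'm) ring_scheme" (structure) and A :: "('k, 'a, 'z) module_scheme" (structure) +
  assumes smult_mult_left:
      "\<lbrakk>k \<in> carrier K; x \<in> carrier A; y \<in> carrier A\<rbrakk>
        \<Longrightarrow> (k \<odot>\<^bsub>A\<^esub> x) \<otimes>\<^bsub>A\<^esub> y = k \<odot>\<^bsub>A\<^esub> (x \<otimes>\<^bsub>A\<^esub> y)"
    and smult_mult_right:
      "\<lbrakk>k \<in> carrier K; x \<in> carrier A; y \<in> carrier A\<rbrakk>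
        \<Longrightarrow> x \<otimes>\<^bsub>A\<^esub> (k \<odot>\<^bsub>A\<^esub> y) = k \<odot>\<^bsub>A\<^esub> (x \<otimes>\<^bsub>A\<^esub> y)"

definition op_alg :: "('k, 'a, 'z) module_scheme \<Rightarrow> ('k, 'a, 'z) module_scheme" where
  "op_alg A = A\<lparr>mult := (\<lambda>x y. y \<otimes>\<^bsub>A\<^esub> x)\<rparr>"

definition ring_center :: "('a, 'm) ring_scheme \<Rightarrow> 'a set" where
  "ring_center R = {z \<in> carrier R. \<forall>r \<in> carrier R. z \<otimes>\<^bsub>R\<^esub> r = r \<otimes>\<^bsub>R\<^esub> z}"

text \<open>Used for two-sided ideals \<open>N\<close> of an algebra, and also for mere submodules \<open>N\<close>, in which
  case only the module part of the result is meaningful.\<close>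

definition quot_alg :: "('k, 'a, 'z) module_scheme \<Rightarrow> 'a set \<Rightarrow> ('k, 'a set) module" where
  "quot_alg A N = ring.extend (A Quot N)
     (module.fields (\<lambda>k C. \<Union>x\<in>C. N +>\<^bsub>A\<^esub> (k \<odot>\<^bsub>A\<^esub> x)))"

text \<open>The map on cosets induced by a map \<open>h\<close> that is constant on every coset.\<close>

definition induced :: "('a \<Rightarrow> 'b) \<Rightarrow> 'a set \<Rightarrow> 'b" where
  "induced h C = the_elem (h ` C)"

context
  fixes K :: "('k, 'm) ring_scheme"
begin

definition scalars :: "('k, 'k) module" where
  "scalars = \<lparr>carrier = carrier K, mult = mult K, one = one K, zero = zero K, add = add K,
              smult = mult K\<rparr>"

definition lin_maps ::
  "('k, 'a, 'y) module_scheme \<Rightarrow> ('k, 'b, 'z) module_scheme \<Rightarrow> ('a \<Rightarrow> 'b) set" where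
  "lin_maps M N = {f \<in> carrier M \<rightarrow> carrier N.
     (\<forall>x \<in> carrier M. \<forall>y \<in> carrier M. f (x \<oplus>\<^bsub>M\<^esub> y) = f x \<oplus>\<^bsub>N\<^esub> f y) \<and>
     (\<forall>k \<in> carrier K. \<forall>x \<in> carrier M. f (k \<odot>\<^bsub>M\<^esub> x) = k \<odot>\<^bsub>N\<^esub> f x)}"

definition alg_homs ::
  "('k, 'a, 'y) module_scheme \<Rightarrow> ('k, 'b, 'z) module_scheme \<Rightarrow> ('a \<Rightarrow> 'b) set" where
  "alg_homs A B = ring_hom A B \<inter> lin_maps A B"

definition submod_gen :: "('k, 'a, 'z) module_scheme \<Rightarrow> 'a set \<Rightarrow> 'a set" where
  "submod_gen M S = \<Inter>{N. submodule N K M \<and> S \<subseteq> N}"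

text \<open>The algebra with basis \<open>S\<close>, realised on the finitely supported functions \<open>S \<rightarrow> K\<close>.  The
  product of basis elements \<open>y\<close>, \<open>z\<close> is the basis element \<open>x\<close> if \<open>m y z = Some x\<close>, and zero if
  \<open>m y z = None\<close>; the unit is the sum of the basis elements in the finite set \<open>U\<close>.\<close>

definition basis_alg ::
  "'s set \<Rightarrow> ('s \<Rightarrow> 's \<Rightarrow> 's option) \<Rightarrow> 's set \<Rightarrow> ('k, 's \<Rightarrow> 'k) module" where
  "basis_alg S m U =
    \<lparr>carrier = {f. (\<forall>x. f x \<in> carrier K) \<and> finite {x. f x \<noteq> \<zero>\<^bsub>K\<^esub>} \<and> (\<forall>x. x \<notin> S \<longrightarrow> f x = \<zero>\<^bsub>K\<^esub>)},
     mult = (\<lambda>f g x. finsum K (\<lambda>(y, z). f y \<otimes>\<^bsub>K\<^esub> g z)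
       {(y, z). f y \<noteq> \<zero>\<^bsub>K\<^esub> \<and> g z \<noteq> \<zero>\<^bsub>K\<^esub> \<and> m y z = Some x}),
     one = (\<lambda>x. if x \<in> U then \<one>\<^bsub>K\<^esub> else \<zero>\<^bsub>K\<^esub>),
     zero = (\<lambda>x. \<zero>\<^bsub>K\<^esub>),
     add = (\<lambda>f g x. f x \<oplus>\<^bsub>K\<^esub> g x),
     smult = (\<lambda>k f x. k \<otimes>\<^bsub>K\<^esub> f x)\<rparr>"

definition basis_elt :: "'s \<Rightarrow> 's \<Rightarrow> 'k" where
  "basis_elt s = (\<lambda>x. if x = s then \<one>\<^bsub>K\<^esub> else \<zero>\<^bsub>K\<^esub>)"

definition lin_ext :: "('k, 'v, 'z) module_scheme \<Rightarrow> ('s \<Rightarrow> 'v) \<Rightarrow> ('s \<Rightarrow> 'k) \<Rightarrow> 'v" where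
  "lin_ext V \<beta> f = (\<Oplus>\<^bsub>V\<^esub>x \<in> {x. f x \<noteq> \<zero>\<^bsub>K\<^esub>}. f x \<odot>\<^bsub>V\<^esub> \<beta> x)"


section \<open>Tensor products\<close>

text \<open>\<open>A \<otimes>\<^sub>K B\<close> is the free module on \<open>A \<times> B\<close> modulo the submodule spanned by the bilinearity
  relations.  The free module carries the product induced from that of \<open>A \<times> B\<close>, which descends to
  the product \<open>(a \<otimes> b)(a' \<otimes> b') = aa' \<otimes> bb'\<close> of the tensor product.\<close>

definition pair_alg ::
  "('k, 'a, 'y) module_scheme \<Rightarrow> ('k, 'b, 'z) module_scheme \<Rightarrow> ('k, ('a \<times> 'b) \<Rightarrow> 'k) module" where
  "pair_alg A B = basis_alg (carrier A \<times> carrier B)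
     (\<lambda>(a, b) (a', b'). Some (a \<otimes>\<^bsub>A\<^esub> a', b \<otimes>\<^bsub>B\<^esub> b')) {(\<one>\<^bsub>A\<^esub>, \<one>\<^bsub>B\<^esub>)}"

definition bilin_rels ::
  "('k, 'a, 'y) module_scheme \<Rightarrow> ('k, 'b, 'z) module_scheme \<Rightarrow> (('a \<times> 'b) \<Rightarrow> 'k) set" where
  "bilin_rels A B = submod_gen (pair_alg A B)
    ({basis_elt (a \<oplus>\<^bsub>A\<^esub> a', b) \<ominus>\<^bsub>pair_alg A B\<^esub> (basis_elt (a, b) \<oplus>\<^bsub>pair_alg A B\<^esub> basis_elt (a', b)) |
        a a' b. a \<in> carrier A \<and> a' \<in> carrier A \<and> b \<in> carrier B} \<union>
     {basis_elt (a, b \<oplus>\<^bsub>B\<^esub> b') \<ominus>\<^bsub>pair_alg A B\<^esub> (basis_elt (a, b) \<oplus>\<^bsub>pair_alg A B\<^esub> basis_elt (a, b')) |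
        a b b'. a \<in> carrier A \<and> b \<in> carrier B \<and> b' \<in> carrier B} \<union>
     {basis_elt (k \<odot>\<^bsub>A\<^esub> a, b) \<ominus>\<^bsub>pair_alg A B\<^esub> (k \<odot>\<^bsub>pair_alg A B\<^esub> basis_elt (a, b)) |
        k a b. k \<in> carrier K \<and> a \<in> carrier A \<and> b \<in> carrier B} \<union>
     {basis_elt (a, k \<odot>\<^bsub>B\<^esub> b) \<ominus>\<^bsub>pair_alg A B\<^esub> (k \<odot>\<^bsub>pair_alg A B\<^esub> basis_elt (a, b)) |
        k a b. k \<in> carrier K \<and> a \<in> carrier A \<and> b \<in> carrier B})"

definition tensor ::
  "('k, 'a, 'y) module_scheme \<Rightarrow> ('k, 'b, 'z) module_scheme \<Rightarrow> ('k, (('a \<times> 'b) \<Rightarrow> 'k) set) module" where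
  "tensor A B = quot_alg (pair_alg A B) (bilin_rels A B)"

definition tens ::
  "('k, 'a, 'y) module_scheme \<Rightarrow> ('k, 'b, 'z) module_scheme \<Rightarrow> 'a \<Rightarrow> 'b \<Rightarrow> (('a \<times> 'b) \<Rightarrow> 'k) set" where
  "tens A B a b = bilin_rels A B +>\<^bsub>pair_alg A B\<^esub> basis_elt (a, b)"

text \<open>The linear map \<open>A \<otimes>\<^sub>K B \<rightarrow> V\<close>, \<open>a \<otimes> b \<mapsto> \<beta> a b\<close>, for bilinear \<open>\<beta>\<close>.\<close>

definition tensor_lift ::
  "('k, 'v, 'z) module_scheme \<Rightarrow> ('a \<Rightarrow> 'b \<Rightarrow> 'v) \<Rightarrow> (('a \<times> 'b) \<Rightarrow> 'k) set \<Rightarrow> 'v" where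
  "tensor_lift V \<beta> = induced (lin_ext V (\<lambda>(a, b). \<beta> a b))"

end


section \<open>Weak bialgebras, weak Hopf algebras and Hopf closures\<close>

record ('k, 'a) weak_bialg = "('k, 'a) module" +
  comult :: "'a \<Rightarrow> (('a \<times> 'a) \<Rightarrow> 'k) set"
  counit :: "'a \<Rightarrow> 'k"

context
  fixes K :: "('k, 'm) ring_scheme"
begin

definition assoc_map ::
  "('k, 'a, 'z) module_scheme \<Rightarrow>
    (((('a \<times> 'a) \<Rightarrow> 'k) set \<times> 'a) \<Rightarrow> 'k) set \<Rightarrow> (('a \<times> (('a \<times> 'a) \<Rightarrow> 'k) set) \<Rightarrow> 'k) set" where
  "assoc_map B = tensor_lift K (tensor K B (tensor K B B))
     (\<lambda>u c. tensor_lift K (tensor K B (tensor K B B))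
        (\<lambda>a b. tens K B (tensor K B B) a (tens K B B b c)) u)"

definition comult_id ::
  "('k, 'a, 'z) weak_bialg_scheme \<Rightarrow> 'a \<Rightarrow> (((('a \<times> 'a) \<Rightarrow> 'k) set \<times> 'a) \<Rightarrow> 'k) set" where
  "comult_id B a = tensor_lift K (tensor K (tensor K B B) B)
     (\<lambda>x y. tens K (tensor K B B) B (comult B x) y) (comult B a)"

definition id_comult ::
  "('k, 'a, 'z) weak_bialg_scheme \<Rightarrow> 'a \<Rightarrow> (('a \<times> (('a \<times> 'a) \<Rightarrow> 'k) set) \<Rightarrow> 'k) set" where
  "id_comult B a = tensor_lift K (tensor K B (tensor K B B))
     (\<lambda>x y. tens K B (tensor K B B) x (comult B y)) (comult B a)"

definition eps_s :: "('k, 'a, 'z) weak_bialg_scheme \<Rightarrow> 'a \<Rightarrow> 'a" where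
  "eps_s B a = tensor_lift K B (\<lambda>x y. counit B (a \<otimes>\<^bsub>B\<^esub> y) \<odot>\<^bsub>B\<^esub> x) (comult B \<one>\<^bsub>B\<^esub>)"

definition eps_t :: "('k, 'a, 'z) weak_bialg_scheme \<Rightarrow> 'a \<Rightarrow> 'a" where
  "eps_t B a = tensor_lift K B (\<lambda>x y. counit B (x \<otimes>\<^bsub>B\<^esub> a) \<odot>\<^bsub>B\<^esub> y) (comult B \<one>\<^bsub>B\<^esub>)"

definition convolution ::
  "('k, 'a, 'y) weak_bialg_scheme \<Rightarrow> ('k, 'b, 'z) module_scheme \<Rightarrow> ('a \<Rightarrow> 'b) \<Rightarrow> ('a \<Rightarrow> 'b) \<Rightarrow> 'a \<Rightarrow> 'b" where
  "convolution H A f g c = tensor_lift K A (\<lambda>x y. f x \<otimes>\<^bsub>A\<^esub> g y) (comult H c)"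

end

locale weak_bialgebra = k_algebra K B
  for K :: "('k, 'm) ring_scheme" (structure) and B :: "('k, 'a, 'z) weak_bialg_scheme" (structure) +
  assumes comult_linear: "comult B \<in> lin_maps K B (tensor K B B)"
    and counit_linear: "counit B \<in> lin_maps K B (scalars K)"
    and coassoc: "a \<in> carrier B \<Longrightarrow> assoc_map K B (comult_id K B a) = id_comult K B a"
    and counit_left:
      "a \<in> carrier B \<Longrightarrow> tensor_lift K B (\<lambda>x y. counit B x \<odot>\<^bsub>B\<^esub> y) (comult B a) = a"
    and counit_right:
      "a \<in> carrier B \<Longrightarrow> tensor_lift K B (\<lambda>x y. counit B y \<odot>\<^bsub>B\<^esub> x) (comult B a) = a"
    and comult_mult:
      "\<lbrakk>a \<in> carrier B; b \<in> carrier B\<rbrakk>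
        \<Longrightarrow> comult B (a \<otimes>\<^bsub>B\<^esub> b) = comult B a \<otimes>\<^bsub>tensor K B B\<^esub> comult B b"
    and comult_one_left:
      "assoc_map K B (tens K (tensor K B B) B (comult B \<one>\<^bsub>B\<^esub>) \<one>\<^bsub>B\<^esub>)
         \<otimes>\<^bsub>tensor K B (tensor K B B)\<^esub> tens K B (tensor K B B) \<one>\<^bsub>B\<^esub> (comult B \<one>\<^bsub>B\<^esub>)
       = id_comult K B \<one>\<^bsub>B\<^esub>"
    and comult_one_right:
      "tens K B (tensor K B B) \<one>\<^bsub>B\<^esub> (comult B \<one>\<^bsub>B\<^esub>)
         \<otimes>\<^bsub>tensor K B (tensor K B B)\<^esub> assoc_map K B (tens K (tensor K B B) B (comult B \<one>\<^bsub>B\<^esub>) \<one>\<^bsub>B\<^esub>)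
       = id_comult K B \<one>\<^bsub>B\<^esub>"
    and counit_mult_left:
      "\<lbrakk>a \<in> carrier B; b \<in> carrier B; c \<in> carrier B\<rbrakk>
        \<Longrightarrow> tensor_lift K (scalars K) (\<lambda>x y. counit B (a \<otimes>\<^bsub>B\<^esub> x) \<otimes>\<^bsub>K\<^esub> counit B (y \<otimes>\<^bsub>B\<^esub> c)) (comult B b)
          = counit B (a \<otimes>\<^bsub>B\<^esub> b \<otimes>\<^bsub>B\<^esub> c)"
    and counit_mult_right:
      "\<lbrakk>a \<in> carrier B; b \<in> carrier B; c \<in> carrier B\<rbrakk>
        \<Longrightarrow> tensor_lift K (scalars K) (\<lambda>x y. counit B (a \<otimes>\<^bsub>B\<^esub> y) \<otimes>\<^bsub>K\<^esub> counit B (x \<otimes>\<^bsub>B\<^esub> c)) (comult B b)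
          = counit B (a \<otimes>\<^bsub>B\<^esub> b \<otimes>\<^bsub>B\<^esub> c)"

context
  fixes K :: "('k, 'm) ring_scheme"
begin

definition is_weak_hopf_antipode :: "('k, 'a, 'z) weak_bialg_scheme \<Rightarrow> ('a \<Rightarrow> 'a) \<Rightarrow> bool" where
  "is_weak_hopf_antipode H S \<longleftrightarrow> S \<in> lin_maps K H H \<and>
     (\<forall>h \<in> carrier H.
        convolution K H H S (\<lambda>x. x) h = eps_s K H h \<and>
        convolution K H H (\<lambda>x. x) S h = eps_t K H h \<and>
        convolution K H H (convolution K H H S (\<lambda>x. x)) S h = S h)"

definition weak_hopf_algebra :: "('k, 'a, 'z) weak_bialg_scheme \<Rightarrow> bool" where
  "weak_hopf_algebra H \<longleftrightarrow> weak_bialgebra K H \<and> (\<exists>S. is_weak_hopf_antipode H S)"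

definition weak_bialg_homs ::
  "('k, 'a, 'y) weak_bialg_scheme \<Rightarrow> ('k, 'b, 'z) weak_bialg_scheme \<Rightarrow> ('a \<Rightarrow> 'b) set" where
  "weak_bialg_homs H B = {f \<in> alg_homs K H B.
     \<forall>a \<in> carrier H.
       comult B (f a) = tensor_lift K (tensor K B B) (\<lambda>x y. tens K B B (f x) (f y)) (comult H a) \<and>
       counit B (f a) = counit H a}"

definition is_antipode_of ::
  "('k, 'a, 'y) weak_bialg_scheme \<Rightarrow> ('k, 'b, 'z) module_scheme \<Rightarrow> ('a \<Rightarrow> 'b) \<Rightarrow> ('a \<Rightarrow> 'b) \<Rightarrow> bool" where
  "is_antipode_of H A f\<^sub>p f\<^sub>m \<longleftrightarrow> f\<^sub>m \<in> lin_maps K H A \<and>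
     (\<forall>h \<in> carrier H.
        convolution K H A f\<^sub>m f\<^sub>p h = f\<^sub>p (eps_s K H h) \<and>
        convolution K H A f\<^sub>p f\<^sub>m h = f\<^sub>p (eps_t K H h) \<and>
        convolution K H A (convolution K H A f\<^sub>p f\<^sub>m) f\<^sub>p h = f\<^sub>p h \<and>
        convolution K H A (convolution K H A f\<^sub>m f\<^sub>p) f\<^sub>m h = f\<^sub>m h)"

end

text \<open>HOL formulas cannot quantify over types, so the type \<open>'b\<close> hosting the test objects \<open>B\<close> of the
  universal property is a parameter; a theorem about \<open>hopf_closure TYPE('b)\<close> with \<open>'b\<close> free covers
  all of them.  Maps matter only on carriers, whence the form of uniqueness.\<close>

definition hopf_closure ::
  "'b itself \<Rightarrow> ('k, 'm) ring_scheme \<Rightarrow> ('k, 'h) weak_bialg \<Rightarrow> ('k, 'c) weak_bialg \<Rightarrow> ('h \<Rightarrow> 'c) \<Rightarrow> bool" where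
  "hopf_closure _ K H C \<iota> \<longleftrightarrow>
     weak_bialgebra K H \<and> weak_hopf_algebra K C \<and> \<iota> \<in> weak_bialg_homs K H C \<and>
     (\<forall>(B :: ('k, 'b) weak_bialg) f\<^sub>p f\<^sub>m.
        weak_bialgebra K B \<and> f\<^sub>p \<in> weak_bialg_homs K H B \<and> is_antipode_of K H B f\<^sub>p f\<^sub>m \<longrightarrow>
        (\<exists>F \<in> weak_bialg_homs K C B.
           (\<forall>h \<in> carrier H. F (\<iota> h) = f\<^sub>p h) \<and>
           (\<forall>F' \<in> weak_bialg_homs K C B.
              (\<forall>h \<in> carrier H. F' (\<iota> h) = f\<^sub>p h) \<longrightarrow> (\<forall>c \<in> carrier C. F' c = F c))))"


section \<open>Frobenius-separable base algebras and left bialgebroids\<close>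

definition idempotent_frobenius_system ::
  "('k, 'm) ring_scheme \<Rightarrow> ('k, 'l) module \<Rightarrow> ('l \<Rightarrow> 'k) \<Rightarrow> (('l \<times> 'l) \<Rightarrow> 'k) set \<Rightarrow> bool" where
  "idempotent_frobenius_system K L \<psi> e \<longleftrightarrow>
     \<psi> \<in> lin_maps K L (scalars K) \<and> e \<in> carrier (tensor K L L) \<and>
     (\<forall>l \<in> carrier L. tensor_lift K L (\<lambda>x y. \<psi> (l \<otimes>\<^bsub>L\<^esub> x) \<odot>\<^bsub>L\<^esub> y) e = l \<and>
                      tensor_lift K L (\<lambda>x y. \<psi> (y \<otimes>\<^bsub>L\<^esub> l) \<odot>\<^bsub>L\<^esub> x) e = l) \<and>
     tensor_lift K L (\<lambda>x y. x \<otimes>\<^bsub>L\<^esub> y) e = \<one>\<^bsub>L\<^esub>"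

text \<open>Structure of a left bialgebroid on the algebra \<open>A\<close> over an algebra with elements of type \<open>'l\<close>.
  The comultiplication takes values in \<open>A \<otimes>\<^sub>L A\<close>, which is constructed as a quotient of \<open>A \<otimes>\<^sub>K A\<close>.\<close>

record ('k, 'a, 'l) left_bialgebroid = "('k, 'a) module" +
  source :: "'l \<Rightarrow> 'a"
  target :: "'l \<Rightarrow> 'a"
  lcomult :: "'a \<Rightarrow> (('a \<times> 'a) \<Rightarrow> 'k) set set"
  lcounit :: "'a \<Rightarrow> 'l"

context
  fixes K :: "('k, 'm) ring_scheme"
begin

text \<open>The kernel of \<open>A \<otimes>\<^sub>K A \<rightarrow> A \<otimes>\<^sub>L A\<close> for the bimodule structure \<open>l \<cdot> a = s(l)a\<close>, \<open>a \<cdot> l = t(l)a\<close>.\<close>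

definition balancing_rels ::
  "('k, 'a, 'y) module_scheme \<Rightarrow> ('k, 'l, 'z) module_scheme \<Rightarrow> ('l \<Rightarrow> 'a) \<Rightarrow> ('l \<Rightarrow> 'a)
    \<Rightarrow> (('a \<times> 'a) \<Rightarrow> 'k) set set" where
  "balancing_rels A L s t = submod_gen K (tensor K A A)
     {tens K A A (t l \<otimes>\<^bsub>A\<^esub> a) b \<ominus>\<^bsub>tensor K A A\<^esub> tens K A A a (s l \<otimes>\<^bsub>A\<^esub> b) |
        l a b. l \<in> carrier L \<and> a \<in> carrier A \<and> b \<in> carrier A}"

text \<open>The projection \<open>A \<otimes>\<^sub>K A \<rightarrow> A \<otimes>\<^sub>L A\<close>.\<close>

definition balanced_class ::
  "('k, 'a, 'y) module_scheme \<Rightarrow> ('k, 'l, 'z) module_scheme \<Rightarrow> ('l \<Rightarrow> 'a) \<Rightarrow> ('l \<Rightarrow> 'a)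
    \<Rightarrow> (('a \<times> 'a) \<Rightarrow> 'k) set \<Rightarrow> (('a \<times> 'a) \<Rightarrow> 'k) set set" where
  "balanced_class A L s t u = balancing_rels A L s t +>\<^bsub>tensor K A A\<^esub> u"

text \<open>The weak bialgebra of a left bialgebroid over an algebra with idempotent Frobenius system
  \<open>(\<psi>, e)\<close>: \<open>\<Delta>(a) = t(e\<^sup>1) a\<^sub>[\<^sub>1\<^sub>] \<otimes> s(e\<^sup>2) a\<^sub>[\<^sub>2\<^sub>]\<close> and \<open>\<epsilon> = \<psi> \<circ> \<pi>\<close>.\<close>

definition weak_bialg_of ::
  "('k, 'a, 'l) left_bialgebroid \<Rightarrow> ('l \<Rightarrow> 'k) \<Rightarrow> (('l \<times> 'l) \<Rightarrow> 'k) set \<Rightarrow> ('k, 'a) weak_bialg" where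
  "weak_bialg_of A \<psi> e = module.extend (module.truncate A) (weak_bialg.fields
     (\<lambda>a. induced
        (tensor_lift K (tensor K A A) (\<lambda>a1 a2.
           tensor_lift K (tensor K A A) (\<lambda>e1 e2.
             tens K A A (target A e1 \<otimes>\<^bsub>A\<^esub> a1) (source A e2 \<otimes>\<^bsub>A\<^esub> a2)) e))
        (lcomult A a))
     (\<lambda>a. \<psi> (lcounit A a)))"

end


section \<open>The base algebra of maps\<close>

text \<open>The non-empty finite set \<open>\<Lambda>\<close> is the set of all elements of the finite type \<open>'l\<close>.  The group
  \<open>G\<close>, opposite to the symmetric group of \<open>\<Lambda>\<close>, acts on the right by \<open>\<kappa>\<alpha> = \<alpha>(\<kappa>)\<close>; so \<open>\<kappa>\<alpha>\<beta>\<close> reads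
  \<open>\<beta> (\<alpha> \<kappa>)\<close>.\<close>

definition map_alg :: "('k, 'r) module \<Rightarrow> ('k, 'l::finite \<Rightarrow> 'r) module" where
  "map_alg R =
    \<lparr>carrier = {f. \<forall>\<kappa>. f \<kappa> \<in> carrier R},
     mult = (\<lambda>f g \<kappa>. f \<kappa> \<otimes>\<^bsub>R\<^esub> g \<kappa>),
     one = (\<lambda>\<kappa>. \<one>\<^bsub>R\<^esub>),
     zero = (\<lambda>\<kappa>. \<zero>\<^bsub>R\<^esub>),
     add = (\<lambda>f g \<kappa>. f \<kappa> \<oplus>\<^bsub>R\<^esub> g \<kappa>),
     smult = (\<lambda>k f \<kappa>. k \<odot>\<^bsub>R\<^esub> f \<kappa>)\<rparr>"

definition const_map :: "'r \<Rightarrow> 'l::finite \<Rightarrow> 'r" where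
  "const_map r = (\<lambda>\<kappa>. r)"

definition delta_map :: "('k, 'r) module \<Rightarrow> 'l::finite \<Rightarrow> 'l \<Rightarrow> 'r" where
  "delta_map R \<kappa> = (\<lambda>\<mu>. if \<mu> = \<kappa> then \<one>\<^bsub>R\<^esub> else \<zero>\<^bsub>R\<^esub>)"

definition shift :: "('l::finite \<Rightarrow> 'l) \<Rightarrow> ('l \<Rightarrow> 'r) \<Rightarrow> 'l \<Rightarrow> 'r" where
  "shift \<alpha> f = (\<lambda>\<kappa>. f (\<alpha> \<kappa>))"

definition map_psi :: "('k, 'm) ring_scheme \<Rightarrow> ('r \<Rightarrow> 'k) \<Rightarrow> ('l::finite \<Rightarrow> 'r) \<Rightarrow> 'k" where
  "map_psi K \<psi> f = (\<Oplus>\<^bsub>K\<^esub>\<kappa>\<in>UNIV. \<psi> (f \<kappa>))"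

definition map_e ::
  "('k, 'm) ring_scheme \<Rightarrow> ('k, 'r) module \<Rightarrow> (('r \<times> 'r) \<Rightarrow> 'k) set
    \<Rightarrow> ((('l::finite \<Rightarrow> 'r) \<times> ('l \<Rightarrow> 'r)) \<Rightarrow> 'k) set" where
  "map_e K R e = (\<Oplus>\<^bsub>tensor K (map_alg R) (map_alg R)\<^esub>\<kappa>\<in>UNIV.
     tensor_lift K (tensor K (map_alg R) (map_alg R))
       (\<lambda>e1 e2. tens K (map_alg R) (map_alg R)
          (const_map e1 \<otimes>\<^bsub>map_alg R\<^esub> delta_map R \<kappa>) (const_map e2 \<otimes>\<^bsub>map_alg R\<^esub> delta_map R \<kappa>)) e)"


section \<open>The left bialgebroid \<open>A\<^sub>\<sigma>\<close>\<close>

datatype ('c, 'x) letter = Coef 'c | Lgen 'x 'x | Linv 'x 'x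

type_synonym ('k, 'r, 'l) coef = "((('l \<Rightarrow> 'r) \<times> ('l \<Rightarrow> 'r)) \<Rightarrow> 'k) set"
type_synonym ('k, 'r, 'l, 'x) free_elt = "(('k, 'r, 'l) coef, 'x) letter list \<Rightarrow> 'k"
type_synonym ('k, 'r, 'l, 'x) A_elt = "('k, 'r, 'l, 'x) free_elt set"

text \<open>Throughout, \<open>\<sigma> a b c d\<close> stands for \<open>\<sigma>\<^sup>a\<^sup>b\<^sub>c\<^sub>d\<close>.\<close>

context
  fixes K :: "('k, 'm) ring_scheme"
    and R :: "('k, 'r) module"
    and X :: "'x set"
    and deg :: "'x \<Rightarrow> 'l::finite \<Rightarrow> 'l"
    and \<sigma> :: "'x \<Rightarrow> 'x \<Rightarrow> 'x \<Rightarrow> 'x \<Rightarrow> 'l \<Rightarrow> 'r"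
begin

abbreviation MapR :: "('k, 'l \<Rightarrow> 'r) module" where
  "MapR \<equiv> map_alg R"

abbreviation coef_alg :: "('k, ('k, 'r, 'l) coef) module" where
  "coef_alg \<equiv> tensor K MapR (op_alg MapR)"

abbreviation coef :: "('l \<Rightarrow> 'r) \<Rightarrow> ('l \<Rightarrow> 'r) \<Rightarrow> ('k, 'r, 'l) coef" where
  "coef f g \<equiv> tens K MapR (op_alg MapR) f g"

definition letters :: "(('k, 'r, 'l) coef, 'x) letter set" where
  "letters = Coef ` carrier coef_alg \<union> {Lgen a b | a b. a \<in> X \<and> b \<in> X} \<union> {Linv a b | a b. a \<in> X \<and> b \<in> X}"

definition free_alg :: "('k, ('k, 'r, 'l, 'x) free_elt) module" where
  "free_alg = basis_alg K (lists letters) (\<lambda>v w. Some (v @ w)) {[]}"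

abbreviation ltr :: "(('k, 'r, 'l) coef, 'x) letter \<Rightarrow> ('k, 'r, 'l, 'x) free_elt" where
  "ltr c \<equiv> basis_elt K [c]"

abbreviation kron :: "'x \<Rightarrow> 'x \<Rightarrow> ('k, 'r, 'l, 'x) free_elt" where
  "kron a b \<equiv> (if a = b then \<one>\<^bsub>free_alg\<^esub> else \<zero>\<^bsub>free_alg\<^esub>)"

definition A_rels :: "('k, 'r, 'l, 'x) free_elt set" where
  "A_rels =
    {ltr (Coef (u \<oplus>\<^bsub>coef_alg\<^esub> v)) \<ominus>\<^bsub>free_alg\<^esub> (ltr (Coef u) \<oplus>\<^bsub>free_alg\<^esub> ltr (Coef v)) |
        u v. u \<in> carrier coef_alg \<and> v \<in> carrier coef_alg} \<union>
    {ltr (Coef (k \<odot>\<^bsub>coef_alg\<^esub> u)) \<ominus>\<^bsub>free_alg\<^esub> (k \<odot>\<^bsub>free_alg\<^esub> ltr (Coef u)) |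
        k u. k \<in> carrier K \<and> u \<in> carrier coef_alg} \<union>
    {ltr (Coef (u \<otimes>\<^bsub>coef_alg\<^esub> v)) \<ominus>\<^bsub>free_alg\<^esub> (ltr (Coef u) \<otimes>\<^bsub>free_alg\<^esub> ltr (Coef v)) |
        u v. u \<in> carrier coef_alg \<and> v \<in> carrier coef_alg} \<union>
    {(\<Oplus>\<^bsub>free_alg\<^esub>c\<in>X. ltr (Lgen a c) \<otimes>\<^bsub>free_alg\<^esub> ltr (Linv c b)) \<ominus>\<^bsub>free_alg\<^esub> kron a b |
        a b. a \<in> X \<and> b \<in> X} \<union>
    {(\<Oplus>\<^bsub>free_alg\<^esub>c\<in>X. ltr (Linv a c) \<otimes>\<^bsub>free_alg\<^esub> ltr (Lgen c b)) \<ominus>\<^bsub>free_alg\<^esub> kron a b |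
        a b. a \<in> X \<and> b \<in> X} \<union>
    {ltr (Coef (coef (shift (deg a) f) \<one>\<^bsub>MapR\<^esub>)) \<otimes>\<^bsub>free_alg\<^esub> ltr (Lgen a b)
       \<ominus>\<^bsub>free_alg\<^esub> (ltr (Lgen a b) \<otimes>\<^bsub>free_alg\<^esub> ltr (Coef (coef f \<one>\<^bsub>MapR\<^esub>))) |
        a b f. a \<in> X \<and> b \<in> X \<and> f \<in> carrier MapR} \<union>
    {ltr (Coef (coef \<one>\<^bsub>MapR\<^esub> (shift (deg b) f))) \<otimes>\<^bsub>free_alg\<^esub> ltr (Lgen a b)
       \<ominus>\<^bsub>free_alg\<^esub> (ltr (Lgen a b) \<otimes>\<^bsub>free_alg\<^esub> ltr (Coef (coef \<one>\<^bsub>MapR\<^esub> f))) |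
        a b f. a \<in> X \<and> b \<in> X \<and> f \<in> carrier MapR} \<union>
    {ltr (Coef (coef f \<one>\<^bsub>MapR\<^esub>)) \<otimes>\<^bsub>free_alg\<^esub> ltr (Linv a b)
       \<ominus>\<^bsub>free_alg\<^esub> (ltr (Linv a b) \<otimes>\<^bsub>free_alg\<^esub> ltr (Coef (coef (shift (deg b) f) \<one>\<^bsub>MapR\<^esub>))) |
        a b f. a \<in> X \<and> b \<in> X \<and> f \<in> carrier MapR} \<union>
    {ltr (Coef (coef \<one>\<^bsub>MapR\<^esub> f)) \<otimes>\<^bsub>free_alg\<^esub> ltr (Linv a b)
       \<ominus>\<^bsub>free_alg\<^esub> (ltr (Linv a b) \<otimes>\<^bsub>free_alg\<^esub> ltr (Coef (coef \<one>\<^bsub>MapR\<^esub> (shift (deg a) f)))) |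
        a b f. a \<in> X \<and> b \<in> X \<and> f \<in> carrier MapR} \<union>
    {(finsum free_alg (\<lambda>(x, y).
         ltr (Coef (coef (\<sigma> x y a c) \<one>\<^bsub>MapR\<^esub>)) \<otimes>\<^bsub>free_alg\<^esub> ltr (Lgen y d) \<otimes>\<^bsub>free_alg\<^esub> ltr (Lgen x b)) (X \<times> X))
       \<ominus>\<^bsub>free_alg\<^esub>
     (finsum free_alg (\<lambda>(x, y).
         ltr (Coef (coef \<one>\<^bsub>MapR\<^esub> (\<sigma> b d x y))) \<otimes>\<^bsub>free_alg\<^esub> ltr (Lgen c y) \<otimes>\<^bsub>free_alg\<^esub> ltr (Lgen a x)) (X \<times> X)) |
        a b c d. a \<in> X \<and> b \<in> X \<and> c \<in> X \<and> d \<in> X} \<union>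
    {\<one>\<^bsub>free_alg\<^esub> \<ominus>\<^bsub>free_alg\<^esub> ltr (Coef (coef \<one>\<^bsub>MapR\<^esub> \<one>\<^bsub>MapR\<^esub>))}"

definition A_ideal :: "('k, 'r, 'l, 'x) free_elt set" where
  "A_ideal = Idl\<^bsub>free_alg\<^esub> A_rels"

definition A_alg :: "('k, ('k, 'r, 'l, 'x) A_elt) module" where
  "A_alg = quot_alg free_alg A_ideal"

definition A_cls :: "('k, 'r, 'l, 'x) free_elt \<Rightarrow> ('k, 'r, 'l, 'x) A_elt" where
  "A_cls u = A_ideal +>\<^bsub>free_alg\<^esub> u"

definition A_source :: "('l \<Rightarrow> 'r) \<Rightarrow> ('k, 'r, 'l, 'x) A_elt" where
  "A_source f = A_cls (ltr (Coef (coef f \<one>\<^bsub>MapR\<^esub>)))"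

definition A_target :: "('l \<Rightarrow> 'r) \<Rightarrow> ('k, 'r, 'l, 'x) A_elt" where
  "A_target f = A_cls (ltr (Coef (coef \<one>\<^bsub>MapR\<^esub> f)))"

text \<open>Products in the relevant part of \<open>A \<otimes>\<^sub>L A\<close> are computed on representatives in \<open>A \<otimes>\<^sub>K A\<close>.
  So \<open>A_comult_free\<close> is the algebra homomorphism from the free algebra to \<open>A \<otimes>\<^sub>K A\<close> with the
  prescribed values on letters, and its composition with the projection onto \<open>A \<otimes>\<^sub>L A\<close> induces the
  comultiplication.\<close>

primrec A_comult_letter ::
  "(('k, 'r, 'l) coef, 'x) letter
    \<Rightarrow> ((('k, 'r, 'l, 'x) A_elt \<times> ('k, 'r, 'l, 'x) A_elt) \<Rightarrow> 'k) set" where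
  "A_comult_letter (Coef u) =
     tensor_lift K (tensor K A_alg A_alg) (\<lambda>f g. tens K A_alg A_alg (A_source f) (A_target g)) u"
| "A_comult_letter (Lgen a b) = (\<Oplus>\<^bsub>tensor K A_alg A_alg\<^esub>c\<in>X.
     tens K A_alg A_alg (A_cls (ltr (Lgen a c))) (A_cls (ltr (Lgen c b))))"
| "A_comult_letter (Linv a b) = (\<Oplus>\<^bsub>tensor K A_alg A_alg\<^esub>c\<in>X.
     tens K A_alg A_alg (A_cls (ltr (Linv c b))) (A_cls (ltr (Linv a c))))"

definition A_comult_free ::
  "('k, 'r, 'l, 'x) free_elt \<Rightarrow> ((('k, 'r, 'l, 'x) A_elt \<times> ('k, 'r, 'l, 'x) A_elt) \<Rightarrow> 'k) set" where
  "A_comult_free = lin_ext K (tensor K A_alg A_alg)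
     (\<lambda>w. foldr (\<lambda>c v. A_comult_letter c \<otimes>\<^bsub>tensor K A_alg A_alg\<^esub> v) w \<one>\<^bsub>tensor K A_alg A_alg\<^esub>)"

primrec chi_letter :: "(('k, 'r, 'l) coef, 'x) letter \<Rightarrow> ('l \<Rightarrow> 'r) \<Rightarrow> 'l \<Rightarrow> 'r" where
  "chi_letter (Coef u) h = tensor_lift K MapR (\<lambda>f g. f \<otimes>\<^bsub>MapR\<^esub> h \<otimes>\<^bsub>MapR\<^esub> g) u"
| "chi_letter (Lgen a b) h = (if a = b then shift (deg a) h else \<zero>\<^bsub>MapR\<^esub>)"
| "chi_letter (Linv a b) h = (if a = b then shift (inv_into UNIV (deg a)) h else \<zero>\<^bsub>MapR\<^esub>)"

text \<open>The product in \<open>End(M)\<close> is composition, hence \<open>\<chi>(c\<^sub>1 \<dots> c\<^sub>n)(h) = \<chi>(c\<^sub>1)(\<dots> \<chi>(c\<^sub>n)(h))\<close>.\<close>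

definition chi :: "('k, 'r, 'l, 'x) A_elt \<Rightarrow> ('l \<Rightarrow> 'r) \<Rightarrow> 'l \<Rightarrow> 'r" where
  "chi a h = induced (lin_ext K MapR (\<lambda>w. foldr chi_letter w h)) a"

definition A_bialgebroid :: "('k, ('k, 'r, 'l, 'x) A_elt, 'l \<Rightarrow> 'r) left_bialgebroid" where
  "A_bialgebroid = module.extend A_alg (left_bialgebroid.fields A_source A_target
     (induced (\<lambda>u. balanced_class K A_alg MapR A_source A_target (A_comult_free u)))
     (\<lambda>a. chi a \<one>\<^bsub>MapR\<^esub>))"

definition rigid :: bool where
  "rigid \<longleftrightarrow> (\<exists>x y. (\<forall>a\<in>X. \<forall>b\<in>X. x a b \<in> carrier A_alg \<and> y a b \<in> carrier A_alg) \<and>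
     (\<forall>a\<in>X. \<forall>b\<in>X.
        let d = (if a = b then \<one>\<^bsub>A_alg\<^esub> else \<zero>\<^bsub>A_alg\<^esub>) in
        (\<Oplus>\<^bsub>A_alg\<^esub>c\<in>X. A_cls (ltr (Linv c b)) \<otimes>\<^bsub>A_alg\<^esub> x a c) = d \<and>
        (\<Oplus>\<^bsub>A_alg\<^esub>c\<in>X. x c b \<otimes>\<^bsub>A_alg\<^esub> A_cls (ltr (Linv a c))) = d \<and>
        (\<Oplus>\<^bsub>A_alg\<^esub>c\<in>X. A_cls (ltr (Lgen c b)) \<otimes>\<^bsub>A_alg\<^esub> y a c) = d \<and>
        (\<Oplus>\<^bsub>A_alg\<^esub>c\<in>X. y c b \<otimes>\<^bsub>A_alg\<^esub> A_cls (ltr (Lgen a c))) = d))"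

end


section \<open>The left bialgebroid \<open>\<AA>(w\<^sub>\<sigma>)\<close>\<close>

text \<open>A path is stored as its source vertex together with its list of arrows, so that the trivial
  paths \<open>(\<kappa>, [])\<close> are the vertices; for a non-empty list the vertex is the source of the first arrow.\<close>

type_synonym ('l, 'x) path = "'l \<times> ('l \<times> 'x) list"

type_synonym ('k, 'l, 'x) G_elt = "(('l, 'x) path \<times> ('l, 'x) path) \<Rightarrow> 'k"
type_synonym ('k, 'r, 'l, 'x) H_elt = "(((('r \<times> 'r) \<Rightarrow> 'k) set \<times> ('k, 'l, 'x) G_elt) \<Rightarrow> 'k) set"
type_synonym ('k, 'r, 'l, 'x) frakA_elt = "('k, 'r, 'l, 'x) H_elt set"

context
  fixes K :: "('k, 'm) ring_scheme"
    and R :: "('k, 'r) module"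
    and X :: "'x set"
    and deg :: "'x \<Rightarrow> 'l::finite \<Rightarrow> 'l"
    and \<sigma> :: "'x \<Rightarrow> 'x \<Rightarrow> 'x \<Rightarrow> 'x \<Rightarrow> 'l \<Rightarrow> 'r"
begin

primrec is_chain :: "'l \<Rightarrow> ('l \<times> 'x) list \<Rightarrow> bool" where
  "is_chain \<kappa> [] \<longleftrightarrow> True"
| "is_chain \<kappa> (q # qs) \<longleftrightarrow> fst q = \<kappa> \<and> snd q \<in> X \<and> is_chain (deg (snd q) \<kappa>) qs"

definition paths :: "nat \<Rightarrow> ('l, 'x) path set" where
  "paths m = {(\<kappa>, qs). is_chain \<kappa> qs \<and> length qs = m}"

definition path_source :: "('l, 'x) path \<Rightarrow> 'l" where
  "path_source p = fst p"

definition path_target :: "('l, 'x) path \<Rightarrow> 'l" where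
  "path_target p = (if snd p = [] then fst p
     else (case last (snd p) of (\<kappa>, x) \<Rightarrow> deg x \<kappa>))"

definition path_concat :: "('l, 'x) path \<Rightarrow> ('l, 'x) path \<Rightarrow> ('l, 'x) path" where
  "path_concat p p' = (fst p, snd p @ snd p')"

definition arrow_path :: "'l \<times> 'x \<Rightarrow> ('l, 'x) path" where
  "arrow_path q = (fst q, [q])"

definition arrow_pairs :: "(('l \<times> 'x) \<times> ('l \<times> 'x)) set" where
  "arrow_pairs = {(q, q'). is_chain (fst q) [q, q']}"

definition w_sigma :: "'l \<times> 'x \<Rightarrow> 'l \<times> 'x \<Rightarrow> 'l \<times> 'x \<Rightarrow> 'l \<times> 'x \<Rightarrow> 'r" where
  "w_sigma x y u v = (if fst x = fst u then \<sigma> (snd y) (snd x) (snd v) (snd u) (fst x) else \<zero>\<^bsub>R\<^esub>)"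

definition G_alg :: "('k, ('k, 'l, 'x) G_elt) module" where
  "G_alg = basis_alg K (\<Union>m. paths m \<times> paths m)
     (\<lambda>(p, q) (p', q').
        if path_target p = path_source p' \<and> path_target q = path_source q'
        then Some (path_concat p p', path_concat q q') else None)
     (paths 0 \<times> paths 0)"

abbreviation e_basis :: "('l, 'x) path \<Rightarrow> ('l, 'x) path \<Rightarrow> ('k, 'l, 'x) G_elt" where
  "e_basis p q \<equiv> basis_elt K (p, q)"

abbreviation RR :: "('k, (('r \<times> 'r) \<Rightarrow> 'k) set) module" where
  "RR \<equiv> tensor K R (op_alg R)"

definition H_alg :: "('k, ('k, 'r, 'l, 'x) H_elt) module" where
  "H_alg = tensor K RR G_alg"

definition H_tens :: "'r \<Rightarrow> 'r \<Rightarrow> ('k, 'l, 'x) G_elt \<Rightarrow> ('k, 'r, 'l, 'x) H_elt" where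
  "H_tens r r' g = tens K RR G_alg (tens K R (op_alg R) r r') g"

definition frakA_rels :: "('k, 'r, 'l, 'x) H_elt set" where
  "frakA_rels =
    {(finsum H_alg (\<lambda>(x, y).
         H_tens (w_sigma x y a b) \<one>\<^bsub>R\<^esub>
           (e_basis (arrow_path x) (arrow_path c) \<otimes>\<^bsub>G_alg\<^esub> e_basis (arrow_path y) (arrow_path d))) arrow_pairs)
       \<ominus>\<^bsub>H_alg\<^esub>
     (finsum H_alg (\<lambda>(x, y).
         H_tens \<one>\<^bsub>R\<^esub> (w_sigma c d x y)
           (e_basis (arrow_path a) (arrow_path x) \<otimes>\<^bsub>G_alg\<^esub> e_basis (arrow_path b) (arrow_path y))) arrow_pairs) |
      a b c d. (a, b) \<in> arrow_pairs \<and> (c, d) \<in> arrow_pairs}"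

definition frakA_ideal :: "('k, 'r, 'l, 'x) H_elt set" where
  "frakA_ideal = Idl\<^bsub>H_alg\<^esub> frakA_rels"

definition frakA_alg :: "('k, ('k, 'r, 'l, 'x) frakA_elt) module" where
  "frakA_alg = quot_alg H_alg frakA_ideal"

definition frakA_cls :: "('k, 'r, 'l, 'x) H_elt \<Rightarrow> ('k, 'r, 'l, 'x) frakA_elt" where
  "frakA_cls u = frakA_ideal +>\<^bsub>H_alg\<^esub> u"

definition frakA_gen :: "'r \<Rightarrow> 'r \<Rightarrow> ('l, 'x) path \<Rightarrow> ('l, 'x) path \<Rightarrow> ('k, 'r, 'l, 'x) frakA_elt" where
  "frakA_gen r r' p q = frakA_cls (H_tens r r' (e_basis p q))"

text \<open>The linear map from the quotient to \<open>V\<close> induced by \<open>r \<otimes> r' \<otimes> e\<^sup>p\<^sub>q \<mapsto> \<beta> r r' p q\<close>.\<close>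

definition frakA_lift ::
  "('k, 'v, 'z) module_scheme \<Rightarrow> ('r \<Rightarrow> 'r \<Rightarrow> ('l, 'x) path \<Rightarrow> ('l, 'x) path \<Rightarrow> 'v)
    \<Rightarrow> ('k, 'r, 'l, 'x) frakA_elt \<Rightarrow> 'v" where
  "frakA_lift V \<beta> = induced (tensor_lift K V (\<lambda>u g.
     tensor_lift K V (\<lambda>r r'. lin_ext K V (\<lambda>(p, q). \<beta> r r' p q) g) u))"

definition frakA_source :: "('l \<Rightarrow> 'r) \<Rightarrow> ('k, 'r, 'l, 'x) frakA_elt" where
  "frakA_source f = finsum frakA_alg (\<lambda>(\<kappa>, \<mu>). frakA_gen (f \<kappa>) \<one>\<^bsub>R\<^esub> (\<kappa>, []) (\<mu>, [])) UNIV"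

definition frakA_target :: "('l \<Rightarrow> 'r) \<Rightarrow> ('k, 'r, 'l, 'x) frakA_elt" where
  "frakA_target f = finsum frakA_alg (\<lambda>(\<kappa>, \<mu>). frakA_gen \<one>\<^bsub>R\<^esub> (f \<kappa>) (\<mu>, []) (\<kappa>, [])) UNIV"

definition frakA_bialgebroid :: "('k, ('k, 'r, 'l, 'x) frakA_elt, 'l \<Rightarrow> 'r) left_bialgebroid" where
  "frakA_bialgebroid = module.extend frakA_alg (left_bialgebroid.fields frakA_source frakA_target
     (frakA_lift
        (quot_alg (tensor K frakA_alg frakA_alg)
           (balancing_rels K frakA_alg (map_alg R) frakA_source frakA_target))
        (\<lambda>r r' p q. balanced_class K frakA_alg (map_alg R) frakA_source frakA_target
           (\<Oplus>\<^bsub>tensor K frakA_alg frakA_alg\<^esub>u \<in> paths (length (snd p)).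
              tens K frakA_alg frakA_alg (frakA_gen r \<one>\<^bsub>R\<^esub> p u) (frakA_gen \<one>\<^bsub>R\<^esub> r' u q))))
     (frakA_lift (map_alg R)
        (\<lambda>r r' p q. if p = q
           then const_map (r \<otimes>\<^bsub>R\<^esub> r') \<otimes>\<^bsub>map_alg R\<^esub> delta_map R (path_source q)
           else \<zero>\<^bsub>map_alg R\<^esub>)))"

definition Phi :: "('k, 'r, 'l, 'x) frakA_elt \<Rightarrow> ('k, 'r, 'l, 'x) A_elt" where
  "Phi = frakA_lift (A_alg K R X deg \<sigma>)
     (\<lambda>r r' p q. A_cls K R X deg \<sigma>
        (basis_elt K [Coef (tens K (map_alg R) (op_alg (map_alg R)) (const_map r) (const_map r')
             \<otimes>\<^bsub>tensor K (map_alg R) (op_alg (map_alg R))\<^esub>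
             tens K (map_alg R) (op_alg (map_alg R))
               (delta_map R (path_source p)) (delta_map R (path_source q)))]
         \<otimes>\<^bsub>free_alg K R X\<^esub>
         foldr (\<lambda>(x, y) v. basis_elt K [Lgen (snd x) (snd y)] \<otimes>\<^bsub>free_alg K R X\<^esub> v)
           (zip (snd p) (snd q)) \<one>\<^bsub>free_alg K R X\<^esub>))"

end

end

theory Submission
  imports Defs
begin

text \<open>
  Both algebras are generated by the images of two maps \<open>s\<close>, \<open>t\<close> of the
  base algebra \<open>M = M\<^sub>\<Lambda>(R)\<close> and by the entries of a matrix \<open>l\<close> that is semilinear over the base
  (moving an entry past \<open>s f\<close> or \<open>t f\<close> shifts \<open>f\<close> by a permutation) and satisfies the exchange
  relation given by \<open>\<sigma>\<close>.  In \<open>\<AA>(w\<^sub>\<sigma>)\<close> the entry \<open>ell a b\<close> is the sum over all vertices of the generators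
  at the arrows \<open>a\<close> and \<open>b\<close>; in \<open>A\<^sub>\<sigma>\<close> it is \<open>L\<^sub>a\<^sub>b\<close>, and there the matrix has in addition an inverse.
  The relations just listed are defining ones: any data in an algebra \<open>B\<close> that satisfy them receive
  a homomorphism from \<open>\<AA>(w\<^sub>\<sigma>)\<close> (locale \<open>rll_target\<close>, map \<open>FF\<close>), and one from \<open>A\<^sub>\<sigma>\<close> if the matrix comes
  with an inverse (locale \<open>A_target\<close>, map \<open>FA\<close>).  So \<open>A\<^sub>\<sigma>\<close> is the localisation of \<open>\<AA>(w\<^sub>\<sigma>)\<close> at the matrix,
  and \<open>\<Phi>\<close> is the localisation map (\<open>Phi_eq\<close>).

  The Frobenius element gives \<open>E = \<Delta>(1) = \<Sum>\<^sub>j t(p\<^sub>j) \<otimes> s(q\<^sub>j)\<close>, an idempotent by separability.  For both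
  algebras the comultiplication is the universal map into the corner \<open>E (B \<otimes> B) E\<close> with
  \<open>\<Delta>(l\<^sub>a\<^sub>b) = E \<Sum>\<^sub>c l\<^sub>a\<^sub>c \<otimes> l\<^sub>c\<^sub>b\<close>; the balanced tensor product over \<open>M\<close> is \<open>B \<otimes> B\<close> modulo the kernel of
  multiplication by \<open>E\<close> (\<open>in_N_iff\<close>), which identifies it with the comultiplication of the
  bialgebroid.  The locale \<open>gen_bialg\<close> collects what the two have in common, and the axioms of a weak
  bialgebra are proved there once, by induction over generators (\<open>weak_bialg\<close>).

  If \<open>\<sigma>\<close> is rigid, an antimultiplicative map of \<open>A\<^sub>\<sigma>\<close> is defined by sending \<open>L\<close> to \<open>L\<inverse>\<close>, \<open>L\<inverse>\<close> to the
  inverse provided by rigidity, \<open>t f\<close> to \<open>s f\<close>, and \<open>s f\<close> to \<open>t f\<close> twisted by the Nakayama automorphism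
  of \<open>\<psi>\<close>.  The antipode identities need only be tested on generators (\<open>antipode_criterion\<close>), so
  \<open>A\<^sub>\<sigma>\<close> is a weak Hopf algebra.

  Let now \<open>f\<^sup>+\<close> be a homomorphism from \<open>\<AA>(w\<^sub>\<sigma>)\<close> to a weak bialgebra \<open>W\<close> with antipode \<open>f\<^sup>-\<close>.  Then
  \<open>f\<^sup>-(l)\<close> is inverse to the matrix \<open>f\<^sup>+(l)\<close> (\<open>m_l\<close>, \<open>l_m\<close>), so \<open>f\<^sup>+\<close> factors through \<open>\<Phi>\<close> by an algebra
  homomorphism \<open>F\<close>, unique since inverse matrices are.  It remains to see that \<open>F\<close> respects the
  comultiplication and the counit on the inverse matrix (\<open>comult_m\<close>, \<open>eps_t_m\<close>): \<open>\<Delta>(f\<^sup>-(l))\<close> and the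
  expected value are both inverse to \<open>\<Delta>(f\<^sup>+(l))\<close> in the corner \<open>\<Delta>(1) (W \<otimes> W) \<Delta>(1)\<close>.
\<close>

text \<open>An algebra stands for its carrier where a set is expected, and the index of an operation may be
  written after a dot: \<open>x *.A y\<close>, \<open>\<one>.A\<close>, \<open>\<Oplus>.A i\<in>I. f i\<close>.\<close>

declare [[coercion_enabled]]
declare [[coercion "carrier :: ('a, 'b) partial_object_scheme \<Rightarrow> 'a set"]]

syntax "_index" :: "logic \<Rightarrow> index" ("._" [1000] 1000)
notation mult (infixl "*\<index>" 70)

abbreviation (input) unit_mat :: "('a, 'b) ring_scheme \<Rightarrow> 'c \<Rightarrow> 'c \<Rightarrow> 'a"
 where "unit_mat A a b \<equiv> (if a = b then \<one>\<^bsub>A\<^esub> else \<zero>\<^bsub>A\<^esub>)"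

lemmas (in module) md = module_axioms

section \<open>Finite sums and linear maps\<close>

lemma (in abelian_monoid) finsum_eqI:
 assumes "!!i. i : A ==> f i = g i" and "!!i. i : A ==> g i : G"
 shows "finsum G f A = finsum G g A"
 using assms by (intro finsum_cong') auto

lemma (in abelian_monoid) finsum_swap:
 assumes "finite A" "finite B" "!!i j. i : A ==> j : B ==> f i j : G"
 shows "(\<Oplus>i\<in>A. \<Oplus>j\<in>B. f i j) = (\<Oplus>j\<in>B. \<Oplus>i\<in>A. f i j)"
 using assms(1,3)
proof (induction A)
 case (insert a A)
 have "(\<Oplus>i\<in>insert a A. \<Oplus>j\<in>B. f i j) = (\<Oplus>j\<in>B. f a j) \<oplus> (\<Oplus>j\<in>B. \<Oplus>i\<in>A. f i j)"
  using insert by (subst finsum_insert) auto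
 also have "... = (\<Oplus>j\<in>B. f a j \<oplus> (\<Oplus>i\<in>A. f i j))"
  using insert by (subst finsum_addf) auto
 also have "... = (\<Oplus>j\<in>B. \<Oplus>i\<in>insert a A. f i j)"
  using insert by (intro finsum_eqI) (auto simp: finsum_insert)
 finally show ?case .
qed (simp add: finsum_zero)

lemma (in abelian_monoid) finsum_prod:
 assumes "finite A" "finite B" "!!i j. i : A ==> j : B ==> f i j : G"
 shows "finsum G (%(i, j). f i j) (A \<times> B) = (\<Oplus>i\<in>A. \<Oplus>j\<in>B. f i j)"
 using assms(1,3)
proof (induction A)
 case (insert a A)
 have 1: "insert a A \<times> B = Pair a ` B \<union> A \<times> B" by auto
 have "finsum G (%(i, j). f i j) (insert a A \<times> B)
   = finsum G (%(i, j). f i j) (Pair a ` B) \<oplus> finsum G (%(i, j). f i j) (A \<times> B)"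
  unfolding 1 using insert assms(2) by (intro finsum_Un_disjoint) auto
 also have "finsum G (%(i, j). f i j) (Pair a ` B) = (\<Oplus>j\<in>B. f a j)"
  using insert by (subst finsum_reindex) (auto simp: inj_on_def)
 finally show ?case using insert by (subst finsum_insert) auto
qed simp

lemma (in abelian_monoid) finsum_delta:
 assumes "finite A" "!!i. i : A ==> f i : G"
 shows "(\<Oplus>i\<in>A. if i = a then f i else \<zero>) = (if a : A then f a else \<zero>)"
  and "(\<Oplus>i\<in>A. if a = i then f i else \<zero>) = (if a : A then f a else \<zero>)"
proof -
 show 1: "(\<Oplus>i\<in>A. if i = a then f i else \<zero>) = (if a : A then f a else \<zero>)"
 proof (cases "a : A")
  case True
  then show ?thesis
   using finsum_singleton[of a A f] assms by (auto simp: Pi_def eq_commute)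
 next
  case False
  then have "(\<Oplus>i\<in>A. if i = a then f i else \<zero>) = (\<Oplus>i\<in>A. \<zero>)"
   by (intro finsum_eqI) auto
  then show ?thesis using False by (simp add: finsum_zero)
 qed
 show "(\<Oplus>i\<in>A. if a = i then f i else \<zero>) = (if a : A then f a else \<zero>)"
  using 1 by (simp add: eq_commute)
qed

lemma lin_mapsI:
 assumes "!!x. x : carrier M ==> f x : carrier N"
  and "!!x y. x : carrier M ==> y : carrier M ==> f (x \<oplus>.M y) = f x \<oplus>.N f y"
  and "!!k x. k : carrier K ==> x : carrier M ==> f (k \<odot>.M x) = k \<odot>.N f x"
 shows "f : lin_maps K M N"
 using assms unfolding lin_maps_def by auto

lemma
 assumes "f : lin_maps K M N"
 shows lin_closed: "x : M ==> f x : N"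
  and lin_add: "x : M ==> y : M ==> f (x \<oplus>.M y) = f x \<oplus>.N f y"
  and lin_smult: "k : K ==> x : M ==> f (k \<odot>.M x) = k \<odot>.N f x"
 using assms unfolding lin_maps_def by auto

lemma lin_zero:
 assumes "f : lin_maps K M N" "module K M" "module K N"
 shows "f \<zero>.M = \<zero>.N"
proof -
 interpret M: module K M by fact
 interpret N: module K N by fact
 have "f (\<zero>.K \<odot>.M \<zero>.M) = \<zero>.K \<odot>.N f \<zero>.M"
  by (rule lin_smult[OF assms(1)]) auto
 then show ?thesis using lin_closed[OF assms(1), of "\<zero>.M"] by simp
qed

lemma lin_minus:
 assumes "f : lin_maps K M N" "module K M" "module K N" "x : M" "y : M"
 shows "f (x \<ominus>.M y) = f x \<ominus>.N f y"
proof -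
 interpret M: module K M by fact
 interpret N: module K N by fact
 have 1: "\<ominus>.M y = (\<ominus>.K \<one>.K) \<odot>.M y"
  using assms by (simp add: M.smult_l_minus)
 show ?thesis
  unfolding a_minus_def 1 using assms lin_closed[OF assms(1)]
  by (simp add: lin_add[OF assms(1)] lin_smult[OF assms(1)] N.smult_l_minus)
qed

lemma lin_finsum:
 assumes "f : lin_maps K M N" "module K M" "module K N" "!!i. i : S ==> x i : M"
 shows "f (finsum M x S) = finsum N (%i. f (x i)) S"
proof -
 interpret M: module K M by fact
 interpret N: module K N by fact
 note cl = lin_closed[OF assms(1)]
 show ?thesis
 proof (cases "finite S")
  case True
  then show ?thesis using assms(4)
  proof (induction S)
   case (insert a S)
   then show ?case
    by (subst M.finsum_insert; (subst N.finsum_insert)?) (auto simp: cl lin_add[OF assms(1)])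
  qed (simp add: lin_zero[OF assms(1-3)])
 next
  case False
  then show ?thesis using lin_zero[OF assms(1-3)] by (simp add: finsum_def finprod_def)
 qed
qed

lemma lin_comp: "f : lin_maps K M N ==> g : lin_maps K N V ==> (%x. g (f x)) : lin_maps K M V"
 by (rule lin_mapsI) (simp_all add: lin_closed lin_add lin_smult)

lemma lin_finsum_fun:
 assumes "module K V" "!!i. i : S ==> f i : lin_maps K M V"
 shows "(%x. finsum V (%i. f i x) S) : lin_maps K M V"
proof -
 interpret V: module K V by fact
 show ?thesis
 proof (cases "finite S")
  case True
  note c = lin_closed[OF assms(2)] and a = lin_add[OF assms(2)] and m = lin_smult[OF assms(2)]
  show ?thesis
  proof (rule lin_mapsI)
   fix x y assume xy: "x : M" "y : M"
   have "finsum V (%i. f i (x \<oplus>.M y)) S = finsum V (%i. f i x \<oplus>.V f i y) S"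
    using xy by (intro V.finsum_eqI) (simp_all add: a c)
   then show "finsum V (%i. f i (x \<oplus>.M y)) S = finsum V (%i. f i x) S \<oplus>.V finsum V (%i. f i y) S"
    using xy c by (simp add: V.finsum_addf Pi_def)
  next
   fix k x assume kx: "k : K" "x : M"
   have "finsum V (%i. f i (k \<odot>.M x)) S = finsum V (%i. k \<odot>.V f i x) S"
    using kx by (intro V.finsum_eqI) (simp_all add: m c)
   then show "finsum V (%i. f i (k \<odot>.M x)) S = k \<odot>.V finsum V (%i. f i x) S"
    using kx c True by (simp add: V.finsum_smult_ldistr Pi_def)
  qed (use c in auto)
 next
  case False
  then show ?thesis
   by (intro lin_mapsI) (auto simp: V.finsum_infinite)
 qed
qed

definition bilin where
 "bilin K A B V \<beta> \<longleftrightarrow> (\<forall>a\<in>carrier A. \<beta> a : lin_maps K B V) \<and> (\<forall>b\<in>carrier B. (%a. \<beta> a b) : lin_maps K A V)"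

lemma bilinI:
 assumes "!!a b. a : carrier A ==> b : carrier B ==> \<beta> a b : carrier V"
  and "!!a b c. a : carrier A ==> b : carrier B ==> c : carrier B ==> \<beta> a (b \<oplus>.B c) = \<beta> a b \<oplus>.V \<beta> a c"
  and "!!a b k. a : carrier A ==> b : carrier B ==> k : carrier K ==> \<beta> a (k \<odot>.B b) = k \<odot>.V \<beta> a b"
  and "!!a b c. a : carrier A ==> b : carrier B ==> c : carrier A ==> \<beta> (a \<oplus>.A c) b = \<beta> a b \<oplus>.V \<beta> c b"
  and "!!a b k. a : carrier A ==> b : carrier B ==> k : carrier K ==> \<beta> (k \<odot>.A a) b = k \<odot>.V \<beta> a b"
 shows "bilin K A B V \<beta>"
 using assms unfolding bilin_def by (auto intro!: lin_mapsI)

lemma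
 assumes "bilin K A B V \<beta>"
 shows bilin_left: "b : B ==> (%a. \<beta> a b) : lin_maps K A V"
  and bilin_right: "a : A ==> \<beta> a : lin_maps K B V"
  and bilin_closed: "a : A ==> b : B ==> \<beta> a b : V"
 using assms unfolding bilin_def by (auto dest: lin_closed)

lemma bilin_comp:
 assumes "bilin K A B V \<beta>" "f : lin_maps K A' A" "g : lin_maps K B' B" "h : lin_maps K V V'"
 shows "bilin K A' B' V' (%a b. h (\<beta> (f a) (g b)))"
proof -
 note fc = lin_closed[OF assms(2)] and gc = lin_closed[OF assms(3)]
 show ?thesis unfolding bilin_def
  using lin_comp[OF assms(2) lin_comp[OF bilin_left[OF assms(1)] assms(4)]]
   lin_comp[OF assms(3) lin_comp[OF bilin_right[OF assms(1)] assms(4)]] fc gc by auto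
qed

section \<open>Algebras with a basis\<close>

locale base_field = K?: field K for K (structure)

sublocale k_algebra \<subseteq> base_field K ..

context base_field begin

lemma in_basis_alg:
 "f : carrier (basis_alg K S m U) \<longleftrightarrow> (\<forall>x. f x : K) \<and> finite {x. f x ~= \<zero>} \<and> (\<forall>x. x \<notin> S \<longrightarrow> f x = \<zero>)"
 by (simp add: basis_alg_def)

lemma basis_alg_simps:
 "zero (basis_alg K S m U) = (%x. \<zero>)" "add (basis_alg K S m U) = (%f g x. f x \<oplus> g x)"
 "smult (basis_alg K S m U) = (%k f x. k \<otimes> f x)"
 "one (basis_alg K S m U) = (%x. if x : U then \<one> else \<zero>)"
 by (simp_all add: basis_alg_def)

lemma basis_module: "module K (basis_alg K S m U)" (is "module K ?B")
proof (rule moduleI)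
 have add: "f \<oplus>.?B g : ?B" if "f : ?B" "g : ?B" for f g
 proof -
  have "finite ({x. f x ~= \<zero>} \<union> {x. g x ~= \<zero>})"
   using that by (simp add: in_basis_alg)
  then have "finite {x. f x \<oplus> g x ~= \<zero>}" by (rule rev_finite_subset) auto
  then show ?thesis using that unfolding in_basis_alg basis_alg_simps by auto
 qed
 show "abelian_group ?B"
 proof (rule abelian_groupI)
  fix x assume x: "x : ?B"
  have "finite {z. \<ominus> x z ~= \<zero>}"
   by (rule rev_finite_subset[of "{z. x z ~= \<zero>}"]) (use x in "auto simp: in_basis_alg")
  then have "(%z. \<ominus> x z) : ?B" using x unfolding in_basis_alg by auto
  moreover have "(%z. \<ominus> x z) \<oplus>.?B x = \<zero>.?B"
   using x unfolding in_basis_alg basis_alg_simps by (auto simp: l_neg)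
  ultimately show "\<exists>y\<in>carrier ?B. y \<oplus>.?B x = \<zero>.?B" by blast
 next
  show "\<zero>.?B : ?B" by (simp add: in_basis_alg basis_alg_simps)
 qed (use add in "auto simp: in_basis_alg basis_alg_simps a_ac")
 fix a x assume a: "a : K" and x: "x : ?B"
 have "finite {z. a \<otimes> x z ~= \<zero>}"
  by (rule rev_finite_subset[of "{z. x z ~= \<zero>}"]) (use a x in "auto simp: in_basis_alg")
 then show "a \<odot>.?B x : ?B" using a x unfolding in_basis_alg basis_alg_simps by auto
qed (auto simp: in_basis_alg basis_alg_simps l_distr r_distr m_assoc is_cring)

lemma basis_elt_closed: "s : S ==> basis_elt K s : carrier (basis_alg K S m U)"
 by (auto simp: in_basis_alg basis_elt_def)

lemma basis_induct [consumes 1, case_names zero step]: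
 assumes "f : carrier (basis_alg K S m U)"
  and "P (zero (basis_alg K S m U))"
  and "!!k s g. k : K ==> s : S ==> g : carrier (basis_alg K S m U) ==> P g ==>
   P (k \<odot>\<^bsub>basis_alg K S m U\<^esub> basis_elt K s \<oplus>\<^bsub>basis_alg K S m U\<^esub> g)"
 shows "P f"
proof -
 have "finite {x. f x ~= \<zero>}" using assms(1) by (simp add: in_basis_alg)
 then show ?thesis using assms(1)
 proof (induction "{x. f x ~= \<zero>}" arbitrary: f rule: finite_induct)
  case empty
  then have "f = (%x. \<zero>)" by auto
  then show ?case using assms(2) by (simp add: basis_alg_simps)
 next
  case (insert s F)
  define g where "g = (%x. if x = s then \<zero> else f x)"
  have s: "s : S" "f s ~= \<zero>" and fc: "f x : K" for x
   using insert by (auto simp: in_basis_alg)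
  have F: "F = {x. g x ~= \<zero>}" using insert(2,4) by (auto simp: g_def)
  have g: "g : carrier (basis_alg K S m U)"
   using insert F by (auto simp: in_basis_alg g_def)
  have "f = (f s \<odot>\<^bsub>basis_alg K S m U\<^esub> basis_elt K s \<oplus>\<^bsub>basis_alg K S m U\<^esub> g)"
   by (auto simp: basis_alg_simps g_def basis_elt_def fc)
  then show ?case using assms(3)[OF fc s(1) g insert(3)[OF F g]] by metis
 qed
qed

lemma basis_lin_eq:
 assumes "f : lin_maps K (basis_alg K S m U) V" "g : lin_maps K (basis_alg K S m U) V" "module K V"
  and "!!s. s : S ==> f (basis_elt K s) = g (basis_elt K s)"
  and "u : carrier (basis_alg K S m U)"
 shows "f u = g u"
 using assms(5)
proof (induction u rule: basis_induct)
 case zero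
 then show ?case using lin_zero[OF assms(1) basis_module assms(3)] lin_zero[OF assms(2) basis_module assms(3)] by simp
next
 case (step k s h)
 have "k \<odot>\<^bsub>basis_alg K S m U\<^esub> basis_elt K s : carrier (basis_alg K S m U)"
  using step module.smult_closed[OF basis_module] basis_elt_closed by metis
 then show ?case using step basis_elt_closed[OF step(2)] assms(4)
  by (simp add: lin_add[OF assms(1)] lin_add[OF assms(2)] lin_smult[OF assms(1)] lin_smult[OF assms(2)])
qed

lemma lin_ext_superset:
 assumes "module K V" "finite T" "{x. f x ~= \<zero>} \<subseteq> T" "!!x. f x : K"
  "!!x. f x ~= \<zero> ==> \<beta> x : V"
 shows "lin_ext K V \<beta> f = (\<Oplus>.V x\<in>T. if f x = \<zero> then \<zero>.V else f x \<odot>.V \<beta> x)"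
proof -
 interpret V: module K V by fact
 show ?thesis unfolding lin_ext_def
  using assms by (intro V.add.finprod_mono_neutral_cong_left) auto
qed

lemma lin_ext_lin:
 assumes "module K V" "!!s. s : S ==> \<beta> s : V"
 shows "lin_ext K V \<beta> : lin_maps K (basis_alg K S m U) V"
proof -
 interpret V: module K V by fact
 have bc: "\<beta> x : V" if "f x ~= \<zero>" "f : carrier (basis_alg K S m U)" for x f
  using that assms(2) by (auto simp: in_basis_alg)
 show ?thesis
 proof (rule lin_mapsI)
  fix f assume f: "f : carrier (basis_alg K S m U)"
  then show "lin_ext K V \<beta> f : V"
   unfolding lin_ext_def using bc[OF _ f] by (intro V.finsum_closed) (auto simp: in_basis_alg)
  fix g assume g: "g : carrier (basis_alg K S m U)"
  let ?T = "{x. f x ~= \<zero>} \<union> {x. g x ~= \<zero>}"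
  have T: "finite ?T" and fc: "!!x. f x : K" "!!x. g x : K"
   using f g by (auto simp: in_basis_alg)
  have \<beta>: "!!x. f x ~= \<zero> ==> \<beta> x : V" "!!x. g x ~= \<zero> ==> \<beta> x : V"
   using bc f g by auto
  have nz: "f x \<oplus> g x ~= \<zero> ==> f x ~= \<zero> \<or> g x ~= \<zero>" for x by auto
  have "lin_ext K V \<beta> (%x. f x \<oplus> g x)
    = (\<Oplus>.V x\<in>?T. if f x \<oplus> g x = \<zero> then \<zero>.V else (f x \<oplus> g x) \<odot>.V \<beta> x)"
   using assms(1) T by (rule lin_ext_superset) (use fc \<beta> nz in "auto, blast")
  also have "... = (\<Oplus>.V x\<in>?T. (if f x = \<zero> then \<zero>.V else f x \<odot>.V \<beta> x)
     \<oplus>.V (if g x = \<zero> then \<zero>.V else g x \<odot>.V \<beta> x))"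
   using fc \<beta> by (intro V.finsum_eqI) (auto simp: V.smult_l_distr[symmetric])
  also have "... = lin_ext K V \<beta> f \<oplus>.V lin_ext K V \<beta> g"
   using T fc \<beta> by (subst V.finsum_addf) (auto simp: lin_ext_superset[OF assms(1), of ?T])
  finally show "lin_ext K V \<beta> (f \<oplus>\<^bsub>basis_alg K S m U\<^esub> g) = lin_ext K V \<beta> f \<oplus>.V lin_ext K V \<beta> g"
   by (simp add: basis_alg_simps)
 next
  fix k f assume k: "k : K" and f: "f : carrier (basis_alg K S m U)"
  let ?T = "{x. f x ~= \<zero>}"
  have T: "finite ?T" and fc: "!!x. f x : K" using f by (auto simp: in_basis_alg)
  have \<beta>: "!!x. f x ~= \<zero> ==> \<beta> x : V" using bc f by auto
  have nz: "k \<otimes> f x ~= \<zero> ==> f x ~= \<zero>" for x using k by auto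
  have "lin_ext K V \<beta> (%x. k \<otimes> f x) = (\<Oplus>.V x\<in>?T. if k \<otimes> f x = \<zero> then \<zero>.V else (k \<otimes> f x) \<odot>.V \<beta> x)"
   using assms(1) T by (rule lin_ext_superset) (use fc \<beta> k nz in auto)
  also have "... = (\<Oplus>.V x\<in>?T. k \<odot>.V (if f x = \<zero> then \<zero>.V else f x \<odot>.V \<beta> x))"
   using fc \<beta> k by (intro V.finsum_eqI) (auto simp: V.smult_assoc1[symmetric])
  also have "... = k \<odot>.V lin_ext K V \<beta> f"
   using T fc \<beta> k by (subst V.finsum_smult_ldistr[symmetric]) (auto simp: lin_ext_superset[OF assms(1), of ?T])
  finally show "lin_ext K V \<beta> (k \<odot>\<^bsub>basis_alg K S m U\<^esub> f) = k \<odot>.V lin_ext K V \<beta> f"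
   by (simp add: basis_alg_simps)
 qed
qed

lemma lin_ext_basis_elt:
 assumes "module K V" "\<beta> s : V"
 shows "lin_ext K V \<beta> (basis_elt K s) = \<beta> s"
proof -
 interpret V: module K V by fact
 have "lin_ext K V \<beta> (basis_elt K s) = (\<Oplus>.V x\<in>{s}. if basis_elt K s x = \<zero> then \<zero>.V else basis_elt K s x \<odot>.V \<beta> x)"
  using assms by (intro lin_ext_superset) (auto simp: basis_elt_def split: if_splits)
 also have "... = \<beta> s" using assms by (simp add: basis_elt_def)
 finally show ?thesis .
qed

text \<open>The product is bilinear; all its further properties then follow from those on basis elements.\<close>

text \<open>The supports that index the product may be enlarged; products of different pairs of elements can
  then be compared term by term over a common index set.\<close>

lemma basis_mult_superset:
 assumes "finite Y" "finite Z" "{x. f x ~= \<zero>} \<subseteq> Y" "{x. g x ~= \<zero>} \<subseteq> Z" "!!x. f x : K" "!!x. g x : K"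
 shows "(f \<otimes>\<^bsub>basis_alg K S m U\<^esub> g) x
  = finsum K (%(y, z). if m y z = Some x then f y \<otimes> g z else \<zero>) (Y \<times> Z)"
proof -
 let ?N = "{(y, z). f y ~= \<zero> \<and> g z ~= \<zero> \<and> m y z = Some x}"
 have "finsum K (%(y, z). f y \<otimes> g z) ?N
   = finsum K (%(y, z). if m y z = Some x then f y \<otimes> g z else \<zero>) (Y \<times> Z)"
 proof (rule K.add.finprod_mono_neutral_cong_left)
  fix i assume i: "i : Y \<times> Z - ?N"
  then show "(case i of (y, z) \<Rightarrow> if m y z = Some x then f y \<otimes> g z else \<zero>) = \<zero>"
   using assms(5,6) by (cases i) (auto simp: l_null r_null)
 qed (use assms in auto)
 then show ?thesis by (simp add: basis_alg_def)
qed

lemma basis_mult_closed: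
 assumes "!!y z x. y : S ==> z : S ==> m y z = Some x ==> x : S"
  and f: "f : carrier (basis_alg K S m U)" and g: "g : carrier (basis_alg K S m U)"
 shows "f \<otimes>\<^bsub>basis_alg K S m U\<^esub> g : carrier (basis_alg K S m U)"
proof -
 let ?Y = "{x. f x ~= \<zero>}" and ?Z = "{x. g x ~= \<zero>}"
 have fin: "finite ?Y" "finite ?Z" and c: "!!x. f x : K" "!!x. g x : K"
  and sub: "?Y \<subseteq> S" "?Z \<subseteq> S"
  using f g by (auto simp: in_basis_alg)
 let ?W = "(%(y, z). the (m y z)) ` (?Y \<times> ?Z)"
 have eq: "(f \<otimes>\<^bsub>basis_alg K S m U\<^esub> g) x
   = finsum K (%(y, z). if m y z = Some x then f y \<otimes> g z else \<zero>) (?Y \<times> ?Z)" for x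
  by (rule basis_mult_superset) (use fin c in auto)
 have z: "(f \<otimes>\<^bsub>basis_alg K S m U\<^esub> g) x = \<zero>" if "!!y z. y : ?Y ==> z : ?Z ==> m y z ~= Some x" for x
  unfolding eq by (rule K.add.finprod_one_eqI) (use that in auto)
 have "{x. (f \<otimes>\<^bsub>basis_alg K S m U\<^esub> g) x ~= \<zero>} \<subseteq> ?W"
  using z by (force simp: image_iff)
 moreover have "finite ?W" using fin by simp
 ultimately have "finite {x. (f \<otimes>\<^bsub>basis_alg K S m U\<^esub> g) x ~= \<zero>}" using finite_subset by blast
 moreover have "(f \<otimes>\<^bsub>basis_alg K S m U\<^esub> g) x : K" for x
  unfolding eq by (rule K.finsum_closed) (use c in auto)
 moreover have "(f \<otimes>\<^bsub>basis_alg K S m U\<^esub> g) x = \<zero>" if "x \<notin> S" for x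
  by (rule z) (use that sub assms(1) in blast)
 ultimately show ?thesis unfolding in_basis_alg[of "f \<otimes>\<^bsub>basis_alg K S m U\<^esub> g"] by blast
qed

lemma basis_mult_bilin:
 assumes cl: "!!y z x. y : S ==> z : S ==> m y z = Some x ==> x : S"
 shows "bilin K (basis_alg K S m U) (basis_alg K S m U) (basis_alg K S m U) (mult (basis_alg K S m U))"
  (is "bilin K ?B ?B ?B _")
proof -
 have closed: "f *.?B g : ?B" if "f : ?B" "g : ?B" for f g
  using basis_mult_closed[OF cl that] .
 show ?thesis
 proof (rule bilinI)
  fix a b c assume abc: "a : ?B" "b : ?B" "c : ?B"
  let ?Y = "{x. a x ~= \<zero>}" and ?Z = "{x. b x ~= \<zero>} \<union> {x. c x ~= \<zero>}"
  have fin: "finite ?Y" "finite ?Z" and cc: "!!x. a x : K" "!!x. b x : K" "!!x. c x : K"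
   using abc by (auto simp: in_basis_alg)
  have "(a *.?B (b \<oplus>.?B c)) x = (a *.?B b) x \<oplus> (a *.?B c) x" for x
  proof -
   have "(a *.?B (b \<oplus>.?B c)) x
    = finsum K (%(y, z). if m y z = Some x then a y \<otimes> (b \<oplus>.?B c) z else \<zero>) (?Y \<times> ?Z)"
    by (rule basis_mult_superset) (use fin cc in "auto simp: basis_alg_simps")
   also have "... = finsum K (%yz. (case yz of (y, z) \<Rightarrow> if m y z = Some x then a y \<otimes> b z else \<zero>) \<oplus>
      (case yz of (y, z) \<Rightarrow> if m y z = Some x then a y \<otimes> c z else \<zero>)) (?Y \<times> ?Z)"
    by (rule K.finsum_eqI) (use cc in "auto simp: basis_alg_simps r_distr")
   also have "... = (a *.?B b) x \<oplus> (a *.?B c) x"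
    using fin cc by (subst K.finsum_addf) (auto simp: basis_mult_superset[of ?Y ?Z])
   finally show ?thesis .
  qed
  then show "a *.?B (b \<oplus>.?B c) = a *.?B b \<oplus>.?B a *.?B c" by (auto simp: basis_alg_simps)
  have "((b \<oplus>.?B c) *.?B a) x = (b *.?B a) x \<oplus> (c *.?B a) x" for x
  proof -
   have "((b \<oplus>.?B c) *.?B a) x
    = finsum K (%(y, z). if m y z = Some x then (b \<oplus>.?B c) y \<otimes> a z else \<zero>) (?Z \<times> ?Y)"
    by (rule basis_mult_superset) (use fin cc in "auto simp: basis_alg_simps")
   also have "... = finsum K (%yz. (case yz of (y, z) \<Rightarrow> if m y z = Some x then b y \<otimes> a z else \<zero>) \<oplus>
      (case yz of (y, z) \<Rightarrow> if m y z = Some x then c y \<otimes> a z else \<zero>)) (?Z \<times> ?Y)"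
    by (rule K.finsum_eqI) (use cc in "auto simp: basis_alg_simps l_distr")
   also have "... = (b *.?B a) x \<oplus> (c *.?B a) x"
    using fin cc by (subst K.finsum_addf) (auto simp: basis_mult_superset[of ?Z ?Y])
   finally show ?thesis .
  qed
  then show "(b \<oplus>.?B c) *.?B a = b *.?B a \<oplus>.?B c *.?B a" by (auto simp: basis_alg_simps)
 next
  fix a b k assume abk: "a : ?B" "b : ?B" "k : K"
  let ?Y = "{x. a x ~= \<zero>}" and ?Z = "{x. b x ~= \<zero>}"
  have fin: "finite ?Y" "finite ?Z" and cc: "!!x. a x : K" "!!x. b x : K"
   using abk by (auto simp: in_basis_alg)
  have ab: "k \<otimes> (a *.?B b) x
    = finsum K (%yz. k \<otimes> (case yz of (y, z) \<Rightarrow> if m y z = Some x then a y \<otimes> b z else \<zero>)) (?Y \<times> ?Z)" for x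
   using fin cc abk by (subst basis_mult_superset[of ?Y ?Z]; (subst K.finsum_rdistr)?) auto
  have "(a *.?B (k \<odot>.?B b)) x = k \<otimes> (a *.?B b) x" for x
  proof -
   have "(a *.?B (k \<odot>.?B b)) x
    = finsum K (%(y, z). if m y z = Some x then a y \<otimes> (k \<odot>.?B b) z else \<zero>) (?Y \<times> ?Z)"
    by (rule basis_mult_superset) (use fin cc abk in "auto simp: basis_alg_simps")
   then show ?thesis unfolding ab
    by (simp, intro K.finsum_eqI) (use cc abk in "auto simp: basis_alg_simps m_lcomm")
  qed
  then show "a *.?B (k \<odot>.?B b) = k \<odot>.?B (a *.?B b)" by (auto simp: basis_alg_simps)
  have "((k \<odot>.?B a) *.?B b) x = k \<otimes> (a *.?B b) x" for x
  proof -
   have "((k \<odot>.?B a) *.?B b) x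
    = finsum K (%(y, z). if m y z = Some x then (k \<odot>.?B a) y \<otimes> b z else \<zero>) (?Y \<times> ?Z)"
    by (rule basis_mult_superset) (use fin cc abk in "auto simp: basis_alg_simps")
   then show ?thesis unfolding ab
    by (simp, intro K.finsum_eqI) (use cc abk in "auto simp: basis_alg_simps m_assoc")
  qed
  then show "(k \<odot>.?B a) *.?B b = k \<odot>.?B (a *.?B b)" by (auto simp: basis_alg_simps)
 qed (use closed in auto)
qed

lemma basis_elt_mult:
 "basis_elt K y \<otimes>\<^bsub>basis_alg K S m U\<^esub> basis_elt K z
  = (case m y z of None \<Rightarrow> zero (basis_alg K S m U) | Some x \<Rightarrow> basis_elt K x)"
proof
 fix x
 have "(basis_elt K y \<otimes>\<^bsub>basis_alg K S m U\<^esub> basis_elt K z) x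
  = finsum K (%(y', z'). if m y' z' = Some x then basis_elt K y y' \<otimes> basis_elt K z z' else \<zero>) ({y} \<times> {z})"
  by (rule basis_mult_superset) (auto simp: basis_elt_def)
 also have "... = (case m y z of None \<Rightarrow> zero (basis_alg K S m U) | Some x \<Rightarrow> basis_elt K x) x"
  by (auto simp: basis_elt_def basis_alg_simps split: option.split)
 finally show "(basis_elt K y \<otimes>\<^bsub>basis_alg K S m U\<^esub> basis_elt K z) x
  = (case m y z of None \<Rightarrow> zero (basis_alg K S m U) | Some x \<Rightarrow> basis_elt K x) x" .
qed

end

context base_field begin

lemma k_algebraI:
 assumes "module K A" "bilin K A A A (mult A)" "\<one>.A : A"
  and "!!x y z. [|x : A; y : A; z : A|] ==> (x *.A y) *.A z = x *.A (y *.A z)"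
  and "!!x. x : A ==> \<one>.A *.A x = x" "!!x. x : A ==> x *.A \<one>.A = x"
 shows "k_algebra K A"
proof -
 interpret A: module K A by fact
 note l = bilin_left[OF assms(2)] and r = bilin_right[OF assms(2)]
 have "ring A"
 proof (rule ringI)
  show "Group.monoid A" by (rule monoidI) (use assms(3-6) bilin_closed[OF assms(2)] in auto)
 qed (use lin_add[OF l] lin_add[OF r] A.abelian_group_axioms in auto)
 then show ?thesis
  by (intro k_algebra.intro k_algebra_axioms.intro assms(1) field_axioms)
    (simp_all add: lin_smult[OF l] lin_smult[OF r])
qed

text \<open>Both sides of the associative law are trilinear, so it passes from basis elements to all elements,
  one argument at a time.  The last two hypotheses say that exactly one of the basis elements in \<open>U\<close>
  acts on a given one as a unit from either side, while the others annihilate it.\<close>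

lemma basis_k_algebra:
 assumes cl: "!!y z x. y : S ==> z : S ==> m y z = Some x ==> x : S"
  and U: "finite U" "U \<subseteq> S"
  and assoc: "!!x y z. x : S ==> y : S ==> z : S ==>
   (case m x y of None \<Rightarrow> None | Some u \<Rightarrow> m u z) = (case m y z of None \<Rightarrow> None | Some u \<Rightarrow> m x u)"
  and lunit: "!!z. z : S ==> \<exists>u\<in>U. m u z = Some z \<and> (\<forall>u'\<in>U. u' ~= u \<longrightarrow> m u' z = None)"
  and runit: "!!z. z : S ==> \<exists>u\<in>U. m z u = Some z \<and> (\<forall>u'\<in>U. u' ~= u \<longrightarrow> m z u' = None)"
 shows "k_algebra K (basis_alg K S m U)" (is "k_algebra K ?B")
proof -
 have bil: "bilin K ?B ?B ?B (mult ?B)" by (rule basis_mult_bilin) (rule cl)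
 interpret B: module K ?B by (rule basis_module)
 note mc = bilin_closed[OF bil] and ll = bilin_left[OF bil] and rl = bilin_right[OF bil]
 note eq = basis_lin_eq[where S = S and m = m and U = U and V = ?B, OF _ _ B.md]
 have zl: "\<zero>.?B *.?B x = \<zero>.?B" and zr: "x *.?B \<zero>.?B = \<zero>.?B" if "x : ?B" for x
  using lin_zero[OF ll[OF that] B.md B.md]
   lin_zero[OF rl[OF that] B.md B.md] by auto
 note be = basis_elt_closed[of _ S m U]
 have a1: "(basis_elt K x *.?B basis_elt K y) *.?B basis_elt K z
   = basis_elt K x *.?B (basis_elt K y *.?B basis_elt K z)" if "x : S" "y : S" "z : S" for x y z
  using assoc[OF that] by (auto simp: basis_elt_mult zl zr be that split: option.splits)
 have a2: "(basis_elt K x *.?B basis_elt K y) *.?B h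
   = basis_elt K x *.?B (basis_elt K y *.?B h)" if "x : S" "y : S" "h : ?B" for x y h
  by (rule eq[OF rl lin_comp[OF rl rl]]) (auto simp: that a1 be mc)
 have a3: "(basis_elt K x *.?B g) *.?B h
   = basis_elt K x *.?B (g *.?B h)" if "x : S" "g : ?B" "h : ?B" for x g h
  by (rule eq[OF lin_comp[OF rl ll] lin_comp[OF ll rl]]) (auto simp: that a2 be mc)
 have a4: "(f *.?B g) *.?B h
   = f *.?B (g *.?B h)" if "f : ?B" "g : ?B" "h : ?B" for f g h
  by (rule eq[OF lin_comp[OF ll ll] ll]) (auto simp: that a3 be mc)
 have one: "\<one>.?B : ?B"
  using U rev_finite_subset[OF U(1)] unfolding in_basis_alg basis_alg_simps by auto
 have idl: "(%x. x) : lin_maps K ?B ?B" by (rule lin_mapsI) auto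
 have l1: "\<one>.?B *.?B basis_elt K z = basis_elt K z" if z: "z : S" for z
 proof
  fix x
  obtain u where u: "u : U" "m u z = Some z" "!!u'. u' : U ==> u' ~= u ==> m u' z = None"
   using lunit[OF z] by blast
  have "(\<one>.?B *.?B basis_elt K z) x
   = finsum K (%(y, z'). if m y z' = Some x then \<one>.?B y \<otimes> basis_elt K z z' else \<zero>) (U \<times> {z})"
   by (rule basis_mult_superset) (use U in "auto simp: basis_elt_def basis_alg_simps")
  also have "... = (\<Oplus>y\<in>U. \<Oplus>z'\<in>{z}. if m y z' = Some x then \<one>.?B y \<otimes> basis_elt K z z' else \<zero>)"
   by (rule K.finsum_prod) (use U in "auto simp: basis_elt_def basis_alg_simps")
  also have "... = (\<Oplus>y\<in>U. if y = u then (if x = z then \<one> else \<zero>) else \<zero>)"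
   by (rule K.finsum_eqI) (use u in "auto simp: basis_elt_def basis_alg_simps")
  also have "... = basis_elt K z x" using U u by (subst K.finsum_delta) (auto simp: basis_elt_def)
  finally show "(\<one>.?B *.?B basis_elt K z) x = basis_elt K z x" .
 qed
 have r1: "basis_elt K z *.?B \<one>.?B = basis_elt K z" if z: "z : S" for z
 proof
  fix x
  obtain u where u: "u : U" "m z u = Some z" "!!u'. u' : U ==> u' ~= u ==> m z u' = None"
   using runit[OF z] by blast
  have "(basis_elt K z *.?B \<one>.?B) x
   = finsum K (%(z', y). if m z' y = Some x then basis_elt K z z' \<otimes> \<one>.?B y else \<zero>) ({z} \<times> U)"
   by (rule basis_mult_superset) (use U in "auto simp: basis_elt_def basis_alg_simps")
  also have "... = (\<Oplus>z'\<in>{z}. \<Oplus>y\<in>U. if m z' y = Some x then basis_elt K z z' \<otimes> \<one>.?B y else \<zero>)"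
   by (rule K.finsum_prod) (use U in "auto simp: basis_elt_def basis_alg_simps")
  also have "... = (\<Oplus>y\<in>U. if m z y = Some x then basis_elt K z z \<otimes> \<one>.?B y else \<zero>)"
   by (subst K.finsum_insert) (auto simp: basis_elt_def basis_alg_simps)
  also have "... = (\<Oplus>y\<in>U. if y = u then (if x = z then \<one> else \<zero>) else \<zero>)"
   by (rule K.finsum_eqI) (use u in "auto simp: basis_elt_def basis_alg_simps")
  also have "... = basis_elt K z x" using U u by (subst K.finsum_delta) (auto simp: basis_elt_def)
  finally show "(basis_elt K z *.?B \<one>.?B) x = basis_elt K z x" .
 qed
 show ?thesis
 proof (rule k_algebraI[OF B.md bil one a4])
  fix x assume x: "x : ?B"
  show "\<one>.?B *.?B x = x" by (rule eq[OF rl[OF one] idl]) (auto simp: l1 x)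
  show "x *.?B \<one>.?B = x" by (rule eq[OF ll[OF one] idl]) (auto simp: r1 x)
 qed
qed

end

section \<open>Quotients\<close>

lemma (in abelian_group) minus_zero_iff:
 assumes "a : G" "b : G"
 shows "a \<ominus> b = \<zero> \<longleftrightarrow> a = b"
 using assms minus_equality[of a "\<ominus> b"] by (auto simp: a_minus_def r_neg)

lemma quot_alg_simps:
 "carrier (quot_alg A N) = {N +>.A x | x. x : A}"
 "zero (quot_alg A N) = N" "add (quot_alg A N) = set_add A"
 "mult (quot_alg A N) = rcoset_mult A N" "one (quot_alg A N) = N +>.A \<one>.A"
 "smult (quot_alg A N) = (%k C. \<Union>x\<in>C. N +>.A (k \<odot>.A x))"
 by (auto simp: quot_alg_def ring.defs module.defs FactRing_def A_RCOSETS_def' a_r_coset_def')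

locale quotient_module = module K M + submodule N K M for K (structure) and M (structure) and N
begin

lemma subgroup_N: "abelian_subgroup N M"
 using subgroup_axioms by (intro abelian_subgroupI3 additive_subgroupI M.abelian_group_axioms)

sublocale NS: abelian_subgroup N M by (rule subgroup_N)

abbreviation "Q \<equiv> quot_alg M N"
abbreviation cls where "cls x \<equiv> N +>.M x"

lemma cls_eq_iff:
 assumes "x : M" "y : M"
 shows "cls x = cls y \<longleftrightarrow> x \<ominus>.M y : N"
proof -
 have "cls x = cls y \<longleftrightarrow> x : cls y"
  using NS.a_repr_independence'[OF _ assms(2), of x, symmetric] NS.a_repr_independenceD[OF assms(1) sym]
  by (intro iffI) assumption+
 then show ?thesis using NS.a_rcos_module[of y x] assms by (simp add: a_minus_def)
qed

lemma cls_closed [simp]: "x : M ==> cls x : Q"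
 by (auto simp: quot_alg_simps)

lemma cls_cases: "C : Q ==> (!!x. x : M ==> C = cls x ==> P) ==> P"
 by (auto simp: quot_alg_simps)

lemma cls_add: "x : M ==> y : M ==> cls x \<oplus>.Q cls y = cls (x \<oplus>.M y)"
 by (simp add: quot_alg_simps NS.a_rcos_sum)

lemma cls_const:
 assumes "x : M" "y : cls x"
 shows "y : M" "cls y = cls x" "y \<ominus>.M x : N"
proof -
 show y: "y : M" using assms NS.a_elemrcos_carrier[of x y] by simp
 show "cls y = cls x" using NS.a_repr_independence'[of y x] assms by simp
 then show "y \<ominus>.M x : N" using cls_eq_iff[OF y assms(1)] by simp
qed

lemma self_in_cls: "x : M ==> x : cls x"
 by (rule NS.a_rcos_self)

lemma cls_smult:
 assumes "x : M" "k : K"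
 shows "k \<odot>.Q cls x = cls (k \<odot>.M x)"
proof -
 have "cls (k \<odot>.M y) = cls (k \<odot>.M x)" if "y : cls x" for y
 proof -
  note y = cls_const[OF assms(1) that]
  have "k \<odot>.M (y \<ominus>.M x) = k \<odot>.M y \<ominus>.M k \<odot>.M x"
   using assms y(1) by (simp add: a_minus_def smult_r_distr smult_r_minus)
  then show ?thesis
   using cls_eq_iff[of "k \<odot>.M y" "k \<odot>.M x"] assms y smult_closed[OF assms(2) y(3)] by simp
 qed
 moreover have "cls x ~= {}" using self_in_cls[OF assms(1)] by blast
 ultimately show ?thesis unfolding quot_alg_simps by (intro SUP_eq_const)
qed

lemma cls_zero: "cls \<zero>.M = \<zero>.Q"
 by (simp add: quot_alg_simps M.a_coset_add_zero[OF NS.a_subset])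

lemma quot_module: "module K Q"
proof (rule moduleI)
 show "abelian_group Q"
 proof (rule abelian_groupI)
  fix x assume "x : Q"
  then show "\<exists>y\<in>carrier Q. y \<oplus>.Q x = \<zero>.Q"
  proof (rule cls_cases)
   fix u assume u: "u : M" "x = cls u"
   then have "cls (\<ominus>.M u) \<oplus>.Q x = \<zero>.Q" by (simp add: cls_add cls_zero[symmetric] M.l_neg)
   then show ?thesis using u by (intro bexI[of _ "cls (\<ominus>.M u)"]) auto
  qed
 next
  show "\<zero>.Q : Q" unfolding cls_zero[symmetric] by simp
 qed (auto elim!: cls_cases simp: cls_add cls_zero[symmetric] M.a_ac)
qed (auto elim!: cls_cases simp: cls_add cls_smult smult_l_distr smult_r_distr smult_assoc1 R.is_cring)

lemma cls_lin: "cls : lin_maps K M Q"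
 by (rule lin_mapsI) (simp_all add: cls_add cls_smult)

lemma
 assumes h: "h : lin_maps K M V" and V: "module K V" and N: "!!n. n : N ==> h n = \<zero>.V"
 shows induced_cls: "x : M ==> induced h (cls x) = h x"
  and induced_lin: "induced h : lin_maps K Q V"
proof -
 interpret V: module K V by fact
 show 1: "induced h (cls x) = h x" if x: "x : M" for x
 proof -
  have "h y = h x" if y: "y : cls x" for y
  proof -
   note y = cls_const[OF x y]
   have "h y \<ominus>.V h x = \<zero>.V" using N[OF y(3)] lin_minus[OF h module_axioms V y(1) x] by simp
   then show ?thesis using V.minus_zero_iff[OF lin_closed[OF h y(1)] lin_closed[OF h x]] by simp
  qed
  then have "h ` cls x = {h x}" using self_in_cls[OF x] by blast
  then show ?thesis by (simp add: induced_def)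
 qed
 show "induced h : lin_maps K Q V"
  by (rule lin_mapsI)
    (auto elim!: cls_cases simp: cls_add cls_smult 1 lin_closed[OF h] lin_add[OF h] lin_smult[OF h])
qed

end

lemma submodule_vimage:
 assumes "h : lin_maps K M V" "module K M" "module K V" "submodule N K V"
 shows "submodule {x \<in> M. h x : N} K M"
proof -
 interpret M: module K M by fact
 interpret V: module K V by fact
 interpret quotient_module K V N using assms by (intro quotient_module.intro)
 have m: "h (\<ominus>.M a) = \<ominus>.V h a" if "a : M" for a
  using lin_minus[OF assms(1-3), of "\<zero>.M" a] that lin_zero[OF assms(1-3)] lin_closed[OF assms(1)]
  by (simp add: a_minus_def)
 show ?thesis
  by (rule M.submoduleI)
    (auto simp: lin_zero[OF assms(1-3)] lin_add[OF assms(1)] lin_smult[OF assms(1)] m)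
qed

lemma (in module) submodule_zero: "submodule {\<zero>.M} R M"
 by (rule submoduleI) auto

lemma submodule_kernel:
 assumes "h : lin_maps K M V" "module K M" "module K V"
 shows "submodule {x \<in> M. h x = \<zero>.V} K M"
 using submodule_vimage[OF assms module.submodule_zero[OF assms(3)]] by simp

lemma submod_gen_minimal: "submodule N K M ==> S \<subseteq> N ==> submod_gen K M S \<subseteq> N"
 by (auto simp: submod_gen_def)

lemma submod_gen_mono: "S \<subseteq> S' ==> submod_gen K M S \<subseteq> submod_gen K M S'"
 by (auto simp: submod_gen_def)

lemma submod_gen_incl: "S \<subseteq> submod_gen K M S"
 by (auto simp: submod_gen_def)

lemma (in module) submod_gen_submodule:
 assumes "S \<subseteq> carrier M"
 shows "submodule (submod_gen R M S) R M"
proof (rule submoduleI)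
 let ?F = "{N. submodule N R M \<and> S \<subseteq> N}"
 have "carrier M : ?F" using assms carrier_is_submodule by simp
 then show "submod_gen R M S \<subseteq> carrier M" by (auto simp: submod_gen_def)
qed (auto simp: submod_gen_def submoduleE, meson quotient_module.intro module_axioms quotient_module.subgroup_N
    abelian_subgroup.axioms(1) additive_subgroup.zero_closed)

locale quotient_algebra = k_algebra K A + I?: ideal N A for K (structure) and A (structure) and N
begin

lemma ideal_submodule: "submodule N K A"
proof (rule submoduleI)
 fix a x assume a: "a : K" "x : N"
 then have "a \<odot>.A x = (a \<odot>.A \<one>.A) *.A x" by (simp add: smult_mult_left)
 then show "a \<odot>.A x : N" using a by (simp add: I_l_closed)
qed auto

sublocale quotient_module K A N
 by (intro quotient_module.intro module_axioms ideal_submodule)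

lemma cls_mult: "x : A ==> y : A ==> cls x *.Q cls y = cls (x *.A y)"
 by (simp add: quot_alg_simps rcoset_mult_add)

lemma cls_one: "cls \<one>.A = \<one>.Q"
 by (simp add: quot_alg_simps)

lemma quot_k_algebra: "k_algebra K Q"
proof (rule k_algebraI[OF quot_module])
 show "bilin K Q Q Q (mult Q)"
  by (rule bilinI)
    (auto elim!: cls_cases simp: cls_mult cls_add cls_smult A.r_distr A.l_distr smult_mult_left smult_mult_right)
qed (auto elim!: cls_cases simp: cls_mult cls_one[symmetric] A.m_assoc)

end

section \<open>Tensor products of algebras\<close>

lemmas U2 = UnI1[OF UnI1] and U4 = UnI1[OF UnI1[OF UnI1[OF UnI1]]]

lemma (in module) id_lin: "(%x. x) : lin_maps R M M"
 by (rule lin_mapsI) auto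

locale alg_pair = A: k_algebra K A + B: k_algebra K B
 for K :: "('k, 'm) ring_scheme" (structure) and A :: "('k, 'a, 'y) module_scheme" and B :: "('k, 'b, 'z) module_scheme"
begin

abbreviation "P \<equiv> pair_alg K A B"
abbreviation "N \<equiv> bilin_rels K A B"
abbreviation "T \<equiv> tensor K A B"
abbreviation elt where "elt a b \<equiv> basis_elt K (a, b)"

lemma pair_k_algebra: "k_algebra K P"
 unfolding pair_alg_def
 by (rule A.basis_k_algebra)
   (auto simp: A.A.m_assoc B.A.m_assoc)

sublocale P: k_algebra K P by (rule pair_k_algebra)

lemma elt_closed [simp]: "a : A ==> b : B ==> elt a b : P"
 unfolding pair_alg_def by (rule A.basis_elt_closed) auto

lemma elt_mult:
 "elt a b *.P elt c d = elt (a *.A c) (b *.B d)"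
 unfolding pair_alg_def by (simp add: A.basis_elt_mult)

lemma P_induct [consumes 1, case_names zero step]:
 assumes "u : P" "Q \<zero>.P"
  and "!!k a b g. k : K ==> a : A ==> b : B ==> g : P ==> Q g ==>
   Q (k \<odot>.P elt a b \<oplus>.P g)"
 shows "Q u"
 using assms unfolding pair_alg_def by (induction u rule: A.basis_induct) auto

inductive_set relators where
 rel1: "a : A ==> a' : A ==> b : B ==>
  elt (a \<oplus>.A a') b \<ominus>.P (elt a b \<oplus>.P elt a' b) : relators"
| rel2: "a : A ==> b : B ==> b' : B ==>
  elt a (b \<oplus>.B b') \<ominus>.P (elt a b \<oplus>.P elt a b') : relators"
| rel3: "k : K ==> a : A ==> b : B ==>
  elt (k \<odot>.A a) b \<ominus>.P (k \<odot>.P elt a b) : relators"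
| rel4: "k : K ==> a : A ==> b : B ==>
  elt a (k \<odot>.B b) \<ominus>.P (k \<odot>.P elt a b) : relators"

lemma N_def: "N = submod_gen K P relators"
 unfolding bilin_rels_def
proof (rule equalityI; rule submod_gen_mono)
 show "relators \<subseteq> {elt (a \<oplus>.A a') b \<ominus>.P (elt a b \<oplus>.P elt a' b) |
    a a' b. a : A \<and> a' : A \<and> b : B} \<union>
   {elt a (b \<oplus>.B b') \<ominus>.P (elt a b \<oplus>.P elt a b') |
    a b b'. a : A \<and> b : B \<and> b' : B} \<union>
   {elt (k \<odot>.A a) b \<ominus>.P (k \<odot>.P elt a b) |
    k a b. k : K \<and> a : A \<and> b : B} \<union>
   {elt a (k \<odot>.B b) \<ominus>.P (k \<odot>.P elt a b) |
    k a b. k : K \<and> a : A \<and> b : B}"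
  apply (rule subsetI)
  apply (erule relators.cases)
    apply (rule U2, rule UnI1, blast)
   apply (rule U2, rule UnI2, blast)
   apply (rule UnI1, rule UnI2, blast)
  apply (rule UnI2, blast)
  done
qed (intro Un_least subsetI; elim CollectE exE conjE; hypsubst; rule relators.intros; assumption)

lemma relators_closed: "relators \<subseteq> carrier P"
 by (auto elim!: relators.cases)

lemma N_submodule: "submodule N K P"
 unfolding N_def by (rule P.submod_gen_submodule[OF relators_closed])

lemma relators_N: "relators \<subseteq> N"
 unfolding N_def by (rule submod_gen_incl)

lemma lin_l: "u : P ==> (%n. u *.P n) : lin_maps K P P"
 by (rule lin_mapsI) (auto simp: P.A.r_distr P.smult_mult_right)
lemma lin_r: "u : P ==> (%n. n *.P u) : lin_maps K P P"
 by (rule lin_mapsI) (auto simp: P.A.l_distr P.smult_mult_left)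

lemma relator_elt:
 assumes "n : relators" "c : A" "d : B"
 shows "elt c d *.P n : relators" "n *.P elt c d : relators"
proof -
 note l = lin_l[OF elt_closed[OF assms(2,3)]] and r = lin_r[OF elt_closed[OF assms(2,3)]]
 note lm = lin_minus[OF l P.md P.md] lin_add[OF l] lin_smult[OF l]
 note rm = lin_minus[OF r P.md P.md] lin_add[OF r] lin_smult[OF r]
 show "elt c d *.P n : relators"
  using assms(1) by cases
   (use assms(2,3) in "auto simp: lm elt_mult A.A.r_distr B.A.r_distr A.smult_mult_right B.smult_mult_right
     intro: relators.intros")
 show "n *.P elt c d : relators"
  using assms(1) by cases
   (use assms(2,3) in "auto simp: rm elt_mult A.A.l_distr B.A.l_distr A.smult_mult_left B.smult_mult_left
     intro: relators.intros")
qed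

lemma N_ideal: "ideal N P"
proof -
 interpret NN: quotient_module K P N by (intro quotient_module.intro P.md N_submodule)
 have l1: "elt c d *.P n : N" if "c : A" "d : B" "n : N" for c d n
 proof -
  have "N \<subseteq> {n \<in> P. elt c d *.P n : N}"
   unfolding N_def[symmetric] by (subst (1) N_def, rule submod_gen_minimal, rule submodule_vimage[OF lin_l])
    (use that relator_elt relators_N relators_closed N_submodule in "auto intro: P.md")
  then show ?thesis using that by auto
 qed
 have r1: "n *.P elt c d : N" if "c : A" "d : B" "n : N" for c d n
 proof -
  have "N \<subseteq> {n \<in> P. n *.P elt c d : N}"
   unfolding N_def[symmetric] by (subst (1) N_def, rule submod_gen_minimal, rule submodule_vimage[OF lin_r])
    (use that relator_elt relators_N relators_closed N_submodule in "auto intro: P.md")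
  then show ?thesis using that by auto
 qed
 have NP: "n : N ==> n : P" for n by (rule NN.NS.a_Hcarr)
 have l2: "u *.P n : N" if n: "n : N" and u: "u : P" for u n
  using u by (induction u rule: P_induct) (auto simp: P.A.l_distr P.smult_mult_left NP[OF n] l1 n)
 have r2: "n *.P u : N" if n: "n : N" and u: "u : P" for u n
  using u by (induction u rule: P_induct) (auto simp: P.A.r_distr P.smult_mult_right NP[OF n] r1 n)
 show ?thesis
  by (rule idealI) (use NN.subgroup_axioms l2 r2 P.A.ring_axioms in auto)
qed

sublocale N: quotient_algebra K P N
 by (intro quotient_algebra.intro P.k_algebra_axioms N_ideal)

lemma T_eq: "T = N.Q"
 by (simp add: tensor_def)

lemma tensor_k_algebra: "k_algebra K T"
 unfolding T_eq by (rule N.quot_k_algebra)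

lemma tens_eq: "tens K A B a b = N.cls (elt a b)"
 by (simp add: tens_def)

lemma tens_closed [simp]: "a : A ==> b : B ==> tens K A B a b : T"
 by (simp add: tens_eq T_eq)

lemma tens_bilin: "bilin K A B T (tens K A B)"
proof (rule bilinI, goal_cases)
 have *: "N.cls x = N.cls y" if "x \<ominus>.P y : relators" "x : P" "y : P" for x y
  using that(1) relators_N N.cls_eq_iff[OF that(2,3)] by auto
 { case (1 a b) then show ?case by simp
 next
  case (2 a b c) then show ?case unfolding tens_eq T_eq by (subst N.cls_add, simp, simp, intro * rel2) simp_all
 next
  case (3 a b k) then show ?case unfolding tens_eq T_eq by (subst N.cls_smult, simp, simp, intro * rel4) simp_all
 next
  case (4 a b c) then show ?case unfolding tens_eq T_eq by (subst N.cls_add, simp, simp, intro * rel1) simp_all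
 next
  case (5 a b k) then show ?case unfolding tens_eq T_eq by (subst N.cls_smult, simp, simp, intro * rel3) simp_all }
qed

lemma tens_mult:
 "a : A ==> b : B ==> c : A ==> d : B ==>
  tens K A B a b *.T tens K A B c d = tens K A B (a *.A c) (b *.B d)"
 by (simp add: tens_eq T_eq N.cls_mult elt_mult)

lemma tens_one: "tens K A B \<one>.A \<one>.B = \<one>.T"
proof -
 have "\<one>.P = elt \<one>.A \<one>.B" by (auto simp: pair_alg_def basis_alg_def basis_elt_def)
 then show ?thesis by (simp add: tens_eq T_eq N.cls_one[symmetric])
qed

lemma tensor_induct [consumes 1, case_names tens add]:
 assumes "z : T"
  and t: "!!a b. a : A ==> b : B ==> Q (tens K A B a b)"
  and p: "!!x y. x : T ==> y : T ==> Q x ==> Q y ==> Q (x \<oplus>.T y)"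
 shows "Q z"
proof -
 interpret T: k_algebra K T by (rule tensor_k_algebra)
 obtain u where u: "u : P" "z = N.cls u" using assms(1) unfolding T_eq by (rule N.cls_cases)
 have cT: "N.cls g : T" if "g : P" for g using that by (simp add: T_eq)
 have "Q (N.cls u)" using u(1)
 proof (induction u rule: P_induct)
  case zero
  have "tens K A B \<zero>.A \<zero>.B = \<zero>.T"
   using lin_zero[OF bilin_left[OF tens_bilin] A.md T.md, of "\<zero>.B"] by simp
  then show ?case using t[of "\<zero>.A" "\<zero>.B"] by (simp add: N.cls_zero T_eq)
 next
  case (step k a b g)
  then have "N.cls (k \<odot>.P elt a b \<oplus>.P g) = tens K A B (k \<odot>.A a) b \<oplus>.T N.cls g"
   using lin_smult[OF bilin_left[OF tens_bilin]]
   by (simp add: N.cls_add[symmetric] T_eq N.cls_smult[symmetric] tens_eq)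
  moreover have "Q (tens K A B (k \<odot>.A a) b \<oplus>.T N.cls g)"
   using step by (intro p t) (auto simp: cT)
  ultimately show ?case by simp
 qed
 then show ?thesis using u by simp
qed

lemma tensor_lin_eq:
 assumes "f : lin_maps K T V" "g : lin_maps K T V"
  and "!!a b. a : A ==> b : B ==> f (tens K A B a b) = g (tens K A B a b)"
  and "z : T"
 shows "f z = g z"
 using assms(4) by (induction z rule: tensor_induct) (auto simp: assms(3) lin_add[OF assms(1)] lin_add[OF assms(2)])

text \<open>With this an abstract Frobenius element becomes a finite family of pairs that can be summed over.\<close>

lemma tensor_finsum:
 assumes "z : T"
 obtains n :: nat and p q where "p : {..<n} \<rightarrow> carrier A" "q : {..<n} \<rightarrow> carrier B"
  "z = (\<Oplus>.T j\<in>{..<n}. tens K A B (p j) (q j))"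
proof -
 interpret T: k_algebra K T by (rule tensor_k_algebra)
 have "\<exists>n p q. p : {..<n::nat} \<rightarrow> carrier A \<and> q : {..<n} \<rightarrow> carrier B \<and>
  z = (\<Oplus>.T j\<in>{..<n}. tens K A B (p j) (q j))"
  using assms
 proof (induction z rule: tensor_induct)
  case (tens a b)
  then show ?case
   by (intro exI[of _ "Suc 0"] exI[of _ "%_. a"] exI[of _ "%_. b"]) (simp add: lessThan_Suc)
 next
  case (add x y)
  obtain n p q n' p' q' where 1: "p : {..<n::nat} \<rightarrow> carrier A" "q : {..<n} \<rightarrow> carrier B"
   "x = (\<Oplus>.T j\<in>{..<n}. tens K A B (p j) (q j))"
   and 2: "p' : {..<n'::nat} \<rightarrow> carrier A" "q' : {..<n'} \<rightarrow> carrier B"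
   "y = (\<Oplus>.T j\<in>{..<n'}. tens K A B (p' j) (q' j))"
   using add by blast
  define P where "P j = (if j < n then p j else p' (j - n))" for j
  define Q where "Q j = (if j < n then q j else q' (j - n))" for j
  have PQ: "P : {..<n + n'} \<rightarrow> carrier A" "Q : {..<n + n'} \<rightarrow> carrier B"
   using 1 2 by (auto simp: P_def Q_def Pi_def)
  have im: "{n..<n + n'} = (%j. j + n) ` {..<n'}"
   by (simp add: lessThan_atLeast0 image_add_atLeastLessThan' add.commute)
  have un: "{..<n + n'} = {..<n} \<union> {n..<n + n'}" by auto
  have "(\<Oplus>.T j\<in>{..<n + n'}. tens K A B (P j) (Q j))
    = (\<Oplus>.T j\<in>{..<n}. tens K A B (P j) (Q j)) \<oplus>.T (\<Oplus>.T j\<in>{n..<n + n'}. tens K A B (P j) (Q j))"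
   unfolding un by (rule T.M.finsum_Un_disjoint) (use PQ in "auto simp: Pi_iff")
  also have "(\<Oplus>.T j\<in>{..<n}. tens K A B (P j) (Q j)) = x"
   unfolding 1(3) using 1(1,2) by (intro T.M.finsum_eqI) (auto simp: P_def Q_def Pi_iff)
  also have "(\<Oplus>.T j\<in>{n..<n + n'}. tens K A B (P j) (Q j)) = (\<Oplus>.T j\<in>{..<n'}. tens K A B (P (j + n)) (Q (j + n)))"
   unfolding im by (rule T.M.finsum_reindex) (use PQ in "auto simp: Pi_iff")
  also have "... = y"
   unfolding 2(3) using 2(1,2) by (intro T.M.finsum_eqI) (auto simp: P_def Q_def Pi_iff)
  finally show ?case using PQ by (intro exI[of _ "n + n'"] exI[of _ P] exI[of _ Q]) simp
 qed
 then show ?thesis using that by blast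
qed

lemma
 assumes b: "bilin K A B V \<beta>" and V: "module K V"
 shows tensor_lift_lin: "tensor_lift K V \<beta> : lin_maps K T V"
  and tensor_lift_tens: "a : A ==> b : B ==> tensor_lift K V \<beta> (tens K A B a b) = \<beta> a b"
proof -
 interpret V: module K V by fact
 let ?f = "lin_ext K V (%(a, b). \<beta> a b)"
 note bc = bilin_closed[OF b]
 have lin: "?f : lin_maps K P V"
  unfolding pair_alg_def by (rule A.lin_ext_lin[OF V]) (auto simp: bc)
 have fe: "?f (elt a b) = \<beta> a b" if "a : A" "b : B" for a b
  by (subst A.lin_ext_basis_elt[OF V]) (auto simp: bc that)
 have "N \<subseteq> {x \<in> P. ?f x = \<zero>.V}"
  unfolding N_def
 proof (rule submod_gen_minimal[OF submodule_kernel[OF lin P.md V]], safe)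
  fix x assume "x : relators"
  then show "x : P" using relators_closed by blast
  have *: "?f (u \<ominus>.P v) = \<zero>.V" if "u : P" "v : P" "?f u = ?f v" for u v
   using that lin_minus[OF lin P.md V that(1,2)] lin_closed[OF lin that(2)]
   by (simp add: V.minus_zero_iff)
  from \<open>x : relators\<close> show "?f x = \<zero>.V"
   by cases (auto intro!: * simp: lin_add[OF lin] lin_smult[OF lin] fe lin_add[OF bilin_left[OF b]]
     lin_add[OF bilin_right[OF b]] lin_smult[OF bilin_left[OF b]] lin_smult[OF bilin_right[OF b]])
 qed
 then have z: "!!n. n : N ==> ?f n = \<zero>.V" by blast
 show "tensor_lift K V \<beta> : lin_maps K T V"
  unfolding tensor_lift_def T_eq by (rule N.induced_lin[OF lin V z])
 show "tensor_lift K V \<beta> (tens K A B a b) = \<beta> a b" if "a : A" "b : B" for a b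
  unfolding tensor_lift_def tens_eq using that by (subst N.induced_cls[OF lin V z]) (auto simp: fe)
qed

lemma tensor_lift_cong:
 assumes b: "bilin K A B V \<beta>" and V: "module K V" and z: "z : T"
  and eq: "!!a b. a : A ==> b : B ==> \<beta> a b = \<gamma> a b"
 shows "tensor_lift K V \<beta> z = tensor_lift K V \<gamma> z"
proof -
 have g: "bilin K A B V \<gamma>"
  by (rule bilinI)
   (simp_all add: eq[symmetric] bilin_closed[OF b] lin_add[OF bilin_left[OF b]] lin_smult[OF bilin_left[OF b]]
    lin_add[OF bilin_right[OF b]] lin_smult[OF bilin_right[OF b]])
 show ?thesis
  by (rule tensor_lin_eq[OF tensor_lift_lin[OF b V] tensor_lift_lin[OF g V] _ z])
   (simp add: tensor_lift_tens[OF b V] tensor_lift_tens[OF g V] eq)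
qed

text \<open>A linear map out of the tensor product is determined by its values on pure tensors.\<close>

lemma tensor_lift_eqI:
 assumes b: "bilin K A B V \<beta>" and V: "module K V" and f: "f : lin_maps K T V" and z: "z : T"
  and eq: "!!a b. a : A ==> b : B ==> \<beta> a b = f (tens K A B a b)"
 shows "tensor_lift K V \<beta> z = f z"
 by (rule tensor_lin_eq[OF tensor_lift_lin[OF b V] f _ z]) (simp add: tensor_lift_tens[OF b V] eq)

lemma tensor_lift_comp:
 assumes b: "bilin K A B V \<beta>" and V: "module K V" "module K W" and f: "f : lin_maps K V W" and z: "z : T"
 shows "f (tensor_lift K V \<beta> z) = tensor_lift K W (%x y. f (\<beta> x y)) z"
 by (rule sym, rule tensor_lift_eqI[OF bilin_comp[OF b A.id_lin B.id_lin f] V(2) lin_comp[OF tensor_lift_lin[OF b V(1)] f] z])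
   (simp add: tensor_lift_tens[OF b V(1)])

lemma lin_mult_multiplicative:
 assumes C: "k_algebra K C" and f: "f : lin_maps K T C"
  and m: "!!a b c d. [|a : A; b : B; c : A; d : B|] ==>
   f (tens K A B (a *.A c) (b *.B d)) = f (tens K A B a b) *.C f (tens K A B c d)"
  and x: "x : T" and y: "y : T"
 shows "f (x *.T y) = f x *.C f y"
proof -
 interpret T: k_algebra K T by (rule tensor_k_algebra)
 interpret C: k_algebra K C by fact
 note fc = lin_closed[OF f] and fa = lin_add[OF f]
 have 1: "f (tens K A B a b *.T y) = f (tens K A B a b) *.C f y"
  if ab: "a : A" "b : B" for a b
  using y by (induction y rule: tensor_induct)
   (auto simp: ab tens_mult m T.A.r_distr C.A.r_distr fc fa)
 show ?thesis
  using x by (induction x rule: tensor_induct) (auto simp: 1 y T.A.l_distr C.A.l_distr fc fa)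
qed

end

section \<open>Opposite, function, endomorphism and scalar algebras\<close>

lemma op_alg_simps [simp]:
 "carrier (op_alg A) = carrier A" "zero (op_alg A) = zero A" "add (op_alg A) = add A"
 "one (op_alg A) = one A" "smult (op_alg A) = smult A" "mult (op_alg A) = (%x y. y *.A x)"
 by (simp_all add: op_alg_def)

lemma lin_maps_op [simp]:
 "lin_maps K (op_alg A) V = lin_maps K A V" "lin_maps K V (op_alg A) = lin_maps K V A"
 by (auto simp: lin_maps_def)

lemma bilin_op [simp]:
 "bilin K (op_alg A) B V = bilin K A B V" "bilin K A (op_alg B) V = bilin K A B V"
 "bilin K A B (op_alg V) = bilin K A B V"
 by (auto simp: bilin_def fun_eq_iff)

lemma (in k_algebra) mult_bilin: "bilin K A A A (mult A)"
 by (rule bilinI) (simp_all add: A.r_distr A.l_distr smult_mult_left smult_mult_right)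

lemma (in k_algebra) mult_left_lin: "a : A ==> (%x. a *.A x) : lin_maps K A A"
 by (rule bilin_right[OF mult_bilin])

lemma (in k_algebra) mult_right_lin: "a : A ==> (%x. x *.A a) : lin_maps K A A"
 by (rule bilin_left[OF mult_bilin])

lemma (in k_algebra) finsum_mult_left:
 "a : A ==> (!!i. i : S ==> x i : A) ==> a *.A finsum A x S = finsum A (%i. a *.A x i) S"
 by (rule lin_finsum[OF mult_left_lin module_axioms module_axioms])

lemma (in k_algebra) finsum_mult_right:
 "a : A ==> (!!i. i : S ==> x i : A) ==> finsum A x S *.A a = finsum A (%i. x i *.A a) S"
 by (rule lin_finsum[OF mult_right_lin module_axioms module_axioms])

lemma (in k_algebra) op_k_algebra: "k_algebra K (op_alg A)"
proof (rule k_algebraI)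
 show "module K (op_alg A)"
  by (rule moduleI) (auto intro!: abelian_groupI simp: smult_l_distr smult_r_distr smult_assoc1 R.is_cring M.a_ac
    intro: M.l_neg bexI[of _ "\<ominus>.A _"])
 show "bilin K (op_alg A) (op_alg A) (op_alg A) (mult (op_alg A))"
  by (rule bilinI) (auto simp: A.r_distr A.l_distr smult_mult_left smult_mult_right)
qed (auto simp: A.m_assoc)

lemma map_alg_simps:
 "f : carrier (map_alg R) \<longleftrightarrow> (\<forall>\<kappa>. f \<kappa> : R)"
 "(f \<otimes>\<^bsub>map_alg R\<^esub> g) \<kappa> = f \<kappa> *.R g \<kappa>" "\<one>\<^bsub>map_alg R\<^esub> \<kappa> = \<one>.R" "\<zero>\<^bsub>map_alg R\<^esub> \<kappa> = \<zero>.R"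
 "(f \<oplus>\<^bsub>map_alg R\<^esub> g) \<kappa> = f \<kappa> \<oplus>.R g \<kappa>" "(k \<odot>\<^bsub>map_alg R\<^esub> f) \<kappa> = k \<odot>.R f \<kappa>"
 by (simp_all add: map_alg_def)

lemma map_k_algebra:
 fixes R :: "('k, 'r) module"
 assumes "k_algebra K R"
 shows "k_algebra K (map_alg R :: ('k, 'l::finite \<Rightarrow> 'r) module)"
  (is "k_algebra K ?M")
proof -
 interpret k_algebra K R by fact
 show ?thesis
 proof (rule k_algebraI)
  show "module K ?M"
  proof (rule moduleI)
   show "abelian_group ?M"
   proof (rule abelian_groupI)
    fix x assume "x : ?M"
    then show "\<exists>y\<in>carrier ?M. y \<oplus>.?M x = \<zero>.?M"
     by (intro bexI[of _ "%\<kappa>. \<ominus>.R x \<kappa>"]) (auto simp: map_alg_simps fun_eq_iff M.l_neg)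
   qed (auto simp: map_alg_simps fun_eq_iff M.a_ac)
  qed (auto simp: map_alg_simps fun_eq_iff smult_l_distr smult_r_distr smult_assoc1 R.is_cring)
  show "bilin K ?M ?M ?M (mult ?M)"
   by (rule bilinI)
     (auto simp: map_alg_simps fun_eq_iff A.r_distr A.l_distr smult_mult_left smult_mult_right)
 qed (auto simp: map_alg_simps fun_eq_iff A.m_assoc)
qed

lemma eval_lin: "(%f. f \<kappa>) : lin_maps K (map_alg R) R"
 by (rule lin_mapsI) (auto simp: map_alg_simps)

lemma (in base_field) scalars_k_algebra: "k_algebra K (scalars K)"
proof (rule k_algebraI)
 show "module K (scalars K)"
  by (rule moduleI) (auto intro!: abelian_groupI bexI[of _ "\<ominus> _"] simp: scalars_def K.l_distr K.r_distr K.m_assoc is_cring K.a_ac K.r_neg)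
 show "bilin K (scalars K) (scalars K) (scalars K) (mult (scalars K))"
  by (rule bilinI) (auto simp: scalars_def K.r_distr K.l_distr K.m_ac)
qed (auto simp: scalars_def K.m_assoc)

lemma scalars_simps [simp]:
 "carrier (scalars K) = carrier K" "mult (scalars K) = mult K" "one (scalars K) = one K"
 "zero (scalars K) = zero K" "add (scalars K) = add K" "smult (scalars K) = mult K"
 by (simp_all add: scalars_def)

lemma finsum_scalars: "finsum (scalars K) = finsum K"
 by (intro ext) (simp add: finsum_def finprod_def foldD_def foldSetD_def cong: if_cong)

text \<open>Elements are undefined outside of the carrier, so that they are determined by their values on it.\<close>

definition end_alg :: "('k, 'm) ring_scheme \<Rightarrow> ('k, 'v, 'z) module_scheme \<Rightarrow> ('k, 'v \<Rightarrow> 'v) module" where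
 "end_alg K M = \<lparr>carrier = lin_maps K M M \<inter> extensional (carrier M),
   mult = (%f g. restrict (%x. f (g x)) (carrier M)), one = restrict (%x. x) (carrier M),
   zero = restrict (%x. \<zero>.M) (carrier M), add = (%f g. restrict (%x. f x \<oplus>.M g x) (carrier M)),
   smult = (%k f. restrict (%x. k \<odot>.M f x) (carrier M))\<rparr>"

lemma end_alg_simps:
 "f : carrier (end_alg K M) \<longleftrightarrow> f : lin_maps K M M \<and> f : extensional (carrier M)"
 "x : M ==> (f \<otimes>\<^bsub>end_alg K M\<^esub> g) x = f (g x)"
 "x : M ==> \<one>\<^bsub>end_alg K M\<^esub> x = x"
 "x : M ==> \<zero>\<^bsub>end_alg K M\<^esub> x = \<zero>.M"
 "x : M ==> (f \<oplus>\<^bsub>end_alg K M\<^esub> g) x = f x \<oplus>.M g x"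
 "x : M ==> (k \<odot>\<^bsub>end_alg K M\<^esub> f) x = k \<odot>.M f x"
 "f \<otimes>\<^bsub>end_alg K M\<^esub> g : extensional (carrier M)" "\<one>\<^bsub>end_alg K M\<^esub> : extensional (carrier M)"
 "\<zero>\<^bsub>end_alg K M\<^esub> : extensional (carrier M)" "f \<oplus>\<^bsub>end_alg K M\<^esub> g : extensional (carrier M)"
 "k \<odot>\<^bsub>end_alg K M\<^esub> f : extensional (carrier M)"
 by (auto simp: end_alg_def)

lemma end_eqI:
 assumes "f : extensional (carrier M)" "g : extensional (carrier M)" "!!x. x : M ==> f x = g x"
 shows "f = g"
 using assms by (rule extensionalityI)

lemma end_app_closed: "f : carrier (end_alg K M) ==> x : M ==> f x : M"
 by (auto simp: end_alg_simps lin_closed)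

lemma end_app_lin: "f : carrier (end_alg K M) ==> f : lin_maps K M M"
 by (auto simp: end_alg_simps)

lemma end_eval_lin: "x : carrier M ==> (%f. f x) : lin_maps K (end_alg K M) M"
 by (rule lin_mapsI) (auto simp: end_alg_simps lin_closed)

lemma (in module) restrict_lin: "f : lin_maps R M M ==> restrict f (carrier M) : carrier (end_alg R M)"
 by (auto simp: end_alg_simps intro!: lin_mapsI simp: lin_closed lin_add lin_smult)

lemma (in k_algebra) end_k_algebra: "k_algebra K (end_alg K A)" (is "k_algebra K ?E")
proof (rule k_algebraI)
 note c = end_app_closed and l = end_app_lin
 have cl: "f \<oplus>.?E g : ?E" "f *.?E g : ?E"
  if f: "f : ?E" and g: "g : ?E" for f g
  unfolding end_alg_simps(1)[of "f \<oplus>.?E g"] end_alg_simps(1)[of "f *.?E g"]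
  by (auto simp: end_alg_simps(2-) c[OF f] c[OF g] lin_add[OF l[OF f]] lin_add[OF l[OF g]]
    lin_smult[OF l[OF f]] lin_smult[OF l[OF g]] M.a_ac smult_r_distr intro!: lin_mapsI)
 have sm: "k \<odot>.?E f : ?E" if k: "k : K" and f: "f : ?E" for f k
  unfolding end_alg_simps(1)[of "k \<odot>.?E f"]
  by (auto simp: end_alg_simps(2-) c[OF f] k lin_add[OF l[OF f]] lin_smult[OF l[OF f]] smult_r_distr
    smult_assoc1[symmetric] R.m_comm intro!: lin_mapsI)
 have zc: "\<zero>.?E : ?E" "\<one>.?E : ?E"
  unfolding end_alg_simps(1)[of "\<zero>.?E"] end_alg_simps(1)[of "\<one>.?E"]
  by (auto simp: end_alg_simps(2-) intro!: lin_mapsI)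
 show one: "\<one>.?E : ?E" by (rule zc)
 show "module K ?E"
 proof (rule moduleI)
  show "abelian_group ?E"
  proof (rule abelian_groupI)
   fix f assume f: "f : ?E"
   have "(\<ominus> \<one>) \<odot>.?E f \<oplus>.?E f = \<zero>.?E"
    by (rule end_eqI[of _ A]) (auto simp: end_alg_simps(2-) c[OF f] smult_l_minus M.l_neg)
   then show "\<exists>y\<in>carrier ?E. y \<oplus>.?E f = \<zero>.?E"
    using sm[OF _ f, of "\<ominus> \<one>"] by auto
   show "\<zero>.?E \<oplus>.?E f = f"
    by (rule end_eqI[of _ A]) (use f in "auto simp: end_alg_simps(2-) c[OF f] end_alg_simps(1)")
  qed (use zc cl in "auto intro!: end_eqI[of _ A] simp: end_alg_simps(2-) c M.a_ac")
 next
  fix f assume f: "f : ?E"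
  show "\<one> \<odot>.?E f = f"
   by (rule end_eqI[of _ A]) (use f in "auto simp: end_alg_simps(2-) c[OF f] end_alg_simps(1)")
 qed (use sm in "auto intro!: end_eqI[of _ A] simp: end_alg_simps(2-) c smult_l_distr smult_r_distr smult_assoc1 R.is_cring")
 show "bilin K ?E ?E ?E (mult ?E)"
  by (rule bilinI)
    (use cl in "auto intro!: end_eqI[of _ A] simp: end_alg_simps(2-) c lin_add[OF l] lin_smult[OF l]")
 fix f assume f: "f : ?E"
 show "\<one>.?E *.?E f = f" "f *.?E \<one>.?E = f"
  by (rule end_eqI[of _ A]; use f in "auto simp: end_alg_simps(2-) c[OF f] end_alg_simps(1)")+
next
 fix f g h assume "f : ?E" "g : ?E" "h : ?E"
 then show "f *.?E g *.?E h = f *.?E (g *.?E h)"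
  by (intro end_eqI[of _ A]) (auto simp: end_alg_simps(2-) end_app_closed)
qed

section \<open>Idempotent Frobenius systems\<close>

locale frob_sys = L: k_algebra K L for K :: "('k, 'm) ring_scheme" (structure) and L :: "('k, 'l, 'z) module_scheme" +
 fixes \<psi> :: "'l \<Rightarrow> 'k" and J :: "'j set" and p q :: "'j \<Rightarrow> 'l"
 assumes psi_lin: "\<psi> : lin_maps K L (scalars K)"
  and finJ: "finite J"
  and pc: "!!j. j : J ==> p j : L" and qc: "!!j. j : J ==> q j : L"
  and dual1: "!!l. l : L ==> (\<Oplus>.L j\<in>J. \<psi> (l *.L p j) \<odot>.L q j) = l"
  and dual2: "!!l. l : L ==> (\<Oplus>.L j\<in>J. \<psi> (q j *.L l) \<odot>.L p j) = l"
  and sep: "(\<Oplus>.L j\<in>J. p j *.L q j) = \<one>.L"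
begin

lemma psi_closed [simp]: "l : L ==> \<psi> l : K"
 using lin_closed[OF psi_lin] by simp

lemma psi_add: "l : L ==> m : L ==> \<psi> (l \<oplus>.L m) = \<psi> l \<oplus> \<psi> m"
 using lin_add[OF psi_lin] by simp

lemma psi_smult: "k : K ==> l : L ==> \<psi> (k \<odot>.L l) = k \<otimes> \<psi> l"
 using lin_smult[OF psi_lin] by simp

lemma psi_finsum: "(!!i. i : S ==> x i : L) ==> \<psi> (finsum L x S) = (\<Oplus>i\<in>S. \<psi> (x i))"
 using lin_finsum[OF psi_lin L.md k_algebra.axioms(1)[OF L.scalars_k_algebra], of S x] by (simp add: finsum_scalars)

lemma dual1_lin:
 assumes "F : lin_maps K L V" "module K V" "l : L"
 shows "(\<Oplus>.V j\<in>J. \<psi> (l *.L p j) \<odot>.V F (q j)) = F l"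
proof -
 interpret V: module K V by fact
 have "F (\<Oplus>.L j\<in>J. \<psi> (l *.L p j) \<odot>.L q j) = (\<Oplus>.V j\<in>J. F (\<psi> (l *.L p j) \<odot>.L q j))"
  by (rule lin_finsum[OF assms(1) L.md assms(2)]) (use assms(3) pc qc in auto)
 also have "... = (\<Oplus>.V j\<in>J. \<psi> (l *.L p j) \<odot>.V F (q j))"
  by (rule V.M.finsum_eqI) (use assms(3) pc qc in "auto simp: lin_smult[OF assms(1)] lin_closed[OF assms(1)]")
 finally show ?thesis using dual1 assms(3) by simp
qed

lemma dual2_lin:
 assumes "F : lin_maps K L V" "module K V" "l : L"
 shows "(\<Oplus>.V j\<in>J. \<psi> (q j *.L l) \<odot>.V F (p j)) = F l"
proof -
 interpret V: module K V by fact
 have "F (\<Oplus>.L j\<in>J. \<psi> (q j *.L l) \<odot>.L p j) = (\<Oplus>.V j\<in>J. F (\<psi> (q j *.L l) \<odot>.L p j))"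
  by (rule lin_finsum[OF assms(1) L.md assms(2)]) (use assms(3) pc qc in auto)
 also have "... = (\<Oplus>.V j\<in>J. \<psi> (q j *.L l) \<odot>.V F (p j))"
  by (rule V.M.finsum_eqI) (use assms(3) pc qc in "auto simp: lin_smult[OF assms(1)] lin_closed[OF assms(1)]")
 finally show ?thesis using dual2 assms(3) by simp
qed

lemma sep_lin:
 assumes "F : lin_maps K L V" "module K V"
 shows "(\<Oplus>.V j\<in>J. F (p j *.L q j)) = F \<one>.L"
 using lin_finsum[OF assms(1) L.md assms(2), of J "%j. p j *.L q j"] pc qc by (simp add: sep)

text \<open>The families \<open>p\<close> and \<open>q\<close> are dual bases for the form \<open>(x, y) \<mapsto> \<psi> (x y)\<close>; an operator on one leg of the
  Frobenius element therefore equals its adjoint on the other leg.\<close>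

lemma adjoint_sum:
 assumes b: "bilin K L L V \<beta>" and V: "module K V"
  and F: "!!x. x : L ==> F x : L" and G: "!!x. x : L ==> G x : L"
  and H: "H : lin_maps K L L"
  and adj: "!!x y. x : L ==> y : L ==> \<psi> (x *.L F y) = \<psi> (G x *.L y)"
 shows "(\<Oplus>.V j\<in>J. \<beta> (F (p j)) (H (q j))) = (\<Oplus>.V i\<in>J. \<beta> (p i) (H (G (q i))))"
proof -
 interpret V: module K V by fact
 note bc = bilin_closed[OF b] and Hc = lin_closed[OF H]
 have "(\<Oplus>.V j\<in>J. \<beta> (F (p j)) (H (q j)))
  = (\<Oplus>.V j\<in>J. \<Oplus>.V i\<in>J. \<psi> (q i *.L F (p j)) \<odot>.V \<beta> (p i) (H (q j)))"
  by (rule V.M.finsum_eqI, rule sym, rule dual2_lin[OF bilin_left[OF b] V])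
   (use pc qc F G Hc bc in "auto intro!: V.M.finsum_closed")
 also have "... = (\<Oplus>.V i\<in>J. \<Oplus>.V j\<in>J. \<psi> (q i *.L F (p j)) \<odot>.V \<beta> (p i) (H (q j)))"
  by (rule V.M.finsum_swap) (use finJ pc qc F Hc bc in auto)
 also have "... = (\<Oplus>.V i\<in>J. \<Oplus>.V j\<in>J. \<psi> (G (q i) *.L p j) \<odot>.V \<beta> (p i) (H (q j)))"
  by (intro V.M.finsum_eqI) (use pc qc F G Hc bc in "auto simp: adj intro!: V.M.finsum_closed")
 also have "... = (\<Oplus>.V i\<in>J. \<beta> (p i) (H (G (q i))))"
  by (rule V.M.finsum_eqI, rule dual1_lin[OF lin_comp[OF H bilin_right[OF b]] V])
   (use pc qc F G Hc bc in auto)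
 finally show ?thesis .
qed

lemma casimir:
 assumes b: "bilin K L L V \<beta>" and V: "module K V" and l: "l : L"
 shows "(\<Oplus>.V j\<in>J. \<beta> (l *.L p j) (q j)) = (\<Oplus>.V j\<in>J. \<beta> (p j) (q j *.L l))"
 using adjoint_sum[OF b V, of "%y. l *.L y" "%x. x *.L l" "%x. x"] l by (simp add: L.id_lin L.A.m_assoc)

lemma invariant:
 assumes b: "bilin K L L V \<beta>" and V: "module K V" and \<tau>: "\<tau> : lin_maps K L L" and \<tau>': "\<tau>' : lin_maps K L L"
  and mult: "!!x y. x : L ==> y : L ==> \<tau> (x *.L y) = \<tau> x *.L \<tau> y"
  and inv: "!!x. x : L ==> \<tau> (\<tau>' x) = x"
  and psi: "!!x. x : L ==> \<psi> (\<tau> x) = \<psi> x"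
 shows "(\<Oplus>.V j\<in>J. \<beta> (\<tau> (p j)) (\<tau> (q j))) = (\<Oplus>.V j\<in>J. \<beta> (p j) (q j))"
proof -
 interpret V: module K V by fact
 have "\<psi> (x *.L \<tau> y) = \<psi> (\<tau>' x *.L y)" if "x : L" "y : L" for x y
  using mult[of "\<tau>' x" y] inv[of x] psi[of "\<tau>' x *.L y"] that lin_closed[OF \<tau>'] by simp
 then have "(\<Oplus>.V j\<in>J. \<beta> (\<tau> (p j)) (\<tau> (q j))) = (\<Oplus>.V i\<in>J. \<beta> (p i) (\<tau> (\<tau>' (q i))))"
  by (intro adjoint_sum[OF b V _ _ \<tau>]) (auto simp: lin_closed[OF \<tau>] lin_closed[OF \<tau>'])
 also have "... = (\<Oplus>.V j\<in>J. \<beta> (p j) (q j))"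
  by (rule V.M.finsum_eqI) (use inv pc qc bilin_closed[OF b] in auto)
 finally show ?thesis .
qed

text \<open>By the Casimir property and separability the Frobenius element is idempotent in \<open>L \<otimes> L\<^sup>o\<^sup>p\<close>.  This
  makes \<open>\<Delta>(1)\<close> idempotent.\<close>

lemma idem_sum:
 assumes b: "bilin K L L V \<beta>" and V: "module K V"
 shows "(\<Oplus>.V j\<in>J. \<Oplus>.V i\<in>J. \<beta> (p j *.L p i) (q i *.L q j)) = (\<Oplus>.V i\<in>J. \<beta> (p i) (q i))"
proof -
 interpret V: module K V by fact
 note bc = bilin_closed[OF b]
 have "(\<Oplus>.V j\<in>J. \<Oplus>.V i\<in>J. \<beta> (p j *.L p i) (q i *.L q j))
  = (\<Oplus>.V j\<in>J. \<Oplus>.V i\<in>J. \<beta> (p i) (q i *.L p j *.L q j))"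
 proof (rule V.M.finsum_eqI)
  fix j assume j: "j : J"
  have b': "bilin K L L V (%x y. \<beta> x (y *.L q j))"
   using bilin_comp[OF b L.id_lin L.mult_right_lin[OF qc[OF j]] V.id_lin] .
  show "(\<Oplus>.V i\<in>J. \<beta> (p j *.L p i) (q i *.L q j)) = (\<Oplus>.V i\<in>J. \<beta> (p i) (q i *.L p j *.L q j))"
   by (rule casimir[OF b' V pc[OF j]])
 qed (use pc qc bc in "auto intro!: V.M.finsum_closed")
 also have "... = (\<Oplus>.V i\<in>J. \<Oplus>.V j\<in>J. \<beta> (p i) (q i *.L (p j *.L q j)))"
  by (subst V.M.finsum_swap) (use finJ pc qc bc in "auto simp: L.A.m_assoc cong: V.M.finsum_cong")
 also have "... = (\<Oplus>.V i\<in>J. \<beta> (p i) (q i *.L \<one>.L))"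
  by (rule V.M.finsum_eqI, rule sep_lin[OF lin_comp[OF L.mult_left_lin bilin_right[OF b]] V]) (use pc qc bc in auto)
 also have "... = (\<Oplus>.V i\<in>J. \<beta> (p i) (q i))"
  by (rule V.M.finsum_eqI) (use pc qc bc in auto)
 finally show ?thesis .
qed

text \<open>The Nakayama automorphism of the Frobenius form; it appears in the antipode because \<open>\<psi>\<close> need not be
  symmetric.\<close>

definition nak :: "'l \<Rightarrow> 'l" where
 "nak l = (\<Oplus>.L j\<in>J. \<psi> (l *.L q j) \<odot>.L p j)"

lemma nak_lin: "nak : lin_maps K L L"
 unfolding nak_def[abs_def]
 by (intro lin_finsum_fun L.md lin_mapsI)
   (auto simp: L.A.l_distr psi_add psi_smult L.smult_l_distr L.smult_assoc1 L.smult_mult_left pc qc)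

lemma nak_closed [simp]: "l : L ==> nak l : L"
 by (rule lin_closed[OF nak_lin])

lemma psi_nak:
 assumes "x : L" "l : L"
 shows "\<psi> (x *.L nak l) = \<psi> (l *.L x)"
proof -
 have "\<psi> (x *.L nak l) = (\<Oplus>j\<in>J. \<psi> (l *.L q j) \<otimes> \<psi> (x *.L p j))"
  unfolding nak_def using assms pc qc
  by (simp add: L.finsum_mult_left psi_finsum L.smult_mult_right psi_smult cong: L.R.finsum_cong)
 also have "... = (\<Oplus>j\<in>J. \<psi> (x *.L p j) \<otimes> \<psi> (l *.L q j))"
  by (rule L.R.finsum_eqI) (use assms pc qc in "auto simp: L.R.m_comm")
 also have "... = \<psi> (l *.L x)"
  using dual1_lin[OF lin_comp[OF L.mult_left_lin[OF assms(2)] psi_lin] k_algebra.axioms(1)[OF L.scalars_k_algebra] assms(1)]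
  by (simp add: finsum_scalars)
 finally show ?thesis .
qed

lemma nondeg:
 assumes "a : L" "b : L" "!!x. x : L ==> \<psi> (x *.L a) = \<psi> (x *.L b)"
 shows "a = b"
proof -
 have "a = (\<Oplus>.L j\<in>J. \<psi> (q j *.L a) \<odot>.L p j)" using assms dual2 by simp
 also have "... = (\<Oplus>.L j\<in>J. \<psi> (q j *.L b) \<odot>.L p j)"
  by (rule L.M.finsum_eqI) (use assms pc qc in auto)
 finally show ?thesis using assms dual2 by simp
qed

lemma nak_mult: "a : L ==> b : L ==> nak (a *.L b) = nak a *.L nak b"
proof (rule nondeg)
 fix x assume ab: "a : L" "b : L" and x: "x : L"
 have "\<psi> (x *.L (nak a *.L nak b)) = \<psi> ((x *.L nak a) *.L nak b)"
  using ab x by (simp add: L.A.m_assoc)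
 also have "... = \<psi> ((b *.L x) *.L nak a)"
  using ab x by (subst psi_nak) (simp_all add: L.A.m_assoc)
 also have "... = \<psi> (x *.L nak (a *.L b))"
  using ab x by (subst (1 2) psi_nak) (simp_all add: L.A.m_assoc)
 finally show "\<psi> (x *.L nak (a *.L b)) = \<psi> (x *.L (nak a *.L nak b))" ..
qed auto

lemma nak_central:
 assumes "z : L" "!!l. l : L ==> z *.L l = l *.L z"
 shows "nak z = z"
 by (rule nondeg) (use assms in "auto simp: psi_nak")

lemma nak_one: "nak \<one>.L = \<one>.L"
 by (rule nak_central) auto

lemma nak_sep: "(\<Oplus>.L j\<in>J. nak (q j) *.L p j) = \<one>.L"
proof -
 have b: "bilin K L L L (%x y. \<psi> y \<odot>.L x)"
  by (rule bilinI) (simp_all add: psi_add psi_smult L.smult_l_distr L.smult_r_distr L.smult_assoc1[symmetric] L.R.m_comm)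
 have "(\<Oplus>.L j\<in>J. nak (q j) *.L p j) = (\<Oplus>.L i\<in>J. \<Oplus>.L j\<in>J. \<psi> (q i *.L q j) \<odot>.L (p j *.L p i))"
  unfolding nak_def using pc qc
  by (intro L.M.finsum_eqI) (auto simp: L.finsum_mult_right L.smult_mult_left cong: L.M.finsum_cong intro!: L.M.finsum_closed)
 also have "... = (\<Oplus>.L j\<in>J. \<Oplus>.L i\<in>J. \<psi> (q i *.L q j) \<odot>.L (p j *.L p i))"
  by (rule L.M.finsum_swap) (use finJ pc qc in auto)
 also have "... = (\<Oplus>.L i\<in>J. \<psi> (q i) \<odot>.L p i)" by (rule idem_sum[OF b L.md])
 also have "... = (\<Oplus>.L i\<in>J. \<psi> (q i *.L \<one>.L) \<odot>.L p i)"
  by (rule L.M.finsum_eqI) (use pc qc in auto)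
 finally show ?thesis using dual2 by simp
qed

end

section \<open>Weak bialgebras presented over a Frobenius-separable base\<close>

lemma (in abelian_monoid) finsum_closedI: "(!!i. i : A ==> f i : G) ==> finsum G f A : G"
 by (rule finsum_closed) auto

lemma (in k_algebra) finsum_mult_finsum:
 assumes "!!i. i : S ==> x i : A" "!!j. j : S' ==> y j : A"
 shows "finsum A x S *.A finsum A y S' = (\<Oplus>.A i\<in>S. \<Oplus>.A j\<in>S'. x i *.A y j)"
 using assms
 by (subst finsum_mult_right)
   (auto intro!: M.finsum_closedI M.finsum_eqI simp: finsum_mult_left)

text \<open>An algebra generated by the base, its opposite and matrices \<open>v i\<close> that are semilinear over it with
  respect to automorphisms \<open>\<tau> i a\<close> preserving \<open>\<psi>\<close>.  The counit is induced by an action \<open>\<chi>\<close> on the base.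
  The last assumption expresses generation as an induction rule in which generators are added on the
  left.  For \<open>A\<^sub>\<sigma>\<close> the index set \<open>I\<close> consists of two elements: \<open>v True a b\<close> is \<open>L\<^sub>a\<^sub>b\<close> and \<open>v False a b\<close> is
  \<open>(L\<inverse>)\<^sub>b\<^sub>a\<close>, transposed because the comultiplication reverses the order of the inverse matrices.\<close>

locale gen_bialg = B: k_algebra K B + F: frob_sys K L \<psi> J p q
 for K :: "('k, 'm) ring_scheme" and B :: "('k, 'b) weak_bialg" and L :: "('k, 'l) module" and \<psi> and J :: "'j set" and p q +
 fixes s t :: "'l \<Rightarrow> 'b" and \<chi> :: "'b \<Rightarrow> 'l \<Rightarrow> 'l" and I :: "'i set" and X :: "'x set"
  and v :: "'i \<Rightarrow> 'x \<Rightarrow> 'x \<Rightarrow> 'b" and \<tau> \<tau>' :: "'i \<Rightarrow> 'x \<Rightarrow> 'l \<Rightarrow> 'l"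
 assumes s_lin: "s : lin_maps K L B" and t_lin: "t : lin_maps K L B"
  and s_mult: "!!f g. f : L ==> g : L ==> s (f *.L g) = s f *.B s g"
  and t_mult: "!!f g. f : L ==> g : L ==> t (f *.L g) = t g *.B t f"
  and s_one: "s \<one>.L = \<one>.B" and t_one: "t \<one>.L = \<one>.B"
  and ts_comm: "!!f g. f : L ==> g : L ==> t g *.B s f = s f *.B t g"
  and finX: "finite X"
  and v_closed [simp]: "!!i a b. i : I ==> a : X ==> b : X ==> v i a b : B"
  and tau_lin: "!!i a. i : I ==> a : X ==> \<tau> i a : lin_maps K L L"
  and tau'_lin: "!!i a. i : I ==> a : X ==> \<tau>' i a : lin_maps K L L"
  and tau_mult: "!!i a x y. i : I ==> a : X ==> x : L ==> y : L ==>
   \<tau> i a (x *.L y) = \<tau> i a x *.L \<tau> i a y"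
  and tau_one: "!!i a. i : I ==> a : X ==> \<tau> i a \<one>.L = \<one>.L"
  and tau_inv: "!!i a x. i : I ==> a : X ==> x : L ==> \<tau> i a (\<tau>' i a x) = x"
  and tau_inv': "!!i a x. i : I ==> a : X ==> x : L ==> \<tau>' i a (\<tau> i a x) = x"
  and tau_psi: "!!i a x. i : I ==> a : X ==> x : L ==> \<psi> (\<tau> i a x) = \<psi> x"
  and sv: "!!i a b f. i : I ==> a : X ==> b : X ==> f : L ==>
   s (\<tau> i a f) *.B v i a b = v i a b *.B s f"
  and tv: "!!i a b f. i : I ==> a : X ==> b : X ==> f : L ==>
   t (\<tau> i b f) *.B v i a b = v i a b *.B t f"
  and comult_lin: "comult B : lin_maps K B (tensor K B B)"
  and comult_mult: "!!a b. a : B ==> b : B ==>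
   comult B (a *.B b) = comult B a \<otimes>\<^bsub>tensor K B B\<^esub> comult B b"
  and comult_one: "comult B \<one>.B = (\<Oplus>\<^bsub>tensor K B B\<^esub>j\<in>J. tens K B B (t (p j)) (s (q j)))"
  and comult_s: "!!f. f : L ==>
   comult B (s f) = comult B \<one>.B \<otimes>\<^bsub>tensor K B B\<^esub> tens K B B (s f) \<one>.B"
  and comult_t: "!!f. f : L ==>
   comult B (t f) = comult B \<one>.B \<otimes>\<^bsub>tensor K B B\<^esub> tens K B B \<one>.B (t f)"
  and comult_v: "!!i a b. i : I ==> a : X ==> b : X ==> comult B (v i a b)
   = comult B \<one>.B \<otimes>\<^bsub>tensor K B B\<^esub> (\<Oplus>\<^bsub>tensor K B B\<^esub>c\<in>X. tens K B B (v i a c) (v i c b))"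
  and chi_lin: "!!a. a : B ==> \<chi> a : lin_maps K L L"
  and chi_lin': "!!h. h : L ==> (%a. \<chi> a h) : lin_maps K B L"
  and chi_mult: "!!a b h. a : B ==> b : B ==> h : L ==> \<chi> (a *.B b) h = \<chi> a (\<chi> b h)"
  and chi_s: "!!f h. f : L ==> h : L ==> \<chi> (s f) h = f *.L h"
  and chi_t: "!!f h. f : L ==> h : L ==> \<chi> (t f) h = h *.L f"
  and chi_v: "!!i a b h. i : I ==> a : X ==> b : X ==> h : L ==>
   \<chi> (v i a b) h = (if a = b then \<tau> i a h else \<zero>.L)"
  and counit_eq: "!!a. a : B ==> counit B a = \<psi> (\<chi> a \<one>.L)"
  and gen: "!!P a. [|a : B; P \<one>.B;
    !!x y. x : B ==> y : B ==> P x ==> P y ==> P (x \<oplus>.B y);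
    !!k x. k : K ==> x : B ==> P x ==> P (k \<odot>.B x);
    !!f x. f : L ==> x : B ==> P x ==> P (s f *.B x);
    !!f x. f : L ==> x : B ==> P x ==> P (t f *.B x);
    !!i a b x. i : I ==> a : X ==> b : X ==> x : B ==> P x ==> P (v i a b *.B x)|] ==> P a"
begin

abbreviation "T \<equiv> tensor K B B"
abbreviation "tt \<equiv> tens K B B"
abbreviation "\<T> \<equiv> tensor K B T"
abbreviation "ttt a b c \<equiv> tens K B T a (tt b c)"
abbreviation "\<pi> a \<equiv> \<chi> a \<one>.L"
abbreviation "E \<equiv> comult B \<one>.B"
abbreviation "D i a b \<equiv> (\<Oplus>.T c\<in>X. tt (v i a c) (v i c b))"

sublocale BB: alg_pair K B B ..
sublocale T: k_algebra K T by (rule BB.tensor_k_algebra)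
sublocale BT: alg_pair K B T ..
sublocale TB: alg_pair K T B ..
sublocale \<T>: k_algebra K \<T> by (rule BT.tensor_k_algebra)
sublocale TB3: k_algebra K "tensor K T B" by (rule TB.tensor_k_algebra)

lemmas sc [simp] = lin_closed[OF s_lin] and tc [simp] = lin_closed[OF t_lin]
lemmas comult_closed [simp] = lin_closed[OF comult_lin]
lemmas pc' [simp] = F.pc and qc' [simp] = F.qc
lemma chi_closed [simp]: "a : B ==> h : L ==> \<chi> a h : L"
 by (rule lin_closed[OF chi_lin])
lemma tau_closed [simp]: "i : I ==> a : X ==> h : L ==> \<tau> i a h : L"
 by (rule lin_closed[OF tau_lin])
lemma tau'_closed [simp]: "i : I ==> a : X ==> h : L ==> \<tau>' i a h : L"
 by (rule lin_closed[OF tau'_lin])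

lemmas lins = lin_add[OF s_lin] lin_add[OF t_lin] lin_smult[OF s_lin] lin_smult[OF t_lin]
 lin_add[OF comult_lin] lin_smult[OF comult_lin]
 lin_add[OF chi_lin] lin_smult[OF chi_lin] lin_add[OF chi_lin'] lin_smult[OF chi_lin']
 lin_add[OF bilin_left[OF BB.tens_bilin]] lin_add[OF bilin_right[OF BB.tens_bilin]]
 lin_smult[OF bilin_left[OF BB.tens_bilin]] lin_smult[OF bilin_right[OF BB.tens_bilin]]
 lin_add[OF bilin_left[OF BT.tens_bilin]] lin_add[OF bilin_right[OF BT.tens_bilin]]
 lin_smult[OF bilin_left[OF BT.tens_bilin]] lin_smult[OF bilin_right[OF BT.tens_bilin]]
 lin_add[OF bilin_left[OF TB.tens_bilin]] lin_add[OF bilin_right[OF TB.tens_bilin]]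
 lin_smult[OF bilin_left[OF TB.tens_bilin]] lin_smult[OF bilin_right[OF TB.tens_bilin]]
 B.A.l_distr B.A.r_distr B.smult_mult_left B.smult_mult_right B.smult_r_distr
 T.A.l_distr T.A.r_distr T.smult_mult_left T.smult_mult_right T.smult_r_distr
 \<T>.A.l_distr \<T>.A.r_distr \<T>.smult_mult_left \<T>.smult_mult_right \<T>.smult_r_distr
 F.L.A.l_distr F.L.A.r_distr F.L.smult_mult_left F.L.smult_mult_right
 F.psi_add F.psi_smult B.smult_l_distr B.smult_assoc1

lemma E_closed [simp]: "E : T" by simp
lemma D_closed [simp]: "i : I ==> a : X ==> b : X ==> D i a b : T"
 by (auto intro!: T.M.finsum_closedI)

lemma chi_one: "h : L ==> \<chi> \<one>.B h = h"
 using chi_s[of "\<one>.L" h] s_one by simp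

lemma
 assumes "f : L" "a : B"
 shows pi_s: "\<pi> (s f *.B a) = f *.L \<pi> a" and pi_t: "\<pi> (t f *.B a) = \<pi> a *.L f"
  and pi_s_right: "\<pi> (a *.B s f) = \<chi> a f" and pi_t_right: "\<pi> (a *.B t f) = \<chi> a f"
 using assms by (simp_all add: chi_mult chi_s chi_t)

lemma E_pure:
 assumes "x : B" "y : B"
 shows "E *.T tt x y = (\<Oplus>.T j\<in>J. tt (t (p j) *.B x) (s (q j) *.B y))"
 unfolding comult_one using assms
 by (subst T.finsum_mult_right) (auto simp: BB.tens_mult intro!: T.M.finsum_eqI)

lemma lift_E_pure:
 assumes b: "bilin K B B V \<beta>" and V: "module K V" and "x : B" "y : B"
 shows "tensor_lift K V \<beta> (E *.T tt x y) = (\<Oplus>.V j\<in>J. \<beta> (t (p j) *.B x) (s (q j) *.B y))"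
proof -
 interpret V: module K V by fact
 show ?thesis
  unfolding E_pure[OF assms(3,4)] using assms(3,4) bilin_closed[OF b]
  by (subst lin_finsum[OF BB.tensor_lift_lin[OF b V] T.md V])
    (auto simp: BB.tensor_lift_tens[OF b V] intro!: V.M.finsum_eqI)
qed

lemma E_comult: "a : B ==> E *.T comult B a = comult B a"
 using comult_mult[of "\<one>.B" a] by simp
lemma comult_E: "a : B ==> comult B a *.T E = comult B a"
 using comult_mult[of a "\<one>.B"] by simp

text \<open>Since \<open>\<Delta>(a) = E \<Delta>(a)\<close>, a bilinear expression in the two legs of \<open>\<Delta>(a)\<close> may be averaged over
 the Frobenius element \<open>E\<close>.\<close>

lemma lift_average:
 assumes b: "bilin K B B V \<beta>" and V: "module K V" and g: "bilin K B B V \<gamma>"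
  and av: "!!x y. x : B ==> y : B ==>
   (\<Oplus>.V j\<in>J. \<beta> (t (p j) *.B x) (s (q j) *.B y)) = \<gamma> x y"
  and z: "z : T"
 shows "tensor_lift K V \<beta> (E *.T z) = tensor_lift K V \<gamma> z"
 by (rule BB.tensor_lin_eq[OF lin_comp[OF T.mult_left_lin[OF E_closed] BB.tensor_lift_lin[OF b V]]
    BB.tensor_lift_lin[OF g V] _ z])
   (simp add: lift_E_pure[OF b V] av BB.tensor_lift_tens[OF g V])

lemma lift_average_comult:
 assumes "bilin K B B V \<beta>" "module K V" "bilin K B B V \<gamma>"
  "!!x y. x : B ==> y : B ==>
   (\<Oplus>.V j\<in>J. \<beta> (t (p j) *.B x) (s (q j) *.B y)) = \<gamma> x y"
  "a : B"
 shows "tensor_lift K V \<beta> (comult B a) = tensor_lift K V \<gamma> (comult B a)"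
 using lift_average[OF assms(1-4), of "comult B a"] assms(5) by (simp add: E_comult)

lemma counit_lin: "counit B : lin_maps K B (scalars K)"
 by (rule lin_mapsI) (simp_all add: counit_eq lins)

text \<open>\<open>\<Phi>1\<close> and \<open>\<Phi>2\<close> are the counits of the bialgebroid applied to one leg.\<close>

definition "\<Phi>1 = tensor_lift K B (%x y. s (\<pi> x) *.B y)"
definition "\<Phi>2 = tensor_lift K B (%x y. t (\<pi> y) *.B x)"

lemma b1: "bilin K B B B (%x y. s (\<pi> x) *.B y)" by (rule bilinI) (simp_all add: lins)
lemma b2: "bilin K B B B (%x y. t (\<pi> y) *.B x)" by (rule bilinI) (simp_all add: lins)

lemma Phi1_lin: "\<Phi>1 : lin_maps K T B" unfolding \<Phi>1_def by (rule BB.tensor_lift_lin[OF b1 B.md])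
lemma Phi2_lin: "\<Phi>2 : lin_maps K T B" unfolding \<Phi>2_def by (rule BB.tensor_lift_lin[OF b2 B.md])
lemma Phi1_tt: "x : B ==> y : B ==> \<Phi>1 (tt x y) = s (\<pi> x) *.B y"
 unfolding \<Phi>1_def by (rule BB.tensor_lift_tens[OF b1 B.md])
lemma Phi2_tt: "x : B ==> y : B ==> \<Phi>2 (tt x y) = t (\<pi> y) *.B x"
 unfolding \<Phi>2_def by (rule BB.tensor_lift_tens[OF b2 B.md])

lemma Phi1_E: "z : T ==> \<Phi>1 (E *.T z) = \<Phi>1 z"
 unfolding \<Phi>1_def
proof (rule lift_average[OF b1 B.md b1])
 fix x y assume xy: "x : B" "y : B"
 have l: "(%l. s (\<pi> x *.L l) *.B y) : lin_maps K L B"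
  by (rule lin_mapsI) (use xy in "simp_all add: lins")
 have "(\<Oplus>.B j\<in>J. s (\<pi> (t (p j) *.B x)) *.B (s (q j) *.B y))
  = (\<Oplus>.B j\<in>J. s (\<pi> x *.L (p j *.L q j)) *.B y)"
  by (rule B.M.finsum_eqI) (use xy in "simp_all add: pi_t s_mult B.A.m_assoc")
 also have "... = s (\<pi> x *.L \<one>.L) *.B y" by (rule F.sep_lin[OF l B.md])
 finally show "(\<Oplus>.B j\<in>J. s (\<pi> (t (p j) *.B x)) *.B (s (q j) *.B y)) = s (\<pi> x) *.B y"
  using xy by simp
qed

lemma Phi2_E: "z : T ==> \<Phi>2 (E *.T z) = \<Phi>2 z"
 unfolding \<Phi>2_def
proof (rule lift_average[OF b2 B.md b2])
 fix x y assume xy: "x : B" "y : B"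
 have l: "(%l. t (l *.L \<pi> y) *.B x) : lin_maps K L B"
  by (rule lin_mapsI) (use xy in "simp_all add: lins")
 have "(\<Oplus>.B j\<in>J. t (\<pi> (s (q j) *.B y)) *.B (t (p j) *.B x))
  = (\<Oplus>.B j\<in>J. t ((p j *.L q j) *.L \<pi> y) *.B x)"
  by (rule B.M.finsum_eqI) (use xy in "simp_all add: pi_s t_mult B.A.m_assoc")
 also have "... = t (\<one>.L *.L \<pi> y) *.B x" by (rule F.sep_lin[OF l B.md])
 finally show "(\<Oplus>.B j\<in>J. t (\<pi> (s (q j) *.B y)) *.B (t (p j) *.B x)) = t (\<pi> y) *.B x"
  using xy by simp
qed

lemma Phi_left:
 assumes \<Phi>: "\<Phi> : lin_maps K T B" and g: "g : B" and d: "d : T"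
  and eq: "!!x y. x : B ==> y : B ==> \<Phi> (d *.T tt x y) = g *.B \<Phi> (tt x y)"
  and z: "z : T"
 shows "\<Phi> (d *.T z) = g *.B \<Phi> z"
 by (rule BB.tensor_lin_eq[OF lin_comp[OF T.mult_left_lin[OF d] \<Phi>] lin_comp[OF \<Phi> B.mult_left_lin[OF g]] eq z])

lemma Phi_v:
 assumes \<Phi>: "\<Phi> : lin_maps K T B" and i: "i : I" "a : X" "b : X" and xy: "x : B" "y : B"
 shows "\<Phi> (D i a b *.T tt x y) = (\<Oplus>.B c\<in>X. \<Phi> (tt (v i a c *.B x) (v i c b *.B y)))"
proof -
 have "D i a b *.T tt x y = (\<Oplus>.T c\<in>X. tt (v i a c *.B x) (v i c b *.B y))"
  using i xy by (subst T.finsum_mult_right) (auto simp: BB.tens_mult intro!: T.M.finsum_eqI)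
 then show ?thesis
  using i xy by (simp add: lin_finsum[OF \<Phi> T.md B.md])
qed

text \<open>The left action of \<open>\<Delta>(g)\<close> becomes left multiplication by \<open>g\<close>; checked for generators \<open>g\<close>, this gives
  the counit laws by induction.\<close>

lemma Phi1_gen:
 assumes z: "z : T"
 shows "f : L ==> \<Phi>1 (tt (s f) \<one>.B *.T z) = s f *.B \<Phi>1 z"
  and "f : L ==> \<Phi>1 (tt \<one>.B (t f) *.T z) = t f *.B \<Phi>1 z"
  and "i : I ==> a : X ==> b : X ==> \<Phi>1 (D i a b *.T z) = v i a b *.B \<Phi>1 z"
proof -
 show "\<Phi>1 (tt (s f) \<one>.B *.T z) = s f *.B \<Phi>1 z" if "f : L"
  by (rule Phi_left[OF Phi1_lin _ _ _ z]) (use that in "simp_all add: BB.tens_mult Phi1_tt pi_s s_mult B.A.m_assoc")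
 show "\<Phi>1 (tt \<one>.B (t f) *.T z) = t f *.B \<Phi>1 z" if "f : L"
  by (rule Phi_left[OF Phi1_lin _ _ _ z])
   (use that in "simp_all add: BB.tens_mult Phi1_tt ts_comm B.A.m_assoc[symmetric]")
 show "\<Phi>1 (D i a b *.T z) = v i a b *.B \<Phi>1 z" if i: "i : I" "a : X" "b : X"
 proof (rule Phi_left[OF Phi1_lin _ _ _ z])
  fix x y assume xy: "x : B" "y : B"
  have "\<Phi>1 (D i a b *.T tt x y)
    = (\<Oplus>.B c\<in>X. if a = c then s (\<tau> i a (\<pi> x)) *.B (v i c b *.B y) else \<zero>.B)"
   unfolding Phi_v[OF Phi1_lin i xy]
   by (rule B.M.finsum_eqI) (use i xy lin_zero[OF s_lin F.L.md B.md] in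
     \<open>simp_all add: Phi1_tt chi_mult chi_v\<close>)
  also have "... = s (\<tau> i a (\<pi> x)) *.B (v i a b *.B y)"
   using i xy finX by (subst B.M.finsum_delta) auto
  also have "... = v i a b *.B \<Phi>1 (tt x y)"
   using i xy by (simp add: Phi1_tt B.A.m_assoc[symmetric] sv)
  finally show "\<Phi>1 (D i a b *.T tt x y) = v i a b *.B \<Phi>1 (tt x y)" .
 qed (use i in auto)
qed

lemma Phi2_gen:
 assumes z: "z : T"
 shows "f : L ==> \<Phi>2 (tt (s f) \<one>.B *.T z) = s f *.B \<Phi>2 z"
  and "f : L ==> \<Phi>2 (tt \<one>.B (t f) *.T z) = t f *.B \<Phi>2 z"
  and "i : I ==> a : X ==> b : X ==> \<Phi>2 (D i a b *.T z) = v i a b *.B \<Phi>2 z"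
proof -
 show "\<Phi>2 (tt (s f) \<one>.B *.T z) = s f *.B \<Phi>2 z" if "f : L"
  by (rule Phi_left[OF Phi2_lin _ _ _ z])
   (use that in "simp_all add: BB.tens_mult Phi2_tt ts_comm B.A.m_assoc[symmetric]")
 show "\<Phi>2 (tt \<one>.B (t f) *.T z) = t f *.B \<Phi>2 z" if "f : L"
  by (rule Phi_left[OF Phi2_lin _ _ _ z])
   (use that in "simp_all add: BB.tens_mult Phi2_tt pi_t t_mult B.A.m_assoc")
 show "\<Phi>2 (D i a b *.T z) = v i a b *.B \<Phi>2 z" if i: "i : I" "a : X" "b : X"
 proof (rule Phi_left[OF Phi2_lin _ _ _ z])
  fix x y assume xy: "x : B" "y : B"
  have "\<Phi>2 (D i a b *.T tt x y)
    = (\<Oplus>.B c\<in>X. if c = b then t (\<tau> i c (\<pi> y)) *.B (v i a c *.B x) else \<zero>.B)"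
   unfolding Phi_v[OF Phi2_lin i xy]
   by (rule B.M.finsum_eqI) (use i xy lin_zero[OF t_lin F.L.md B.md] in
     \<open>simp_all add: Phi2_tt chi_mult chi_v\<close>)
  also have "... = t (\<tau> i b (\<pi> y)) *.B (v i a b *.B x)"
   using i xy finX by (subst B.M.finsum_delta) auto
  also have "... = v i a b *.B \<Phi>2 (tt x y)"
   using i xy by (simp add: Phi2_tt B.A.m_assoc[symmetric] tv)
  finally show "\<Phi>2 (D i a b *.T tt x y) = v i a b *.B \<Phi>2 (tt x y)" .
 qed (use i in auto)
qed

lemma E_one: "E *.T tt \<one>.B \<one>.B = E" by (simp add: BB.tens_one)

lemma counital:
 assumes a: "a : B"
 shows "\<Phi>1 (comult B a) = a" "\<Phi>2 (comult B a) = a"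
proof -
 show "\<Phi>1 (comult B a) = a" using a
 proof (rule gen)
  show "\<Phi>1 E = \<one>.B"
   using Phi1_E[of "tt \<one>.B \<one>.B"] by (simp add: E_one Phi1_tt chi_one s_one)
 qed (simp_all add: lins lin_add[OF Phi1_lin] lin_smult[OF Phi1_lin] comult_mult comult_s comult_t comult_v T.A.m_assoc
   Phi1_E Phi1_gen del: comult_one)
 show "\<Phi>2 (comult B a) = a" using a
 proof (rule gen)
  show "\<Phi>2 E = \<one>.B"
   using Phi2_E[of "tt \<one>.B \<one>.B"] by (simp add: E_one Phi2_tt chi_one t_one)
 qed (simp_all add: lins lin_add[OF Phi2_lin] lin_smult[OF Phi2_lin] comult_mult comult_s comult_t comult_v T.A.m_assoc
   Phi2_E Phi2_gen del: comult_one)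
qed

end

section \<open>Weak bialgebra axioms\<close>

context k_algebra begin

lemma smult_lcomm: "k : K ==> c : K ==> x : A ==> k \<odot>.A (c \<odot>.A x) = c \<odot>.A (k \<odot>.A x)"
 by (simp add: smult_assoc1[symmetric] R.m_comm)

text \<open>The re-bracketing map is an algebra homomorphism.\<close>

lemma assoc_maps:
 fixes BB3 defines "BB3 \<equiv> tensor K A (tensor K A A)"
 shows assoc_lin: "assoc_map K A : lin_maps K (tensor K (tensor K A A) A) BB3"
  and assoc_tens3: "a : A ==> b : A ==> c : A ==>
   assoc_map K A (tens K (tensor K A A) A (tens K A A a b) c) = tens K A (tensor K A A) a (tens K A A b c)"
  and assoc_mult: "x : carrier (tensor K (tensor K A A) A) ==> y : carrier (tensor K (tensor K A A) A) ==>
   assoc_map K A (x \<otimes>\<^bsub>tensor K (tensor K A A) A\<^esub> y) = assoc_map K A x *.BB3 assoc_map K A y"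
proof -
 let ?T = "tensor K A A" and ?aa = "tens K A A" and ?lf = "tensor_lift K BB3"
 let ?TA = "tensor K ?T A" and ?ta = "tens K ?T A" and ?at = "tens K A ?T"
 interpret AA: alg_pair K A A ..
 interpret T: k_algebra K ?T by (rule AA.tensor_k_algebra)
 interpret AT: alg_pair K A ?T ..
 interpret TA: alg_pair K ?T A ..
 interpret B3: k_algebra K BB3 unfolding BB3_def by (rule AT.tensor_k_algebra)
 note l1 = bilin_left[OF AA.tens_bilin] and r1 = bilin_right[OF AA.tens_bilin]
 note l2 = bilin_left[OF AT.tens_bilin, folded BB3_def] and r2 = bilin_right[OF AT.tens_bilin, folded BB3_def]
 note c2 = AT.tens_closed[folded BB3_def]
 let ?g = "%c a b. ?at a (?aa b c)"
 have b: "bilin K A A BB3 (?g c)" if "c : A" for c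
  by (rule bilinI) (use that in "simp_all add: c2 lin_add[OF l1] lin_add[OF r2] lin_add[OF l2] lin_smult[OF l1]
    lin_smult[OF r2] lin_smult[OF l2]")
 note gl = AA.tensor_lift_lin[OF b B3.md] and gt = AA.tensor_lift_tens[OF b B3.md]
 have add: "?lf (?g (c \<oplus>.A d)) u = ?lf (?g c) u \<oplus>.BB3 ?lf (?g d) u"
  if cd: "c : A" "d : A" and u: "u : ?T" for c d u
  using u by (induction u rule: AA.tensor_induct)
   (use cd in "simp_all add: gt c2 lin_add[OF gl] lin_closed[OF gl] lin_add[OF r1] lin_add[OF r2] B3.M.a_ac")
 have sm: "?lf (?g (k \<odot>.A d)) u = k \<odot>.BB3 ?lf (?g d) u"
  if cd: "k : K" "d : A" and u: "u : ?T" for k d u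
  using u by (induction u rule: AA.tensor_induct)
   (use cd in "simp_all add: gt c2 lin_add[OF gl] lin_closed[OF gl] lin_smult[OF r1] lin_smult[OF r2] B3.smult_r_distr")
 have b': "bilin K ?T A BB3 (%u c. ?lf (?g c) u)"
  by (rule bilinI) (simp_all add: lin_closed[OF gl] lin_add[OF gl] lin_smult[OF gl] add sm)
 note lin = TA.tensor_lift_lin[OF b' B3.md] and tens = TA.tensor_lift_tens[OF b' B3.md]
 have eq: "assoc_map K A = ?lf (%u c. ?lf (?g c) u)"
  by (simp add: assoc_map_def BB3_def)
 show lin': "assoc_map K A : lin_maps K ?TA BB3" unfolding eq by (rule lin)
 have t: "assoc_map K A (?ta u c) = ?lf (?g c) u"
  if "u : ?T" "c : A" for u c
  unfolding eq using that by (rule tens)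
 show t3: "assoc_map K A (?ta (?aa a b) c) = ?g c a b"
  if "a : A" "b : A" "c : A" for a b c
  using that by (simp add: t gt)
 have gm: "?lf (?g (c *.A d)) (x *.?T y)
   = ?lf (?g c) x *.BB3 ?lf (?g d) y"
  if cd: "c : A" "d : A" and x: "x : ?T" and y: "y : ?T" for c d x y
 proof -
  have 1: "?lf (?g (c *.A d)) (?aa a b *.?T y)
   = ?g c a b *.BB3 ?lf (?g d) y" if ab: "a : A" "b : A" for a b
   using y by (induction y rule: AA.tensor_induct)
    (use cd ab in "simp_all add: AA.tens_mult gt AT.tens_mult[folded BB3_def] c2 T.A.r_distr B3.A.r_distr
      lin_add[OF gl] lin_closed[OF gl]")
  show ?thesis
   using x by (induction x rule: AA.tensor_induct)
    (use cd y in "simp_all add: 1 gt T.A.l_distr B3.A.l_distr lin_add[OF gl] lin_closed[OF gl]")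
 qed
 show "assoc_map K A (x *.?TA y) = assoc_map K A x *.BB3 assoc_map K A y"
  if "x : ?TA" "y : ?TA" for x y
  by (rule TA.lin_mult_multiplicative[OF B3.k_algebra_axioms lin' _ that]) (simp add: t gm)
qed

end

context gen_bialg begin

lemmas as_lin = B.assoc_lin and as_mult = B.assoc_mult and as_tens3 = B.assoc_tens3

definition "m1 = (%z. assoc_map K B (tensor_lift K (tensor K T B) (%x y. tens K T B (comult B x) y) z))"
definition "m2 = tensor_lift K \<T> (%x y. tens K B T x (comult B y))"

lemma bm1: "bilin K B B (tensor K T B) (%x y. tens K T B (comult B x) y)"
 by (rule bilinI) (simp_all add: lins)
lemma bm2: "bilin K B B \<T> (%x y. tens K B T x (comult B y))"
 by (rule bilinI) (simp_all add: lins)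

lemma m1_lin: "m1 : lin_maps K T \<T>"
 unfolding m1_def by (rule lin_comp[OF BB.tensor_lift_lin[OF bm1 TB3.md] as_lin])
lemma m2_lin: "m2 : lin_maps K T \<T>"
 unfolding m2_def by (rule BB.tensor_lift_lin[OF bm2 \<T>.md])
lemma m1_tt: "x : B ==> y : B ==> m1 (tt x y) = assoc_map K B (tens K T B (comult B x) y)"
 unfolding m1_def by (simp add: BB.tensor_lift_tens[OF bm1 TB3.md])
lemma m2_tt: "x : B ==> y : B ==> m2 (tt x y) = tens K B T x (comult B y)"
 unfolding m2_def by (simp add: BB.tensor_lift_tens[OF bm2 \<T>.md])

lemma m1_mult: "x : T ==> y : T ==> m1 (x *.T y) = m1 x *.\<T> m1 y"
 by (rule BB.lin_mult_multiplicative[OF \<T>.k_algebra_axioms m1_lin])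
   (simp_all add: m1_tt comult_mult TB.tens_mult[symmetric] as_mult)
lemma m2_mult: "x : T ==> y : T ==> m2 (x *.T y) = m2 x *.\<T> m2 y"
 by (rule BB.lin_mult_multiplicative[OF \<T>.k_algebra_axioms m2_lin])
   (simp_all add: m2_tt comult_mult BT.tens_mult[symmetric])

lemmas m1_closed [simp] = lin_closed[OF m1_lin] and m2_closed [simp] = lin_closed[OF m2_lin]

abbreviation "W1 \<equiv> assoc_map K B (tens K T B E \<one>.B)"
abbreviation "W2 \<equiv> tens K B T \<one>.B E"

lemma W_closed [simp]: "W1 : \<T>" "W2 : \<T>"
 using m1_closed[of "tt \<one>.B \<one>.B"] m2_closed[of "tt \<one>.B \<one>.B"] by (simp_all add: m1_tt m2_tt)

lemma m_W: "z : T ==> m1 z *.\<T> W1 = m1 z" "z : T ==> m2 z *.\<T> W2 = m2 z"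
 using m1_mult[of z "\<one>.T"] m2_mult[of z "\<one>.T"] by (simp_all add: BB.tens_one[symmetric] m1_tt m2_tt)
   (simp_all add: BB.tens_one)

lemma as_left:
 assumes "x : T" "c : B"
 shows "assoc_map K B (tens K T B (E *.T x) c) = W1 *.\<T> assoc_map K B (tens K T B x c)"
 using assms by (simp add: as_mult[symmetric] TB.tens_mult)
lemma tens_right:
 assumes "x : T" "c : B"
 shows "tens K B T c (E *.T x) = W2 *.\<T> tens K B T c x"
 using assms by (simp add: BT.tens_mult)

lemma tens_finsum:
 assumes "!!i. i : S ==> x i : T" "c : B"
 shows "tens K B T c (finsum T x S) = (\<Oplus>.\<T> i\<in>S. tens K B T c (x i))"
  and "assoc_map K B (tens K T B (finsum T x S) c) = (\<Oplus>.\<T> i\<in>S. assoc_map K B (tens K T B (x i) c))"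
 using lin_finsum[OF bilin_right[OF BT.tens_bilin] T.md \<T>.md, of c S x]
  lin_finsum[OF lin_comp[OF bilin_left[OF TB.tens_bilin] as_lin] T.md \<T>.md, of c S x] assms
 by auto

lemma W1_eq: "W1 = (\<Oplus>.\<T> i\<in>J. ttt (t (p i)) (s (q i)) \<one>.B)"
 unfolding comult_one by (subst tens_finsum) (auto simp: as_tens3 intro!: \<T>.M.finsum_eqI)
lemma W2_eq: "W2 = (\<Oplus>.\<T> j\<in>J. ttt \<one>.B (t (p j)) (s (q j)))"
 unfolding comult_one by (subst tens_finsum) (auto intro!: \<T>.M.finsum_eqI)

abbreviation "E3 \<equiv> (\<Oplus>.\<T> i\<in>J. \<Oplus>.\<T> j\<in>J. ttt (t (p i)) (s (q i) *.B t (p j)) (s (q j)))"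

lemma W1_W2: "W1 *.\<T> W2 = E3"
 unfolding W1_eq W2_eq
 by (subst \<T>.finsum_mult_finsum) (auto simp: BT.tens_mult BB.tens_mult intro!: \<T>.M.finsum_eqI \<T>.M.finsum_closedI)

lemma W2_W1: "W2 *.\<T> W1 = E3"
proof -
 have "W2 *.\<T> W1 = (\<Oplus>.\<T> j\<in>J. \<Oplus>.\<T> i\<in>J. ttt (t (p i)) (s (q i) *.B t (p j)) (s (q j)))"
  unfolding W1_eq W2_eq
  by (subst \<T>.finsum_mult_finsum)
    (auto simp: BT.tens_mult BB.tens_mult ts_comm intro!: \<T>.M.finsum_eqI \<T>.M.finsum_closedI)
 also have "... = E3" by (rule \<T>.M.finsum_swap) (auto simp: F.finJ)
 finally show ?thesis .
qed

lemma m1_E: "m1 E = E3"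
proof -
 have "m1 E = (\<Oplus>.\<T> j\<in>J. m1 (tt (t (p j)) (s (q j))))"
  unfolding comult_one by (rule lin_finsum[OF m1_lin T.md \<T>.md]) auto
 also have "... = (\<Oplus>.\<T> j\<in>J. W1 *.\<T> ttt \<one>.B (t (p j)) (s (q j)))"
  by (rule \<T>.M.finsum_eqI) (auto simp: m1_tt comult_t as_left as_tens3)
 also have "... = W1 *.\<T> W2"
  unfolding W2_eq by (subst \<T>.finsum_mult_left) auto
 finally show ?thesis by (simp only: W1_W2)
qed

lemma m2_E: "m2 E = E3"
proof -
 have "m2 E = (\<Oplus>.\<T> j\<in>J. m2 (tt (t (p j)) (s (q j))))"
  unfolding comult_one by (rule lin_finsum[OF m2_lin T.md \<T>.md]) auto
 also have "... = (\<Oplus>.\<T> j\<in>J. W2 *.\<T> ttt (t (p j)) (s (q j)) \<one>.B)"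
  by (rule \<T>.M.finsum_eqI) (auto simp: m2_tt comult_s tens_right)
 also have "... = W2 *.\<T> W1"
  unfolding W1_eq by (subst \<T>.finsum_mult_left) auto
 finally show ?thesis by (simp only: W2_W1)
qed

text \<open>The two iterated comultiplications are multiplicative, and \<open>\<Delta>(g)\<close> has the form \<open>E d\<close> on generators.
  It is enough that \<open>d\<close> is coassociative, because both maps send \<open>E\<close> to the same element.\<close>

lemma m_gen:
 assumes "d : T" "z : \<T>" "m1 d = W1 *.\<T> z" "m2 d = W2 *.\<T> z"
 shows "m1 (E *.T d) = m2 (E *.T d)"
 using assms m_W[of E] by (simp add: m1_mult m2_mult \<T>.A.m_assoc[symmetric]) (simp add: m1_E m2_E)

lemma m_coassoc:
 assumes "a : B"
 shows "m1 (comult B a) = m2 (comult B a)"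
 using assms
proof (rule gen)
 show "m1 E = m2 E" by (simp add: m1_E m2_E)
next
 fix f x assume f: "f : L" and x: "x : B" and IH: "m1 (comult B x) = m2 (comult B x)"
 have "m1 (comult B (s f)) = m2 (comult B (s f))" unfolding comult_s[OF f]
  by (rule m_gen[of _ "ttt (s f) \<one>.B \<one>.B"])
   (use f in "simp_all add: m1_tt m2_tt comult_s as_left as_tens3 BT.tens_mult BB.tens_one")
 then show "m1 (comult B (s f *.B x)) = m2 (comult B (s f *.B x))"
  using f x IH by (simp add: comult_mult m1_mult m2_mult)
 have "m1 (comult B (t f)) = m2 (comult B (t f))" unfolding comult_t[OF f]
  by (rule m_gen[of _ "ttt \<one>.B \<one>.B (t f)"])
   (use f as_left[of "tt \<one>.B \<one>.B" "t f"] in "simp_all add: m1_tt m2_tt comult_t tens_right E_one as_tens3")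
 then show "m1 (comult B (t f *.B x)) = m2 (comult B (t f *.B x))"
  using f x IH by (simp add: comult_mult m1_mult m2_mult)
next
 fix i a b x assume i: "i : I" "a : X" "b : X" and x: "x : B" and IH: "m1 (comult B x) = m2 (comult B x)"
 let ?z = "%c d. ttt (v i a d) (v i d c) (v i c b)"
 let ?Z = "\<Oplus>.\<T> c\<in>X. \<Oplus>.\<T> d\<in>X. ?z c d"
 have "m1 (comult B (v i a b)) = m2 (comult B (v i a b))" unfolding comult_v[OF i]
 proof (rule m_gen[of _ ?Z])
  have "m1 (D i a b) = (\<Oplus>.\<T> c\<in>X. m1 (tt (v i a c) (v i c b)))"
   by (rule lin_finsum[OF m1_lin T.md \<T>.md]) (use i in auto)
  also have "... = (\<Oplus>.\<T> c\<in>X. W1 *.\<T> (\<Oplus>.\<T> d\<in>X. ?z c d))"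
   by (rule \<T>.M.finsum_eqI)
    (use i in \<open>auto simp: m1_tt comult_v as_left tens_finsum as_tens3 intro!: \<T>.M.finsum_closedI \<T>.A.m_closed
      arg_cong2[where f = "mult \<T>"] \<T>.M.finsum_eqI\<close>)
  also have "... = W1 *.\<T> ?Z"
   by (rule sym, rule \<T>.finsum_mult_left) (use i in \<open>auto intro!: \<T>.M.finsum_closedI\<close>)
  finally show "m1 (D i a b) = W1 *.\<T> ?Z" .
  have "m2 (D i a b) = (\<Oplus>.\<T> d\<in>X. m2 (tt (v i a d) (v i d b)))"
   by (rule lin_finsum[OF m2_lin T.md \<T>.md]) (use i in auto)
  also have "... = (\<Oplus>.\<T> d\<in>X. W2 *.\<T> (\<Oplus>.\<T> c\<in>X. ?z c d))"
   by (rule \<T>.M.finsum_eqI)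
    (use i in \<open>auto simp: m2_tt comult_v tens_right tens_finsum intro!: \<T>.M.finsum_closedI \<T>.A.m_closed\<close>)
  also have "... = W2 *.\<T> (\<Oplus>.\<T> d\<in>X. \<Oplus>.\<T> c\<in>X. ?z c d)"
   by (rule sym, rule \<T>.finsum_mult_left) (use i in \<open>auto intro!: \<T>.M.finsum_closedI\<close>)
  also have "(\<Oplus>.\<T> d\<in>X. \<Oplus>.\<T> c\<in>X. ?z c d) = ?Z"
   by (rule \<T>.M.finsum_swap) (use i finX in auto)
  finally show "m2 (D i a b) = W2 *.\<T> ?Z" .
 qed (use i in \<open>auto intro!: \<T>.M.finsum_closedI\<close>)
 then show "m1 (comult B (v i a b *.B x)) = m2 (comult B (v i a b *.B x))"
  using i x IH by (simp add: comult_mult m1_mult m2_mult)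
qed (simp_all add: lins lin_add[OF m1_lin] lin_add[OF m2_lin] lin_smult[OF m1_lin] lin_smult[OF m2_lin])

lemma comult_id_eq: "assoc_map K B (comult_id K B a) = m1 (comult B a)" "id_comult K B a = m2 (comult B a)"
 by (simp_all add: comult_id_def id_comult_def m1_def m2_def)

text \<open>Contracting \<open>E\<close> against \<open>\<epsilon>\<close> on one leg.\<close>

lemma eps_contract:
 assumes F: "F : lin_maps K L V" and V: "module K V" and a: "a : B"
 shows "(\<Oplus>.V j\<in>J. counit B (t (p j) *.B a) \<odot>.V F (q j)) = F (\<pi> a)"
  and "(\<Oplus>.V j\<in>J. counit B (s (q j) *.B a) \<odot>.V F (p j)) = F (\<pi> a)"
proof -
 interpret V: module K V by fact
 have "(\<Oplus>.V j\<in>J. counit B (t (p j) *.B a) \<odot>.V F (q j)) = (\<Oplus>.V j\<in>J. \<psi> (\<pi> a *.L p j) \<odot>.V F (q j))"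
  by (rule V.M.finsum_eqI) (use a in "auto simp: counit_eq pi_t lin_closed[OF F]")
 then show "(\<Oplus>.V j\<in>J. counit B (t (p j) *.B a) \<odot>.V F (q j)) = F (\<pi> a)"
  using F.dual1_lin[OF F V, of "\<pi> a"] a by simp
 have "(\<Oplus>.V j\<in>J. counit B (s (q j) *.B a) \<odot>.V F (p j)) = (\<Oplus>.V j\<in>J. \<psi> (q j *.L \<pi> a) \<odot>.V F (p j))"
  by (rule V.M.finsum_eqI) (use a in "auto simp: counit_eq pi_s lin_closed[OF F]")
 then show "(\<Oplus>.V j\<in>J. counit B (s (q j) *.B a) \<odot>.V F (p j)) = F (\<pi> a)"
  using F.dual2_lin[OF F V, of "\<pi> a"] a by simp
qed

lemmas counit_closed = lin_closed[OF counit_lin, unfolded scalars_simps]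
lemmas counit_add = lin_add[OF counit_lin, unfolded scalars_simps]
lemmas counit_smult = lin_smult[OF counit_lin, unfolded scalars_simps]

lemma Phi_lift:
 assumes G: "G : lin_maps K B V" and V: "module K V" and a: "a : B"
 shows "tensor_lift K V (%x y. G (s (\<pi> x) *.B y)) (comult B a) = G a"
  "tensor_lift K V (%x y. G (t (\<pi> y) *.B x)) (comult B a) = G a"
 using BB.tensor_lift_comp[OF b1 B.md V G comult_closed[OF a]]
  BB.tensor_lift_comp[OF b2 B.md V G comult_closed[OF a]] counital[OF a]
 unfolding \<Phi>1_def \<Phi>2_def by auto

text \<open>In a sum over \<open>\<Delta>(a)\<close> one may insert \<open>E\<close>, and \<open>E\<close> turns the counit into the action on the base
  (\<open>eps_contract\<close>); so every axiom with the counit becomes an instance of \<open>counital\<close>.\<close>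

lemma weak_bialg: "weak_bialgebra K B"
proof (unfold_locales)
 show "comult B : lin_maps K B T" by (rule comult_lin)
 show "counit B : lin_maps K B (scalars K)" by (rule counit_lin)
 note SM = k_algebra.axioms(1)[OF B.scalars_k_algebra]
 interpret S: k_algebra K "scalars K" by (rule B.scalars_k_algebra)
 fix a assume a: "a : B"
 show "assoc_map K B (comult_id K B a) = id_comult K B a"
  using m_coassoc[OF a] by (simp add: comult_id_eq)
 show "tensor_lift K B (%x y. counit B x \<odot>.B y) (comult B a) = a"
 proof -
  have "tensor_lift K B (%x y. counit B x \<odot>.B y) (comult B a) = tensor_lift K B (%x y. s (\<pi> x) *.B y) (comult B a)"
  proof (rule lift_average_comult[OF _ B.md b1 _ a])
   fix x y assume xy: "x : B" "y : B"
   show "(\<Oplus>.B j\<in>J. counit B (t (p j) *.B x) \<odot>.B (s (q j) *.B y)) = s (\<pi> x) *.B y"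
    by (rule eps_contract[OF lin_comp[OF s_lin B.mult_right_lin[OF xy(2)]] B.md xy(1)])
  qed (rule bilinI; simp add: lins counit_closed counit_add counit_smult B.R.m_comm B.smult_lcomm)
  then show ?thesis using counital[OF a] by (simp add: \<Phi>1_def)
 qed
 show "tensor_lift K B (%x y. counit B y \<odot>.B x) (comult B a) = a"
 proof -
  have "tensor_lift K B (%x y. counit B y \<odot>.B x) (comult B a) = tensor_lift K B (%x y. t (\<pi> y) *.B x) (comult B a)"
  proof (rule lift_average_comult[OF _ B.md b2 _ a])
   fix x y assume xy: "x : B" "y : B"
   show "(\<Oplus>.B j\<in>J. counit B (s (q j) *.B y) \<odot>.B (t (p j) *.B x)) = t (\<pi> y) *.B x"
    by (rule eps_contract[OF lin_comp[OF t_lin B.mult_right_lin[OF xy(1)]] B.md xy(2)])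
  qed (rule bilinI; simp add: lins counit_closed counit_add counit_smult B.R.m_comm B.smult_lcomm)
  then show ?thesis using counital[OF a] by (simp add: \<Phi>2_def)
 qed
next
 fix a b assume "a : B" "b : B"
 then show "comult B (a *.B b) = comult B a *.T comult B b" by (rule comult_mult)
next
 show "W1 *.\<T> W2 = id_comult K B \<one>.B" "W2 *.\<T> W1 = id_comult K B \<one>.B"
  by (simp_all add: comult_id_eq m2_E W1_W2 W2_W1)
next
 interpret S: k_algebra K "scalars K" by (rule B.scalars_k_algebra)
 note SM = S.md
 fix a b c assume abc: "a : B" "b : B" "c : B"
 have G: "(%u. counit B (a *.B (u *.B c))) : lin_maps K B (scalars K)"
  using lin_comp[OF B.mult_right_lin[OF abc(3)] lin_comp[OF B.mult_left_lin[OF abc(1)] counit_lin]] .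
 have b1: "bilin K B B (scalars K) (%x y. counit B (a *.B (s (\<pi> x) *.B y *.B c)))"
  using bilin_comp[OF b1 B.id_lin B.id_lin G] .
 have b2: "bilin K B B (scalars K) (%x y. counit B (a *.B (t (\<pi> y) *.B x *.B c)))"
  using bilin_comp[OF b2 B.id_lin B.id_lin G] .
 show "tensor_lift K (scalars K) (%x y. counit B (a *.B x) *.K counit B (y *.B c)) (comult B b)
   = counit B (a *.B b *.B c)"
 proof -
  have "tensor_lift K (scalars K) (%x y. counit B (a *.B x) *.K counit B (y *.B c)) (comult B b)
   = tensor_lift K (scalars K) (%x y. counit B (a *.B (s (\<pi> x) *.B y *.B c))) (comult B b)"
  proof (rule lift_average_comult[OF _ SM b1 _ abc(2)])
   fix x y assume xy: "x : B" "y : B"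
   have l: "(%l. counit B (a *.B (t l *.B x))) : lin_maps K L (scalars K)"
    using lin_comp[OF t_lin lin_comp[OF B.mult_right_lin[OF xy(1)] lin_comp[OF B.mult_left_lin[OF abc(1)] counit_lin]]] .
   have "(\<Oplus>\<^bsub>scalars K\<^esub>j\<in>J. counit B (a *.B (t (p j) *.B x)) *.K counit B (s (q j) *.B y *.B c))
    = (\<Oplus>\<^bsub>scalars K\<^esub>j\<in>J. counit B (s (q j) *.B (y *.B c)) \<odot>\<^bsub>scalars K\<^esub> counit B (a *.B (t (p j) *.B x)))"
    by (rule S.M.finsum_eqI) (use abc xy in "auto simp: counit_closed B.R.m_comm B.A.m_assoc")
   also have "... = counit B (a *.B (t (\<pi> (y *.B c)) *.B x))"
    by (rule eps_contract[OF l SM]) (use abc xy in auto)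
   also have "... = counit B (a *.B (s (\<pi> x) *.B y *.B c))"
    using abc xy by (simp add: counit_eq chi_mult chi_s chi_t)
   finally show "(\<Oplus>\<^bsub>scalars K\<^esub>j\<in>J. counit B (a *.B (t (p j) *.B x)) *.K counit B (s (q j) *.B y *.B c))
    = counit B (a *.B (s (\<pi> x) *.B y *.B c))" .
  qed (rule bilinI; use abc in "simp add: lins counit_closed counit_add counit_smult B.R.m_ac B.R.l_distr B.R.r_distr")
  then show ?thesis using Phi_lift(1)[OF G SM abc(2)] abc by (simp add: B.A.m_assoc)
 qed
 show "tensor_lift K (scalars K) (%x y. counit B (a *.B y) *.K counit B (x *.B c)) (comult B b)
   = counit B (a *.B b *.B c)"
 proof -
  have "tensor_lift K (scalars K) (%x y. counit B (a *.B y) *.K counit B (x *.B c)) (comult B b)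
   = tensor_lift K (scalars K) (%x y. counit B (a *.B (t (\<pi> y) *.B x *.B c))) (comult B b)"
  proof (rule lift_average_comult[OF _ SM b2 _ abc(2)])
   fix x y assume xy: "x : B" "y : B"
   have l: "(%l. counit B (a *.B (s l *.B y))) : lin_maps K L (scalars K)"
    using lin_comp[OF s_lin lin_comp[OF B.mult_right_lin[OF xy(2)] lin_comp[OF B.mult_left_lin[OF abc(1)] counit_lin]]] .
   have "(\<Oplus>\<^bsub>scalars K\<^esub>j\<in>J. counit B (a *.B (s (q j) *.B y)) *.K counit B (t (p j) *.B x *.B c))
    = (\<Oplus>\<^bsub>scalars K\<^esub>j\<in>J. counit B (t (p j) *.B (x *.B c)) \<odot>\<^bsub>scalars K\<^esub> counit B (a *.B (s (q j) *.B y)))"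
    by (rule S.M.finsum_eqI) (use abc xy in "auto simp: counit_closed B.R.m_comm B.A.m_assoc")
   also have "... = counit B (a *.B (s (\<pi> (x *.B c)) *.B y))"
    by (rule eps_contract[OF l SM]) (use abc xy in auto)
   also have "... = counit B (a *.B (t (\<pi> y) *.B x *.B c))"
    using abc xy by (simp add: counit_eq chi_mult chi_s chi_t)
   finally show "(\<Oplus>\<^bsub>scalars K\<^esub>j\<in>J. counit B (a *.B (s (q j) *.B y)) *.K counit B (t (p j) *.B x *.B c))
    = counit B (a *.B (t (\<pi> y) *.B x *.B c))" .
  qed (rule bilinI; use abc in "simp add: lins counit_closed counit_add counit_smult B.R.m_ac B.R.l_distr B.R.r_distr")
  then show ?thesis using Phi_lift(2)[OF G SM abc(2)] abc by (simp add: B.A.m_assoc)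
 qed
qed

lemma eps_t_eq:
 assumes a: "a : B"
 shows "eps_t K B a = s (\<pi> a)"
proof -
 have b: "bilin K B B B (%x y. counit B (x *.B a) \<odot>.B y)"
  by (rule bilinI; use a in "simp add: lins counit_closed counit_add counit_smult B.R.m_comm B.smult_lcomm")
 have "eps_t K B a = (\<Oplus>.B j\<in>J. tensor_lift K B (%x y. counit B (x *.B a) \<odot>.B y) (tt (t (p j)) (s (q j))))"
  unfolding eps_t_def comult_one
  by (rule lin_finsum[OF BB.tensor_lift_lin[OF b B.md] T.md B.md]) auto
 also have "... = (\<Oplus>.B j\<in>J. counit B (t (p j) *.B a) \<odot>.B s (q j))"
  by (rule B.M.finsum_eqI) (use a in "auto simp: BB.tensor_lift_tens[OF b B.md] counit_closed")
 also have "... = s (\<pi> a)" by (rule eps_contract[OF s_lin B.md a])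
 finally show ?thesis .
qed

lemma eps_s_eq:
 assumes a: "a : B"
 shows "eps_s K B a = t (\<Oplus>.L j\<in>J. \<psi> (\<chi> a (q j)) \<odot>.L p j)"
proof -
 have b: "bilin K B B B (%x y. counit B (a *.B y) \<odot>.B x)"
  by (rule bilinI; use a in "simp add: lins counit_closed counit_add counit_smult B.R.m_comm B.smult_lcomm")
 have "eps_s K B a = (\<Oplus>.B j\<in>J. tensor_lift K B (%x y. counit B (a *.B y) \<odot>.B x) (tt (t (p j)) (s (q j))))"
  unfolding eps_s_def comult_one
  by (rule lin_finsum[OF BB.tensor_lift_lin[OF b B.md] T.md B.md]) auto
 also have "... = (\<Oplus>.B j\<in>J. t (\<psi> (\<chi> a (q j)) \<odot>.L p j))"
  by (rule B.M.finsum_eqI) (use a in "auto simp: BB.tensor_lift_tens[OF b B.md] counit_eq pi_s_right lins")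
 also have "... = t (\<Oplus>.L j\<in>J. \<psi> (\<chi> a (q j)) \<odot>.L p j)"
  by (rule sym, rule lin_finsum[OF t_lin F.L.md B.md]) (use a in auto)
 finally show ?thesis .
qed

end

section \<open>Convolution and target counit in a weak bialgebra\<close>

context weak_bialgebra begin

sublocale BB: alg_pair K B B ..
sublocale T: k_algebra K "tensor K B B" by (rule BB.tensor_k_algebra)
sublocale BT: alg_pair K B "tensor K B B" ..
sublocale TB: alg_pair K "tensor K B B" B ..
sublocale \<T>: k_algebra K "tensor K B (tensor K B B)" by (rule BT.tensor_k_algebra)
sublocale TB3: k_algebra K "tensor K (tensor K B B) B" by (rule TB.tensor_k_algebra)

abbreviation "\<Delta> \<equiv> comult B"
lemmas Delta_closed [simp] = lin_closed[OF comult_linear]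
lemmas eps_closed [simp] = lin_closed[OF counit_linear, unfolded scalars_simps]

lemma conv_bilin:
 assumes "k_algebra K C" "f : lin_maps K B C" "g : lin_maps K B C"
 shows "bilin K B B C (%x y. f x *.C g y)"
proof -
 interpret C: k_algebra K C by fact
 show ?thesis using bilin_comp[OF C.mult_bilin assms(2,3) C.id_lin] .
qed

lemma conv_lin:
 assumes "k_algebra K C" "f : lin_maps K B C" "g : lin_maps K B C"
 shows "convolution K B C f g : lin_maps K B C"
 using lin_comp[OF comult_linear BB.tensor_lift_lin[OF conv_bilin[OF assms] k_algebra.axioms(1)[OF assms(1)]]]
 by (simp add: convolution_def[abs_def])

lemma conv_assoc:
 assumes C: "k_algebra K C" and f: "f : lin_maps K B C" and g: "g : lin_maps K B C" and h: "h : lin_maps K B C"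
  and c: "c : B"
 shows "convolution K B C (convolution K B C f g) h c = convolution K B C f (convolution K B C g h) c"
proof -
 interpret C: k_algebra K C by fact
 note CM = C.md
 let ?l = "%f g. tensor_lift K C (%x y. f x *.C g y)"
 note fg = conv_bilin[OF C f g] and gh = conv_bilin[OF C g h]
 note fgl = BB.tensor_lift_lin[OF fg CM] and ghl = BB.tensor_lift_lin[OF gh CM]
 have bW: "bilin K B (tensor K B B) C (%x u. f x *.C ?l g h u)"
  using bilin_comp[OF C.mult_bilin f ghl C.id_lin] .
 define W where "W = tensor_lift K C (%x u. f x *.C ?l g h u)"
 have W: "W : lin_maps K (tensor K B (tensor K B B)) C" unfolding W_def by (rule BT.tensor_lift_lin[OF bW CM])
 have Wt: "W (tens K B (tensor K B B) x u) = f x *.C ?l g h u" if "x : B" "u : carrier (tensor K B B)" for x u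
  unfolding W_def using that by (rule BT.tensor_lift_tens[OF bW CM])
 have tb: "bilin K B B (tensor K B (tensor K B B)) (%x y. tens K B (tensor K B B) x (\<Delta> y))"
  using bilin_comp[OF BT.tens_bilin id_lin comult_linear \<T>.id_lin] .
 have tb': "bilin K B B (tensor K (tensor K B B) B) (%x y. tens K (tensor K B B) B (\<Delta> x) y)"
  using bilin_comp[OF TB.tens_bilin comult_linear id_lin TB3.id_lin] .
 have 1: "W (id_comult K B c) = convolution K B C f (convolution K B C g h) c"
  unfolding id_comult_def convolution_def
   BB.tensor_lift_comp[OF tb \<T>.md CM W Delta_closed[OF c]]
  by (rule BB.tensor_lift_cong[OF bilin_comp[OF tb id_lin id_lin W] CM Delta_closed[OF c]]) (simp add: Wt)
 have Wa: "W (assoc_map K B (tens K (tensor K B B) B u y)) = ?l f g u *.C h y"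
  if y: "y : B" and u: "u : carrier (tensor K B B)" for u y
 proof (rule BB.tensor_lin_eq[OF lin_comp[OF bilin_left[OF TB.tens_bilin] lin_comp[OF assoc_lin W]]
    lin_comp[OF fgl C.mult_right_lin] _ u])
  fix a b assume "a : B" "b : B"
  then show "W (assoc_map K B (tens K (tensor K B B) B (tens K B B a b) y)) = ?l f g (tens K B B a b) *.C h y"
   using y lin_closed[OF f] lin_closed[OF g] lin_closed[OF h]
   by (simp add: assoc_tens3 Wt BB.tensor_lift_tens[OF gh CM] BB.tensor_lift_tens[OF fg CM] C.A.m_assoc)
 qed (use y lin_closed[OF h] in auto)
 have "W (assoc_map K B (comult_id K B c)) = convolution K B C (convolution K B C f g) h c"
  unfolding comult_id_def convolution_def
   BB.tensor_lift_comp[OF tb' TB3.md CM lin_comp[OF assoc_lin W] Delta_closed[OF c]]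
  by (rule BB.tensor_lift_cong[OF bilin_comp[OF tb' id_lin id_lin lin_comp[OF assoc_lin W]] CM Delta_closed[OF c]])
    (simp add: Wa)
 then show ?thesis using 1 coassoc[OF c] by simp
qed

lemma eps_t_bilin: "a : B ==> bilin K B B B (%x y. counit B (x *.B a) \<odot>.B y)"
 by (rule bilinI) (simp_all add: A.l_distr smult_mult_left lin_add[OF counit_linear] lin_smult[OF counit_linear]
   smult_l_distr smult_r_distr smult_assoc1 smult_lcomm)

lemma eps_t_closed [simp]: "a : B ==> eps_t K B a : B"
 unfolding eps_t_def by (rule lin_closed[OF BB.tensor_lift_lin[OF eps_t_bilin module_axioms]]) auto

text \<open>This form of weak counitality lets \<open>\<epsilon>\<^sub>t\<close> carry the information about the counit of a product.\<close>

lemma counit_eps_t_right: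
 assumes "u : B" "c : B"
 shows "counit B (u *.B eps_t K B c) = counit B (u *.B c)"
proof -
 interpret S: k_algebra K "scalars K" by (rule scalars_k_algebra)
 have "counit B (u *.B eps_t K B c)
   = tensor_lift K (scalars K) (%x y. counit B (u *.B (counit B (x *.B c) \<odot>.B y))) (\<Delta> \<one>.B)"
  unfolding eps_t_def
  by (rule BB.tensor_lift_comp[OF eps_t_bilin module_axioms S.md
    lin_comp[OF mult_left_lin counit_linear]]) (use assms in auto)
 also have "... = tensor_lift K (scalars K) (%x y. counit B (u *.B y) \<otimes> counit B (x *.B c)) (\<Delta> \<one>.B)"
  by (rule BB.tensor_lift_cong[OF bilin_comp[OF eps_t_bilin id_lin id_lin lin_comp[OF mult_left_lin counit_linear]]
     S.md])
    (use assms in "auto simp: smult_mult_right lin_smult[OF counit_linear] R.m_comm")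
 also have "... = counit B (u *.B \<one>.B *.B c)"
  by (rule counit_mult_right) (use assms in auto)
 finally show ?thesis using assms by simp
qed

lemma counit_eps_t: "c : B ==> counit B (eps_t K B c) = counit B c"
 using counit_eps_t_right[of "\<one>.B" c] by simp

lemma eps_t_eps_t:
 assumes "b : B" "c : B"
 shows "eps_t K B (b *.B eps_t K B c) = eps_t K B (b *.B c)"
 unfolding eps_t_def[of _ _ "b *.B c"] eps_t_def[of _ _ "b *.B eps_t K B c"]
 by (rule BB.tensor_lift_cong[OF eps_t_bilin module_axioms])
   (use assms in "auto simp: A.m_assoc[symmetric] counit_eps_t_right")

lemma eps_t_lin: "eps_t K B : lin_maps K B B"
proof (rule lin_mapsI)
 fix x y assume xy: "x : B" "y : B"
 have "tensor_lift K B (%a b. counit B (a *.B (x \<oplus>.B y)) \<odot>.B b) z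
  = tensor_lift K B (%a b. counit B (a *.B x) \<odot>.B b) z \<oplus>.B tensor_lift K B (%a b. counit B (a *.B y) \<odot>.B b) z"
  if z: "z : carrier (tensor K B B)" for z
  using z by (induction z rule: BB.tensor_induct)
   (use xy in "simp_all add: BB.tensor_lift_tens[OF eps_t_bilin module_axioms] A.r_distr smult_l_distr lin_add[OF counit_linear]
    lin_add[OF BB.tensor_lift_lin[OF eps_t_bilin module_axioms]] lin_closed[OF BB.tensor_lift_lin[OF eps_t_bilin module_axioms]]
    M.a_ac")
 then show "eps_t K B (x \<oplus>.B y) = eps_t K B x \<oplus>.B eps_t K B y" by (simp add: eps_t_def)
next
 fix k x assume xy: "k : K" "x : B"
 have "tensor_lift K B (%a b. counit B (a *.B (k \<odot>.B x)) \<odot>.B b) z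
  = k \<odot>.B tensor_lift K B (%a b. counit B (a *.B x) \<odot>.B b) z"
  if z: "z : carrier (tensor K B B)" for z
  using z by (induction z rule: BB.tensor_induct)
   (use xy in "simp_all add: BB.tensor_lift_tens[OF eps_t_bilin module_axioms] smult_mult_right smult_assoc1 lin_smult[OF counit_linear]
    lin_add[OF BB.tensor_lift_lin[OF eps_t_bilin module_axioms]] lin_closed[OF BB.tensor_lift_lin[OF eps_t_bilin module_axioms]]
    smult_r_distr")
 then show "eps_t K B (k \<odot>.B x) = k \<odot>.B eps_t K B x" by (simp add: eps_t_def)
qed auto

end

section \<open>Antipodes\<close>

context gen_bialg begin

lemma E_tk:
 assumes "k : L"
 shows "E *.T tt \<one>.B (t k) = tt \<one>.B (t k) *.T E"
  and "E *.T tt (s k) \<one>.B = tt (s k) \<one>.B *.T E"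
 unfolding comult_one using assms
 by (auto simp: T.finsum_mult_left T.finsum_mult_right BB.tens_mult ts_comm intro!: T.M.finsum_eqI)

lemma D_E:
 assumes i: "i : I" "a : X" "b : X"
 shows "D i a b *.T E = E *.T D i a b"
proof -
 have "tt (v i a c) (v i c b) *.T E = E *.T tt (v i a c) (v i c b)" if c: "c : X" for c
 proof -
  have bil: "bilin K L L T (%f g. tt (t f *.B v i a c) (s g *.B v i c b))"
   by (rule bilinI) (use i c in "simp_all add: lins")
  have "tt (v i a c) (v i c b) *.T E = (\<Oplus>.T j\<in>J. tt (t (\<tau> i c (p j)) *.B v i a c) (s (\<tau> i c (q j)) *.B v i c b))"
   unfolding comult_one using i c
   by (subst T.finsum_mult_left) (auto simp: BB.tens_mult sv tv intro!: T.M.finsum_eqI)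
  also have "... = (\<Oplus>.T j\<in>J. tt (t (p j) *.B v i a c) (s (q j) *.B v i c b))"
   by (rule F.invariant[OF bil T.md tau_lin[OF i(1) c] tau'_lin[OF i(1) c]])
    (use i c in "auto simp: tau_mult tau_inv tau_psi")
  also have "... = E *.T tt (v i a c) (v i c b)" using i c by (simp add: E_pure)
  finally show ?thesis .
 qed
 then show ?thesis using i
  by (subst T.finsum_mult_left, simp, simp, subst T.finsum_mult_right, simp, simp)
    (auto intro!: T.M.finsum_eqI)
qed

lemma comult_tk: "k : L ==> x : B ==> comult B (t k *.B x) = tt \<one>.B (t k) *.T comult B x"
 by (simp add: comult_mult comult_t E_tk T.A.m_assoc E_comult)
lemma comult_sk: "k : L ==> x : B ==> comult B (x *.B s k) = comult B x *.T tt (s k) \<one>.B"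
 by (simp add: comult_mult comult_s T.A.m_assoc[symmetric] comult_E)

text \<open>The element of the base with \<open>\<epsilon>\<^sub>s (a) = t (es a)\<close>, that is, the one representing the functional
  \<open>h \<mapsto> \<psi> (\<chi> a h)\<close>.\<close>

definition es where "es a = (\<Oplus>.L j\<in>J. \<psi> (\<chi> a (q j)) \<odot>.L p j)"

lemma es_closed [simp]: "a : B ==> es a : L"
 unfolding es_def by (auto intro!: F.L.M.finsum_closedI)

lemma eps_s_es: "a : B ==> eps_s K B a = t (es a)"
 by (simp add: eps_s_eq es_def)

lemma psi_es:
 assumes "a : B" "h : L"
 shows "\<psi> (h *.L es a) = \<psi> (\<chi> a h)"
proof -
 have "\<psi> (h *.L es a) = (\<Oplus>\<^bsub>scalars K\<^esub>j\<in>J. \<psi> (\<chi> a (q j)) *.K \<psi> (h *.L p j))"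
  unfolding es_def finsum_scalars using assms
  by (simp add: F.L.finsum_mult_left F.psi_finsum F.L.smult_mult_right F.psi_smult cong: B.R.finsum_cong)
 also have "... = (\<Oplus>\<^bsub>scalars K\<^esub>j\<in>J. \<psi> (h *.L p j) \<odot>\<^bsub>scalars K\<^esub> \<psi> (\<chi> a (q j)))"
  unfolding finsum_scalars by (rule B.R.finsum_eqI) (use assms in "auto simp: B.R.m_comm")
 also have "... = \<psi> (\<chi> a h)"
  by (rule F.dual1_lin[OF lin_comp[OF chi_lin F.psi_lin] k_algebra.axioms(1)[OF B.scalars_k_algebra]]) (use assms in auto)
 finally show ?thesis .
qed

lemma es_eqI:
 assumes "a : B" "l : L" "!!j. j : J ==> \<psi> (\<chi> a (q j)) = \<psi> (q j *.L l)"
 shows "es a = l"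
proof -
 have "es a = (\<Oplus>.L j\<in>J. \<psi> (q j *.L l) \<odot>.L p j)"
  unfolding es_def by (rule F.L.M.finsum_eqI) (use assms in auto)
 then show ?thesis using F.dual2 assms(2) by simp
qed

lemma es_es: "a : B ==> x : B ==> es (t (es a) *.B x) = es (a *.B x)"
 by (rule es_eqI) (simp_all add: chi_mult chi_t psi_es)

text \<open>For antimultiplicative \<open>S\<close>, the map \<open>Lft\<close> sending \<open>x \<otimes> y\<close> to \<open>S(x) y\<close> satisfies
  \<open>Lft (z w) = Lft ((1 \<otimes> Lft z) w)\<close>, and there is a dual rule for \<open>Rgt\<close>.  Hence the values at \<open>\<Delta>(g x)\<close> follow from
  those at \<open>\<Delta>(g)\<close> and \<open>\<Delta>(x)\<close>.  Since \<open>Lft (\<Delta> g)\<close> lies in \<open>t(L)\<close>, the claim about \<open>\<epsilon>\<^sub>s\<close> is proved for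
  all \<open>t k x\<close> simultaneously.  The twist in \<open>S (s f)\<close> is what makes \<open>E\<close> disappear under \<open>Rgt\<close>.\<close>

lemma antipode_criterion:
 assumes S_lin: "S : lin_maps K B B"
  and S_mult: "!!x y. x : B ==> y : B ==> S (x *.B y) = S y *.B S x"
  and S_s: "!!f. f : L ==> S (s f) = t (F.nak f)"
  and S_t: "!!f. f : L ==> S (t f) = s f"
  and S_v: "!!i a b. i : I ==> a : X ==> b : X ==>
    (\<Oplus>.B c\<in>X. S (v i a c) *.B v i c b) = unit_mat B a b"
  and S_v': "!!i a b. i : I ==> a : X ==> b : X ==>
    (\<Oplus>.B c\<in>X. v i a c *.B S (v i c b)) = unit_mat B a b"
 shows "is_weak_hopf_antipode K B S"
proof -
 interpret W: weak_bialgebra K B by (rule weak_bialg)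
 note Sc [simp] = lin_closed[OF S_lin]
 have S1: "S \<one>.B = \<one>.B" using S_t[of "\<one>.L"] by (simp add: t_one s_one)
 define Lft where "Lft = tensor_lift K B (%x y. S x *.B y)"
 define Rgt where "Rgt = tensor_lift K B (%x y. x *.B S y)"
 have bL: "bilin K B B B (%x y. S x *.B y)" and bR: "bilin K B B B (%x y. x *.B S y)"
  using W.conv_bilin[OF B.k_algebra_axioms S_lin B.id_lin] W.conv_bilin[OF B.k_algebra_axioms B.id_lin S_lin] by auto
 note LL = BB.tensor_lift_lin[OF bL B.md, folded Lft_def]
  and LT = BB.tensor_lift_tens[OF bL B.md, folded Lft_def]
  and RL = BB.tensor_lift_lin[OF bR B.md, folded Rgt_def]
  and RT = BB.tensor_lift_tens[OF bR B.md, folded Rgt_def]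
 note cl [simp] = lin_closed[OF LL] lin_closed[OF RL]
 let ?P = "%k x. Lft (comult B (t k *.B x)) = t (es (t k *.B x))"
 have L_mult: "Lft (z *.T w) = Lft (tt \<one>.B (Lft z) *.T w)" if z: "z : T" and w: "w : T" for z w
 proof -
  have *: "Lft (z *.T tt x y) = S x *.B (Lft z *.B y)" if xy: "x : B" "y : B" for x y
   by (rule BB.tensor_lin_eq[OF lin_comp[OF T.mult_right_lin LL]
      lin_comp[OF lin_comp[OF LL B.mult_right_lin] B.mult_left_lin] _ z])
    (use xy in "auto simp: BB.tens_mult LT S_mult B.A.m_assoc")
  show ?thesis
   by (rule BB.tensor_lin_eq[OF lin_comp[OF T.mult_left_lin LL] lin_comp[OF T.mult_left_lin LL] _ w])
    (use z in "auto simp: * BB.tens_mult LT")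
 qed
 have R_mult: "Rgt (z *.T w) = Rgt (z *.T tt (Rgt w) \<one>.B)" if z: "z : T" and w: "w : T" for z w
 proof -
  have *: "Rgt (tt x y *.T w) = (x *.B Rgt w) *.B S y" if xy: "x : B" "y : B" for x y
   by (rule BB.tensor_lin_eq[OF lin_comp[OF T.mult_left_lin RL]
      lin_comp[OF lin_comp[OF RL B.mult_left_lin] B.mult_right_lin] _ w])
    (use xy in "auto simp: BB.tens_mult RT S_mult B.A.m_assoc")
  show ?thesis
   by (rule BB.tensor_lin_eq[OF lin_comp[OF T.mult_right_lin RL] lin_comp[OF T.mult_right_lin RL] _ z])
    (use w in "auto simp: * BB.tens_mult RT S1")
 qed
 (* S turns t (p j) on the left leg into s (p j), which meets s (q j): separability. *)
 have L_E: "Lft (E *.T z) = Lft z" if z: "z : T" for z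
  unfolding Lft_def
 proof (rule lift_average[OF bL B.md bL _ z])
  fix x y assume xy: "x : B" "y : B"
  have l: "(%l. S x *.B (s l *.B y)) : lin_maps K L B"
   by (rule lin_mapsI) (use xy in "simp_all add: lins")
  have "(\<Oplus>.B j\<in>J. S (t (p j) *.B x) *.B (s (q j) *.B y)) = (\<Oplus>.B j\<in>J. S x *.B (s (p j *.L q j) *.B y))"
   by (rule B.M.finsum_eqI) (use xy in "auto simp: S_mult S_t s_mult B.A.m_assoc")
  also have "... = S x *.B y" using F.sep_lin[OF l B.md] xy by (simp add: s_one)
  finally show "(\<Oplus>.B j\<in>J. S (t (p j) *.B x) *.B (s (q j) *.B y)) = S x *.B y" .
 qed
 (* If Rgt w lies in the image of s, then E contributes the sum of all nak (q j) p j, which is the unit. *)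
 have R_E: "Rgt (E *.T w) = s l" if w: "w : T" and l: "l : L" and eq: "Rgt w = s l" for w l
 proof -
  have lin: "t : lin_maps K L B" by (rule t_lin)
  have "Rgt (E *.T w) = Rgt (E *.T tt (s l) \<one>.B)" using R_mult[OF E_closed w] eq by simp
  also have "... = (\<Oplus>.B j\<in>J. (t (p j) *.B s l) *.B S (s (q j) *.B \<one>.B))"
   unfolding Rgt_def using l by (intro lift_E_pure[OF bR B.md]) auto
  also have "... = (\<Oplus>.B j\<in>J. s l *.B t (F.nak (q j) *.L p j))"
   by (rule B.M.finsum_eqI) (use l in "auto simp: S_s ts_comm t_mult B.A.m_assoc")
  also have "... = s l *.B t (\<Oplus>.L j\<in>J. F.nak (q j) *.L p j)"
   using l by (subst lin_finsum[OF lin_comp[OF t_lin B.mult_left_lin] F.L.md B.md]) auto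
  finally show ?thesis using l by (simp add: F.nak_sep t_one)
 qed
 have L_base: "Lft (comult B g *.T comult B x) = t (es (g *.B x))"
  if g: "g : B" "Lft (comult B g) = t (es g)" and x: "x : B"
   and IH: "!!k. k : L ==> ?P k x" for g x
  using L_mult[of "comult B g" "comult B x"] g x IH[of "es g"] by (simp add: comult_tk es_es)
 have L_D: "Lft (comult B (t k *.B g)) = Lft (tt \<one>.B (t k) *.T d)"
  if "k : L" "g : B" "d : T" "comult B g = E *.T d" for k g d
  using that L_E[of "tt \<one>.B (t k) *.T d"] by (simp add: comult_tk T.A.m_assoc[symmetric] E_tk)
 have Lc: "\<forall>k\<in>carrier L. ?P k x" if "x : B" for x
  using that
 proof (rule gen)
  show "\<forall>k\<in>carrier L. ?P k \<one>.B"
  proof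
   fix k assume k: "k : L"
   have "es (t k) = k" by (rule es_eqI) (use k in "auto simp: chi_t")
   then show "?P k \<one>.B"
    using k L_E[of "tt \<one>.B (t k)"] by (simp add: comult_t LT S1)
  qed
 next
  fix x y assume xy: "x : B" "y : B" and x: "\<forall>k\<in>carrier L. ?P k x"
   and y: "\<forall>k\<in>carrier L. ?P k y"
  show "\<forall>k\<in>carrier L. ?P k (x \<oplus>.B y)"
  proof
   fix k assume k: "k : L"
   have "es (t k *.B (x \<oplus>.B y)) = es (t k *.B x) \<oplus>.L es (t k *.B y)"
    by (rule es_eqI) (use k xy in "auto simp: lins psi_es")
   then show "?P k (x \<oplus>.B y)"
    using k xy x y by (simp add: lins lin_add[OF LL])
  qed
 next
  fix c x assume xy: "c : K" "x : B" and x: "\<forall>k\<in>carrier L. ?P k x"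
  show "\<forall>k\<in>carrier L. ?P k (c \<odot>.B x)"
  proof
   fix k assume k: "k : L"
   have "es (t k *.B (c \<odot>.B x)) = c \<odot>.L es (t k *.B x)"
    by (rule es_eqI) (use k xy in "auto simp: lins psi_es")
   then show "?P k (c \<odot>.B x)"
    using k xy x by (simp add: lins lin_smult[OF LL])
  qed
 next
  fix f x assume f: "f : L" and x: "x : B"
   and IH: "\<forall>k\<in>carrier L. ?P k x"
  show "\<forall>k\<in>carrier L. ?P k (s f *.B x)"
  proof
   fix k assume k: "k : L"
   have es: "es (t k *.B s f) = k *.L F.nak f"
    by (rule es_eqI) (use k f in "auto simp: chi_mult chi_s chi_t F.L.A.m_assoc[symmetric] F.psi_nak")
   have "?P k (s f)"
    unfolding es using k f by (subst L_D[of _ _ "tt (s f) \<one>.B"]) (auto simp: comult_s BB.tens_mult LT S_s t_mult)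
   then show "?P k (s f *.B x)"
    using L_base[of "t k *.B s f" x] k f x IH by (simp add: comult_mult[symmetric] B.A.m_assoc)
  qed
  show "\<forall>k\<in>carrier L. ?P k (t f *.B x)"
  proof
   fix k assume k: "k : L"
   show "?P k (t f *.B x)"
    using IH k f x by (simp add: B.A.m_assoc[symmetric] t_mult[symmetric])
  qed
 next
  fix i a b x assume i: "i : I" "a : X" "b : X" and x: "x : B"
   and IH: "\<forall>k\<in>carrier L. ?P k x"
  show "\<forall>k\<in>carrier L. ?P k (v i a b *.B x)"
  proof
   fix k assume k: "k : L"
   have "\<psi> (\<tau> i a (q j) *.L k) = \<psi> (q j *.L \<tau>' i a k)" if "j : J" for j
    using tau_psi[of i a "q j *.L \<tau>' i a k"] i k that by (simp add: tau_mult tau_inv)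
   then have es: "es (t k *.B v i a b) = (if a = b then \<tau>' i b k else \<zero>.L)"
    by (intro es_eqI) (use k i in "auto simp: chi_mult chi_t chi_v")
   have "tt \<one>.B (t k) *.T D i a b = (\<Oplus>.T c\<in>X. tt (v i a c) (t k *.B v i c b))"
    using i k by (subst T.finsum_mult_left) (auto simp: BB.tens_mult intro!: T.M.finsum_eqI)
   then have "Lft (comult B (t k *.B v i a b)) = (\<Oplus>.B c\<in>X. S (v i a c) *.B (t k *.B v i c b))"
    using i k by (subst L_D[of _ _ "D i a b"])
     (auto simp: comult_v lin_finsum[OF LL T.md B.md] LT intro!: B.M.finsum_eqI)
   also have "... = (\<Oplus>.B c\<in>X. (S (v i a c) *.B v i c b) *.B t (\<tau>' i b k))"
    by (rule B.M.finsum_eqI) (use i k tv[of i _ b "\<tau>' i b k"] in "auto simp: B.A.m_assoc tau_inv")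
   also have "... = t (es (t k *.B v i a b))"
    unfolding es using i k S_v[OF i] lin_zero[OF t_lin F.L.md B.md]
    by (subst B.finsum_mult_right[symmetric]) auto
   finally show "?P k (v i a b *.B x)"
    using L_base[of "t k *.B v i a b" x] k i x IH by (simp add: comult_mult[symmetric] B.A.m_assoc)
  qed
 qed
 have c1: "convolution K B B S (%x. x) h = eps_s K B h" if "h : B" for h
  using Lc[OF that] that by (auto simp: convolution_def Lft_def eps_s_es t_one dest!: bspec[of _ _ "\<one>.L"])
 have R_step: "Rgt (comult B (g *.B x)) = s (\<pi> (g *.B x))"
  if g: "g : B" and d: "d : T" "comult B g = E *.T d" and x: "x : B" "Rgt (comult B x) = s (\<pi> x)"
   and eq: "Rgt (d *.T tt (s (\<pi> x)) \<one>.B) = s (\<chi> g (\<pi> x))" for g d x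
  using R_mult[of "comult B g" "comult B x"] R_E[OF _ _ eq] that by (simp add: comult_mult chi_mult T.A.m_assoc)
 have Rc: "Rgt (comult B h) = s (\<pi> h)" if "h : B" for h
  using that
 proof (rule gen)
  show "Rgt E = s (\<pi> \<one>.B)"
   using R_E[of "tt \<one>.B \<one>.B" "\<one>.L"] by (simp add: E_one RT S1 s_one chi_one)
 next
  fix f x assume f: "f : L" and x: "x : B" "Rgt (comult B x) = s (\<pi> x)"
  show "Rgt (comult B (s f *.B x)) = s (\<pi> (s f *.B x))"
   by (rule R_step[of _ "tt (s f) \<one>.B"]) (use f x in "auto simp: comult_s BB.tens_mult RT S1 chi_s s_mult")
  show "Rgt (comult B (t f *.B x)) = s (\<pi> (t f *.B x))"
   by (rule R_step[of _ "tt \<one>.B (t f)"]) (use f x in "auto simp: comult_t BB.tens_mult RT S_t chi_t s_mult")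
 next
  fix i a b x assume i: "i : I" "a : X" "b : X" and x: "x : B" "Rgt (comult B x) = s (\<pi> x)"
  have "D i a b *.T tt (s (\<pi> x)) \<one>.B = (\<Oplus>.T c\<in>X. tt (s (\<tau> i a (\<pi> x)) *.B v i a c) (v i c b))"
   using i x by (subst T.finsum_mult_right) (auto simp: BB.tens_mult sv intro!: T.M.finsum_eqI)
  then have "Rgt (D i a b *.T tt (s (\<pi> x)) \<one>.B) = (\<Oplus>.B c\<in>X. s (\<tau> i a (\<pi> x)) *.B (v i a c *.B S (v i c b)))"
   using i x by (auto simp: lin_finsum[OF RL T.md B.md] RT B.A.m_assoc intro!: B.M.finsum_eqI)
  also have "... = s (\<chi> (v i a b) (\<pi> x))"
   using i x S_v'[OF i] lin_zero[OF s_lin F.L.md B.md]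
   by (subst B.finsum_mult_left[symmetric]) (auto simp: chi_v)
  finally show "Rgt (comult B (v i a b *.B x)) = s (\<pi> (v i a b *.B x))"
   by (intro R_step[of _ "D i a b"]) (use i x in "auto simp: comult_v")
 qed (simp_all add: lins lin_add[OF RL] lin_smult[OF RL])
 have c2: "convolution K B B (%x. x) S h = eps_t K B h" if "h : B" for h
  using Rc[OF that] that by (simp add: convolution_def Rgt_def eps_t_eq)
 have c3: "convolution K B B (convolution K B B S (%x. x)) S h = S h" if h: "h : B" for h
 proof -
  have "convolution K B B (convolution K B B S (%x. x)) S h = convolution K B B S (convolution K B B (%x. x) S) h"
   by (rule W.conv_assoc[OF B.k_algebra_axioms S_lin B.id_lin S_lin h])
  also have "... = tensor_lift K B (%x y. S (t (\<pi> y) *.B x)) (comult B h)"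
   unfolding convolution_def[of _ _ _ S]
   by (rule BB.tensor_lift_cong[OF W.conv_bilin[OF B.k_algebra_axioms S_lin W.conv_lin[OF B.k_algebra_axioms B.id_lin S_lin]] B.md])
     (use h in "auto simp: c2 eps_t_eq S_mult S_t")
  also have "... = S h" by (rule Phi_lift(2)[OF S_lin B.md h])
  finally show ?thesis .
 qed
 show ?thesis unfolding is_weak_hopf_antipode_def using S_lin c1 c2 c3 by auto
qed

end

section \<open>Matrices over an algebra\<close>

context k_algebra begin

lemma kron_sum_left:
 assumes "finite X" "a : X" "!!c. c : X ==> y c : A" "e : A" "!!c. c : X ==> e *.A y c = y c"
 shows "(\<Oplus>.A c\<in>X. (if a = c then e else \<zero>.A) *.A y c) = y a"
proof -
 have "(\<Oplus>.A c\<in>X. (if a = c then e else \<zero>.A) *.A y c) = (\<Oplus>.A c\<in>X. if a = c then y c else \<zero>.A)"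
  by (rule M.finsum_eqI) (use assms in auto)
 then show ?thesis using M.finsum_delta(2)[of X y a] assms by simp
qed

lemma kron_sum_right:
 assumes "finite X" "b : X" "!!c. c : X ==> y c : A" "e : A" "!!c. c : X ==> y c *.A e = y c"
 shows "(\<Oplus>.A c\<in>X. y c *.A (if c = b then e else \<zero>.A)) = y b"
proof -
 have "(\<Oplus>.A c\<in>X. y c *.A (if c = b then e else \<zero>.A)) = (\<Oplus>.A c\<in>X. if c = b then y c else \<zero>.A)"
  by (rule M.finsum_eqI) (use assms in auto)
 then show ?thesis using M.finsum_delta(1)[of X y b] assms by simp
qed

lemma matrix_assoc:
 assumes "finite X" "!!c. c : X ==> P c : A" "!!c d. c : X ==> d : X ==> Q c d : A" "!!c. c : X ==> Z c : A"
 shows "(\<Oplus>.A d\<in>X. (\<Oplus>.A c\<in>X. P c *.A Q c d) *.A Z d) = (\<Oplus>.A c\<in>X. P c *.A (\<Oplus>.A d\<in>X. Q c d *.A Z d))"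
proof -
 have "(\<Oplus>.A d\<in>X. (\<Oplus>.A c\<in>X. P c *.A Q c d) *.A Z d) = (\<Oplus>.A d\<in>X. \<Oplus>.A c\<in>X. P c *.A (Q c d *.A Z d))"
  using assms by (intro M.finsum_eqI) (auto simp: finsum_mult_right A.m_assoc intro!: M.finsum_closedI M.finsum_eqI)
 also have "... = (\<Oplus>.A c\<in>X. \<Oplus>.A d\<in>X. P c *.A (Q c d *.A Z d))"
  using assms by (intro M.finsum_swap) auto
 also have "... = (\<Oplus>.A c\<in>X. P c *.A (\<Oplus>.A d\<in>X. Q c d *.A Z d))"
  using assms by (intro M.finsum_eqI) (auto simp: finsum_mult_left intro!: M.finsum_closedI)
 finally show ?thesis .
qed

lemma sum_mult_sum_inverse:
 assumes fin: "finite X" and cl: "!!d. d : X ==> x d : A" "!!g. g : X ==> w g : A"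
   "!!d c. d : X ==> c : X ==> y d c : A" "!!c g. c : X ==> g : X ==> z c g : A"
  and inner: "!!d g. d : X ==> g : X ==> (\<Oplus>.A c\<in>X. y d c *.A z c g) = unit_mat A d g"
 shows "(\<Oplus>.A c\<in>X. (\<Oplus>.A d\<in>X. x d *.A y d c) *.A (\<Oplus>.A g\<in>X. z c g *.A w g)) = (\<Oplus>.A d\<in>X. x d *.A w d)"
proof -
 have "(\<Oplus>.A c\<in>X. y d c *.A (\<Oplus>.A g\<in>X. z c g *.A w g)) = w d" if d: "d : X" for d
 proof -
  have "(\<Oplus>.A c\<in>X. y d c *.A (\<Oplus>.A g\<in>X. z c g *.A w g)) = (\<Oplus>.A g\<in>X. (\<Oplus>.A c\<in>X. y d c *.A z c g) *.A w g)"
   using cl d by (intro matrix_assoc[OF fin, symmetric]) auto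
  also have "... = (\<Oplus>.A g\<in>X. unit_mat A d g *.A w g)"
   using cl d inner by (intro M.finsum_eqI) auto
  also have "... = w d" by (rule kron_sum_left[OF fin d]) (use cl in auto)
  finally show ?thesis .
 qed
 then have "(\<Oplus>.A d\<in>X. x d *.A (\<Oplus>.A c\<in>X. y d c *.A (\<Oplus>.A g\<in>X. z c g *.A w g))) = (\<Oplus>.A d\<in>X. x d *.A w d)"
  using cl by (intro M.finsum_eqI) auto
 then show ?thesis
  using matrix_assoc[OF fin, of x y "%c. \<Oplus>.A g\<in>X. z c g *.A w g"] cl by (auto intro!: M.finsum_closedI)
qed

text \<open>The idempotent \<open>e\<close> allows for matrices over a corner of the algebra, whose unit it is.\<close>

context
 fixes X and U W N and e
 assumes fin: "finite X"
  and cl: "!!a b. a : X ==> b : X ==> U a b : A" "!!a b. a : X ==> b : X ==> W a b : A"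
   "!!a b. a : X ==> b : X ==> N a b : A" "e : A"
  and left: "!!a b. a : X ==> b : X ==> (\<Oplus>.A c\<in>X. W a c *.A U c b) = (if a = b then e else \<zero>.A)"
  and right: "!!a b. a : X ==> b : X ==> (\<Oplus>.A c\<in>X. U a c *.A N c b) = (if a = b then e else \<zero>.A)"
  and unit: "!!a b. a : X ==> b : X ==> W a b *.A e = W a b" "!!a b. a : X ==> b : X ==> e *.A N a b = N a b"
begin

lemma matrix_inverse_unique:
 assumes ab: "a : X" "b : X"
 shows "W a b = N a b"
proof -
 have "N a b = (\<Oplus>.A d\<in>X. (\<Oplus>.A c\<in>X. W a c *.A U c d) *.A N d b)"
  using kron_sum_left[OF fin ab(1), of "%c. N c b" e] ab cl unit by (simp add: left cong: M.finsum_cong)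
 also have "... = (\<Oplus>.A c\<in>X. W a c *.A (\<Oplus>.A d\<in>X. U c d *.A N d b))"
  using ab cl fin by (intro matrix_assoc) auto
 also have "... = W a b"
  using kron_sum_right[OF fin ab(2), of "%c. W a c" e] ab cl unit by (simp add: right cong: M.finsum_cong)
 finally show ?thesis by simp
qed

text \<open>A semilinearity relation passes to the inverse matrix by multiplying it with the inverse from both
  sides.\<close>

lemma inverse_row_commute:
 assumes ab: "a : X" "b : X" and w: "w : A" "w *.A e = w" "e *.A w = w" and u: "!!c. c : X ==> u c : A"
  and e: "u b *.A e = u b"
  and comm: "!!a b. a : X ==> b : X ==> u a *.A U a b = U a b *.A w"
 shows "w *.A N a b = W a b *.A u b"
proof -
 have "w *.A N a b = (\<Oplus>.A d\<in>X. (\<Oplus>.A c\<in>X. W a c *.A U c d) *.A (w *.A N d b))"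
  using kron_sum_left[OF fin ab(1), of "%c. w *.A N c b" e] ab cl w
  by (simp add: left A.m_assoc[symmetric] cong: M.finsum_cong)
 also have "... = (\<Oplus>.A c\<in>X. W a c *.A (\<Oplus>.A d\<in>X. U c d *.A (w *.A N d b)))"
  using ab cl fin w by (intro matrix_assoc) auto
 also have "... = (\<Oplus>.A c\<in>X. W a c *.A (u c *.A (\<Oplus>.A d\<in>X. U c d *.A N d b)))"
 proof (rule M.finsum_eqI)
  fix c assume c: "c : X"
  have "(\<Oplus>.A d\<in>X. U c d *.A (w *.A N d b)) = (\<Oplus>.A d\<in>X. u c *.A (U c d *.A N d b))"
   using ab c cl w u by (intro M.finsum_eqI) (auto simp: A.m_assoc[symmetric] comm)
  then show "W a c *.A (\<Oplus>.A d\<in>X. U c d *.A (w *.A N d b)) = W a c *.A (u c *.A (\<Oplus>.A d\<in>X. U c d *.A N d b))"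
   using ab c cl u by (simp add: finsum_mult_left)
 qed (use ab cl u in "auto intro!: M.finsum_closedI")
 also have "... = (\<Oplus>.A c\<in>X. if c = b then W a c *.A u c else \<zero>.A)"
  using ab cl u e by (intro M.finsum_eqI) (auto simp: right)
 also have "... = W a b *.A u b"
  using ab cl u fin by (subst M.finsum_delta) auto
 finally show ?thesis .
qed

lemma inverse_column_commute:
 assumes ab: "a : X" "b : X" and w: "w : A" and u: "!!c. c : X ==> u c : A"
  and we: "e *.A u a = u a" "w *.A e = w"
  and comm: "!!a b. a : X ==> b : X ==> w *.A U a b = U a b *.A u b"
 shows "u a *.A N a b = W a b *.A w"
proof -
 have "u a *.A N a b = (\<Oplus>.A d\<in>X. if a = d then u d *.A N d b else \<zero>.A)"
  using ab cl u fin by (subst M.finsum_delta) auto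
 also have "... = (\<Oplus>.A d\<in>X. (\<Oplus>.A c\<in>X. W a c *.A U c d) *.A (u d *.A N d b))"
  using ab cl u we by (intro M.finsum_eqI) (auto simp: left A.m_assoc[symmetric])
 also have "... = (\<Oplus>.A c\<in>X. W a c *.A (\<Oplus>.A d\<in>X. U c d *.A (u d *.A N d b)))"
  using ab cl fin u by (intro matrix_assoc) auto
 also have "... = (\<Oplus>.A c\<in>X. W a c *.A (w *.A (\<Oplus>.A d\<in>X. U c d *.A N d b)))"
 proof (rule M.finsum_eqI)
  fix c assume c: "c : X"
  have "(\<Oplus>.A d\<in>X. U c d *.A (u d *.A N d b)) = (\<Oplus>.A d\<in>X. w *.A (U c d *.A N d b))"
   using ab c cl w u by (intro M.finsum_eqI) (auto simp: A.m_assoc[symmetric] comm)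
  then show "W a c *.A (\<Oplus>.A d\<in>X. U c d *.A (u d *.A N d b)) = W a c *.A (w *.A (\<Oplus>.A d\<in>X. U c d *.A N d b))"
   using ab c cl w by (simp add: finsum_mult_left)
 qed (use ab cl w in "auto intro!: M.finsum_closedI")
 also have "... = (\<Oplus>.A c\<in>X. if c = b then W a c *.A w else \<zero>.A)"
  using ab cl w we by (intro M.finsum_eqI) (auto simp: right)
 also have "... = W a b *.A w"
  using ab cl w fin by (subst M.finsum_delta) auto
 finally show ?thesis .
qed

end

end

context alg_pair begin

text \<open>The inner index collapses and the product of the outer factors remains.  Hence the matrices
  \<open>\<Sum>\<^sub>c L\<^sub>a\<^sub>c \<otimes> L\<^sub>c\<^sub>b\<close> and \<open>\<Sum>\<^sub>c (L\<inverse>)\<^sub>c\<^sub>b \<otimes> (L\<inverse>)\<^sub>a\<^sub>c\<close> are mutually inverse.\<close>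

lemma tens_sum_inverse:
 assumes fin: "finite X"
 shows "[|!!d. d : X ==> u d : A \<and> n d : A;
    !!c d. c : X ==> d : X ==> U c d : B \<and> Z c d : B;
    !!d g. d : X ==> g : X ==> (\<Oplus>.B c\<in>X. U d c *.B Z c g) = unit_mat B d g|] ==>
   (\<Oplus>.T c\<in>X. (\<Oplus>.T d\<in>X. tens K A B (u d) (U d c)) *.T (\<Oplus>.T g\<in>X. tens K A B (n g) (Z c g)))
    = tens K A B (\<Oplus>.A d\<in>X. u d *.A n d) \<one>.B"
  and "[|!!d. d : X ==> u' d : B \<and> n' d : B;
    !!c d. c : X ==> d : X ==> U' c d : A \<and> Z' c d : A;
    !!d g. d : X ==> g : X ==> (\<Oplus>.A c\<in>X. U' d c *.A Z' c g) = unit_mat A d g|] ==>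
   (\<Oplus>.T c\<in>X. (\<Oplus>.T d\<in>X. tens K A B (U' d c) (u' d)) *.T (\<Oplus>.T g\<in>X. tens K A B (Z' c g) (n' g)))
    = tens K A B \<one>.A (\<Oplus>.B d\<in>X. u' d *.B n' d)"
proof -
 interpret T: k_algebra K T by (rule tensor_k_algebra)
 note l = bilin_left[OF tens_bilin] and r = bilin_right[OF tens_bilin]
 let ?a = "%a. tens K A B a \<one>.B" and ?b = "%b. tens K A B \<one>.A b"
 show "(\<Oplus>.T c\<in>X. (\<Oplus>.T d\<in>X. tens K A B (u d) (U d c)) *.T (\<Oplus>.T g\<in>X. tens K A B (n g) (Z c g)))
    = tens K A B (\<Oplus>.A d\<in>X. u d *.A n d) \<one>.B"
  if c: "!!d. d : X ==> u d : A \<and> n d : A"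
    "!!c d. c : X ==> d : X ==> U c d : B \<and> Z c d : B"
   and e: "!!d g. d : X ==> g : X ==> (\<Oplus>.B c\<in>X. U d c *.B Z c g) = unit_mat B d g" for u n U Z
 proof -
  have "(\<Oplus>.T c\<in>X. ?b (U d c) *.T ?b (Z c g)) = unit_mat T d g" if dg: "d : X" "g : X" for d g
  proof -
   have "(\<Oplus>.T c\<in>X. ?b (U d c) *.T ?b (Z c g)) = ?b (\<Oplus>.B c\<in>X. U d c *.B Z c g)"
    using c dg by (subst lin_finsum[OF r B.md T.md]) (auto simp: tens_mult intro!: T.M.finsum_eqI)
   then show ?thesis using lin_zero[OF r[OF A.A.one_closed] B.md T.md] by (simp add: e[OF dg] tens_one)
  qed
  then have "(\<Oplus>.T c\<in>X. (\<Oplus>.T d\<in>X. ?a (u d) *.T ?b (U d c)) *.T (\<Oplus>.T g\<in>X. ?b (Z c g) *.T ?a (n g)))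
    = (\<Oplus>.T d\<in>X. ?a (u d) *.T ?a (n d))"
   using c by (intro T.sum_mult_sum_inverse fin) auto
  also have "... = ?a (\<Oplus>.A d\<in>X. u d *.A n d)"
   using c by (subst lin_finsum[OF l A.md T.md]) (auto simp: tens_mult intro!: T.M.finsum_eqI)
  finally show ?thesis using c by (simp add: tens_mult cong: T.M.finsum_cong)
 qed
 show "(\<Oplus>.T c\<in>X. (\<Oplus>.T d\<in>X. tens K A B (U d c) (u d)) *.T (\<Oplus>.T g\<in>X. tens K A B (Z c g) (n g)))
    = tens K A B \<one>.A (\<Oplus>.B d\<in>X. u d *.B n d)"
  if c: "!!d. d : X ==> u d : B \<and> n d : B"
    "!!c d. c : X ==> d : X ==> U c d : A \<and> Z c d : A"
   and e: "!!d g. d : X ==> g : X ==> (\<Oplus>.A c\<in>X. U d c *.A Z c g) = unit_mat A d g" for u n U Z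
 proof -
  have "(\<Oplus>.T c\<in>X. ?a (U d c) *.T ?a (Z c g)) = unit_mat T d g" if dg: "d : X" "g : X" for d g
  proof -
   have "(\<Oplus>.T c\<in>X. ?a (U d c) *.T ?a (Z c g)) = ?a (\<Oplus>.A c\<in>X. U d c *.A Z c g)"
    using c dg by (subst lin_finsum[OF l A.md T.md]) (auto simp: tens_mult intro!: T.M.finsum_eqI)
   then show ?thesis using lin_zero[OF l[OF B.A.one_closed] A.md T.md] by (simp add: e[OF dg] tens_one)
  qed
  then have "(\<Oplus>.T c\<in>X. (\<Oplus>.T d\<in>X. ?b (u d) *.T ?a (U d c)) *.T (\<Oplus>.T g\<in>X. ?a (Z c g) *.T ?b (n g)))
    = (\<Oplus>.T d\<in>X. ?b (u d) *.T ?b (n d))"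
   using c by (intro T.sum_mult_sum_inverse fin) auto
  also have "... = ?b (\<Oplus>.B d\<in>X. u d *.B n d)"
   using c by (subst lin_finsum[OF r B.md T.md]) (auto simp: tens_mult intro!: T.M.finsum_eqI)
  finally show ?thesis using c by (simp add: tens_mult cong: T.M.finsum_cong)
 qed
qed

end

section \<open>Weak bialgebra homomorphisms\<close>

lemma
 assumes "f : alg_homs K A C"
 shows alg_hom_lin: "f : lin_maps K A C"
  and alg_hom_mult: "x : A ==> y : A ==> f (x *.A y) = f x *.C f y"
  and alg_hom_one: "f \<one>.A = \<one>.C"
 using assms by (auto simp: alg_homs_def ring_hom_def)

lemma alg_homsI:
 assumes "f : lin_maps K A C" "!!x y. x : A ==> y : A ==> f (x *.A y) = f x *.C f y" "f \<one>.A = \<one>.C"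
 shows "f : alg_homs K A C"
 using assms by (auto simp: alg_homs_def intro!: ring_hom_memI lin_closed[of f K A C] lin_add[of f K A C])

definition tensor_sq where
 "tensor_sq K C f = tensor_lift K (tensor K C C) (%x y. tens K C C (f x) (f y))"

lemma tensor_sq:
 assumes A: "k_algebra K A" and C: "k_algebra K C" and f: "f : lin_maps K A C"
 shows tensor_sq_lin: "tensor_sq K C f : lin_maps K (tensor K A A) (tensor K C C)"
  and tensor_sq_tens: "x : A ==> y : A ==> tensor_sq K C f (tens K A A x y) = tens K C C (f x) (f y)"
  and tensor_sq_mult: "(!!x y. x : A ==> y : A ==> f (x *.A y) = f x *.C f y) ==>
   z : carrier (tensor K A A) ==> w : carrier (tensor K A A) ==>
   tensor_sq K C f (z \<otimes>\<^bsub>tensor K A A\<^esub> w) = tensor_sq K C f z \<otimes>\<^bsub>tensor K C C\<^esub> tensor_sq K C f w"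
proof -
 interpret A: k_algebra K A by fact
 interpret C: k_algebra K C by fact
 interpret AA: alg_pair K A A ..
 interpret CC: alg_pair K C C ..
 interpret TC: k_algebra K "tensor K C C" by (rule CC.tensor_k_algebra)
 have b: "bilin K A A (tensor K C C) (%x y. tens K C C (f x) (f y))"
  using bilin_comp[OF CC.tens_bilin f f TC.id_lin] .
 show l: "tensor_sq K C f : lin_maps K (tensor K A A) (tensor K C C)"
  unfolding tensor_sq_def by (rule AA.tensor_lift_lin[OF b TC.md])
 show t: "tensor_sq K C f (tens K A A x y) = tens K C C (f x) (f y)" if "x : A" "y : A" for x y
  unfolding tensor_sq_def using that by (rule AA.tensor_lift_tens[OF b TC.md])
 show "tensor_sq K C f (z \<otimes>\<^bsub>tensor K A A\<^esub> w) = tensor_sq K C f z \<otimes>\<^bsub>tensor K C C\<^esub> tensor_sq K C f w"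
  if m: "!!x y. x : A ==> y : A ==> f (x *.A y) = f x *.C f y"
   and "z : carrier (tensor K A A)" "w : carrier (tensor K A A)"
  by (rule AA.lin_mult_multiplicative[OF TC.k_algebra_axioms l])
    (use that in "auto simp: t m CC.tens_mult lin_closed[OF f]")
qed

lemma in_weak_bialg_homs:
 "f : weak_bialg_homs K H B \<longleftrightarrow> f : alg_homs K H B \<and>
  (\<forall>a\<in>carrier H. comult B (f a) = tensor_sq K B f (comult H a) \<and> counit B (f a) = counit H a)"
 by (auto simp: weak_bialg_homs_def tensor_sq_def)

lemma hom_eps_t:
 assumes "weak_bialgebra K H" "weak_bialgebra K W" and f: "f : weak_bialg_homs K H W" and h: "h : H"
 shows "f (eps_t K H h) = eps_t K W (f h)"
proof -
 interpret H: weak_bialgebra K H by fact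
 interpret W: weak_bialgebra K W by fact
 note fa = f[unfolded in_weak_bialg_homs]
 have fa1: "f : alg_homs K H W" using fa by simp
 note fl = alg_hom_lin[OF fa1]
 have fm: "f (x *.H y) = f x *.W f y" if "x : H" "y : H" for x y
  by (rule alg_hom_mult[OF fa1 that])
 note fc [simp] = lin_closed[OF fl]
 note sq = tensor_sq_lin[OF H.k_algebra_axioms W.k_algebra_axioms fl]
 let ?l = "tensor_lift K W (%x y. counit W (x *.W f h) \<odot>.W y)"
 have one: "\<Delta>\<^sub>W = tensor_sq K W f (comult H \<one>.H)" if "\<Delta>\<^sub>W = comult W \<one>.W" for \<Delta>\<^sub>W
  using fa alg_hom_one[OF fa1] H.A.one_closed that by metis
 have "f (eps_t K H h) = tensor_lift K W (%x y. f (counit H (x *.H h) \<odot>.H y)) (comult H \<one>.H)"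
  unfolding eps_t_def
  by (rule H.BB.tensor_lift_comp[OF H.eps_t_bilin H.md W.md fl]) (use h in auto)
 also have "... = ?l (tensor_sq K W f (comult H \<one>.H))"
  by (rule H.BB.tensor_lift_eqI[OF bilin_comp[OF H.eps_t_bilin H.id_lin H.id_lin fl] W.md
     lin_comp[OF sq W.BB.tensor_lift_lin[OF W.eps_t_bilin W.md]]])
    (use h fa in "auto simp: tensor_sq_tens[OF H.k_algebra_axioms W.k_algebra_axioms fl]
     W.BB.tensor_lift_tens[OF W.eps_t_bilin W.md] lin_smult[OF fl] fm[symmetric]")
 also have "... = eps_t K W (f h)" using one[OF refl] by (simp add: eps_t_def)
 finally show ?thesis .
qed

context gen_bialg begin

text \<open>Compatibility with the comultiplication is multiplicative.  Compatibility with the counit is not,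
  but the stronger compatibility with \<open>\<epsilon>\<^sub>t\<close> is, since \<open>\<epsilon>\<^sub>t (a b) = \<epsilon>\<^sub>t (a \<epsilon>\<^sub>t (b))\<close>; and \<open>\<epsilon> \<circ> \<epsilon>\<^sub>t = \<epsilon>\<close>.\<close>

lemma hom_criterion:
 assumes W: "weak_bialgebra K W" and f: "f : alg_homs K B W"
  and comult_1: "comult W \<one>.W = tensor_sq K W f E"
  and comult_f: "!!g. g : L ==> comult W (f (s g)) = tensor_sq K W f (comult B (s g))"
   "!!g. g : L ==> comult W (f (t g)) = tensor_sq K W f (comult B (t g))"
   "!!i a b. i : I ==> a : X ==> b : X ==> comult W (f (v i a b)) = tensor_sq K W f (comult B (v i a b))"
  and eps_f: "!!l. l : L ==> eps_t K W (f (s l)) = f (s l)"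
   "!!g l. g : L ==> l : L ==> eps_t K W (f (t g) *.W f (s l)) = f (s (l *.L g))"
   "!!i a b l. i : I ==> a : X ==> b : X ==> l : L ==>
    eps_t K W (f (v i a b) *.W f (s l)) = f (s (\<chi> (v i a b) l))"
  and counit_f: "!!l. l : L ==> counit W (f (s l)) = \<psi> l"
 shows "f : weak_bialg_homs K B W"
proof -
 interpret W: weak_bialgebra K W by fact
 note fl = alg_hom_lin[OF f] and fm = alg_hom_mult[OF f] and f1 = alg_hom_one[OF f]
 note fc [simp] = lin_closed[OF fl]
 note sq = tensor_sq_lin[OF B.k_algebra_axioms W.k_algebra_axioms fl]
  and sqm = tensor_sq_mult[OF B.k_algebra_axioms W.k_algebra_axioms fl fm]
 have 1: "comult W (f a) = tensor_sq K W f (comult B a)" if "a : B" for a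
  using that
 proof (rule gen)
 qed (simp_all add: f1 comult_1 comult_f lins lin_add[OF fl] lin_smult[OF fl] lin_add[OF sq] lin_smult[OF sq]
   lin_add[OF W.comult_linear] lin_smult[OF W.comult_linear] fm comult_mult W.comult_mult sqm)
 have 2: "\<forall>l\<in>carrier L. eps_t K W (f a *.W f (s l)) = f (s (\<chi> a l))" if "a : B" for a
  using that
 proof (rule gen)
  have step: "\<forall>l\<in>carrier L. eps_t K W (f (g *.B x) *.W f (s l)) = f (s (\<chi> (g *.B x) l))"
   if g: "g : B" "x : B" and IH: "\<forall>l\<in>carrier L. eps_t K W (f x *.W f (s l)) = f (s (\<chi> x l))"
    and gg: "!!l. l : L ==> eps_t K W (f g *.W f (s l)) = f (s (\<chi> g l))" for g x
  proof
   fix l assume l: "l : L"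
   have "eps_t K W (f (g *.B x) *.W f (s l)) = eps_t K W (f g *.W eps_t K W (f x *.W f (s l)))"
    using g l by (simp add: fm W.A.m_assoc W.eps_t_eps_t)
   then show "eps_t K W (f (g *.B x) *.W f (s l)) = f (s (\<chi> (g *.B x) l))"
    using g l IH gg by (simp add: chi_mult)
  qed
  fix g x assume g: "g : L" "x : B" and IH: "\<forall>l\<in>carrier L. eps_t K W (f x *.W f (s l)) = f (s (\<chi> x l))"
  show "\<forall>l\<in>carrier L. eps_t K W (f (s g *.B x) *.W f (s l)) = f (s (\<chi> (s g *.B x) l))"
   by (rule step) (use g IH in "auto simp: fm[symmetric] s_mult[symmetric] chi_s eps_f")
  show "\<forall>l\<in>carrier L. eps_t K W (f (t g *.B x) *.W f (s l)) = f (s (\<chi> (t g *.B x) l))"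
   by (rule step) (use g IH in "auto simp: chi_t eps_f")
 next
  fix i a b x assume i: "i : I" "a : X" "b : X" and x: "x : B"
   and IH: "\<forall>l\<in>carrier L. eps_t K W (f x *.W f (s l)) = f (s (\<chi> x l))"
  show "\<forall>l\<in>carrier L. eps_t K W (f (v i a b *.B x) *.W f (s l)) = f (s (\<chi> (v i a b *.B x) l))"
  proof
   fix l assume l: "l : L"
   have "eps_t K W (f (v i a b *.B x) *.W f (s l)) = eps_t K W (f (v i a b) *.W eps_t K W (f x *.W f (s l)))"
    using i x l by (simp add: fm W.A.m_assoc W.eps_t_eps_t)
   then show "eps_t K W (f (v i a b *.B x) *.W f (s l)) = f (s (\<chi> (v i a b *.B x) l))"
    using i x l IH by (simp add: chi_mult eps_f)
  qed
 qed (simp_all add: f1 chi_one eps_f lins lin_add[OF fl] lin_smult[OF fl] lin_add[OF W.eps_t_lin] lin_smult[OF W.eps_t_lin]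
   W.A.l_distr W.smult_mult_left)
 have "counit W (f a) = counit B a" if a: "a : B" for a
 proof -
  have "eps_t K W (f a) = f (s (\<pi> a))" using 2[OF a] a by (auto simp: s_one f1 dest: bspec[of _ _ "\<one>.L"])
  then show ?thesis using W.counit_eps_t[of "f a"] a by (simp add: counit_f counit_eq)
 qed
 then show ?thesis using 1 f by (auto simp: in_weak_bialg_homs)
qed

end

context gen_bialg begin

lemma sq_vals:
 assumes W: "k_algebra K W" and f: "f : alg_homs K B W"
 shows sq_E: "tensor_sq K W f E = (\<Oplus>\<^bsub>tensor K W W\<^esub>j\<in>J. tens K W W (f (t (p j))) (f (s (q j))))"
  and sq_s: "g : L ==> tensor_sq K W f (comult B (s g)) = tensor_sq K W f E \<otimes>\<^bsub>tensor K W W\<^esub> tens K W W (f (s g)) \<one>.W"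
  and sq_t: "g : L ==> tensor_sq K W f (comult B (t g)) = tensor_sq K W f E \<otimes>\<^bsub>tensor K W W\<^esub> tens K W W \<one>.W (f (t g))"
  and sq_v: "i : I ==> a : X ==> b : X ==> tensor_sq K W f (comult B (v i a b))
   = tensor_sq K W f E \<otimes>\<^bsub>tensor K W W\<^esub> (\<Oplus>\<^bsub>tensor K W W\<^esub>c\<in>X. tens K W W (f (v i a c)) (f (v i c b)))"
proof -
 interpret W: k_algebra K W by fact
 interpret WW: alg_pair K W W ..
 interpret \<W>: k_algebra K "tensor K W W" by (rule WW.tensor_k_algebra)
 note fl = alg_hom_lin[OF f] and fm = alg_hom_mult[OF f] and f1 = alg_hom_one[OF f]
 note fc [simp] = lin_closed[OF fl]
 note sq = tensor_sq_lin[OF B.k_algebra_axioms W.k_algebra_axioms fl]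
  and sqt = tensor_sq_tens[OF B.k_algebra_axioms W.k_algebra_axioms fl]
  and sqm = tensor_sq_mult[OF B.k_algebra_axioms W.k_algebra_axioms fl fm]
 note fin = lin_finsum[OF sq T.md \<W>.md]
 show "tensor_sq K W f E = (\<Oplus>\<^bsub>tensor K W W\<^esub>j\<in>J. tens K W W (f (t (p j))) (f (s (q j))))"
  unfolding comult_one by (subst fin) (auto simp: sqt intro!: \<W>.M.finsum_eqI)
 show "tensor_sq K W f (comult B (s g)) = tensor_sq K W f E \<otimes>\<^bsub>tensor K W W\<^esub> tens K W W (f (s g)) \<one>.W" if "g : L"
  using that by (simp add: comult_s sqm sqt f1)
 show "tensor_sq K W f (comult B (t g)) = tensor_sq K W f E \<otimes>\<^bsub>tensor K W W\<^esub> tens K W W \<one>.W (f (t g))" if "g : L"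
  using that by (simp add: comult_t sqm sqt f1)
 show "tensor_sq K W f (comult B (v i a b))
   = tensor_sq K W f E \<otimes>\<^bsub>tensor K W W\<^esub> (\<Oplus>\<^bsub>tensor K W W\<^esub>c\<in>X. tens K W W (f (v i a c)) (f (v i c b)))"
  if i: "i : I" "a : X" "b : X"
 proof -
  have "tensor_sq K W f (D i a b) = (\<Oplus>\<^bsub>tensor K W W\<^esub>c\<in>X. tens K W W (f (v i a c)) (f (v i c b)))"
   using i by (subst fin) (auto simp: sqt intro!: \<W>.M.finsum_eqI)
  then show ?thesis using i by (simp add: comult_v sqm)
 qed
qed

lemma es_v: "i : I ==> a : X ==> b : X ==> es (v i a b) = unit_mat L a b"
 by (rule es_eqI) (auto simp: chi_v tau_psi)

lemma es_average:
 assumes x: "x : B"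
 shows "(\<Oplus>.L j\<in>J. es (x *.B s (q j)) *.L p j) = es x"
proof -
 have b: "bilin K L L L (%a b. \<psi> (\<chi> x b) \<odot>.L a)"
  by (rule bilinI) (use x in "simp_all add: lins F.L.smult_l_distr F.L.smult_r_distr F.L.smult_assoc1 F.L.smult_lcomm")
 have "(\<Oplus>.L j\<in>J. es (x *.B s (q j)) *.L p j)
  = (\<Oplus>.L j\<in>J. \<Oplus>.L i\<in>J. \<psi> (\<chi> x (q j *.L q i)) \<odot>.L (p i *.L p j))"
 proof (rule F.L.M.finsum_eqI)
  fix j assume j: "j : J"
  have "es (x *.B s (q j)) *.L p j = (\<Oplus>.L i\<in>J. \<psi> (\<chi> (x *.B s (q j)) (q i)) \<odot>.L p i *.L p j)"
   unfolding es_def using j x by (subst F.L.finsum_mult_right) auto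
  also have "... = (\<Oplus>.L i\<in>J. \<psi> (\<chi> x (q j *.L q i)) \<odot>.L (p i *.L p j))"
   by (rule F.L.M.finsum_eqI) (use j x in "auto simp: chi_mult chi_s F.L.smult_mult_left")
  finally show "es (x *.B s (q j)) *.L p j = (\<Oplus>.L i\<in>J. \<psi> (\<chi> x (q j *.L q i)) \<odot>.L (p i *.L p j))" .
 qed (use x in "auto intro!: F.L.M.finsum_closedI")
 also have "... = (\<Oplus>.L i\<in>J. \<Oplus>.L j\<in>J. \<psi> (\<chi> x (q j *.L q i)) \<odot>.L (p i *.L p j))"
  by (rule F.L.M.finsum_swap) (use x F.finJ in auto)
 also have "... = (\<Oplus>.L i\<in>J. \<psi> (\<chi> x (q i)) \<odot>.L p i)" by (rule F.idem_sum[OF b F.L.md])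
 finally show ?thesis by (simp add: es_def)
qed

end

section \<open>Homomorphisms with an antipode\<close>

locale antipode_hom = H: gen_bialg K HB L \<psi> J p q s t \<chi> I X v \<tau> \<tau>' + W: weak_bialgebra K W
 for K :: "('k, 'm) ring_scheme" and HB :: "('k, 'h) weak_bialg" and L :: "('k, 'l) module" and \<psi> and J :: "'j set" and p q
  and s t :: "'l \<Rightarrow> 'h" and \<chi> and I :: "'i set" and X :: "'x set" and v \<tau> \<tau>' and W :: "('k, 'w) weak_bialg" +
 fixes fp fm :: "'h \<Rightarrow> 'w"
 assumes fp: "fp : weak_bialg_homs K HB W" and anti: "is_antipode_of K HB W fp fm"
begin

sublocale HW: weak_bialgebra K HB by (rule H.weak_bialg)

abbreviation "\<W> \<equiv> tensor K W W"
abbreviation "tw \<equiv> tens K W W"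
abbreviation "EW \<equiv> comult W \<one>.W"
abbreviation "l i a b \<equiv> fp (v i a b)"
abbreviation "m i a b \<equiv> fm (v i a b)"
abbreviation "kr a b \<equiv> (unit_mat W a b)"

lemma fp_alg: "fp : alg_homs K HB W" using fp by (simp add: in_weak_bialg_homs)
lemmas fp_lin = alg_hom_lin[OF fp_alg] and fp_mult = alg_hom_mult[OF fp_alg] and fp_one = alg_hom_one[OF fp_alg]
lemma fm_lin: "fm : lin_maps K HB W" using anti by (simp add: is_antipode_of_def)
lemmas fpc [simp] = lin_closed[OF fp_lin] and fmc [simp] = lin_closed[OF fm_lin]
lemmas fp_zero = lin_zero[OF fp_lin H.B.md W.md]

lemma fp_comult: "a : HB ==> comult W (fp a) = tensor_sq K W fp (comult HB a)"
 and fp_counit: "a : HB ==> counit W (fp a) = counit HB a"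
 using fp by (auto simp: in_weak_bialg_homs)

lemma conv_anti:
 assumes "h : HB"
 shows "convolution K HB W fm fp h = fp (t (H.es h))" "convolution K HB W fp fm h = fp (s (\<chi> h \<one>.L))"
  "convolution K HB W (convolution K HB W fm fp) fm h = fm h"
 using anti assms by (simp_all add: is_antipode_of_def H.eps_s_es H.eps_t_eq)

lemma ft_lin: "(%y. fp (s (\<chi> y \<one>.L))) : lin_maps K HB W"
 by (rule lin_comp[OF H.chi_lin' lin_comp[OF H.s_lin fp_lin]]) auto

lemma es_lin: "(%y. fp (t (H.es y))) : lin_maps K HB W"
proof -
 have "H.es : lin_maps K HB L"
  by (rule lin_mapsI; (rule H.es_eqI)?) (auto simp: H.lins H.psi_es)
 then show ?thesis by (rule lin_comp[OF _ lin_comp[OF H.t_lin fp_lin]])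
qed

text \<open>This and the next lemma write \<open>f\<^sup>-\<close> as \<open>f\<^sup>- \<star> (f\<^sup>+ \<star> f\<^sup>-)\<close> and as \<open>(f\<^sup>- \<star> f\<^sup>+) \<star> f\<^sup>-\<close>.\<close>

lemma fm_eq1:
 assumes h: "h : HB"
 shows "fm h = tensor_lift K W (%x y. fm x *.W fp (s (\<chi> y \<one>.L))) (comult HB h)"
proof -
 have "fm h = convolution K HB W fm (convolution K HB W fp fm) h"
  using conv_anti(3)[OF h] HW.conv_assoc[OF W.k_algebra_axioms fm_lin fp_lin fm_lin h] by simp
 also have "... = tensor_lift K W (%x y. fm x *.W fp (s (\<chi> y \<one>.L))) (comult HB h)"
  unfolding convolution_def[of _ _ _ fm "convolution K HB W fp fm"]
  by (rule H.BB.tensor_lift_cong[OF HW.conv_bilin[OF W.k_algebra_axioms fm_lin HW.conv_lin[OF W.k_algebra_axioms fp_lin fm_lin]] W.md])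
    (use h in "auto simp: conv_anti")
 finally show ?thesis .
qed

lemma fm_eq2:
 assumes h: "h : HB"
 shows "fm h = tensor_lift K W (%x y. fp (t (H.es x)) *.W fm y) (comult HB h)"
proof -
 have "fm h = convolution K HB W (convolution K HB W fm fp) fm h"
  using conv_anti(3)[OF h] by simp
 also have "... = tensor_lift K W (%x y. fp (t (H.es x)) *.W fm y) (comult HB h)"
  unfolding convolution_def[of _ _ _ "convolution K HB W fm fp" fm]
  by (rule H.BB.tensor_lift_cong[OF HW.conv_bilin[OF W.k_algebra_axioms HW.conv_lin[OF W.k_algebra_axioms fm_lin fp_lin] fm_lin] W.md])
    (use h in "auto simp: conv_anti")
 finally show ?thesis .
qed

lemma fm_t_left:
 assumes k: "k : L" and h: "h : HB"
 shows "fm (t k \<otimes>\<^bsub>HB\<^esub> h) = fm h *.W fp (s k)"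
proof -
 note b = HW.conv_bilin[OF W.k_algebra_axioms fm_lin ft_lin]
 note l = H.BB.tensor_lift_lin[OF b W.md] and lt = H.BB.tensor_lift_tens[OF b W.md]
 let ?l = "tensor_lift K W (%x y. fm x *.W fp (s (\<chi> y \<one>.L)))"
 have "?l (H.tt \<one>\<^bsub>HB\<^esub> (t k) \<otimes>\<^bsub>H.T\<^esub> comult HB h) = ?l (comult HB h) *.W fp (s k)"
  by (rule H.BB.tensor_lin_eq[OF lin_comp[OF H.T.mult_left_lin l] lin_comp[OF l W.mult_right_lin]])
    (use k h in "auto simp: H.BB.tens_mult lt H.pi_t H.s_mult fp_mult W.A.m_assoc")
 then show ?thesis using fm_eq1[of "t k \<otimes>\<^bsub>HB\<^esub> h"] fm_eq1[OF h] k h by (simp add: H.comult_tk)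
qed

lemma fm_average:
 assumes h: "h : HB"
 shows "(\<Oplus>.W j\<in>J. fp (t (p j)) *.W fm (h \<otimes>\<^bsub>HB\<^esub> s (q j))) = fm h"
proof -
 note b = HW.conv_bilin[OF W.k_algebra_axioms es_lin fm_lin]
 note l = H.BB.tensor_lift_lin[OF b W.md] and lt = H.BB.tensor_lift_tens[OF b W.md]
 let ?l = "tensor_lift K W (%x y. fp (t (H.es x)) *.W fm y)"
 have "(\<Oplus>.W j\<in>J. fp (t (p j)) *.W ?l (comult HB h \<otimes>\<^bsub>H.T\<^esub> H.tt (s (q j)) \<one>\<^bsub>HB\<^esub>)) = ?l (comult HB h)"
 proof (rule H.BB.tensor_lin_eq[OF lin_finsum_fun[OF W.md lin_comp[OF lin_comp[OF H.T.mult_right_lin l] W.mult_left_lin]] l])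
  fix x y assume xy: "x : HB" "y : HB"
  have f: "(%k. fp (t k) *.W fm y) : lin_maps K L W"
   using xy by (intro lin_comp[OF lin_comp[OF H.t_lin fp_lin] W.mult_right_lin]) auto
  have "(\<Oplus>.W j\<in>J. fp (t (p j)) *.W ?l (H.tt x y \<otimes>\<^bsub>H.T\<^esub> H.tt (s (q j)) \<one>\<^bsub>HB\<^esub>))
   = (\<Oplus>.W j\<in>J. fp (t (H.es (x \<otimes>\<^bsub>HB\<^esub> s (q j)) *.L p j)) *.W fm y)"
   by (rule W.M.finsum_eqI) (use xy in "auto simp: H.BB.tens_mult lt H.t_mult fp_mult W.A.m_assoc")
  also have "... = fp (t (H.es x)) *.W fm y"
   using lin_finsum[OF f H.F.L.md W.md, of J "%j. H.es (x \<otimes>\<^bsub>HB\<^esub> s (q j)) *.L p j"] xy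
   by (simp add: H.es_average)
  finally show "(\<Oplus>.W j\<in>J. fp (t (p j)) *.W ?l (H.tt x y \<otimes>\<^bsub>H.T\<^esub> H.tt (s (q j)) \<one>\<^bsub>HB\<^esub>)) = ?l (H.tt x y)"
   using xy by (simp add: lt)
 qed (use h in auto)
 moreover have "(\<Oplus>.W j\<in>J. fp (t (p j)) *.W ?l (comult HB h \<otimes>\<^bsub>H.T\<^esub> H.tt (s (q j)) \<one>\<^bsub>HB\<^esub>))
   = (\<Oplus>.W j\<in>J. fp (t (p j)) *.W fm (h \<otimes>\<^bsub>HB\<^esub> s (q j)))"
  by (rule W.M.finsum_eqI) (use h fm_eq2[of "h \<otimes>\<^bsub>HB\<^esub> s (q _)"] in "auto simp: H.comult_sk[symmetric] fm_eq2[symmetric]")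
 ultimately show ?thesis using fm_eq2[OF h] by simp
qed

text \<open>The convolution identity at an entry of the matrix is this equation except for the factor \<open>E\<close>,
  which is absorbed because \<open>f\<^sup>-\<close> turns \<open>t\<close> on the left into \<open>f\<^sup>+ \<circ> s\<close> on the right.\<close>

lemma m_l:
 assumes i: "i : I" "a : X" "b : X"
 shows "(\<Oplus>.W c\<in>X. m i a c *.W l i c b) = kr a b"
proof -
 note b = HW.conv_bilin[OF W.k_algebra_axioms fm_lin fp_lin]
 note lin = H.BB.tensor_lift_lin[OF b W.md] and lt = H.BB.tensor_lift_tens[OF b W.md]
 let ?l = "tensor_lift K W (%x y. fm x *.W fp y)"
 have "kr a b = convolution K HB W fm fp (v i a b)"
  using i by (simp add: conv_anti H.es_v H.t_one fp_one fp_zero lin_zero[OF H.t_lin H.F.L.md H.B.md])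
 also have "... = ?l (H.E \<otimes>\<^bsub>H.T\<^esub> H.D i a b)" using i by (simp add: convolution_def H.comult_v)
 also have "... = ?l (H.D i a b)"
 proof (rule H.lift_average[OF b W.md b])
  fix x y assume xy: "x : HB" "y : HB"
  have f: "(%k. fm x *.W (fp (s k) *.W fp y)) : lin_maps K L W"
   using xy by (intro lin_comp[OF lin_comp[OF lin_comp[OF H.s_lin fp_lin] W.mult_right_lin] W.mult_left_lin]) auto
  have "(\<Oplus>.W j\<in>J. fm (t (p j) \<otimes>\<^bsub>HB\<^esub> x) *.W fp (s (q j) \<otimes>\<^bsub>HB\<^esub> y)) = (\<Oplus>.W j\<in>J. fm x *.W (fp (s (p j *.L q j)) *.W fp y))"
   by (rule W.M.finsum_eqI) (use xy in "auto simp: fm_t_left fp_mult H.s_mult W.A.m_assoc")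
  also have "... = fm x *.W fp y" using H.F.sep_lin[OF f W.md] xy by (simp add: H.s_one fp_one)
  finally show "(\<Oplus>.W j\<in>J. fm (t (p j) \<otimes>\<^bsub>HB\<^esub> x) *.W fp (s (q j) \<otimes>\<^bsub>HB\<^esub> y)) = fm x *.W fp y" .
 qed (use i in auto)
 also have "... = (\<Oplus>.W c\<in>X. m i a c *.W l i c b)"
  using i by (subst lin_finsum[OF lin H.T.md W.md]) (auto simp: lt intro!: W.M.finsum_eqI)
 finally show ?thesis by simp
qed

text \<open>Here \<open>E\<close> is first moved to the right of \<open>\<Sum> v \<otimes> v\<close>, where \<open>fm_average\<close> absorbs it.\<close>

lemma l_m:
 assumes i: "i : I" "a : X" "b : X"
 shows "(\<Oplus>.W c\<in>X. l i a c *.W m i c b) = kr a b"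
proof -
 note b = HW.conv_bilin[OF W.k_algebra_axioms fp_lin fm_lin]
 note lin = H.BB.tensor_lift_lin[OF b W.md] and lt = H.BB.tensor_lift_tens[OF b W.md]
 let ?l = "tensor_lift K W (%x y. fp x *.W fm y)"
 have tE: "?l (H.tt x y \<otimes>\<^bsub>H.T\<^esub> H.E) = fp x *.W fm y" if xy: "x : HB" "y : HB" for x y
 proof -
  have "?l (H.tt x y \<otimes>\<^bsub>H.T\<^esub> H.E) = (\<Oplus>.W j\<in>J. fp x *.W (fp (t (p j)) *.W fm (y \<otimes>\<^bsub>HB\<^esub> s (q j))))"
   unfolding H.comult_one using xy
   by (subst lin_finsum[OF lin_comp[OF H.T.mult_left_lin lin] H.T.md W.md])
     (auto simp: H.BB.tens_mult lt fp_mult W.A.m_assoc intro!: W.M.finsum_eqI)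
  also have "... = fp x *.W fm y"
   using xy by (subst W.finsum_mult_left[symmetric]) (auto simp: fm_average)
  finally show ?thesis .
 qed
 have "kr a b = convolution K HB W fp fm (v i a b)"
  using i by (simp add: conv_anti H.chi_v H.tau_one H.s_one fp_one fp_zero lin_zero[OF H.s_lin H.F.L.md H.B.md])
 also have "... = ?l (H.D i a b \<otimes>\<^bsub>H.T\<^esub> H.E)" using i by (simp add: convolution_def H.comult_v H.D_E)
 also have "... = (\<Oplus>.W c\<in>X. l i a c *.W m i c b)"
  using i by (subst lin_finsum[OF lin_comp[OF H.T.mult_right_lin lin] H.T.md W.md])
   (auto simp: tE intro!: W.M.finsum_eqI)
 finally show ?thesis by simp
qed

lemma EW_eq: "EW = tensor_sq K W fp H.E"
 using fp_comult[of "\<one>\<^bsub>HB\<^esub>"] by (simp add: fp_one)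

lemmas sqs = H.sq_vals[OF W.k_algebra_axioms fp_alg, folded EW_eq]

lemma comult_l: "i : I ==> a : X ==> b : X ==> comult W (l i a b) = EW *.\<W> (\<Oplus>.\<W> c\<in>X. tw (l i a c) (l i c b))"
 by (simp add: fp_comult sqs)

lemma EW_idem: "x : W ==> EW *.\<W> comult W x = comult W x" "x : W ==> comult W x *.\<W> EW = comult W x"
 using W.comult_mult[of "\<one>.W" x] W.comult_mult[of x "\<one>.W"] by simp_all

lemma kr_comult: "comult W (kr a b) = (if a = b then EW else \<zero>.\<W>)"
 using lin_zero[OF W.comult_linear W.md W.T.md] by simp

text \<open>In the corner \<open>\<Delta>(1) (B \<otimes> B) \<Delta>(1)\<close> the matrix \<open>\<Delta>(l)\<close> has the inverse \<open>\<Delta>(m)\<close>; so it suffices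
 that the right-hand side is an inverse as well.\<close>

lemma comult_m:
 assumes i: "i : I" and ab: "a : X" "b : X"
 shows "comult W (m i a b) = EW *.\<W> (\<Oplus>.\<W> c\<in>X. tw (m i c b) (m i a c))"
proof (rule W.T.matrix_inverse_unique[where U = "%a b. comult W (l i a b)" and W = "%a b. comult W (m i a b)" and e = EW,
   OF H.finX _ _ _ _ _ _ _ _ ab])
 let ?Q = "%a b. \<Oplus>.\<W> c\<in>X. tw (m i c b) (m i a c)"
 let ?V = "%a b. \<Oplus>.\<W> c\<in>X. tw (l i a c) (l i c b)"
 have Q [simp]: "?Q a b : \<W>" if "a : X" "b : X" for a b
  using i that by (auto intro!: W.T.M.finsum_closedI)
 have V [simp]: "?V a b : \<W>" if "a : X" "b : X" for a b
  using i that by (auto intro!: W.T.M.finsum_closedI)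
 show "EW : \<W>" by simp
 fix a b assume ab: "a : X" "b : X"
 show "comult W (l i a b) : \<W>" "comult W (m i a b) : \<W>"
  using i ab by auto
 show "EW *.\<W> ?Q a b : \<W>" using ab by simp
 show "comult W (m i a b) *.\<W> EW = comult W (m i a b)" using i ab by (simp add: EW_idem)
 show "EW *.\<W> (EW *.\<W> ?Q a b) = EW *.\<W> ?Q a b" using ab EW_idem(1)[of "\<one>.W"]
  by (simp add: W.T.A.m_assoc[symmetric])
 have "(\<Oplus>.\<W> c\<in>X. comult W (m i a c) *.\<W> comult W (l i c b)) = comult W (\<Oplus>.W c\<in>X. m i a c *.W l i c b)"
  using i ab by (subst lin_finsum[OF W.comult_linear W.md W.T.md])
   (auto simp: W.comult_mult intro!: W.T.M.finsum_eqI)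
 then show "(\<Oplus>.\<W> c\<in>X. comult W (m i a c) *.\<W> comult W (l i c b)) = (if a = b then EW else \<zero>.\<W>)"
  by (simp only: m_l[OF i ab] kr_comult)
 have VQ: "(\<Oplus>.\<W> c\<in>X. ?V a c *.\<W> ?Q c b) = unit_mat \<W> a b"
  using i ab l_m[OF i] lin_zero[OF bilin_left[OF W.BB.tens_bilin] W.md W.T.md]
  by (subst W.BB.tens_sum_inverse(1)[OF H.finX]) (auto simp: W.BB.tens_one)
 have "(\<Oplus>.\<W> c\<in>X. comult W (l i a c) *.\<W> (EW *.\<W> ?Q c b)) = (\<Oplus>.\<W> c\<in>X. EW *.\<W> (?V a c *.\<W> ?Q c b))"
 proof (rule W.T.M.finsum_eqI)
  fix c assume c: "c : X"
  have "comult W (l i a c) *.\<W> (EW *.\<W> ?Q c b) = comult W (l i a c) *.\<W> ?Q c b"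
   using i ab c by (simp add: W.T.A.m_assoc[symmetric] EW_idem)
  then show "comult W (l i a c) *.\<W> (EW *.\<W> ?Q c b) = EW *.\<W> (?V a c *.\<W> ?Q c b)"
   using i ab c by (simp add: comult_l W.T.A.m_assoc)
 qed (use ab in auto)
 also have "... = EW *.\<W> (\<Oplus>.\<W> c\<in>X. ?V a c *.\<W> ?Q c b)"
  using ab by (subst W.T.finsum_mult_left) auto
 finally show "(\<Oplus>.\<W> c\<in>X. comult W (l i a c) *.\<W> (EW *.\<W> ?Q c b)) = (if a = b then EW else \<zero>.\<W>)"
  unfolding VQ by simp
qed

lemma fp_eps_t: "h : HB ==> eps_t K W (fp h) = fp (s (\<chi> h \<one>.L))"
 using hom_eps_t[OF H.weak_bialg W.weak_bialgebra_axioms fp] by (simp add: H.eps_t_eq)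

lemma eps_t_m:
 assumes i: "i : I" and ab: "a : X" "b : X" and k: "k : L"
 shows "eps_t K W (m i a b *.W fp (s k)) = (if a = b then fp (s (\<tau>' i b k)) else \<zero>.W)"
proof -
 let ?k = "\<tau>' i b k"
 have kc: "?k : L" using i ab k by simp
 have z: "eps_t K W \<zero>.W = \<zero>.W" by (rule lin_zero[OF W.eps_t_lin W.md W.md])
 have sz: "fp (s \<zero>.L) = \<zero>.W" by (simp add: lin_zero[OF H.s_lin H.F.L.md H.B.md] fp_zero)
 have lk: "eps_t K W (l i c b *.W fp (s ?k)) = (if c = b then fp (s k) else \<zero>.W)" if c: "c : X" for c
  using fp_eps_t[of "v i c b \<otimes>\<^bsub>HB\<^esub> s ?k"] i ab c k by (simp add: fp_mult H.pi_s_right H.chi_v H.tau_inv sz)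
 have "(if a = b then fp (s ?k) else \<zero>.W) = eps_t K W (kr a b *.W fp (s ?k))"
  using kc fp_eps_t[of "s ?k"] by (simp add: z H.chi_s)
 also have "kr a b *.W fp (s ?k) = (\<Oplus>.W c\<in>X. m i a c *.W (l i c b *.W fp (s ?k)))"
  unfolding m_l[OF i ab, symmetric] using i ab kc
  by (subst W.finsum_mult_right) (auto simp: W.A.m_assoc intro!: W.M.finsum_eqI)
 also have "eps_t K W ... = (\<Oplus>.W c\<in>X. eps_t K W (m i a c *.W (l i c b *.W fp (s ?k))))"
  by (rule lin_finsum[OF W.eps_t_lin W.md W.md]) (use i ab kc in auto)
 also have "... = (\<Oplus>.W c\<in>X. if c = b then eps_t K W (m i a c *.W fp (s k)) else \<zero>.W)"
 proof (rule W.M.finsum_eqI)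
  fix c assume c: "c : X"
  have "eps_t K W (m i a c *.W (l i c b *.W fp (s ?k))) = eps_t K W (m i a c *.W eps_t K W (l i c b *.W fp (s ?k)))"
   using i ab kc c by (simp add: W.eps_t_eps_t)
  then show "eps_t K W (m i a c *.W (l i c b *.W fp (s ?k))) = (if c = b then eps_t K W (m i a c *.W fp (s k)) else \<zero>.W)"
   using i ab c by (simp add: lk z)
 qed (use i ab k in auto)
 also have "... = eps_t K W (m i a b *.W fp (s k))"
  using i ab k H.finX by (subst W.M.finsum_delta) auto
 finally show ?thesis by simp
qed

end

section \<open>Localisation at a matrix coalgebra\<close>

text \<open>The second algebra has the matrix of the first one and its transposed inverse.\<close>

locale localisation = H: gen_bialg K HB L \<psi> J p q sH tH \<chi>H "{True}" X vH \<tau> \<tau>' + C: gen_bialg K CB L \<psi> J p q sC tC \<chi>C "UNIV :: bool set" X vC \<tau> \<tau>'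
 for K :: "('k, 'm) ring_scheme" and HB :: "('k, 'h) weak_bialg" and CB :: "('k, 'c) weak_bialg" and L :: "('k, 'l) module" and \<psi> and J :: "'j set" and p q
  and sH tH :: "'l \<Rightarrow> 'h" and \<chi>H and sC tC :: "'l \<Rightarrow> 'c" and \<chi>C and X :: "'x set" and vH vC \<tau> \<tau>' +
 fixes \<Phi>
 assumes inv1: "!!a b. a : X ==> b : X ==> (\<Oplus>\<^bsub>CB\<^esub>c\<in>X. vC True a c \<otimes>\<^bsub>CB\<^esub> vC False b c) = (if a = b then \<one>\<^bsub>CB\<^esub> else \<zero>\<^bsub>CB\<^esub>)"
  and inv2: "!!a b. a : X ==> b : X ==> (\<Oplus>\<^bsub>CB\<^esub>c\<in>X. vC False c a \<otimes>\<^bsub>CB\<^esub> vC True c b) = (if a = b then \<one>\<^bsub>CB\<^esub> else \<zero>\<^bsub>CB\<^esub>)"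
  and tauF: "!!a f. a : X ==> f : L ==> \<tau> False a f = \<tau>' True a f"
  and Phi_alg: "\<Phi> : alg_homs K HB CB"
  and Phi_s: "!!f. f : L ==> \<Phi> (sH f) = sC f"
  and Phi_t: "!!f. f : L ==> \<Phi> (tH f) = tC f"
  and Phi_v: "!!a b. a : X ==> b : X ==> \<Phi> (vH True a b) = vC True a b"
begin

lemma Phi_hom: "\<Phi> : weak_bialg_homs K HB CB"
proof -
 interpret CW: weak_bialgebra K CB by (rule C.weak_bialg)
 note sq = H.sq_vals[OF C.B.k_algebra_axioms Phi_alg]
 have E: "tensor_sq K CB \<Phi> H.E = C.E"
  unfolding sq C.comult_one by (rule C.T.M.finsum_eqI) (auto simp: Phi_s Phi_t)
 show ?thesis
 proof (rule H.hom_criterion[OF C.weak_bialg Phi_alg])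
  show "comult CB (\<Phi> (vH i a b)) = tensor_sq K CB \<Phi> (comult HB (vH i a b))" if "i : {True}" "a : X" "b : X" for i a b
   using that by (auto simp: sq(4) E Phi_v C.comult_v intro!: arg_cong2[where f = "mult C.T"] C.T.M.finsum_eqI)
 qed (auto simp: sq(2,3) E Phi_s Phi_t Phi_v C.comult_s C.comult_t C.eps_t_eq C.chi_s C.chi_t C.chi_v H.chi_v C.pi_s_right C.counit_eq)
qed

lemma universal:
 fixes W :: "('k, 'w) weak_bialg"
 assumes W: "weak_bialgebra K W" and fp: "fp : weak_bialg_homs K HB W" and anti: "is_antipode_of K HB W fp fm"
  and F: "F : alg_homs K CB W"
  and F_s: "!!f. f : L ==> F (sC f) = fp (sH f)"
  and F_t: "!!f. f : L ==> F (tC f) = fp (tH f)"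
  and F_v: "!!a b. a : X ==> b : X ==> F (vC True a b) = fp (vH True a b)"
  and F_v': "!!a b. a : X ==> b : X ==> F (vC False b a) = fm (vH True a b)"
 shows "F : weak_bialg_homs K CB W" and "h : HB ==> F (\<Phi> h) = fp h"
proof -
 interpret antipode_hom K HB L \<psi> J p q sH tH \<chi>H "{True}" X vH \<tau> \<tau>' W fp fm
  by (intro antipode_hom.intro antipode_hom_axioms.intro H.gen_bialg_axioms W fp anti)
 note sq = C.sq_vals[OF W.k_algebra_axioms F]
 have E: "tensor_sq K W F C.E = EW"
  unfolding sq(1) sqs(1) by (rule W.T.M.finsum_eqI) (auto simp: F_s F_t)
 have sz: "F (sC \<zero>.L) = \<zero>.W"
  using F_s[of "\<zero>.L"] by (simp add: lin_zero[OF H.s_lin H.F.L.md H.B.md] fp_zero)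
 show "F : weak_bialg_homs K CB W"
 proof (rule C.hom_criterion[OF W F])
  fix i a b assume ab: "a : X" "b : X"
  show "comult W (F (vC i a b)) = tensor_sq K W F (comult CB (vC i a b))"
  proof (cases i)
   case True
   then show ?thesis using ab
    by (auto simp: sq(4) E F_v comult_l intro!: arg_cong2[where f = "mult \<W>"] W.T.M.finsum_eqI)
  next
   case False
   then show ?thesis using ab
    by (auto simp: sq(4) E F_v' comult_m intro!: arg_cong2[where f = "mult \<W>"] W.T.M.finsum_eqI)
  qed
  fix k assume k: "k : L"
  show "eps_t K W (F (vC i a b) *.W F (sC k)) = F (sC (\<chi>C (vC i a b) k))"
  proof (cases i)
   case True
   then show ?thesis using ab k fp_eps_t[of "vH True a b \<otimes>\<^bsub>HB\<^esub> sH k"]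
    by (auto simp: F_v F_s C.chi_v H.chi_v fp_mult H.pi_s_right)
  next
   case False
   then show ?thesis using ab k sz by (auto simp: F_v' F_s C.chi_v eps_t_m tauF)
  qed
 next
  fix g k assume "g : L" "k : L"
  then show "eps_t K W (F (tC g) *.W F (sC k)) = F (sC (k *.L g))"
   using fp_eps_t[of "tH g \<otimes>\<^bsub>HB\<^esub> sH k"] by (simp add: F_t F_s fp_mult H.pi_s_right H.chi_t)
 next
  fix k assume "k : L"
  then show "eps_t K W (F (sC k)) = F (sC k)" "counit W (F (sC k)) = \<psi> k"
   "comult W (F (sC k)) = tensor_sq K W F (comult CB (sC k))" "comult W (F (tC k)) = tensor_sq K W F (comult CB (tC k))"
   using fp_eps_t[of "sH k"]
   by (simp_all add: F_s F_t H.chi_s fp_counit H.counit_eq fp_comult sq(2,3) sqs(2,3) E)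
 qed (simp add: E)
 note Fl = alg_hom_lin[OF F] and Pl = alg_hom_lin[OF Phi_alg]
 note Pc [simp] = lin_closed[OF Pl]
 show "F (\<Phi> h) = fp h" if "h : HB"
  using that
 proof (rule H.gen)
 qed (auto simp: alg_hom_one[OF F] alg_hom_one[OF Phi_alg] fp_one lin_add[OF Fl] lin_add[OF Pl] lin_add[OF fp_lin]
   lin_smult[OF Fl] lin_smult[OF Pl] lin_smult[OF fp_lin] alg_hom_mult[OF F] alg_hom_mult[OF Phi_alg] fp_mult
   Phi_s Phi_t Phi_v F_s F_t F_v)
qed

text \<open>The values on the inverse matrix are forced, since inverse matrices are unique.\<close>

lemma universal_unique:
 assumes W: "k_algebra K W" and F: "F : alg_homs K CB W" and G: "G : alg_homs K CB W"
  and eq: "!!h. h : HB ==> F (\<Phi> h) = G (\<Phi> h)" and c: "c : CB"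
 shows "F c = G c"
proof -
 interpret W: k_algebra K W by fact
 note Fl = alg_hom_lin[OF F] and Gl = alg_hom_lin[OF G]
 note Fc [simp] = lin_closed[OF Fl] lin_closed[OF Gl]
 have s: "F (sC f) = G (sC f)" "F (tC f) = G (tC f)" if "f : L" for f
  using eq[of "sH f"] eq[of "tH f"] that by (simp_all add: Phi_s Phi_t)
 have v: "F (vC True a b) = G (vC True a b)" if "a : X" "b : X" for a b
  using eq[of "vH True a b"] that by (simp add: Phi_v)
 have inv: "(\<Oplus>.W c\<in>X. F' (vC True a c) *.W F' (vC False b c)) = unit_mat W a b"
  "(\<Oplus>.W c\<in>X. F' (vC False c a) *.W F' (vC True c b)) = unit_mat W a b"
  if F': "F' : alg_homs K CB W" and ab: "a : X" "b : X" for F' a b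
 proof -
  note F'l = alg_hom_lin[OF F'] and F'm = alg_hom_mult[OF F']
  note fin = lin_finsum[OF F'l C.B.md W.md] and z = lin_zero[OF F'l C.B.md W.md]
  have "(\<Oplus>.W c\<in>X. F' (vC True a c) *.W F' (vC False b c)) = F' (\<Oplus>\<^bsub>CB\<^esub>c\<in>X. vC True a c \<otimes>\<^bsub>CB\<^esub> vC False b c)"
   using ab by (subst fin) (auto simp: F'm lin_closed[OF F'l] intro!: W.M.finsum_eqI)
  then show "(\<Oplus>.W c\<in>X. F' (vC True a c) *.W F' (vC False b c)) = unit_mat W a b"
   using inv1[OF ab] alg_hom_one[OF F'] z by simp
  have "(\<Oplus>.W c\<in>X. F' (vC False c a) *.W F' (vC True c b)) = F' (\<Oplus>\<^bsub>CB\<^esub>c\<in>X. vC False c a \<otimes>\<^bsub>CB\<^esub> vC True c b)"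
   using ab by (subst fin) (auto simp: F'm lin_closed[OF F'l] intro!: W.M.finsum_eqI)
  then show "(\<Oplus>.W c\<in>X. F' (vC False c a) *.W F' (vC True c b)) = unit_mat W a b"
   using inv2[OF ab] alg_hom_one[OF F'] z by simp
 qed
 have FG: "(\<Oplus>.W c\<in>X. F (vC True a c) *.W G (vC False b c)) = unit_mat W a b"
  if ab: "a : X" "b : X" for a b
  by (rule trans[OF W.M.finsum_eqI inv(1)[OF G ab]]) (use ab v in auto)
 have v': "F (vC False b a) = G (vC False b a)" if ab: "a : X" "b : X" for a b
  by (rule W.matrix_inverse_unique[where W = "%a b. F (vC False b a)" and N = "%a b. G (vC False b a)"
     and U = "%a b. F (vC True a b)" and e = "\<one>.W", OF C.finX _ _ _ _ _ _ _ _ ab])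
    (use inv[OF F] FG in simp_all)
 show ?thesis using c
 proof (rule C.gen)
  fix i a b x assume "a : X" "b : X" "x : CB" "F x = G x"
  then show "F (vC i a b \<otimes>\<^bsub>CB\<^esub> x) = G (vC i a b \<otimes>\<^bsub>CB\<^esub> x)"
   using v[of a b] v'[of b a] by (cases i) (auto simp: alg_hom_mult[OF F] alg_hom_mult[OF G])
 qed (auto simp: alg_hom_one[OF F] alg_hom_one[OF G] lin_add[OF Fl] lin_add[OF Gl] lin_smult[OF Fl] lin_smult[OF Gl]
   alg_hom_mult[OF F] alg_hom_mult[OF G] s)
qed

end

section \<open>From left bialgebroids to weak bialgebras\<close>

lemma lin_maps_ext:
 assumes "carrier A' = carrier A" "add A' = add A" "smult A' = smult A"
 shows "lin_maps K A' V = lin_maps K A V" "lin_maps K V A' = lin_maps K V A"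
 unfolding lin_maps_def using assms by auto

lemma a_minus_ext:
 assumes "carrier A' = carrier A" "add A' = add A" "zero A' = zero A"
 shows "a_minus A' = a_minus A" "finsum A' = finsum A"
 unfolding a_minus_def[abs_def] a_inv_def[abs_def] m_inv_def finsum_def finprod_def[abs_def] foldD_def foldSetD_def using assms
 by (simp_all cong: if_cong)

lemma k_algebra_ext:
 assumes A: "k_algebra K A" and "carrier A' = carrier A" "add A' = add A" "smult A' = smult A" "mult A' = mult A"
  "one A' = one A" "zero A' = zero A"
 shows "k_algebra K A'"
proof -
 interpret A: k_algebra K A by fact
 show ?thesis
 proof (rule A.k_algebraI)
  show "module K A'"
  proof (rule moduleI)
   show "abelian_group A'"
    by (rule abelian_groupI) (use assms(2-) in \<open>auto simp: A.M.a_ac intro: A.M.l_neg bexI[of _ "\<ominus>.A _"]\<close>)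
  qed (use assms(2-) in "auto simp: A.smult_l_distr A.smult_r_distr A.smult_assoc1 A.R.is_cring")
  show "bilin K A' A' A' (mult A')"
   by (rule bilinI) (use assms(2-) in "auto simp: A.A.r_distr A.A.l_distr A.smult_mult_left A.smult_mult_right")
 qed (use assms(2-) in "auto simp: A.A.m_assoc")
qed

lemma tensor_ext:
 assumes "carrier A' = carrier A" "add A' = add A" "smult A' = smult A" "mult A' = mult A" "one A' = one A"
 shows "tensor K A' A' = tensor K A A" "tens K A' A' = tens K A A"
proof -
 have p: "pair_alg K A' A' = pair_alg K A A" using assms by (simp add: pair_alg_def)
 have b: "bilin_rels K A' A' = bilin_rels K A A" unfolding bilin_rels_def p using assms by simp
 show "tensor K A' A' = tensor K A A" "tens K A' A' = tens K A A"
  by (simp_all add: tensor_def tens_def[abs_def] p b)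
qed

locale base_maps = B: k_algebra K B + F: frob_sys K L \<psi> J p q
 for K :: "('k, 'm) ring_scheme" and B :: "('k, 'b, 'y) module_scheme" and L :: "('k, 'l, 'z) module_scheme" and \<psi> and J :: "'j set" and p q +
 fixes s t :: "'l \<Rightarrow> 'b"
 assumes s_lin: "s : lin_maps K L B" and t_lin: "t : lin_maps K L B"
  and s_mult: "!!f g. f : L ==> g : L ==> s (f *.L g) = s f *.B s g"
  and t_mult: "!!f g. f : L ==> g : L ==> t (f *.L g) = t g *.B t f"
  and s_one: "s \<one>.L = \<one>.B" and t_one: "t \<one>.L = \<one>.B"
  and ts_comm: "!!f g. f : L ==> g : L ==> t g *.B s f = s f *.B t g"
begin

abbreviation "T \<equiv> tensor K B B"
abbreviation "tt \<equiv> tens K B B"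

sublocale BB: alg_pair K B B ..
sublocale T: k_algebra K T by (rule BB.tensor_k_algebra)

lemmas sc [simp] = lin_closed[OF s_lin] and tc [simp] = lin_closed[OF t_lin]
lemmas pq_closed [simp] = F.pc F.qc
lemmas lins = lin_add[OF s_lin] lin_add[OF t_lin] lin_smult[OF s_lin] lin_smult[OF t_lin]
 lin_add[OF bilin_left[OF BB.tens_bilin]] lin_add[OF bilin_right[OF BB.tens_bilin]]
 lin_smult[OF bilin_left[OF BB.tens_bilin]] lin_smult[OF bilin_right[OF BB.tens_bilin]]
 B.A.l_distr B.A.r_distr B.smult_mult_left B.smult_mult_right B.smult_r_distr
 T.A.l_distr T.A.r_distr T.smult_mult_left T.smult_mult_right T.smult_r_distr
 F.L.A.l_distr F.L.A.r_distr F.L.smult_mult_left F.L.smult_mult_right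

definition E where "E = (\<Oplus>.T j\<in>J. tt (t (p j)) (s (q j)))"

lemma E_closed [simp]: "E : T" unfolding E_def by (rule T.M.finsum_closedI) auto

lemma E_pure:
 assumes "x : B" "y : B"
 shows "E *.T tt x y = (\<Oplus>.T j\<in>J. tt (t (p j) *.B x) (s (q j) *.B y))"
 unfolding E_def using assms
 by (subst T.finsum_mult_right) (auto simp: BB.tens_mult intro!: T.M.finsum_eqI)

lemma pure_E:
 assumes "x : B" "y : B"
 shows "tt x y *.T E = (\<Oplus>.T j\<in>J. tt (x *.B t (p j)) (y *.B s (q j)))"
 unfolding E_def using assms
 by (subst T.finsum_mult_left) (auto simp: BB.tens_mult intro!: T.M.finsum_eqI)

text \<open>By the Casimir property \<open>E\<close> does not distinguish \<open>t f\<close> on the left leg from \<open>s f\<close> on the right leg.\<close>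

lemma E_balance:
 assumes f: "f : L" and xy: "x : B" "y : B"
 shows "E *.T tt (t f *.B x) y = E *.T tt x (s f *.B y)"
proof -
 have b: "bilin K L L T (%g h. tt (t g *.B x) (s h *.B y))"
  by (rule bilinI) (use xy in "simp_all add: lins")
 have "E *.T tt (t f *.B x) y = (\<Oplus>.T j\<in>J. tt (t (f *.L p j) *.B x) (s (q j) *.B y))"
  using f xy by (subst E_pure) (auto simp: t_mult B.A.m_assoc intro!: T.M.finsum_eqI)
 also have "... = (\<Oplus>.T j\<in>J. tt (t (p j) *.B x) (s (q j *.L f) *.B y))"
  by (rule F.casimir[OF b T.md f])
 also have "... = E *.T tt x (s f *.B y)"
  using f xy by (subst E_pure) (auto simp: s_mult B.A.m_assoc intro!: T.M.finsum_eqI)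
 finally show ?thesis .
qed

lemma E_idem: "E *.T E = E"
proof -
 have b: "bilin K L L T (%g h. tt (t g) (s h))"
  by (rule bilinI) (simp_all add: lins)
 have "E *.T E = (\<Oplus>.T i\<in>J. \<Oplus>.T j\<in>J. tt (t (p j *.L p i)) (s (q i *.L q j)))"
  unfolding E_def by (subst T.finsum_mult_finsum)
   (auto simp: BB.tens_mult s_mult t_mult intro!: T.M.finsum_eqI T.M.finsum_closedI)
 also have "... = (\<Oplus>.T j\<in>J. \<Oplus>.T i\<in>J. tt (t (p j *.L p i)) (s (q i *.L q j)))"
  by (rule T.M.finsum_swap) (auto simp: F.finJ)
 also have "... = E" unfolding E_def by (rule F.idem_sum[OF b T.md])
 finally show ?thesis .
qed

text \<open>Moving \<open>x \<otimes> y\<close> past \<open>E\<close> applies \<open>\<tau>\<close> to both legs of the Frobenius element, which is invariant.\<close>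

lemma E_comm_twist:
 assumes xy: "x : B" "y : B" and \<tau>: "\<tau> : lin_maps K L L" "\<tau>' : lin_maps K L L"
  and mult: "!!f g. f : L ==> g : L ==> \<tau> (f *.L g) = \<tau> f *.L \<tau> g"
  and inv: "!!f. f : L ==> \<tau> (\<tau>' f) = f"
  and psi: "!!f. f : L ==> \<psi> (\<tau> f) = \<psi> f"
  and tx: "!!f. f : L ==> t (\<tau> f) *.B x = x *.B t f"
  and sy: "!!f. f : L ==> s (\<tau> f) *.B y = y *.B s f"
 shows "tt x y *.T E = E *.T tt x y"
proof -
 have b: "bilin K L L T (%g h. tt (t g *.B x) (s h *.B y))"
  by (rule bilinI) (use xy in "simp_all add: lins")
 have "tt x y *.T E = (\<Oplus>.T j\<in>J. tt (t (\<tau> (p j)) *.B x) (s (\<tau> (q j)) *.B y))"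
  unfolding pure_E[OF xy] by (rule T.M.finsum_eqI) (use xy lin_closed[OF \<tau>(1)] in "auto simp: tx sy")
 also have "... = E *.T tt x y"
  unfolding E_pure[OF xy] by (rule F.invariant[OF b T.md \<tau> mult inv psi])
 finally show ?thesis .
qed

lemma E_comm_st:
 assumes "f : L" "g : L"
 shows "tt (s f) (t g) *.T E = E *.T tt (s f) (t g)"
 by (rule E_comm_twist[OF _ _ F.L.id_lin F.L.id_lin]) (use assms in "auto simp: ts_comm")

text \<open>The balanced tensor product \<open>B \<otimes>\<^sub>L B\<close> is the quotient of \<open>B \<otimes> B\<close> by the kernel of
 multiplication by the idempotent \<open>E\<close>: separability turns \<open>z - E z\<close> into a balancing relation.\<close>

abbreviation "N \<equiv> balancing_rels K B L s t"

lemma N_gens: "{tt (t l *.B a) b \<ominus>.T tt a (s l *.B b) | l a b. l : L \<and> a : B \<and> b : B} \<subseteq> carrier T"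
 by auto

lemma N_submodule: "submodule N K T"
 unfolding balancing_rels_def by (rule T.submod_gen_submodule[OF N_gens])

sublocale N: quotient_module K T N
 by (intro quotient_module.intro T.md N_submodule)

lemma N_kill: "z : N ==> E *.T z = \<zero>.T"
proof -
 have "N \<subseteq> {z \<in> T. E *.T z = \<zero>.T}"
  unfolding balancing_rels_def
 proof (rule submod_gen_minimal[OF submodule_kernel[OF T.mult_left_lin[OF E_closed] T.md T.md]], rule subsetI)
  fix z assume "z : {tt (t l *.B a) b \<ominus>.T tt a (s l *.B b) | l a b. l : L \<and> a : B \<and> b : B}"
  then obtain l a b where z: "z = tt (t l *.B a) b \<ominus>.T tt a (s l *.B b)"
   and lab: "l : L" "a : B" "b : B" by blast
  then have "E *.T z = \<zero>.T"
   using lin_minus[OF T.mult_left_lin[OF E_closed] T.md T.md]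
   by (simp add: T.M.minus_zero_iff E_balance)
  then show "z : {z \<in> T. E *.T z = \<zero>.T}" using z lab by simp
 qed
 then show "z : N ==> E *.T z = \<zero>.T" by blast
qed

lemma N_balance: "l : L ==> a : B ==> b : B ==> N.cls (tt (t l *.B a) b) = N.cls (tt a (s l *.B b))"
 using N.cls_eq_iff[of "tt (t l *.B a) b" "tt a (s l *.B b)"] submod_gen_incl[of _ K T]
 unfolding balancing_rels_def by (auto intro!: subsetD[OF submod_gen_incl])

lemma N_E: "z : T ==> N.cls (E *.T z) = N.cls z"
proof (rule BB.tensor_lin_eq[OF lin_comp[OF T.mult_left_lin N.cls_lin] N.cls_lin])
 interpret Q: module K N.Q by (rule N.quot_module)
 fix x y assume xy: "x : B" "y : B"
 have l: "(%f. N.cls (tt x (s f *.B y))) : lin_maps K L N.Q"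
  using lin_comp[OF lin_comp[OF s_lin B.mult_right_lin[OF xy(2)]] lin_comp[OF bilin_right[OF BB.tens_bilin xy(1)] N.cls_lin]] .
 have "N.cls (E *.T tt x y) = (\<Oplus>\<^bsub>N.Q\<^esub>j\<in>J. N.cls (tt (t (p j) *.B x) (s (q j) *.B y)))"
  unfolding E_pure[OF xy] by (rule lin_finsum[OF N.cls_lin T.md N.quot_module]) (use xy in auto)
 also have "... = (\<Oplus>\<^bsub>N.Q\<^esub>j\<in>J. N.cls (tt x (s (p j *.L q j) *.B y)))"
  by (rule Q.M.finsum_eqI) (use xy in "auto simp: N_balance s_mult B.A.m_assoc")
 also have "... = N.cls (tt x y)" using F.sep_lin[OF l N.quot_module] xy by (simp add: s_one)
 finally show "N.cls (E *.T tt x y) = N.cls (tt x y)" .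
qed auto

lemma in_N_iff: "z : T ==> z : N \<longleftrightarrow> E *.T z = \<zero>.T"
proof
 assume z: "z : T" "E *.T z = \<zero>.T"
 then have "N.cls z = N.cls \<zero>.T" using N_E[OF z(1)] by simp
 then show "z : N" using N.cls_eq_iff[of z "\<zero>.T"] z by (simp add: a_minus_def)
qed (rule N_kill)

lemma weak_comult_eq:
 assumes e: "e = (\<Oplus>\<^bsub>tensor K L L\<^esub>j\<in>J. tens K L L (p j) (q j))" and z: "z : T"
 shows "induced (tensor_lift K T (%a1 a2. tensor_lift K T (%e1 e2. tt (t e1 *.B a1) (s e2 *.B a2)) e))
  (balanced_class K B L s t z) = E *.T z"
proof -
 interpret LL: alg_pair K L L ..
 interpret TL: k_algebra K "tensor K L L" by (rule LL.tensor_k_algebra)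
 have b: "bilin K L L T (%g h. tt (t g *.B x) (s h *.B y))" if "x : B" "y : B" for x y
  by (rule bilinI) (use that in "simp_all add: lins")
 have pure: "tensor_lift K T (%e1 e2. tt (t e1 *.B x) (s e2 *.B y)) e = E *.T tt x y"
  if xy: "x : B" "y : B" for x y
  unfolding e E_pure[OF xy] using xy
  by (subst lin_finsum[OF LL.tensor_lift_lin[OF b[OF xy] T.md] TL.md T.md])
    (auto simp: LL.tensor_lift_tens[OF b[OF xy] T.md] intro!: T.M.finsum_eqI)
 have b': "bilin K B B T (%x y. E *.T tt x y)"
  using bilin_comp[OF BB.tens_bilin B.id_lin B.id_lin T.mult_left_lin[OF E_closed]] .
 let ?h = "tensor_lift K T (%a1 a2. tensor_lift K T (%e1 e2. tt (t e1 *.B a1) (s e2 *.B a2)) e)"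
 have b2: "bilin K B B T (%a1 a2. tensor_lift K T (%e1 e2. tt (t e1 *.B a1) (s e2 *.B a2)) e)"
  by (rule bilinI) (simp_all add: pure lins)
 note hl = BB.tensor_lift_lin[OF b2 T.md]
 have h: "?h w = E *.T w" if "w : T" for w
  by (rule BB.tensor_lin_eq[OF hl T.mult_left_lin[OF E_closed] _ that])
    (simp add: BB.tensor_lift_tens[OF b2 T.md] pure)
 have "induced ?h (N.cls z) = ?h z"
  by (rule N.induced_cls[OF hl T.md _ z]) (use N_kill h N.NS.a_Hcarr in auto)
 then show ?thesis using h z by (simp add: balanced_class_def)
qed

text \<open>If a linear map \<open>D\<close> into \<open>B \<otimes> B\<close> descends to a quotient after projection to \<open>B \<otimes>\<^sub>L B\<close>, then
 the weak comultiplication of a class \<open>[u]\<close> is \<open>E D(u)\<close>.\<close>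

lemma weak_comult_quot:
 assumes e: "e = (\<Oplus>\<^bsub>tensor K L L\<^esub>j\<in>J. tens K L L (p j) (q j))"
  and Q: "quotient_module K P I" and D: "D : lin_maps K P T"
  and I: "!!n. n : I ==> E *.T D n = \<zero>.T" and u: "u : P"
 shows "induced (tensor_lift K T (%a1 a2. tensor_lift K T (%e1 e2. tt (t e1 *.B a1) (s e2 *.B a2)) e))
  (induced (%u. balanced_class K B L s t (D u)) (I +>.P u)) = E *.T D u"
proof -
 interpret Q: quotient_module K P I by fact
 have "induced (%u. N.cls (D u)) (Q.cls u) = N.cls (D u)"
 proof (rule Q.induced_cls[OF lin_comp[OF D N.cls_lin] N.quot_module _ u])
  fix n assume n: "n : I"
  then have nP: "n : P" by (rule Q.NS.a_Hcarr)
  then have "D n : N" using in_N_iff[OF lin_closed[OF D nP]] I[OF n] by simp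
  then show "N.cls (D n) = \<zero>\<^bsub>N.Q\<^esub>"
   using N.cls_eq_iff[OF lin_closed[OF D nP] T.M.zero_closed] lin_closed[OF D nP] N.cls_zero by (simp add: a_minus_def)
 qed
 then show ?thesis
  using weak_comult_eq[OF e lin_closed[OF D u]] by (simp add: balanced_class_def)
qed

end

lemma weak_bialg_of_simps:
 "carrier (weak_bialg_of K Bd \<psi> e) = carrier Bd" "mult (weak_bialg_of K Bd \<psi> e) = mult Bd"
 "one (weak_bialg_of K Bd \<psi> e) = one Bd" "zero (weak_bialg_of K Bd \<psi> e) = zero Bd"
 "add (weak_bialg_of K Bd \<psi> e) = add Bd" "smult (weak_bialg_of K Bd \<psi> e) = smult Bd"
 "counit (weak_bialg_of K Bd \<psi> e) a = \<psi> (lcounit Bd a)"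
 "comult (weak_bialg_of K Bd \<psi> e) a = induced (tensor_lift K (tensor K Bd Bd) (%a1 a2.
      tensor_lift K (tensor K Bd Bd) (%e1 e2.
       tens K Bd Bd (target Bd e1 \<otimes>\<^bsub>Bd\<^esub> a1) (source Bd e2 \<otimes>\<^bsub>Bd\<^esub> a2)) e)) (lcomult Bd a)"
 by (simp_all add: weak_bialg_of_def module.defs weak_bialg.defs)

section \<open>The base algebra of maps\<close>

locale ybe_data = R: k_algebra K R + FR: frob_sys K R \<psi> JR pR qR
 for K :: "('k, 'm) ring_scheme" and R :: "('k, 'r) module" and \<psi> and JR :: "nat set" and pR qR +
 fixes e :: "(('r \<times> 'r) \<Rightarrow> 'k) set"
  and X :: "'x set" and deg :: "'x \<Rightarrow> 'l::finite \<Rightarrow> 'l" and \<sigma> :: "'x \<Rightarrow> 'x \<Rightarrow> 'x \<Rightarrow> 'x \<Rightarrow> 'l \<Rightarrow> 'r"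
 assumes e_eq: "e = (\<Oplus>\<^bsub>tensor K R R\<^esub>j\<in>JR. tens K R R (pR j) (qR j))"
  and finX: "finite X"
  and deg_bij: "!!a. a : X ==> bij (deg a)"
  and sigma_center: "!!a b c d \<kappa>. [|a : X; b : X; c : X; d : X|] ==> \<sigma> a b c d \<kappa> : ring_center R"
  and sigma_zero: "!!a b c d \<kappa>. [|a : X; b : X; c : X; d : X; deg b (deg d \<kappa>) ~= deg a (deg c \<kappa>)|]
      ==> \<sigma> b d a c \<kappa> = \<zero>.R"
begin

abbreviation M :: "('k, 'l \<Rightarrow> 'r) module" where "M \<equiv> map_alg R"

sublocale M: k_algebra K M by (rule map_k_algebra[OF R.k_algebra_axioms])

definition pM :: "nat \<times> 'l \<Rightarrow> 'l \<Rightarrow> 'r" where "pM = (%(j, \<kappa>) \<mu>. if \<mu> = \<kappa> then pR j else \<zero>.R)"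
definition qM :: "nat \<times> 'l \<Rightarrow> 'l \<Rightarrow> 'r" where "qM = (%(j, \<kappa>) \<mu>. if \<mu> = \<kappa> then qR j else \<zero>.R)"
abbreviation "JM \<equiv> JR \<times> (UNIV :: 'l set)"
abbreviation "\<psi>M \<equiv> map_psi K \<psi>"

lemma M_closed: "f : M ==> f \<kappa> : R" by (simp add: map_alg_simps)
lemma eval_finsum: "(!!i. i : S ==> x i : M) ==> finsum M x S \<kappa> = (\<Oplus>.R i\<in>S. x i \<kappa>)"
 by (rule lin_finsum[OF eval_lin M.md R.md])

lemma psiM_lin: "\<psi>M : lin_maps K M (scalars K)"
proof -
 have "(%f. finsum (scalars K) (%\<kappa>. \<psi> (f \<kappa>)) UNIV) : lin_maps K M (scalars K)"
  by (rule lin_finsum_fun[OF k_algebra.axioms(1)[OF R.scalars_k_algebra] lin_comp[OF eval_lin FR.psi_lin]])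
 then show ?thesis by (simp add: map_psi_def[abs_def] finsum_scalars)
qed

lemma psi_zero: "\<psi> \<zero>.R = \<zero>.K"
 using lin_zero[OF FR.psi_lin R.md k_algebra.axioms(1)[OF R.scalars_k_algebra]] by simp

lemma psiM_single:
 assumes "!!\<mu>. \<mu> ~= \<kappa> ==> f \<mu> = \<zero>.R" "f \<kappa> : R"
 shows "\<psi>M f = \<psi> (f \<kappa>)"
proof -
 have "\<psi>M f = (\<Oplus>.K \<mu>\<in>UNIV. if \<mu> = \<kappa> then \<psi> (f \<kappa>) else \<zero>.K)"
  unfolding map_psi_def by (rule R.R.finsum_eqI) (use assms psi_zero in auto)
 then show ?thesis using assms by (subst (asm) R.R.finsum_delta) auto
qed

lemma pM_closed: "j : JM ==> pM j : M" "j : JM ==> qM j : M"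
 by (auto simp: pM_def qM_def map_alg_simps FR.pc FR.qc)

lemma sum_JM:
 assumes "!!j \<kappa>. j : JR ==> x (j, \<kappa>) : M" "!!j \<kappa>. j : JR ==> \<kappa> ~= \<mu> ==> x (j, \<kappa>) \<mu> = \<zero>.R"
 shows "finsum M x JM \<mu> = (\<Oplus>.R j\<in>JR. x (j, \<mu>) \<mu>)"
proof -
 have "finsum M x JM \<mu> = (\<Oplus>.R i\<in>JM. x i \<mu>)" by (rule eval_finsum) (use assms in auto)
 also have "... = (\<Oplus>.R j\<in>JR. \<Oplus>.R \<kappa>\<in>UNIV. x (j, \<kappa>) \<mu>)"
  using R.M.finsum_prod[of JR "UNIV :: 'l set" "%j \<kappa>. x (j, \<kappa>) \<mu>"] assms M_closed FR.finJ
  by (simp add: case_prod_unfold)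
 also have "... = (\<Oplus>.R j\<in>JR. \<Oplus>.R \<kappa>\<in>UNIV. if \<kappa> = \<mu> then x (j, \<kappa>) \<mu> else \<zero>.R)"
  by (intro R.M.finsum_eqI) (use assms M_closed in "auto intro!: R.M.finsum_closedI")
 also have "... = (\<Oplus>.R j\<in>JR. x (j, \<mu>) \<mu>)"
  by (rule R.M.finsum_eqI, subst R.M.finsum_delta) (use assms M_closed in auto)
 finally show ?thesis .
qed

sublocale FM: frob_sys K M \<psi>M JM pM qM
proof (unfold_locales)
 show "\<psi>M : lin_maps K M (scalars K)" by (rule psiM_lin)
 show "finite JM" by (simp add: FR.finJ)
 show "pM j : M" "qM j : M" if "j : JM" for j using that pM_closed by auto
 have psi1: "\<psi>M (l *.M pM (j, \<kappa>)) = \<psi> (l \<kappa> *.R pR j)" "\<psi>M (qM (j, \<kappa>) *.M l) = \<psi> (qR j *.R l \<kappa>)"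
  if "l : M" "j : JR" for l j \<kappa>
  using that psiM_single[of \<kappa> "l *.M pM (j, \<kappa>)"] psiM_single[of \<kappa> "qM (j, \<kappa>) *.M l"]
  by (simp_all add: map_alg_simps pM_def qM_def FR.pc FR.qc)
 have psic: "\<psi>M x : K" if "x : M" for x using lin_closed[OF psiM_lin that] by simp
 fix l assume l: "l : M"
 show "(\<Oplus>.M j\<in>JM. \<psi>M (l *.M pM j) \<odot>.M qM j) = l"
 proof
  fix \<mu>
  have "(\<Oplus>.M j\<in>JM. \<psi>M (l *.M pM j) \<odot>.M qM j) \<mu> = (\<Oplus>.R j\<in>JR. (\<psi>M (l *.M pM (j, \<mu>)) \<odot>.M qM (j, \<mu>)) \<mu>)"
   by (rule sum_JM) (use l psic pM_closed in "auto simp: map_alg_simps(6), simp_all add: qM_def")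
  also have "... = (\<Oplus>.R j\<in>JR. \<psi> (l \<mu> *.R pR j) \<odot>.R qR j)"
   by (rule R.M.finsum_eqI) (use l M_closed in "auto simp: map_alg_simps(6) psi1 qM_def FR.pc FR.qc")
  also have "... = l \<mu>" using FR.dual1[of "l \<mu>"] l M_closed by simp
  finally show "(\<Oplus>.M j\<in>JM. \<psi>M (l *.M pM j) \<odot>.M qM j) \<mu> = l \<mu>" .
 qed
 show "(\<Oplus>.M j\<in>JM. \<psi>M (qM j *.M l) \<odot>.M pM j) = l"
 proof
  fix \<mu>
  have "(\<Oplus>.M j\<in>JM. \<psi>M (qM j *.M l) \<odot>.M pM j) \<mu> = (\<Oplus>.R j\<in>JR. (\<psi>M (qM (j, \<mu>) *.M l) \<odot>.M pM (j, \<mu>)) \<mu>)"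
   by (rule sum_JM) (use l psic pM_closed in "auto simp: map_alg_simps(6), simp_all add: pM_def")
  also have "... = (\<Oplus>.R j\<in>JR. \<psi> (qR j *.R l \<mu>) \<odot>.R pR j)"
   by (rule R.M.finsum_eqI) (use l M_closed in "auto simp: map_alg_simps(6) psi1 pM_def FR.pc FR.qc")
  also have "... = l \<mu>" using FR.dual2[of "l \<mu>"] l M_closed by simp
  finally show "(\<Oplus>.M j\<in>JM. \<psi>M (qM j *.M l) \<odot>.M pM j) \<mu> = l \<mu>" .
 qed
next
 show "(\<Oplus>.M j\<in>JM. pM j *.M qM j) = \<one>.M"
 proof
  fix \<mu>
  have "(\<Oplus>.M j\<in>JM. pM j *.M qM j) \<mu> = (\<Oplus>.R j\<in>JR. (pM (j, \<mu>) *.M qM (j, \<mu>)) \<mu>)"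
   by (rule sum_JM) (use pM_closed in "auto simp: map_alg_simps(2), simp_all add: pM_def qM_def")
  also have "... = (\<Oplus>.R j\<in>JR. pR j *.R qR j)"
   by (rule R.M.finsum_eqI) (auto simp: map_alg_simps(2) pM_def qM_def FR.pc FR.qc)
  finally show "(\<Oplus>.M j\<in>JM. pM j *.M qM j) \<mu> = \<one>.M \<mu>" using FR.sep by (simp add: map_alg_simps)
 qed
qed

lemma delta_M:
 "r : R ==> const_map r *.M delta_map R \<kappa> = (%\<mu>. if \<mu> = \<kappa> then r else \<zero>.R)"
 by (auto simp: fun_eq_iff map_alg_simps const_map_def delta_map_def)

lemma map_e_eq: "map_e K R e = (\<Oplus>\<^bsub>tensor K M M\<^esub>j\<in>JM. tens K M M (pM j) (qM j))"
proof -
 interpret RR: alg_pair K R R ..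
 interpret MM: alg_pair K M M ..
 interpret TR: k_algebra K "tensor K R R" by (rule RR.tensor_k_algebra)
 interpret TM: k_algebra K "tensor K M M" by (rule MM.tensor_k_algebra)
 let ?d = "%\<kappa> r. const_map r *.M delta_map R \<kappa>"
 have dl: "?d \<kappa> : lin_maps K R M" for \<kappa>
  by (rule lin_mapsI) (auto simp: map_alg_simps fun_eq_iff const_map_def delta_map_def)
 note b = bilin_comp[OF MM.tens_bilin dl dl TM.id_lin]
 note bl = RR.tensor_lift_lin[OF b TM.md] and bt = RR.tensor_lift_tens[OF b TM.md]
 have "map_e K R e = (\<Oplus>\<^bsub>tensor K M M\<^esub>\<kappa>\<in>UNIV. \<Oplus>\<^bsub>tensor K M M\<^esub>j\<in>JR. tens K M M (pM (j, \<kappa>)) (qM (j, \<kappa>)))"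
  unfolding map_e_def
 proof (rule TM.M.finsum_eqI)
  fix \<kappa>
  show "tensor_lift K (tensor K M M) (%e1 e2. tens K M M (?d \<kappa> e1) (?d \<kappa> e2)) e
    = (\<Oplus>\<^bsub>tensor K M M\<^esub>j\<in>JR. tens K M M (pM (j, \<kappa>)) (qM (j, \<kappa>)))"
   unfolding e_eq using lin_closed[OF dl] FR.pc FR.qc
   by (subst lin_finsum[OF bl TR.md TM.md])
     (auto simp: bt delta_M pM_def qM_def intro!: TM.M.finsum_eqI)
 qed (auto intro!: TM.M.finsum_closedI simp: pM_closed)
 also have "... = (\<Oplus>\<^bsub>tensor K M M\<^esub>j\<in>JR. \<Oplus>\<^bsub>tensor K M M\<^esub>\<kappa>\<in>UNIV. tens K M M (pM (j, \<kappa>)) (qM (j, \<kappa>)))"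
  by (rule TM.M.finsum_swap) (auto simp: pM_closed FR.finJ)
 also have "... = (\<Oplus>\<^bsub>tensor K M M\<^esub>j\<in>JM. tens K M M (pM j) (qM j))"
  using TM.M.finsum_prod[of JR "UNIV :: 'l set" "%j \<kappa>. tens K M M (pM (j, \<kappa>)) (qM (j, \<kappa>))"] pM_closed FR.finJ
  by (simp add: case_prod_unfold)
 finally show ?thesis .
qed

abbreviation "Tr a \<equiv> shift (deg a) :: ('l \<Rightarrow> 'r) \<Rightarrow> 'l \<Rightarrow> 'r"
abbreviation "Ti a \<equiv> shift (inv_into UNIV (deg a)) :: ('l \<Rightarrow> 'r) \<Rightarrow> 'l \<Rightarrow> 'r"

lemma shift_lin: "shift \<alpha> : lin_maps K M M"
 by (rule lin_mapsI) (auto simp: map_alg_simps fun_eq_iff shift_def)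
lemma shift_mult: "shift \<alpha> (f *.M g) = shift \<alpha> f *.M shift \<alpha> g"
 by (auto simp: map_alg_simps fun_eq_iff shift_def)
lemma shift_one: "shift \<alpha> \<one>.M = \<one>.M"
 by (auto simp: map_alg_simps fun_eq_iff shift_def)
lemma shift_closed [simp]: "f : M ==> shift \<alpha> f : M"
 by (rule lin_closed[OF shift_lin])
lemma Tr_Ti: "a : X ==> Tr a (Ti a f) = f" "a : X ==> Ti a (Tr a f) = f"
 using deg_bij[of a] by (auto simp: shift_def fun_eq_iff bij_is_inj bij_is_surj surj_f_inv_f)
lemma shift_psi:
 assumes "bij \<alpha>" "f : M"
 shows "\<psi>M (shift \<alpha> f) = \<psi>M f"
proof -
 have u: "UNIV = \<alpha> ` UNIV" using assms(1) by (simp add: bij_is_surj)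
 have "(\<Oplus>.K \<kappa>\<in>UNIV. \<psi> (f \<kappa>)) = (\<Oplus>.K \<kappa>\<in>UNIV. \<psi> (f (\<alpha> \<kappa>)))"
  by (subst u, rule R.R.finsum_reindex) (use assms M_closed in "auto simp: bij_is_inj")
 then show ?thesis by (simp add: map_psi_def shift_def)
qed

abbreviation "Y \<equiv> X \<times> X"
text \<open>\<open>\<sigma>\<close> as a matrix whose rows and columns are pairs.\<close>

definition "\<Sigma> u k = \<sigma> (fst u) (snd u) (fst k) (snd k)"

lemma Sigma_closed [simp]: "u : Y ==> k : Y ==> \<Sigma> u k : M"
 using sigma_center by (auto simp: \<Sigma>_def map_alg_simps ring_center_def)

lemma Sigma_central: "u : Y ==> k : Y ==> f : M ==> \<Sigma> u k *.M f = f *.M \<Sigma> u k"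
 using sigma_center by (auto simp: \<Sigma>_def map_alg_simps ring_center_def fun_eq_iff)

lemma Sigma_zero: "u : Y ==> k : Y ==> deg (fst u) (deg (snd u) \<kappa>) ~= deg (fst k) (deg (snd k) \<kappa>) ==> \<Sigma> u k \<kappa> = \<zero>.R"
 using sigma_zero by (auto simp: \<Sigma>_def)

end

section \<open>The algebra \<open>A\<^sub>\<sigma>\<close>\<close>

lemma kernel_ideal:
 assumes P: "k_algebra K P" and B: "k_algebra K B" and f: "f : lin_maps K P B"
  and m: "!!x y. x : P ==> y : P ==> f (x *.P y) = f x *.B f y"
 shows "ideal {u \<in> P. f u = \<zero>.B} P"
proof -
 interpret P: k_algebra K P by fact
 interpret B: k_algebra K B by fact
 interpret Z: quotient_module K P "{u \<in> P. f u = \<zero>.B}"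
  by (intro quotient_module.intro P.md submodule_kernel[OF f P.md B.md])
 show ?thesis
 proof (rule idealI)
  show "ring P" by (rule P.A.ring_axioms)
  show "subgroup {u \<in> P. f u = \<zero>.B} (add_monoid P)" by (rule Z.subgroup_axioms)
 next
  fix a x assume "a : {u \<in> P. f u = \<zero>.B}" and x: "x : P"
  then have a: "a : P" "f a = \<zero>.B" by blast+
  have fx: "f x : B" by (rule lin_closed[OF f x])
  have "f (x *.P a) = \<zero>.B" "f (a *.P x) = \<zero>.B"
   by (rule trans[OF m[OF x a(1), unfolded a(2)] B.A.r_null[OF fx]], rule trans[OF m[OF a(1) x, unfolded a(2)] B.A.l_null[OF fx]])
  then show "x *.P a : {u \<in> P. f u = \<zero>.B}" "a *.P x : {u \<in> P. f u = \<zero>.B}"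
   using P.A.m_closed[OF x a(1)] P.A.m_closed[OF a(1) x] by (blast intro: CollectI)+
 qed
qed

primrec target_letter where
 "target_letter K B s t l m (Coef u) = tensor_lift K B (%f g. s f *.B t g) u"
| "target_letter K B s t l m (Lgen a b) = l a b"
| "target_letter K B s t l m (Linv a b) = m a b"

definition target_free where
 "target_free K B E s t l m = lin_ext K B (%w. foldr (%c v. target_letter K B s t l m c *.B v) w E)"

context ybe_data begin

abbreviation \<F> :: "('k, ('k, 'r, 'l, 'x) free_elt) module" where "\<F> \<equiv> free_alg K R X"
abbreviation "\<A> \<equiv> A_alg K R X deg \<sigma>"
abbreviation "cls \<equiv> A_cls K R X deg \<sigma>"
abbreviation CA :: "('k, ('k, 'r, 'l) coef) module" where "CA \<equiv> tensor K M (op_alg M)"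
abbreviation cf :: "('l \<Rightarrow> 'r) \<Rightarrow> ('l \<Rightarrow> 'r) \<Rightarrow> ('k, 'r, 'l) coef" where "cf \<equiv> tens K M (op_alg M)"
abbreviation lts :: "(('k, 'r, 'l) coef, 'x) letter set" where "lts \<equiv> letters K R X"
abbreviation "lt c \<equiv> basis_elt K [c]"
abbreviation "rels \<equiv> A_rels K R X deg \<sigma>"
abbreviation "IA \<equiv> A_ideal K R X deg \<sigma>"

sublocale Mop: k_algebra K "op_alg M" by (rule M.op_k_algebra)
sublocale CAp: alg_pair K M "op_alg M" ..
sublocale CA: k_algebra K CA by (rule CAp.tensor_k_algebra)

lemma Fr_k_algebra: "k_algebra K \<F>"
 unfolding free_alg_def by (rule R.basis_k_algebra) auto

sublocale \<F>: k_algebra K \<F> by (rule Fr_k_algebra)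

lemma bw_closed [simp]: "w : lists lts ==> basis_elt K w : \<F>"
 unfolding free_alg_def by (rule R.basis_elt_closed)
lemma bw_mult: "basis_elt K v *.\<F> basis_elt K w = basis_elt K (v @ w)"
 unfolding free_alg_def by (simp add: R.basis_elt_mult)
lemma bw_one: "\<one>.\<F> = basis_elt K []"
 by (auto simp: free_alg_def basis_alg_def basis_elt_def)

lemma lts_simps [simp]:
 "Coef u : lts \<longleftrightarrow> u : CA" "Lgen a b : lts \<longleftrightarrow> a : X \<and> b : X" "Linv a b : lts \<longleftrightarrow> a : X \<and> b : X"
 by (auto simp: letters_def)

lemma Fr_lin_eq:
 assumes "f : lin_maps K \<F> V" "g : lin_maps K \<F> V" "module K V"
  and "!!w. w : lists lts ==> f (basis_elt K w) = g (basis_elt K w)" and "u : \<F>"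
 shows "f u = g u"
 using R.basis_lin_eq[of f "lists lts" _ _ V g u] assms unfolding free_alg_def by blast

lemma coef_closed [simp]: "f : M ==> g : M ==> cf f g : CA"
 by (rule CAp.tens_closed) auto

lemma sigma_closed: "x : X ==> y : X ==> z : X ==> v : X ==> \<sigma> x y z v : M"
 using Sigma_closed[of "(x, y)" "(z, v)"] by (simp add: \<Sigma>_def)

lemma rels_closed: "rels \<subseteq> carrier \<F>"
 unfolding A_rels_def
 by (intro Un_least subsetI; elim CollectE exE conjE singletonE; hypsubst)
   (insert sigma_closed, auto intro!: \<F>.M.finsum_closedI \<F>.M.minus_closed split: if_splits)

lemma IA_ideal: "ideal IA \<F>"
 unfolding A_ideal_def by (rule \<F>.A.genideal_ideal[OF rels_closed])

sublocale IA: quotient_algebra K \<F> IA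
 by (intro quotient_algebra.intro \<F>.k_algebra_axioms IA_ideal)

lemma Aa_eq: "\<A> = IA.Q" by (simp add: A_alg_def)
lemma cls_eq: "cls = IA.cls" by (simp add: A_cls_def fun_eq_iff)

lemma Aa_k_algebra: "k_algebra K \<A>" unfolding Aa_eq by (rule IA.quot_k_algebra)
sublocale \<A>: k_algebra K \<A> by (rule Aa_k_algebra)

lemma cls_closed [simp]: "u : \<F> ==> cls u : \<A>" by (simp add: cls_eq Aa_eq)
lemma cls_lin: "cls : lin_maps K \<F> \<A>" unfolding cls_eq Aa_eq by (rule IA.cls_lin)
lemma cls_mult: "u : \<F> ==> v : \<F> ==> cls (u *.\<F> v) = cls u *.\<A> cls v"
 by (simp add: cls_eq Aa_eq IA.cls_mult)
lemma cls_one: "cls \<one>.\<F> = \<one>.\<A>" by (simp add: cls_eq Aa_eq IA.cls_one)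
lemma cls_cases: "a : \<A> ==> (!!u. u : \<F> ==> a = cls u ==> P) ==> P"
 unfolding cls_eq Aa_eq by (rule IA.cls_cases)

lemma cls_rel:
 assumes "u \<ominus>.\<F> v : rels" "u : \<F>" "v : \<F>"
 shows "cls u = cls v"
 using assms IA.cls_eq_iff[OF assms(2,3)] \<F>.A.genideal_self[OF rels_closed] by (auto simp: cls_eq A_ideal_def)

abbreviation "sA \<equiv> A_source K R X deg \<sigma>"
abbreviation "tA \<equiv> A_target K R X deg \<sigma>"
abbreviation "LA a b \<equiv> cls (lt (Lgen a b))"
abbreviation "NA a b \<equiv> cls (lt (Linv a b))"
abbreviation "cc u \<equiv> cls (lt (Coef u))"

lemma cc_lin: "(%u. cc u) : lin_maps K CA \<A>"
proof (rule lin_mapsI)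
 fix u v assume uv: "u : CA" "v : CA"
 have "cc (u \<oplus>\<^bsub>CA\<^esub> v) = cls (lt (Coef u) \<oplus>.\<F> lt (Coef v))"
  by (rule cls_rel) (unfold A_rels_def, (rule UnI1)+, use uv in "auto")
 then show "cc (u \<oplus>\<^bsub>CA\<^esub> v) = cc u \<oplus>.\<A> cc v" using uv by (simp add: lin_add[OF cls_lin])
next
 fix k u assume ku: "k : K" "u : CA"
 have "cc (k \<odot>\<^bsub>CA\<^esub> u) = cls (k \<odot>.\<F> lt (Coef u))"
  by (rule cls_rel) (unfold A_rels_def, rule U4, rule U4, rule UnI1, rule UnI2, use ku in auto)
 then show "cc (k \<odot>\<^bsub>CA\<^esub> u) = k \<odot>.\<A> cc u" using ku by (simp add: lin_smult[OF cls_lin])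
qed simp

lemma cc_mult: "u : CA ==> v : CA ==> cc (u \<otimes>\<^bsub>CA\<^esub> v) = cc u *.\<A> cc v"
proof -
 assume uv: "u : CA" "v : CA"
 have "cc (u \<otimes>\<^bsub>CA\<^esub> v) = cls (lt (Coef u) *.\<F> lt (Coef v))"
  by (rule cls_rel) (unfold A_rels_def, rule U4, rule U4, rule UnI2, use uv in auto)
 then show ?thesis using uv by (simp add: cls_mult)
qed

lemma cc_one: "cc (cf \<one>.M \<one>.M) = \<one>.\<A>"
proof -
 have "cls \<one>.\<F> = cc (cf \<one>.M \<one>.M)"
  by (rule cls_rel) (unfold A_rels_def, rule UnI2, auto)
 then show ?thesis by (simp add: cls_one)
qed

lemma sA_eq: "sA f = cc (cf f \<one>.M)" and tA_eq: "tA f = cc (cf \<one>.M f)"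
 by (simp_all add: A_source_def A_target_def)

lemma coef_mult: "f : M ==> g : M ==> f' : M ==> g' : M ==>
  cf f g \<otimes>\<^bsub>CA\<^esub> cf f' g' = cf (f *.M f') (g' *.M g)"
 by (simp add: CAp.tens_mult)

lemma base_A: "base_maps K \<A> M \<psi>M JM pM qM sA tA"
proof
 show "sA : lin_maps K M \<A>"
  unfolding sA_eq[abs_def] by (rule lin_comp[OF bilin_left[OF CAp.tens_bilin] cc_lin]) simp
 show "tA : lin_maps K M \<A>"
  unfolding tA_eq[abs_def] by (rule lin_comp[OF bilin_right[OF CAp.tens_bilin, simplified] cc_lin]) simp
qed (simp_all add: sA_eq tA_eq cc_mult[symmetric] coef_mult cc_one)

sublocale Ab: base_maps K \<A> M \<psi>M JM pM qM sA tA by (rule base_A)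

lemma cc_coef: "f : M ==> g : M ==> cc (cf f g) = sA f *.\<A> tA g"
 by (simp add: sA_eq tA_eq cc_mult[symmetric] coef_mult)

lemma sL: "a : X ==> b : X ==> f : M ==> sA (Tr a f) *.\<A> LA a b = LA a b *.\<A> sA f"
proof -
 assume ab: "a : X" "b : X" "f : M"
 have "cls (lt (Coef (cf (Tr a f) \<one>.M)) *.\<F> lt (Lgen a b)) = cls (lt (Lgen a b) *.\<F> lt (Coef (cf f \<one>.M)))"
  by (rule cls_rel) (unfold A_rels_def, rule U4, rule UnI1, rule UnI2, use ab in auto)
 then show ?thesis using ab by (simp add: cls_mult sA_eq)
qed
lemma tL: "a : X ==> b : X ==> f : M ==> tA (Tr b f) *.\<A> LA a b = LA a b *.\<A> tA f"
proof -
 assume ab: "a : X" "b : X" "f : M"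
 have "cls (lt (Coef (cf \<one>.M (Tr b f))) *.\<F> lt (Lgen a b)) = cls (lt (Lgen a b) *.\<F> lt (Coef (cf \<one>.M f)))"
  by (rule cls_rel) (unfold A_rels_def, rule U4, rule UnI2, use ab in auto)
 then show ?thesis using ab by (simp add: cls_mult tA_eq)
qed
lemma sN: "a : X ==> b : X ==> f : M ==> sA f *.\<A> NA a b = NA a b *.\<A> sA (Tr b f)"
proof -
 assume ab: "a : X" "b : X" "f : M"
 have "cls (lt (Coef (cf f \<one>.M)) *.\<F> lt (Linv a b)) = cls (lt (Linv a b) *.\<F> lt (Coef (cf (Tr b f) \<one>.M)))"
  by (rule cls_rel) (unfold A_rels_def, rule U2, rule UnI1, rule UnI2, use ab in auto)
 then show ?thesis using ab by (simp add: cls_mult sA_eq)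
qed
lemma tN: "a : X ==> b : X ==> f : M ==> tA f *.\<A> NA a b = NA a b *.\<A> tA (Tr a f)"
proof -
 assume ab: "a : X" "b : X" "f : M"
 have "cls (lt (Coef (cf \<one>.M f)) *.\<F> lt (Linv a b)) = cls (lt (Linv a b) *.\<F> lt (Coef (cf \<one>.M (Tr a f))))"
  by (rule cls_rel) (unfold A_rels_def, rule U2, rule UnI2, use ab in auto)
 then show ?thesis using ab by (simp add: cls_mult tA_eq)
qed

abbreviation "krA a b \<equiv> (unit_mat \<A> a b)"

lemma cls_zero: "cls \<zero>.\<F> = \<zero>.\<A>"
 by (rule lin_zero[OF cls_lin \<F>.md \<A>.md])

lemma LN: "a : X ==> b : X ==> (\<Oplus>.\<A> c\<in>X. LA a c *.\<A> NA c b) = krA a b"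
proof -
 assume ab: "a : X" "b : X"
 have "cls (\<Oplus>.\<F> c\<in>X. lt (Lgen a c) *.\<F> lt (Linv c b)) = cls (unit_mat \<F> a b)"
  by (rule cls_rel) (unfold A_rels_def, rule U4, rule U2, rule UnI1, rule UnI2,
   use ab in \<open>auto intro!: \<F>.M.finsum_closedI\<close>)
 moreover have "cls (\<Oplus>.\<F> c\<in>X. lt (Lgen a c) *.\<F> lt (Linv c b)) = (\<Oplus>.\<A> c\<in>X. LA a c *.\<A> NA c b)"
  using ab by (subst lin_finsum[OF cls_lin \<F>.md \<A>.md]) (auto simp: cls_mult intro!: \<A>.M.finsum_eqI)
 ultimately show ?thesis by (simp add: cls_one cls_zero split: if_splits)
qed

lemma NL: "a : X ==> b : X ==> (\<Oplus>.\<A> c\<in>X. NA a c *.\<A> LA c b) = krA a b"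
proof -
 assume ab: "a : X" "b : X"
 have "cls (\<Oplus>.\<F> c\<in>X. lt (Linv a c) *.\<F> lt (Lgen c b)) = cls (unit_mat \<F> a b)"
  by (rule cls_rel) (unfold A_rels_def, rule U4, rule U2, rule UnI2,
   use ab in \<open>auto intro!: \<F>.M.finsum_closedI\<close>)
 moreover have "cls (\<Oplus>.\<F> c\<in>X. lt (Linv a c) *.\<F> lt (Lgen c b)) = (\<Oplus>.\<A> c\<in>X. NA a c *.\<A> LA c b)"
  using ab by (subst lin_finsum[OF cls_lin \<F>.md \<A>.md]) (auto simp: cls_mult intro!: \<A>.M.finsum_eqI)
 ultimately show ?thesis by (simp add: cls_one cls_zero split: if_splits)
qed

text \<open>The matrix of products of two entries, indexed by pairs with the second components as the left
  factor; the exchange relation for \<open>l\<close> is then a matrix identity between \<open>\<Sigma>\<close> and \<open>LL\<close>.\<close>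

definition "LL B l u w = l (snd u) (snd w) *.B l (fst u) (fst w)"

lemma LLA_closed [simp]: "u : Y ==> w : Y ==> LL \<A> LA u w : \<A>"
 by (auto simp: LL_def)

lemma RLL_A:
 assumes k: "k : Y" and w: "w : Y"
 shows "(\<Oplus>.\<A> u\<in>Y. sA (\<Sigma> u k) *.\<A> LL \<A> LA u w) = (\<Oplus>.\<A> u\<in>Y. tA (\<Sigma> w u) *.\<A> LL \<A> LA k u)"
proof -
 obtain a c b d where kw: "k = (a, c)" "w = (b, d)" by fastforce
 then have X: "a : X" "b : X" "c : X" "d : X" using k w by auto
 let ?l = "%(x, y). lt (Coef (cf (\<sigma> x y a c) \<one>.M)) *.\<F> lt (Lgen y d) *.\<F> lt (Lgen x b)"
 let ?r = "%(x, y). lt (Coef (cf \<one>.M (\<sigma> b d x y))) *.\<F> lt (Lgen c y) *.\<F> lt (Lgen a x)"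
 have \<sigma>: "\<sigma> x y z v : M" if "x : X" "y : X" "z : X" "v : X" for x y z v
  using Sigma_closed[of "(x, y)" "(z, v)"] that by (simp add: \<Sigma>_def)
 have "cls (finsum \<F> ?l Y) = cls (finsum \<F> ?r Y)"
  by (rule cls_rel) (unfold A_rels_def, rule UnI1, rule UnI2, use X \<sigma> in \<open>auto intro!: \<F>.M.finsum_closedI\<close>)
 moreover have "cls (finsum \<F> ?l Y) = (\<Oplus>.\<A> u\<in>Y. sA (\<Sigma> u k) *.\<A> LL \<A> LA u w)"
  using X \<sigma> by (subst lin_finsum[OF cls_lin \<F>.md \<A>.md])
   (auto simp: cls_mult sA_eq \<Sigma>_def LL_def kw \<A>.A.m_assoc intro!: \<A>.M.finsum_eqI)
 moreover have "cls (finsum \<F> ?r Y) = (\<Oplus>.\<A> u\<in>Y. tA (\<Sigma> w u) *.\<A> LL \<A> LA k u)"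
  using X \<sigma> by (subst lin_finsum[OF cls_lin \<F>.md \<A>.md])
   (auto simp: cls_mult tA_eq \<Sigma>_def LL_def kw \<A>.A.m_assoc intro!: \<A>.M.finsum_eqI)
 ultimately show ?thesis by simp
qed

lemma A_gen:
 assumes a: "a : \<A>" and one: "P \<one>.\<A>"
  and add: "!!x y. x : \<A> ==> y : \<A> ==> P x ==> P y ==> P (x \<oplus>.\<A> y)"
  and sm: "!!k x. k : K ==> x : \<A> ==> P x ==> P (k \<odot>.\<A> x)"
  and s: "!!f x. f : M ==> x : \<A> ==> P x ==> P (sA f *.\<A> x)"
  and t: "!!f x. f : M ==> x : \<A> ==> P x ==> P (tA f *.\<A> x)"
  and L: "!!a b x. a : X ==> b : X ==> x : \<A> ==> P x ==> P (LA a b *.\<A> x)"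
  and N: "!!a b x. a : X ==> b : X ==> x : \<A> ==> P x ==> P (NA a b *.\<A> x)"
 shows "P a"
proof -
 have c: "P (cc u *.\<A> x)" if u: "u : CA" and x: "x : \<A>" "P x" for u x
  using u
 proof (induction u rule: CAp.tensor_induct)
  case (tens f g)
  then show ?case using s[of f "tA g *.\<A> x"] t[of g x] x by (simp add: cc_coef \<A>.A.m_assoc)
 next
  case (add u v)
  then show ?case using x assms(3)[of "cc u *.\<A> x" "cc v *.\<A> x"] by (simp add: lin_add[OF cc_lin] \<A>.A.l_distr)
 qed
 have w: "P (cls (basis_elt K w))" if "w : lists lts" for w
  using that
 proof (induction w)
  case Nil
  then show ?case using one by (simp add: cls_one[symmetric] bw_one)
 next
  case (Cons x w)
  have e: "cls (basis_elt K (x # w)) = cls (lt x) *.\<A> cls (basis_elt K w)"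
   using Cons by (simp add: cls_mult[symmetric] bw_mult)
  have "cls (basis_elt K w) : \<A>" "P (cls (basis_elt K w))" "x : lts" using Cons by simp_all
  then show ?case unfolding e by (cases x) (auto intro!: c L N)
 qed
 obtain u where u: "u : \<F>" "a = cls u" using a by (rule cls_cases)
 have "P (cls u)" using u(1) unfolding free_alg_def
 proof (induction u rule: R.basis_induct)
  case zero
  then show ?case using sm[OF R.R.zero_closed \<A>.A.one_closed one] by (simp add: cls_zero[unfolded free_alg_def])
 next
  case (step k w g)
  then have gw: "g : \<F>" "w : lists lts" "k : K" "P (cls g)" by (simp_all add: free_alg_def)
  have "P (k \<odot>.\<A> cls (basis_elt K w) \<oplus>.\<A> cls g)"
   using gw w[OF gw(2)] bw_closed[OF gw(2)] by (intro add sm) simp_all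
  then have "P (cls (k \<odot>.\<F> basis_elt K w \<oplus>.\<F> g))"
   using gw bw_closed[OF gw(2)] by (simp add: lin_add[OF cls_lin] lin_smult[OF cls_lin])
  then show ?case by (simp only: free_alg_def)
 qed
 then show ?thesis using u by simp
qed

end

text \<open>Data that define a homomorphism from \<open>\<AA>(w\<^sub>\<sigma>)\<close> to \<open>B\<close>.  Its value at the unit is an idempotent \<open>E\<close>,
  not necessarily the unit of \<open>B\<close>, because the main example is the comultiplication, with \<open>E = \<Delta>(1)\<close>.\<close>

locale rll_target = ybe_data K R \<psi> JR pR qR e X deg \<sigma> + B: k_algebra K B
 for K :: "('k, 'm) ring_scheme" and R :: "('k, 'r) module" and \<psi> JR pR qR e and X :: "'x set" and deg :: "'x \<Rightarrow> 'l::finite \<Rightarrow> 'l"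
  and \<sigma> and B :: "('k, 'b, 'z) module_scheme" +
 fixes E :: 'b and s t :: "('l \<Rightarrow> 'r) \<Rightarrow> 'b" and l :: "'x \<Rightarrow> 'x \<Rightarrow> 'b"
 assumes s_lin: "s : lin_maps K M B" and t_lin: "t : lin_maps K M B"
  and s_mult: "!!f g. f : M ==> g : M ==> s (f *.M g) = s f *.B s g"
  and t_mult: "!!f g. f : M ==> g : M ==> t (f *.M g) = t g *.B t f"
  and s_one: "s \<one>.M = E" and t_one: "t \<one>.M = E"
  and ts_comm: "!!f g. f : M ==> g : M ==> t g *.B s f = s f *.B t g"
  and lc [simp]: "!!a b. a : X ==> b : X ==> l a b : B"
  and l_unit: "!!a b. a : X ==> b : X ==> E *.B l a b = l a b" "!!a b. a : X ==> b : X ==> l a b *.B E = l a b"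
  and sl: "!!a b f. a : X ==> b : X ==> f : M ==> s (shift (deg a) f) *.B l a b = l a b *.B s f"
  and tl: "!!a b f. a : X ==> b : X ==> f : M ==> t (shift (deg b) f) *.B l a b = l a b *.B t f"
  and RLL: "!!k w. k : X \<times> X ==> w : X \<times> X ==>
   (\<Oplus>.B u\<in>X \<times> X. s (\<Sigma> u k) *.B LL B l u w) = (\<Oplus>.B u\<in>X \<times> X. t (\<Sigma> w u) *.B LL B l k u)"
begin

lemmas stc [simp] = lin_closed[OF s_lin] lin_closed[OF t_lin]

lemma Ec [simp]: "E : B" using stc(1)[of "\<one>.M"] by (simp add: s_one)
lemma s_E: "f : M ==> s f *.B E = s f" "f : M ==> E *.B s f = s f"
  "f : M ==> t f *.B E = t f" "f : M ==> E *.B t f = t f"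
 using s_mult[of f "\<one>.M"] s_mult[of "\<one>.M" f] t_mult[of f "\<one>.M"] t_mult[of "\<one>.M" f] by (simp_all add: s_one t_one)
lemma EE: "E *.B E = E" using s_E(1)[of "\<one>.M"] by (simp add: s_one)

lemma b_st: "bilin K M (op_alg M) B (%f g. s f *.B t g)"
 using bilin_comp[OF B.mult_bilin s_lin t_lin B.id_lin] by simp
lemmas st_lift_lin = CAp.tensor_lift_lin[OF b_st B.md]
lemmas st_lift_tens = CAp.tensor_lift_tens[OF b_st B.md, simplified]

end

text \<open>The inverse matrix is what is needed to extend the homomorphism to \<open>A\<^sub>\<sigma>\<close>.\<close>

locale A_target = rll_target K R \<psi> JR pR qR e X deg \<sigma> B E s t l
 for K :: "('k, 'm) ring_scheme" and R :: "('k, 'r) module" and \<psi> JR pR qR e and X :: "'x set" and deg :: "'x \<Rightarrow> 'l::finite \<Rightarrow> 'l"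
  and \<sigma> and B :: "('k, 'b, 'z) module_scheme" and E s t l +
 fixes m :: "'x \<Rightarrow> 'x \<Rightarrow> 'b"
 assumes mc [simp]: "!!a b. a : X ==> b : X ==> m a b : B"
  and m_unit: "!!a b. a : X ==> b : X ==> E *.B m a b = m a b" "!!a b. a : X ==> b : X ==> m a b *.B E = m a b"
  and lm: "!!a b. a : X ==> b : X ==> (\<Oplus>.B c\<in>X. l a c *.B m c b) = (if a = b then E else \<zero>.B)"
  and ml: "!!a b. a : X ==> b : X ==> (\<Oplus>.B c\<in>X. m a c *.B l c b) = (if a = b then E else \<zero>.B)"
  and sm: "!!a b f. a : X ==> b : X ==> f : M ==> s f *.B m a b = m a b *.B s (shift (deg b) f)"
  and tm: "!!a b f. a : X ==> b : X ==> f : M ==> t f *.B m a b = m a b *.B t (shift (deg a) f)"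
begin

abbreviation "hl \<equiv> target_letter K B s t l m"
abbreviation "hw w \<equiv> foldr (%c v. hl c *.B v) w E"
definition "F0 = (target_free K B E s t l m :: ('k, 'r, 'l, 'x) free_elt \<Rightarrow> 'b)"
definition "FA = induced F0"

lemma hl_closed [simp]: "c : lts ==> hl c : B"
 by (cases c) (auto simp: lin_closed[OF st_lift_lin])

lemma hl_E: "c : lts ==> E *.B hl c = hl c" "c : lts ==> hl c *.B E = hl c"
proof -
 have 1: "E *.B tensor_lift K B (%f g. s f *.B t g) u = tensor_lift K B (%f g. s f *.B t g) u"
  "tensor_lift K B (%f g. s f *.B t g) u *.B E = tensor_lift K B (%f g. s f *.B t g) u" if "u : CA" for u
  by (rule CAp.tensor_lin_eq[OF lin_comp[OF st_lift_lin B.mult_left_lin] st_lift_lin _ that];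
    simp add: st_lift_tens s_E B.A.m_assoc[symmetric])
    (rule CAp.tensor_lin_eq[OF lin_comp[OF st_lift_lin B.mult_right_lin] st_lift_lin _ that];
    simp add: st_lift_tens s_E B.A.m_assoc)
 show "c : lts ==> E *.B hl c = hl c" "c : lts ==> hl c *.B E = hl c"
  by (cases c; auto simp: 1 l_unit m_unit)+
qed

lemma hw_closed [simp]: "w : lists lts ==> hw w : B"
 by (induction w) auto

lemma hw_append: "v : lists lts ==> w : lists lts ==> hw (v @ w) = hw v *.B hw w"
proof (induction v)
 case Nil
 have "E *.B hw w = hw w" using Nil(2)
  by (induction w) (auto simp: EE hl_E B.A.m_assoc[symmetric])
 then show ?case by simp
qed (auto simp: B.A.m_assoc)

lemma F0_lin: "F0 : lin_maps K \<F> B"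
 unfolding F0_def target_free_def free_alg_def by (rule R.lin_ext_lin[OF B.md]) simp

lemma F0_bw: "w : lists lts ==> F0 (basis_elt K w) = hw w"
 unfolding F0_def target_free_def by (rule R.lin_ext_basis_elt[OF B.md]) simp

lemmas F0_closed [simp] = lin_closed[OF F0_lin]

lemma F0_mult: "u : \<F> ==> v : \<F> ==> F0 (u *.\<F> v) = F0 u *.B F0 v"
proof -
 assume u: "u : \<F>" and v: "v : \<F>"
 have 1: "F0 (basis_elt K w *.\<F> v) = F0 (basis_elt K w) *.B F0 v" if w: "w : lists lts" for w
  by (rule Fr_lin_eq[OF lin_comp[OF \<F>.mult_left_lin F0_lin] lin_comp[OF F0_lin B.mult_left_lin] B.md _ v])
    (use w in "simp_all add: bw_mult F0_bw hw_append del: foldr_append")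
 show ?thesis
  by (rule Fr_lin_eq[OF lin_comp[OF \<F>.mult_right_lin F0_lin] lin_comp[OF F0_lin B.mult_right_lin] B.md _ u])
    (use v in "simp_all add: 1")
qed

lemma F0_ltr: "c : lts ==> F0 (lt c) = hl c"
 by (simp add: F0_bw hl_E)

lemma F0_one: "F0 \<one>.\<F> = E" by (simp add: bw_one F0_bw)
lemma F0_zero: "F0 \<zero>.\<F> = \<zero>.B" by (rule lin_zero[OF F0_lin \<F>.md B.md])
lemmas F0_fin = lin_finsum[OF F0_lin \<F>.md B.md]

lemma hl_mult: "u : CA ==> v : CA ==> hl (Coef (u \<otimes>\<^bsub>CA\<^esub> v)) = hl (Coef u) *.B hl (Coef v)"
proof (unfold target_letter.simps, rule CAp.lin_mult_multiplicative[OF B.k_algebra_axioms st_lift_lin])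
 fix f g f' g' assume "f : M" "g : carrier (op_alg M)" "f' : M" "g' : carrier (op_alg M)"
 then have c: "f : M" "g : M" "f' : M" "g' : M" by auto
 have "s f *.B s f' *.B (t g *.B t g') = s f *.B (s f' *.B t g) *.B t g'"
  using c by (simp add: B.A.m_assoc)
 also have "... = s f *.B (t g *.B s f') *.B t g'"
  by (simp only: ts_comm[OF c(3,2)])
 also have "... = s f *.B t g *.B (s f' *.B t g')"
  using c by (simp add: B.A.m_assoc)
 finally show "tensor_lift K B (%f g. s f *.B t g) (cf (f *.M f') (g \<otimes>\<^bsub>op_alg M\<^esub> g'))
   = tensor_lift K B (%f g. s f *.B t g) (cf f g) *.B tensor_lift K B (%f g. s f *.B t g) (cf f' g')"
  using c by (simp add: st_lift_tens s_mult t_mult)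
qed

lemma hl_coef: "f : M ==> g : M ==> hl (Coef (cf f g)) = s f *.B t g"
 by (simp add: st_lift_tens)

lemma rels_kernel: "rels \<subseteq> {u \<in> \<F>. F0 u = \<zero>.B}"
proof -
 let ?Z = "{u \<in> \<F>. F0 u = \<zero>.B}"
 have Z: "u \<ominus>.\<F> v : ?Z" if "F0 u = F0 v" "u : \<F>" "v : \<F>" for u v
  using that lin_minus[OF F0_lin \<F>.md B.md that(2,3)] B.M.minus_zero_iff[of "F0 u" "F0 v"] by simp
 have \<sigma>: "\<sigma> x y z v : M" if "x : X" "y : X" "z : X" "v : X" for x y z v
  using Sigma_closed[of "(x, y)" "(z, v)"] that by (simp add: \<Sigma>_def)
 have l10: "F0 (finsum \<F> (%(x, y). lt (Coef (cf (\<sigma> x y a c) \<one>.M)) *.\<F> lt (Lgen y d) *.\<F> lt (Lgen x b)) Y)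
   = (\<Oplus>.B u\<in>X \<times> X. s (\<Sigma> u (a, c)) *.B LL B l u (b, d))"
  if "a : X" "b : X" "c : X" "d : X" for a b c d
  using that \<sigma> by (subst F0_fin) (auto simp: F0_ltr F0_mult hl_coef s_one t_one s_E \<Sigma>_def LL_def B.A.m_assoc
     simp del: target_letter.simps(1) intro!: B.M.finsum_eqI)
 have r10: "F0 (finsum \<F> (%(x, y). lt (Coef (cf \<one>.M (\<sigma> b d x y))) *.\<F> lt (Lgen c y) *.\<F> lt (Lgen a x)) Y)
   = (\<Oplus>.B u\<in>X \<times> X. t (\<Sigma> (b, d) u) *.B LL B l (a, c) u)"
  if "a : X" "b : X" "c : X" "d : X" for a b c d
  using that \<sigma> by (subst F0_fin) (auto simp: F0_ltr F0_mult hl_coef s_one t_one s_E \<Sigma>_def LL_def B.A.m_assoc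
     simp del: target_letter.simps(1) intro!: B.M.finsum_eqI)
 show ?thesis
  unfolding A_rels_def
 proof ((intro Un_least subsetI; elim CollectE exE conjE singletonE; hypsubst), goal_cases)
  case 1 then show ?case
   by (intro Z) (simp_all add: F0_ltr lin_add[OF F0_lin] lin_add[OF st_lift_lin])
 next
  case 2 then show ?case
   by (intro Z) (simp_all add: F0_ltr lin_smult[OF F0_lin] lin_smult[OF st_lift_lin])
 next
  case 3 then show ?case
   by (intro Z) (simp_all add: F0_ltr F0_mult hl_mult del: target_letter.simps)
 next
  case (4 u a b)
  then have "F0 (\<Oplus>.\<F> c\<in>X. lt (Lgen a c) *.\<F> lt (Linv c b)) = (if a = b then E else \<zero>.B)"
   by (subst F0_fin) (auto simp: F0_mult F0_ltr lm[symmetric] simp del: target_letter.simps(1) intro!: B.M.finsum_eqI)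
  then show ?case using 4 by (intro Z) (auto simp: F0_one F0_zero intro!: \<F>.M.finsum_closedI)
 next
  case (5 u a b)
  then have "F0 (\<Oplus>.\<F> c\<in>X. lt (Linv a c) *.\<F> lt (Lgen c b)) = (if a = b then E else \<zero>.B)"
   by (subst F0_fin) (auto simp: F0_mult F0_ltr ml[symmetric] simp del: target_letter.simps(1) intro!: B.M.finsum_eqI)
  then show ?case using 5 by (intro Z) (auto simp: F0_one F0_zero intro!: \<F>.M.finsum_closedI)
 next
  case 6 then show ?case
   by (intro Z) (simp_all add: F0_ltr F0_mult hl_coef s_one t_one s_E sl del: target_letter.simps(1))
 next
  case 7 then show ?case
   by (intro Z) (simp_all add: F0_ltr F0_mult hl_coef s_one t_one s_E tl del: target_letter.simps(1))
 next
  case 8 then show ?case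
   by (intro Z) (simp_all add: F0_ltr F0_mult hl_coef s_one t_one s_E sm del: target_letter.simps(1))
 next
  case 9 then show ?case
   by (intro Z) (simp_all add: F0_ltr F0_mult hl_coef s_one t_one s_E tm del: target_letter.simps(1))
 next
  case 10
  then show ?case using \<sigma> by (intro Z) (auto simp: r10 l10 RLL intro!: \<F>.M.finsum_closedI)
 next
  case 11 then show ?case
   by (intro Z) (simp_all add: F0_one F0_ltr hl_coef s_one t_one EE del: target_letter.simps(1))
 qed
qed

lemma F0_kernel: "n : IA ==> F0 n = \<zero>.B"
proof -
 have "ideal {u \<in> \<F>. F0 u = \<zero>.B} \<F>"
  by (rule kernel_ideal[OF \<F>.k_algebra_axioms B.k_algebra_axioms F0_lin]) (rule F0_mult)
 then show "n : IA ==> F0 n = \<zero>.B"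
  using \<F>.A.genideal_minimal[OF _ rels_kernel] by (auto simp: A_ideal_def)
qed

lemma FA_lin: "FA : lin_maps K \<A> B"
 unfolding FA_def Aa_eq by (rule IA.induced_lin[OF F0_lin B.md F0_kernel])
lemma FA_cls: "u : \<F> ==> FA (cls u) = F0 u"
 unfolding FA_def cls_eq by (rule IA.induced_cls[OF F0_lin B.md F0_kernel])

lemma FA_mult: "x : \<A> ==> y : \<A> ==> FA (x *.\<A> y) = FA x *.B FA y"
 by (elim cls_cases) (simp add: cls_mult[symmetric] FA_cls F0_mult)

lemma FA_one: "FA \<one>.\<A> = E" by (simp add: cls_one[symmetric] FA_cls F0_one)
lemma FA_s: "f : M ==> FA (sA f) = s f"
 by (simp add: sA_eq FA_cls F0_ltr hl_coef t_one s_E del: target_letter.simps(1))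
lemma FA_t: "f : M ==> FA (tA f) = t f"
 by (simp add: tA_eq FA_cls F0_ltr hl_coef s_one s_E del: target_letter.simps(1))
lemma FA_L: "a : X ==> b : X ==> FA (LA a b) = l a b" by (simp add: FA_cls F0_ltr)
lemma FA_N: "a : X ==> b : X ==> FA (NA a b) = m a b" by (simp add: FA_cls F0_ltr)

end

section \<open>The comultiplication of an algebra with an \<open>RLL\<close> matrix\<close>

context base_maps begin

text \<open>Relations among elements commuting with \<open>E\<close> carry over to the corner algebra cut out by \<open>E\<close>.\<close>

lemma corner:
 assumes "x : T" "y : T" "x *.T E = E *.T x"
 shows "(E *.T x) *.T (E *.T y) = E *.T (x *.T y)"
proof -
 have "(E *.T x) *.T (E *.T y) = E *.T (x *.T E) *.T y"
  using assms(1,2) by (simp add: T.A.m_assoc)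
 also have "... = (E *.T E) *.T x *.T y"
  unfolding assms(3) using assms(1,2) by (simp add: T.A.m_assoc)
 finally show ?thesis using assms(1,2) E_idem by (simp add: T.A.m_assoc)
qed

lemma corner_right:
 assumes "x : T" "x *.T E = E *.T x"
 shows "(E *.T x) *.T E = E *.T x"
 using corner[OF assms(1) T.A.one_closed assms(2)] assms(1) by simp

lemma corner_left:
 assumes "x : T"
 shows "E *.T (E *.T x) = E *.T x"
 using assms E_idem by (simp add: T.A.m_assoc[symmetric])

lemma comm_finsum:
 assumes "!!i. i : S ==> x i : T" "!!i. i : S ==> x i *.T E = E *.T x i"
 shows "finsum T x S *.T E = E *.T finsum T x S"
 using assms by (subst T.finsum_mult_right) (auto simp: T.finsum_mult_left intro!: T.M.finsum_eqI)

lemma tt_finsum_left: "(!!i. i : S ==> x i : B) ==> y : B ==> tt (finsum B x S) y = (\<Oplus>.T i\<in>S. tt (x i) y)"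
 by (rule lin_finsum[OF bilin_left[OF BB.tens_bilin] B.md T.md])
lemma tt_finsum_right: "(!!i. i : S ==> y i : B) ==> x : B ==> tt x (finsum B y S) = (\<Oplus>.T i\<in>S. tt x (y i))"
 by (rule lin_finsum[OF bilin_right[OF BB.tens_bilin] B.md T.md])

end

context ybe_data begin

lemma shift_psi_X: "a : X ==> f : M ==> \<psi>M (Tr a f) = \<psi>M f" "a : X ==> f : M ==> \<psi>M (Ti a f) = \<psi>M f"
 using shift_psi[OF deg_bij] shift_psi[OF bij_imp_bij_inv[OF deg_bij]] by auto

end

locale rll_algebra = rll_target K R \<psi> JR pR qR e X deg \<sigma> B "\<one>.B" s t l
 for K :: "('k, 'm) ring_scheme" and R :: "('k, 'r) module" and \<psi> JR pR qR e and X :: "'x set" and deg :: "'x \<Rightarrow> 'l::finite \<Rightarrow> 'l"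
  and \<sigma> and B :: "('k, 'b, 'z) module_scheme" and s t l
begin

sublocale Bm: base_maps K B M \<psi>M JM pM qM s t
 by unfold_locales (auto intro: s_lin t_lin s_mult t_mult s_one t_one ts_comm)

abbreviation "T \<equiv> tensor K B B"
abbreviation "tb \<equiv> tens K B B"
abbreviation "EB \<equiv> Bm.E"

definition "Dl a b = (\<Oplus>.T c\<in>X. tb (l a c) (l c b))"
abbreviation "sDl f \<equiv> EB *.T tb (s f) \<one>.B"
abbreviation "tDl f \<equiv> EB *.T tb \<one>.B (t f)"
abbreviation "lDl a b \<equiv> EB *.T Dl a b"

lemma LLl_closed [simp]: "u : Y ==> w : Y ==> LL B l u w : B"
 by (auto simp: LL_def)

lemma Dl_closed [simp]: "a : X ==> b : X ==> Dl a b : T"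
 unfolding Dl_def by (auto intro!: Bm.T.M.finsum_closedI)

lemma Dl_comm: "a : X ==> b : X ==> Dl a b *.T EB = EB *.T Dl a b"
 unfolding Dl_def
proof (rule Bm.comm_finsum)
 fix c assume ab: "a : X" "b : X" and c: "c : X"
 show "tb (l a c) (l c b) *.T EB = EB *.T tb (l a c) (l c b)"
  by (rule Bm.E_comm_twist[OF _ _ shift_lin[of "deg c"] shift_lin[of "inv_into UNIV (deg c)"] shift_mult])
    (use ab c in "simp_all add: Tr_Ti shift_psi_X sl tl")
qed simp

lemma st_comm:
 "f : M ==> tb (s f) \<one>.B *.T EB = EB *.T tb (s f) \<one>.B"
 "f : M ==> tb \<one>.B (t f) *.T EB = EB *.T tb \<one>.B (t f)"
 using Bm.E_comm_st[of f "\<one>.M"] Bm.E_comm_st[of "\<one>.M" f] by (simp_all add: Bm.s_one Bm.t_one)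

lemma LL_D:
 assumes u: "u : Y" and w: "w : Y"
 shows "LL T lDl u w = EB *.T (\<Oplus>.T x\<in>Y. tb (LL B l u x) (LL B l x w))"
proof -
 have X: "fst u : X" "snd u : X" "fst w : X" "snd w : X" using u w by auto
 have "LL T lDl u w = EB *.T (Dl (snd u) (snd w) *.T Dl (fst u) (fst w))"
  unfolding LL_def using X by (intro Bm.corner Dl_comm) simp_all
 also have "Dl (snd u) (snd w) *.T Dl (fst u) (fst w) = (\<Oplus>.T d\<in>X. \<Oplus>.T c\<in>X. tb (LL B l u (c, d)) (LL B l (c, d) w))"
  unfolding Dl_def LL_def using X by (subst Bm.T.finsum_mult_finsum) (auto simp: Bm.BB.tens_mult intro!: Bm.T.M.finsum_eqI Bm.T.M.finsum_closedI)
 also have "... = (\<Oplus>.T c\<in>X. \<Oplus>.T d\<in>X. tb (LL B l u (c, d)) (LL B l (c, d) w))"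
  using u w finX by (intro Bm.T.M.finsum_swap) auto
 also have "... = (\<Oplus>.T x\<in>Y. tb (LL B l u x) (LL B l x w))"
  using Bm.T.M.finsum_prod[of X X "%c d. tb (LL B l u (c, d)) (LL B l (c, d) w)"] u w finX by (simp add: case_prod_unfold)
 finally show ?thesis .
qed

lemma EB_lin_sum: "(!!i. i : S ==> x i : T) ==> EB *.T finsum T x S = (\<Oplus>.T i\<in>S. EB *.T x i)"
 by (rule Bm.T.finsum_mult_left[OF Bm.E_closed])

text \<open>The exchange relation is applied on the left leg, where it produces a factor \<open>t(\<Sigma>)\<close>; \<open>E\<close> moves this factor to
  the right leg as \<open>s(\<Sigma>)\<close>, and there the exchange relation is applied once more.\<close>

lemma RLL_D:
 assumes k: "k : Y" and w: "w : Y"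
 shows "(\<Oplus>.T u\<in>Y. sDl (\<Sigma> u k) *.T LL T lDl u w) = (\<Oplus>.T u\<in>Y. tDl (\<Sigma> w u) *.T LL T lDl k u)"
proof -
 let ?L = "LL B l"
 let ?f = "%u x. tb (s (\<Sigma> u k) *.B ?L u x) (?L x w)" and ?g = "%u x. EB *.T tb (?L k u) (s (\<Sigma> x u) *.B ?L x w)"
  and ?h = "%u x. EB *.T tb (?L k u) (t (\<Sigma> w x) *.B ?L u x)"
 note fc = Bm.T.M.finsum_closedI and fe = Bm.T.M.finsum_eqI and fs = Bm.T.M.finsum_swap
 have finY: "finite Y" using finX by simp
 have "(\<Oplus>.T u\<in>Y. sDl (\<Sigma> u k) *.T LL T lDl u w)
   = (\<Oplus>.T u\<in>Y. EB *.T (\<Oplus>.T x\<in>Y. ?f u x))"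
 proof (rule fe)
  fix u assume u: "u : Y"
  have "sDl (\<Sigma> u k) *.T LL T lDl u w = EB *.T (tb (s (\<Sigma> u k)) \<one>.B *.T (\<Oplus>.T x\<in>Y. tb (?L u x) (?L x w)))"
   unfolding LL_D[OF u w] using u w k by (intro Bm.corner st_comm) (auto intro!: fc)
  also have "tb (s (\<Sigma> u k)) \<one>.B *.T (\<Oplus>.T x\<in>Y. tb (?L u x) (?L x w)) = (\<Oplus>.T x\<in>Y. ?f u x)"
   using u w k by (subst Bm.T.finsum_mult_left) (auto simp: Bm.BB.tens_mult intro!: fe)
  finally show "sDl (\<Sigma> u k) *.T LL T lDl u w = EB *.T (\<Oplus>.T x\<in>Y. ?f u x)" .
 qed (use k w in "auto intro!: fc Bm.T.A.m_closed")
 also have "... = EB *.T (\<Oplus>.T u\<in>Y. \<Oplus>.T x\<in>Y. ?f u x)"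
  by (rule EB_lin_sum[symmetric]) (use k w in "auto intro!: fc")
 also have "(\<Oplus>.T u\<in>Y. \<Oplus>.T x\<in>Y. ?f u x)
   = (\<Oplus>.T x\<in>Y. \<Oplus>.T u\<in>Y. ?f u x)"
  by (rule fs) (use k w finY in auto)
 also have "... = (\<Oplus>.T x\<in>Y. \<Oplus>.T u\<in>Y. tb (t (\<Sigma> x u) *.B ?L k u) (?L x w))"
 proof (rule fe)
  fix x assume x: "x : Y"
  show "(\<Oplus>.T u\<in>Y. ?f u x) = (\<Oplus>.T u\<in>Y. tb (t (\<Sigma> x u) *.B ?L k u) (?L x w))"
   using Bm.tt_finsum_left[of Y "%u. s (\<Sigma> u k) *.B ?L u x" "?L x w"] Bm.tt_finsum_left[of Y "%u. t (\<Sigma> x u) *.B ?L k u" "?L x w"]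
    RLL[OF k x] x k w by simp
 qed (use k w in "auto intro!: fc")
 also have "EB *.T ... = (\<Oplus>.T x\<in>Y. \<Oplus>.T u\<in>Y. EB *.T tb (t (\<Sigma> x u) *.B ?L k u) (?L x w))"
  using k w by (subst EB_lin_sum) (auto intro!: fc fe EB_lin_sum)
 also have "... = (\<Oplus>.T x\<in>Y. \<Oplus>.T u\<in>Y. ?g u x)"
  by (intro fe Bm.E_balance) (use k w in "auto intro!: fc")
 also have "... = (\<Oplus>.T u\<in>Y. \<Oplus>.T x\<in>Y. ?g u x)"
  by (rule fs) (use k w finY in auto)
 also have "... = (\<Oplus>.T u\<in>Y. \<Oplus>.T x\<in>Y. ?h u x)"
 proof (rule fe)
  fix u assume u: "u : Y"
  have e: "(\<Oplus>.T x\<in>Y. EB *.T tb (?L k u) (g x)) = EB *.T tb (?L k u) (finsum B g Y)" if "!!x. x : Y ==> g x : B" for g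
   using that u k by (subst Bm.tt_finsum_right, simp, simp, subst EB_lin_sum) auto
  show "(\<Oplus>.T x\<in>Y. ?g u x) = (\<Oplus>.T x\<in>Y. ?h u x)"
   using RLL[OF u w] u w k by (subst (1 2) e) simp_all
 qed (use k w in "auto intro!: fc")
 also have "... = (\<Oplus>.T x\<in>Y. \<Oplus>.T u\<in>Y. ?h u x)"
  by (rule fs) (use k w finY in auto)
 also have "... = (\<Oplus>.T x\<in>Y. tDl (\<Sigma> w x) *.T LL T lDl k x)"
 proof (rule fe)
  fix x assume x: "x : Y"
  have "tDl (\<Sigma> w x) *.T LL T lDl k x = EB *.T (tb \<one>.B (t (\<Sigma> w x)) *.T (\<Oplus>.T u\<in>Y. tb (?L k u) (?L u x)))"
   unfolding LL_D[OF k x] using x w k by (intro Bm.corner st_comm) (auto intro!: fc)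
  also have "... = (\<Oplus>.T u\<in>Y. ?h u x)"
   using x w k by (subst Bm.T.finsum_mult_left, simp, simp, subst EB_lin_sum) (auto simp: Bm.BB.tens_mult intro!: fe)
  finally show "(\<Oplus>.T u\<in>Y. ?h u x) = tDl (\<Sigma> w x) *.T LL T lDl k x" by simp
 qed (use k w in "auto intro!: fc simp: LL_D")
 finally show ?thesis .
qed

lemma tt_one_lin: "(%x. tb x \<one>.B) : lin_maps K B T" "tb \<one>.B : lin_maps K B T"
 using bilin_left[OF Bm.BB.tens_bilin, of "\<one>.B"] bilin_right[OF Bm.BB.tens_bilin, of "\<one>.B"] by auto

lemma EB_mult: "x : T ==> y : T ==> x *.T EB = EB *.T x ==>
  x *.T y = z ==> (EB *.T x) *.T (EB *.T y) = EB *.T z"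
 using Bm.corner by auto

lemma Dl_s: "a : X ==> b : X ==> f : M ==> tb (s (Tr a f)) \<one>.B *.T Dl a b = Dl a b *.T tb (s f) \<one>.B"
 unfolding Dl_def by (subst Bm.T.finsum_mult_left, simp, simp, subst Bm.T.finsum_mult_right)
  (auto simp: Bm.BB.tens_mult sl intro!: Bm.T.M.finsum_eqI)
lemma Dl_t: "a : X ==> b : X ==> f : M ==> tb \<one>.B (t (Tr b f)) *.T Dl a b = Dl a b *.T tb \<one>.B (t f)"
 unfolding Dl_def by (subst Bm.T.finsum_mult_left, simp, simp, subst Bm.T.finsum_mult_right)
  (auto simp: Bm.BB.tens_mult tl intro!: Bm.T.M.finsum_eqI)

lemma D_rll: "rll_target K R \<psi> JR pR qR e X deg \<sigma> T EB (%f. sDl f) (%f. tDl f) lDl"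
proof (intro rll_target.intro ybe_data_axioms Bm.T.k_algebra_axioms rll_target_axioms.intro)
 show "(%f. sDl f) : lin_maps K M T"
  by (rule lin_comp[OF s_lin lin_comp[OF tt_one_lin(1) Bm.T.mult_left_lin[OF Bm.E_closed]]])
 show "(%f. tDl f) : lin_maps K M T"
  by (rule lin_comp[OF t_lin lin_comp[OF tt_one_lin(2) Bm.T.mult_left_lin[OF Bm.E_closed]]])
next
 fix f g assume fg: "f : M" "g : M"
 show "sDl (f *.M g) = sDl f *.T sDl g" "tDl (f *.M g) = tDl g *.T tDl f"
  using fg by (intro EB_mult[symmetric] st_comm; simp add: Bm.BB.tens_mult s_mult t_mult)+
 have "tDl g *.T sDl f = EB *.T tb (s f) (t g)" "sDl f *.T tDl g = EB *.T tb (s f) (t g)"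
  using fg by (intro EB_mult st_comm; simp add: Bm.BB.tens_mult)+
 then show "tDl g *.T sDl f = sDl f *.T tDl g" by simp
next
 show "sDl \<one>.M = EB" "tDl \<one>.M = EB" by (simp_all add: s_one t_one Bm.BB.tens_one)
next
 fix a b assume ab: "a : X" "b : X"
 show "lDl a b : T" using ab by simp_all
 show "EB *.T lDl a b = lDl a b" "lDl a b *.T EB = lDl a b"
  using ab by (simp_all add: Bm.corner_left Bm.corner_right Dl_comm)
 fix f assume f: "f : M"
 show "sDl (Tr a f) *.T lDl a b = lDl a b *.T sDl f"
  using ab f by (simp add: Bm.corner st_comm Dl_comm Dl_s)
 show "tDl (Tr b f) *.T lDl a b = lDl a b *.T tDl f"
  using ab f by (simp add: Bm.corner st_comm Dl_comm Dl_t)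
next
 fix k w assume "k : Y" "w : Y"
 then show "(\<Oplus>.T u\<in>Y. sDl (\<Sigma> u k) *.T LL T lDl u w) = (\<Oplus>.T u\<in>Y. tDl (\<Sigma> w u) *.T LL T lDl k u)"
  by (rule RLL_D)
qed

end

section \<open>The comultiplication of \<open>A\<^sub>\<sigma>\<close>\<close>

context ybe_data begin

abbreviation "\<T> \<equiv> Ab.T"
abbreviation "tt \<equiv> Ab.tt"
abbreviation "E2 \<equiv> Ab.E"

definition "DL a b = (\<Oplus>.\<T> c\<in>X. tt (LA a c) (LA c b))"
lemma A_rll: "rll_algebra K R \<psi> JR pR qR e X deg \<sigma> \<A> sA tA (%a b. LA a b)"
 by (intro rll_algebra.intro rll_target.intro ybe_data_axioms \<A>.k_algebra_axioms rll_target_axioms.intro)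
   (simp_all add: Ab.s_lin Ab.t_lin Ab.s_mult Ab.t_mult Ab.s_one Ab.t_one Ab.ts_comm sL tL RLL_A)

interpretation Al: rll_algebra K R \<psi> JR pR qR e X deg \<sigma> \<A> sA tA "%a b. LA a b"
 by (rule A_rll)

lemma DL_Al: "Al.Dl = DL" by (intro ext) (simp add: Al.Dl_def DL_def)
lemmas DL_comm = Al.Dl_comm[unfolded DL_Al] and st_comm = Al.st_comm
 and DL_s = Al.Dl_s[unfolded DL_Al] and DL_t = Al.Dl_t[unfolded DL_Al]
 and D_rll = Al.D_rll[unfolded DL_Al]

definition "DN a b = (\<Oplus>.\<T> c\<in>X. tt (NA c b) (NA a c))"

lemma LN_closed [simp]: "a : X ==> b : X ==> LA a b : \<A>" "a : X ==> b : X ==> NA a b : \<A>"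
 by simp_all

lemma D_closed [simp]: "a : X ==> b : X ==> DL a b : \<T>" "a : X ==> b : X ==> DN a b : \<T>"
 unfolding DL_def DN_def by (auto intro!: Ab.T.M.finsum_closedI)

lemma Ti_N:
 assumes "a : X" "b : X" "f : M"
 shows "sA (Ti b f) *.\<A> NA a b = NA a b *.\<A> sA f" "tA (Ti a f) *.\<A> NA a b = NA a b *.\<A> tA f"
 using sN[of a b "Ti b f"] tN[of a b "Ti a f"] assms by (simp_all add: Tr_Ti)

lemma DN_comm: "a : X ==> b : X ==> DN a b *.\<T> E2 = E2 *.\<T> DN a b"
 unfolding DN_def
proof (rule Ab.comm_finsum)
 fix c assume ab: "a : X" "b : X" and c: "c : X"
 show "tt (NA c b) (NA a c) *.\<T> E2 = E2 *.\<T> tt (NA c b) (NA a c)"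
  by (rule Ab.E_comm_twist[OF _ _ shift_lin[of "inv_into UNIV (deg c)"] shift_lin[of "deg c"] shift_mult])
    (use ab c in "simp_all add: Tr_Ti shift_psi_X Ti_N")
qed simp

lemma DL_DN:
 assumes ab: "a : X" "b : X"
 shows "(\<Oplus>.\<T> c\<in>X. DL a c *.\<T> DN c b) = unit_mat \<T> a b" "(\<Oplus>.\<T> c\<in>X. DN a c *.\<T> DL c b) = unit_mat \<T> a b"
 unfolding DL_def DN_def
 using ab lin_zero[OF bilin_left[OF Ab.BB.tens_bilin] \<A>.md Ab.T.md] lin_zero[OF bilin_right[OF Ab.BB.tens_bilin] \<A>.md Ab.T.md]
 by (subst Ab.BB.tens_sum_inverse(1)[OF finX] Ab.BB.tens_sum_inverse(2)[OF finX]; auto simp: LN NL Ab.BB.tens_one)+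

abbreviation "sD f \<equiv> E2 *.\<T> tt (sA f) \<one>.\<A>"
abbreviation "tD f \<equiv> E2 *.\<T> tt \<one>.\<A> (tA f)"
abbreviation "lD a b \<equiv> E2 *.\<T> DL a b"
abbreviation "mD a b \<equiv> E2 *.\<T> DN a b"

lemma E2_lin_sum: "(!!i. i : S ==> x i : \<T>) ==> E2 *.\<T> finsum \<T> x S = (\<Oplus>.\<T> i\<in>S. E2 *.\<T> x i)"
 by (rule Ab.T.finsum_mult_left[OF Ab.E_closed])

end

context ybe_data begin

lemma DN_s: "a : X ==> b : X ==> f : M ==> tt (sA f) \<one>.\<A> *.\<T> DN a b = DN a b *.\<T> tt (sA (Tr b f)) \<one>.\<A>"
 unfolding DN_def by (subst Ab.T.finsum_mult_left, simp, simp, subst Ab.T.finsum_mult_right)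
  (auto simp: Ab.BB.tens_mult sN intro!: Ab.T.M.finsum_eqI)
lemma DN_t: "a : X ==> b : X ==> f : M ==> tt \<one>.\<A> (tA f) *.\<T> DN a b = DN a b *.\<T> tt \<one>.\<A> (tA (Tr a f))"
 unfolding DN_def by (subst Ab.T.finsum_mult_left, simp, simp, subst Ab.T.finsum_mult_right)
  (auto simp: Ab.BB.tens_mult tN intro!: Ab.T.M.finsum_eqI)

lemma E2_kron_sum:
 assumes "!!c. c : X ==> x c : \<T>" "!!c. c : X ==> y c : \<T>" "!!c. c : X ==> x c *.\<T> E2 = E2 *.\<T> x c"
  and "(\<Oplus>.\<T> c\<in>X. x c *.\<T> y c) = unit_mat \<T> a b"
 shows "(\<Oplus>.\<T> c\<in>X. (E2 *.\<T> x c) *.\<T> (E2 *.\<T> y c)) = (if a = b then E2 else \<zero>.\<T>)"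
proof -
 have "(\<Oplus>.\<T> c\<in>X. (E2 *.\<T> x c) *.\<T> (E2 *.\<T> y c)) = (\<Oplus>.\<T> c\<in>X. E2 *.\<T> (x c *.\<T> y c))"
  using assms by (intro Ab.T.M.finsum_eqI Ab.corner) auto
 also have "... = E2 *.\<T> (\<Oplus>.\<T> c\<in>X. x c *.\<T> y c)" using assms by (intro E2_lin_sum[symmetric]) auto
 finally show ?thesis using assms(4) by simp
qed

lemma D_target: "A_target K R \<psi> JR pR qR e X deg \<sigma> \<T> E2 (%f. sD f) (%f. tD f) lD mD"
proof (intro A_target.intro D_rll A_target_axioms.intro)
 fix a b assume ab: "a : X" "b : X"
 show "mD a b : \<T>" using ab by simp_all
 show "E2 *.\<T> mD a b = mD a b" "mD a b *.\<T> E2 = mD a b"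
  using ab by (simp_all add: Ab.corner_left Ab.corner_right DN_comm)
 show "(\<Oplus>.\<T> c\<in>X. lD a c *.\<T> mD c b) = (if a = b then E2 else \<zero>.\<T>)"
  using ab by (intro E2_kron_sum DL_DN(1) DL_comm) simp_all
 show "(\<Oplus>.\<T> c\<in>X. mD a c *.\<T> lD c b) = (if a = b then E2 else \<zero>.\<T>)"
  using ab by (intro E2_kron_sum DL_DN(2) DN_comm) simp_all
 fix f assume f: "f : M"
 show "sD f *.\<T> mD a b = mD a b *.\<T> sD (Tr b f)"
  using ab f by (simp add: Ab.corner st_comm DN_comm DN_s)
 show "tD f *.\<T> mD a b = mD a b *.\<T> tD (Tr a f)"
  using ab f by (simp add: Ab.corner st_comm DN_comm DN_t)
qed

interpretation DT: A_target K R \<psi> JR pR qR e X deg \<sigma> \<T> E2 "%f. sD f" "%f. tD f" lD mD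
 by (rule D_target)

abbreviation "cl \<equiv> A_comult_letter K R X deg \<sigma>"

lemma b_tt_st: "bilin K M (op_alg M) \<T> (%f g. tt (sA f) (tA g))"
 using bilin_comp[OF Ab.BB.tens_bilin Ab.s_lin Ab.t_lin Ab.T.id_lin]
 by (simp add: bilin_def op_alg_simps lin_maps_op)

lemma cl_props:
 assumes "c : lts"
 shows "cl c : \<T>" "cl c *.\<T> E2 = E2 *.\<T> cl c" "DT.hl c = E2 *.\<T> cl c"
proof -
 note l = CAp.tensor_lift_lin[OF b_tt_st Ab.T.md] and t = CAp.tensor_lift_tens[OF b_tt_st Ab.T.md, simplified]
 have "cl c : \<T> \<and> cl c *.\<T> E2 = E2 *.\<T> cl c \<and> DT.hl c = E2 *.\<T> cl c"
 proof (cases c)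
  case (Coef u)
  then have u: "u : CA" using assms by simp
  have "cl c *.\<T> E2 = E2 *.\<T> cl c" unfolding Coef A_comult_letter.simps
   by (rule CAp.tensor_lin_eq[OF lin_comp[OF l Ab.T.mult_right_lin[OF Ab.E_closed]] lin_comp[OF l Ab.T.mult_left_lin[OF Ab.E_closed]] _ u])
     (simp add: t Ab.E_comm_st)
  moreover have "DT.hl c = E2 *.\<T> cl c" unfolding Coef A_comult_letter.simps target_letter.simps
   by (rule CAp.tensor_lin_eq[OF DT.st_lift_lin lin_comp[OF l Ab.T.mult_left_lin[OF Ab.E_closed]] _ u])
     (simp add: t DT.st_lift_tens Ab.corner st_comm Ab.BB.tens_mult)
  ultimately show ?thesis using lin_closed[OF l u] Coef by simp
 next
  case (Lgen a b)
  then have "cl c = DL a b" by (simp add: DL_def)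
  then show ?thesis using Lgen assms by (simp add: DL_comm del: A_comult_letter.simps)
 next
  case (Linv a b)
  then have "cl c = DN a b" by (simp add: DN_def)
  then show ?thesis using Linv assms by (simp add: DN_comm del: A_comult_letter.simps)
 qed
 then show "cl c : \<T>" "cl c *.\<T> E2 = E2 *.\<T> cl c" "DT.hl c = E2 *.\<T> cl c" by auto
qed

abbreviation "clw w \<equiv> foldr (%c v. cl c *.\<T> v) w \<one>.\<T>"

lemma clw_props: "w : lists lts ==> clw w : \<T> \<and> DT.hw w = E2 *.\<T> clw w"
proof (induction w)
 case (Cons c w)
 then have c: "c : lts" and w: "clw w : \<T>" "DT.hw w = E2 *.\<T> clw w" by auto
 show ?case using w cl_props[OF c] Ab.corner[OF cl_props(1)[OF c] w(1) cl_props(2)[OF c]]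
  by (simp del: A_comult_letter.simps target_letter.simps)
qed simp

abbreviation "Dfree \<equiv> A_comult_free K R X deg \<sigma>"

lemma Dfree_lin: "Dfree : lin_maps K \<F> \<T>"
 unfolding A_comult_free_def by (subst free_alg_def, rule R.lin_ext_lin[OF Ab.T.md]) (use clw_props in blast)

text \<open>The comultiplication of the bialgebroid is given on words without the factor \<open>E\<close>; multiplication by
  \<open>E\<close>, which commutes with the image of every letter, makes it the universal map into the corner.\<close>

lemma Dfree_E: "u : \<F> ==> E2 *.\<T> Dfree u = DT.F0 u"
proof (rule Fr_lin_eq[OF lin_comp[OF Dfree_lin Ab.T.mult_left_lin[OF Ab.E_closed]] DT.F0_lin Ab.T.md])
 fix w assume w: "w : lists lts"
 have "Dfree (basis_elt K w) = clw w"
  unfolding A_comult_free_def by (rule R.lin_ext_basis_elt[OF Ab.T.md]) (use clw_props[OF w] in blast)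
 then show "E2 *.\<T> Dfree (basis_elt K w) = DT.F0 (basis_elt K w)"
  using clw_props[OF w] by (simp add: DT.F0_bw[OF w])
qed

abbreviation "AB \<equiv> weak_bialg_of K (A_bialgebroid K R X deg \<sigma>) \<psi>M (map_e K R e)"

lemma Abd_simps: "carrier (A_bialgebroid K R X deg \<sigma>) = carrier \<A>" "mult (A_bialgebroid K R X deg \<sigma>) = mult \<A>"
 "one (A_bialgebroid K R X deg \<sigma>) = one \<A>" "zero (A_bialgebroid K R X deg \<sigma>) = zero \<A>"
 "add (A_bialgebroid K R X deg \<sigma>) = add \<A>" "smult (A_bialgebroid K R X deg \<sigma>) = smult \<A>"
 "source (A_bialgebroid K R X deg \<sigma>) = sA" "target (A_bialgebroid K R X deg \<sigma>) = tA"
 "lcounit (A_bialgebroid K R X deg \<sigma>) = (%a. chi K R deg a \<one>.M)"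
 "lcomult (A_bialgebroid K R X deg \<sigma>) = induced (%u. balanced_class K \<A> M sA tA (Dfree u))"
 by (simp_all add: A_bialgebroid_def module.defs left_bialgebroid.defs)

lemma AB_simps [simp]: "carrier AB = carrier \<A>" "mult AB = mult \<A>" "one AB = one \<A>" "zero AB = zero \<A>"
 "add AB = add \<A>" "smult AB = smult \<A>"
 by (simp_all add: weak_bialg_of_simps Abd_simps)

lemma AB_tensor [simp]: "tensor K AB AB = \<T>" "tens K AB AB = tt"
 by (rule tensor_ext; simp)+

lemma AB_comult_cls: "u : \<F> ==> comult AB (cls u) = DT.F0 u"
proof -
 assume u: "u : \<F>"
 have t: "tensor K (A_bialgebroid K R X deg \<sigma>) (A_bialgebroid K R X deg \<sigma>) = \<T>"
  "tens K (A_bialgebroid K R X deg \<sigma>) (A_bialgebroid K R X deg \<sigma>) = tt"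
  by (rule tensor_ext; simp add: Abd_simps)+
 have "comult AB (cls u) = E2 *.\<T> Dfree u"
  unfolding weak_bialg_of_simps(8) Abd_simps t A_cls_def
  by (rule Ab.weak_comult_quot[OF map_e_eq IA.quotient_module_axioms Dfree_lin _ u])
    (use Dfree_E DT.F0_kernel ideal.Icarr[OF IA_ideal] in auto)
 then show ?thesis by (simp add: Dfree_E u)
qed

lemma AB_comult: "a : \<A> ==> comult AB a = DT.FA a"
 by (elim cls_cases) (simp add: AB_comult_cls DT.FA_cls)

lemma AB_comult_facts:
 "comult AB : lin_maps K \<A> \<T>"
 "!!a b. a : \<A> ==> b : \<A> ==> comult AB (a *.\<A> b) = comult AB a *.\<T> comult AB b"
 "comult AB \<one>.\<A> = E2"
 "!!f. f : M ==> comult AB (sA f) = sD f" "!!f. f : M ==> comult AB (tA f) = tD f"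
 "!!a b. a : X ==> b : X ==> comult AB (LA a b) = lD a b"
 "!!a b. a : X ==> b : X ==> comult AB (NA a b) = mD a b"
proof -
 show "comult AB : lin_maps K \<A> \<T>"
  by (rule lin_mapsI) (simp_all add: AB_comult lin_closed[OF DT.FA_lin] lin_add[OF DT.FA_lin] lin_smult[OF DT.FA_lin])
qed (simp_all add: AB_comult DT.FA_mult DT.FA_one DT.FA_s DT.FA_t DT.FA_L DT.FA_N)

section \<open>The counit of \<open>A\<^sub>\<sigma>\<close>\<close>

abbreviation "\<E> \<equiv> end_alg K M"
definition "sX f = restrict (%h. f *.M h) (carrier M)"
definition "tX f = restrict (%h. h *.M f) (carrier M)"
definition "lX a b = (if a = b then restrict (Tr a) (carrier M) else \<zero>.\<E>)"
definition "mX a b = (if a = b then restrict (Ti a) (carrier M) else \<zero>.\<E>)"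

sublocale \<E>: k_algebra K \<E> by (rule M.end_k_algebra)

lemma X_closed: "f : M ==> sX f : \<E>" "f : M ==> tX f : \<E>"
 "lX a b : \<E>" "mX a b : \<E>"
 using M.restrict_lin[OF M.mult_left_lin[of f]] M.restrict_lin[OF M.mult_right_lin[of f]] M.restrict_lin[OF shift_lin]
 by (auto simp: sX_def tX_def lX_def mX_def)

lemma X_app:
 assumes "h : M"
 shows "sX f h = f *.M h" "tX f h = h *.M f" "lX a b h = (if a = b then Tr a h else \<zero>.M)" "mX a b h = (if a = b then Ti a h else \<zero>.M)"
 using assms by (simp_all add: sX_def tX_def lX_def mX_def end_alg_simps(4))

lemma X_off: "a ~= b ==> lX a b = \<zero>.\<E>" "a ~= b ==> mX a b = \<zero>.\<E>"
 by (simp_all add: lX_def mX_def)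

lemma EM_eqI: "x : \<E> ==> y : \<E> ==> (!!h. h : M ==> x h = y h) ==> x = y"
 by (rule end_eqI[of _ M]) (auto simp: end_alg_simps(1))

text \<open>In the exchange relation only one term survives on each side: \<open>\<Sigma> w k\<close> times the shift by the pair
  \<open>w\<close> or \<open>k\<close>.  The two shifts agree wherever \<open>\<Sigma> w k\<close> does not vanish, and its values are central.\<close>

lemma chi_rll: "rll_target K R \<psi> JR pR qR e X deg \<sigma> \<E> \<one>.\<E> sX tX lX"
proof (intro rll_target.intro ybe_data_axioms \<E>.k_algebra_axioms rll_target_axioms.intro)
 show "sX : lin_maps K M \<E>" "tX : lin_maps K M \<E>"
  by (intro lin_mapsI X_closed EM_eqI \<E>.M.a_closed \<E>.smult_closed M.M.a_closed M.smult_closed;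
    simp add: X_app end_alg_simps(2-) M.A.l_distr M.A.r_distr M.smult_mult_left M.smult_mult_right)+
next
 fix f g assume fg: "f : M" "g : M"
 show "sX (f *.M g) = sX f *.\<E> sX g" "tX (f *.M g) = tX g *.\<E> tX f" "tX g *.\<E> sX f = sX f *.\<E> tX g"
  using fg by (intro EM_eqI; simp add: X_app X_closed end_alg_simps(2-) M.A.m_assoc)+
next
 show "sX \<one>.M = \<one>.\<E>" "tX \<one>.M = \<one>.\<E>"
  by (intro EM_eqI; simp add: X_app X_closed end_alg_simps(2-))+
next
 fix a b assume ab: "a : X" "b : X"
 show "lX a b : \<E>" by (rule X_closed)+
 then show "\<one>.\<E> *.\<E> lX a b = lX a b" "lX a b *.\<E> \<one>.\<E> = lX a b" by simp_all
 fix f assume f: "f : M"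
 note c = \<E>.A.m_closed[OF X_closed(1) X_closed(3)] \<E>.A.m_closed[OF X_closed(2) X_closed(3)] \<E>.A.m_closed[OF X_closed(3) X_closed(1)] \<E>.A.m_closed[OF X_closed(3) X_closed(2)]
  \<E>.A.m_closed[OF X_closed(1) X_closed(4)] \<E>.A.m_closed[OF X_closed(2) X_closed(4)] \<E>.A.m_closed[OF X_closed(4) X_closed(1)] \<E>.A.m_closed[OF X_closed(4) X_closed(2)]
 show "sX (Tr a f) *.\<E> lX a b = lX a b *.\<E> sX f"
  by (rule EM_eqI[OF c(1)[OF shift_closed] c(3)], fact, fact) (use ab f in "simp add: X_app end_alg_simps(2-) shift_mult")
 show "tX (Tr b f) *.\<E> lX a b = lX a b *.\<E> tX f"
  by (rule EM_eqI[OF c(2)[OF shift_closed] c(4)], fact, fact) (use ab f in "simp add: X_app end_alg_simps(2-) shift_mult")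
next
 fix k w assume k: "k : Y" and w: "w : Y"
 let ?S = "restrict (%h. shift (deg (snd k)) (shift (deg (fst k)) h)) (carrier M)"
 have finY: "finite Y" using finX by simp
 have Sc: "restrict (%h. shift (deg (snd u)) (shift (deg (fst u)) h)) (carrier M) : \<E>" for u
  by (rule M.restrict_lin[OF lin_comp[OF shift_lin shift_lin]])
 have LL: "LL \<E> lX u v = (if u = v then restrict (%h. shift (deg (snd u)) (shift (deg (fst u)) h)) (carrier M) else \<zero>.\<E>)" for u v
 proof (cases "u = v")
  case True
  then show ?thesis using X_closed(3)[of "fst u" "fst u"] X_closed(3)[of "snd u" "snd u"] Sc
   by (intro EM_eqI) (auto simp: LL_def X_app end_alg_simps(2-))
 next
  case False
  then have "fst u ~= fst v \<or> snd u ~= snd v" by (simp add: prod_eq_iff)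
  then show ?thesis using False X_closed(3)[of "fst u" "fst v"] X_closed(3)[of "snd u" "snd v"] by (auto simp: LL_def X_off)
 qed
 have "(\<Oplus>.\<E> u\<in>Y. sX (\<Sigma> u k) *.\<E> LL \<E> lX u w) = sX (\<Sigma> w k) *.\<E> LL \<E> lX w w"
 proof -
  have "(\<Oplus>.\<E> u\<in>Y. sX (\<Sigma> u k) *.\<E> LL \<E> lX u w)
   = (\<Oplus>.\<E> u\<in>Y. if u = w then sX (\<Sigma> w k) *.\<E> LL \<E> lX w w else \<zero>.\<E>)"
   using Sc k w X_closed(1) by (intro \<E>.M.finsum_eqI) (auto simp: LL simp del: restrict_apply)
  then show ?thesis using Sc k w X_closed(1) finY by (subst (asm) \<E>.M.finsum_delta) (auto simp: LL simp del: restrict_apply)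
 qed
 moreover have "(\<Oplus>.\<E> u\<in>Y. tX (\<Sigma> w u) *.\<E> LL \<E> lX k u) = tX (\<Sigma> w k) *.\<E> LL \<E> lX k k"
 proof -
  have "(\<Oplus>.\<E> u\<in>Y. tX (\<Sigma> w u) *.\<E> LL \<E> lX k u)
   = (\<Oplus>.\<E> u\<in>Y. if u = k then tX (\<Sigma> w k) *.\<E> LL \<E> lX k k else \<zero>.\<E>)"
   using Sc k w X_closed(2) by (intro \<E>.M.finsum_eqI) (auto simp: LL simp del: restrict_apply)
  then show ?thesis using Sc k w X_closed(2) finY by (subst (asm) \<E>.M.finsum_delta) (auto simp: LL simp del: restrict_apply)
 qed
 moreover have "sX (\<Sigma> w k) *.\<E> LL \<E> lX w w = tX (\<Sigma> w k) *.\<E> LL \<E> lX k k"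
 proof (rule EM_eqI)
  fix h assume h: "h : M"
  have "\<Sigma> w k *.M shift (deg (snd w)) (shift (deg (fst w)) h) = \<Sigma> w k *.M shift (deg (snd k)) (shift (deg (fst k)) h)"
  proof
   fix \<kappa>
   show "(\<Sigma> w k *.M shift (deg (snd w)) (shift (deg (fst w)) h)) \<kappa> = (\<Sigma> w k *.M shift (deg (snd k)) (shift (deg (fst k)) h)) \<kappa>"
    using Sigma_zero[OF w k, of \<kappa>] M_closed[OF h] by (cases "deg (fst w) (deg (snd w) \<kappa>) = deg (fst k) (deg (snd k) \<kappa>)") (simp_all add: map_alg_simps shift_def)
  qed
  then show "(sX (\<Sigma> w k) *.\<E> LL \<E> lX w w) h = (tX (\<Sigma> w k) *.\<E> LL \<E> lX k k) h"
   using h k w Sigma_central[OF w k, of "shift (deg (snd k)) (shift (deg (fst k)) h)"] by (simp add: LL X_app end_alg_simps(2-))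
 qed (use Sc k w X_closed(1,2) in "auto simp: LL simp del: restrict_apply")
 ultimately show "(\<Oplus>.\<E> u\<in>Y. sX (\<Sigma> u k) *.\<E> LL \<E> lX u w) = (\<Oplus>.\<E> u\<in>Y. tX (\<Sigma> w u) *.\<E> LL \<E> lX k u)"
  by simp
qed

lemma chi_target: "A_target K R \<psi> JR pR qR e X deg \<sigma> \<E> \<one>.\<E> sX tX lX mX"
proof (intro A_target.intro chi_rll A_target_axioms.intro)
 fix a b assume ab: "a : X" "b : X"
 show "mX a b : \<E>" by (rule X_closed)+
 then show "\<one>.\<E> *.\<E> mX a b = mX a b" "mX a b *.\<E> \<one>.\<E> = mX a b" by simp_all
 have inv: "lX b b *.\<E> mX b b = \<one>.\<E>" "mX b b *.\<E> lX b b = \<one>.\<E>"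
  using ab X_closed(3,4)[of b b] by (intro EM_eqI; simp add: X_app end_alg_simps(2-) Tr_Ti)+
 have "(\<Oplus>.\<E> c\<in>X. lX a c *.\<E> mX c b) = (\<Oplus>.\<E> c\<in>X. if c = b then (unit_mat \<E> a b) else \<zero>.\<E>)"
  using inv X_closed(3,4) by (intro \<E>.M.finsum_eqI) (auto simp: \<E>.A.r_null \<E>.A.l_null X_off split: if_splits)
 then show "(\<Oplus>.\<E> c\<in>X. lX a c *.\<E> mX c b) = unit_mat \<E> a b"
  using ab finX by (subst (asm) \<E>.M.finsum_delta) auto
 have "(\<Oplus>.\<E> c\<in>X. mX a c *.\<E> lX c b) = (\<Oplus>.\<E> c\<in>X. if c = b then (unit_mat \<E> a b) else \<zero>.\<E>)"
  using inv X_closed(3,4) by (intro \<E>.M.finsum_eqI) (auto simp: \<E>.A.r_null \<E>.A.l_null X_off split: if_splits)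
 then show "(\<Oplus>.\<E> c\<in>X. mX a c *.\<E> lX c b) = unit_mat \<E> a b"
  using ab finX by (subst (asm) \<E>.M.finsum_delta) auto
 fix f assume f: "f : M"
 note c = \<E>.A.m_closed[OF X_closed(1) X_closed(3)] \<E>.A.m_closed[OF X_closed(2) X_closed(3)] \<E>.A.m_closed[OF X_closed(3) X_closed(1)] \<E>.A.m_closed[OF X_closed(3) X_closed(2)]
  \<E>.A.m_closed[OF X_closed(1) X_closed(4)] \<E>.A.m_closed[OF X_closed(2) X_closed(4)] \<E>.A.m_closed[OF X_closed(4) X_closed(1)] \<E>.A.m_closed[OF X_closed(4) X_closed(2)]
 show "sX f *.\<E> mX a b = mX a b *.\<E> sX (Tr b f)"
  by (rule EM_eqI[OF c(5) c(7)[OF shift_closed]], fact, fact) (use ab f in "simp add: X_app end_alg_simps(2-) shift_mult Tr_Ti")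
 show "tX f *.\<E> mX a b = mX a b *.\<E> tX (Tr a f)"
  by (rule EM_eqI[OF c(6) c(8)[OF shift_closed]], fact, fact) (use ab f in "simp add: X_app end_alg_simps(2-) shift_mult Tr_Ti")
qed

interpretation XT: A_target K R \<psi> JR pR qR e X deg \<sigma> \<E> "\<one>.\<E>" sX tX lX mX
 by (rule chi_target)

abbreviation "chil \<equiv> chi_letter K R deg"

lemma chi_letter_eq: "c : lts ==> h : M ==> chil c h = XT.hl c h"
proof (cases c)
 case (Coef u)
 assume "c : lts" and h: "h : M"
 then have u: "u : CA" using Coef by simp
 have "tensor_lift K \<E> (%f g. sX f *.\<E> tX g) u h = tensor_lift K M (%f g. (sX f *.\<E> tX g) h) u"
  by (rule CAp.tensor_lift_comp[OF XT.b_st \<E>.md M.md end_eval_lin[OF h] u])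
 also have "... = tensor_lift K M (%f g. f *.M h *.M g) u"
  by (rule CAp.tensor_lift_cong[OF bilin_comp[OF XT.b_st M.id_lin Mop.id_lin end_eval_lin[OF h]] M.md u])
    (use h in "simp add: X_app end_alg_simps(2-) M.A.m_assoc")
 finally show ?thesis using Coef by simp
qed (auto simp: X_app)

lemma chi_word: "w : lists lts ==> h : M ==> foldr chil w h = XT.hw w h"
proof (induction w)
 case (Cons c w)
 then have c: "c : lts" "w : lists lts" by auto
 have "XT.hw w h : M" by (rule end_app_closed[OF XT.hw_closed[OF c(2)] Cons.prems(2)])
 then have "chil c (XT.hw w h) = (XT.hl c *.\<E> XT.hw w) h"
  unfolding end_alg_simps(2)[OF Cons.prems(2)] by (rule chi_letter_eq[OF c(1)])
 then show ?case using Cons.IH[OF c(2) Cons.prems(2)] by (simp only: foldr.simps o_apply)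
qed (simp add: end_alg_simps(3))

abbreviation "chiA \<equiv> chi K R deg"

lemma chi_FA: "a : \<A> ==> h : M ==> chiA a h = XT.FA a h"
proof (elim cls_cases)
 fix u assume h: "h : M" and u: "u : \<F>" and a: "a = cls u"
 let ?f = "lin_ext K M (%w. foldr chil w h)"
 have w: "foldr chil w h : M" if "w : lists lts" for w
  unfolding chi_word[OF that h] by (rule end_app_closed[OF XT.hw_closed[OF that] h])
 have f: "?f : lin_maps K \<F> M"
  by (subst free_alg_def, rule R.lin_ext_lin[OF M.md]) (rule w)
 have eq: "?f v = XT.F0 v h" if v: "v : \<F>" for v
 proof (rule Fr_lin_eq[OF f lin_comp[OF XT.F0_lin end_eval_lin[OF h]] M.md _ v])
  fix x assume x: "x : lists lts"
  show "?f (basis_elt K x) = XT.F0 (basis_elt K x) h"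
   unfolding XT.F0_bw[OF x] chi_word[OF x h, symmetric] by (rule R.lin_ext_basis_elt[OF M.md]) (rule w[OF x])
 qed
 have "chiA (cls u) h = ?f u"
  unfolding chi_def cls_eq
  by (rule IA.induced_cls[OF f M.md _ u])
    (use eq ideal.Icarr[OF IA_ideal] XT.F0_kernel h in "auto simp: end_alg_simps(4)")
 then show "chiA a h = XT.FA a h" using eq[OF u] XT.FA_cls[OF u] a by simp
qed

lemma chi_facts:
 "!!a. a : \<A> ==> chiA a : lin_maps K M M"
 "!!h. h : M ==> (%a. chiA a h) : lin_maps K \<A> M"
 "!!a b h. a : \<A> ==> b : \<A> ==> h : M ==> chiA (a *.\<A> b) h = chiA a (chiA b h)"
 "!!f h. f : M ==> h : M ==> chiA (sA f) h = f *.M h"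
 "!!f h. f : M ==> h : M ==> chiA (tA f) h = h *.M f"
 "!!a b h. a : X ==> b : X ==> h : M ==> chiA (LA a b) h = (if a = b then Tr a h else \<zero>.M)"
 "!!a b h. a : X ==> b : X ==> h : M ==> chiA (NA a b) h = (if a = b then Ti a h else \<zero>.M)"
proof -
 note c = lin_closed[OF XT.FA_lin]
 note lin = end_app_lin[OF c] and app = end_app_closed[OF c]
 fix a assume a: "a : \<A>"
 show "chiA a : lin_maps K M M"
  by (rule lin_mapsI) (simp_all add: chi_FA a app[OF a] lin_add[OF lin[OF a]] lin_smult[OF lin[OF a]])
 fix b h assume b: "b : \<A>" and h: "h : M"
 show "chiA (a *.\<A> b) h = chiA a (chiA b h)"
  using a b h by (simp add: chi_FA app XT.FA_mult end_alg_simps(2))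
next
 note c = lin_closed[OF XT.FA_lin]
 fix h assume h: "h : M"
 show "(%a. chiA a h) : lin_maps K \<A> M"
  by (rule lin_mapsI) (simp_all add: chi_FA h end_app_closed[OF c h] lin_add[OF XT.FA_lin] lin_smult[OF XT.FA_lin] end_alg_simps(5,6))
qed (simp_all add: chi_FA XT.FA_s XT.FA_t XT.FA_L XT.FA_N X_app)

section \<open>\<open>A\<^sub>\<sigma>\<close> as a weak bialgebra\<close>

abbreviation "vA i a b \<equiv> if i then LA a b else NA b a"
abbreviation "tau i a \<equiv> if i then Tr a else Ti a"
abbreviation "tau' i a \<equiv> if i then Ti a else Tr a"

lemma AB_ext [simp]: "lin_maps K AB V = lin_maps K \<A> V" "lin_maps K V AB = lin_maps K V \<A>" "finsum AB = finsum \<A>"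
 by (rule lin_maps_ext; simp)+ (rule a_minus_ext; simp)

lemma AB_k_algebra: "k_algebra K AB"
 by (rule k_algebra_ext[OF Aa_k_algebra]) simp_all

lemma A_gen_bialg: "gen_bialg K AB M \<psi>M JM pM qM sA tA chiA (UNIV :: bool set) X (%i a b. vA i a b) (%i a. tau i a) (%i a. tau' i a)"
proof (intro gen_bialg.intro AB_k_algebra FM.frob_sys_axioms gen_bialg_axioms.intro)
 show "finite X" by (rule finX)
 fix P a
 assume *: "a : AB" "P \<one>\<^bsub>AB\<^esub>" "!!x y. x : AB ==> y : AB ==> P x ==> P y ==> P (x \<oplus>\<^bsub>AB\<^esub> y)"
  "!!k x. k : K ==> x : AB ==> P x ==> P (k \<odot>\<^bsub>AB\<^esub> x)"
  "!!f x. f : M ==> x : AB ==> P x ==> P (sA f \<otimes>\<^bsub>AB\<^esub> x)"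
  "!!f x. f : M ==> x : AB ==> P x ==> P (tA f \<otimes>\<^bsub>AB\<^esub> x)"
  "!!i a b x. i : UNIV ==> a : X ==> b : X ==> x : AB ==> P x ==> P (vA i a b \<otimes>\<^bsub>AB\<^esub> x)"
 show "P a"
 proof (rule A_gen[of a P])
  fix c b and x :: "('k, 'r, 'l, 'x) A_elt" assume "c : X" "b : X" "x : \<A>" "P x"
  then show "P (LA c b *.\<A> x)" "P (NA c b *.\<A> x)"
   using *(7)[of True c b x] *(7)[of False b c x] by simp_all
 qed (use * in simp_all)
next
 fix i :: bool and a b assume ab: "a : X" "b : X"
 have "DN b a = (\<Oplus>.\<T> c\<in>X. tt (NA c a) (NA b c))" by (simp add: DN_def)
 then show "comult AB (vA i a b) = comult AB \<one>\<^bsub>AB\<^esub> \<otimes>\<^bsub>tensor K AB AB\<^esub> (\<Oplus>\<^bsub>tensor K AB AB\<^esub>c\<in>X. tens K AB AB (vA i a c) (vA i c b))"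
  using ab by (cases i) (simp_all add: AB_comult_facts DL_def)
qed (auto simp: Ab.s_lin Ab.t_lin Ab.s_mult Ab.t_mult Ab.s_one Ab.t_one Ab.ts_comm shift_lin shift_mult shift_one Tr_Ti shift_psi_X
   sL tL Ti_N AB_comult_facts chi_facts weak_bialg_of_simps(7) Abd_simps Ab.E_def)

sublocale AG: gen_bialg K AB M \<psi>M JM pM qM sA tA chiA "UNIV :: bool set" X "%i a b. vA i a b" "%i a. tau i a" "%i a. tau' i a"
 by (rule A_gen_bialg)

end

section \<open>The antipode of \<open>A\<^sub>\<sigma>\<close>\<close>

lemma (in frob_sys) nak_commute:
 assumes \<tau>: "\<tau> : lin_maps K L L" and \<tau>': "\<tau>' : lin_maps K L L"
  and mult: "!!x y. x : L ==> y : L ==> \<tau> (x *.L y) = \<tau> x *.L \<tau> y"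
  and inv: "!!x. x : L ==> \<tau> (\<tau>' x) = x"
  and psi: "!!x. x : L ==> \<psi> (\<tau> x) = \<psi> x" and f: "f : L"
 shows "nak (\<tau> f) = \<tau> (nak f)"
proof (rule nondeg)
 note [simp] = lin_closed[OF \<tau>] lin_closed[OF \<tau>']
 show "nak (\<tau> f) : L" "\<tau> (nak f) : L" using f by simp_all
 fix x assume x: "x : L"
 have "\<psi> (x *.L nak (\<tau> f)) = \<psi> (\<tau> f *.L x)" using f x by (simp add: psi_nak)
 also have "... = \<psi> (\<tau> (f *.L \<tau>' x))" using f x by (simp add: mult inv)
 also have "... = \<psi> (\<tau>' x *.L nak f)" using f x by (simp add: psi psi_nak)
 also have "... = \<psi> (\<tau> (\<tau>' x *.L nak f))" using f x by (simp add: psi)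
 finally show "\<psi> (x *.L nak (\<tau> f)) = \<psi> (x *.L \<tau> (nak f))" using f x by (simp add: mult inv)
qed

lemma finsum_op [simp]: "finsum (op_alg A) = finsum A"
 by (rule a_minus_ext) simp_all

lemma (in k_algebra) nested_kron_sum:
 assumes fin: "finite X" and c [simp]: "!!i. i : X ==> x i : A" "!!i. i : X ==> y i : A"
   "!!i. i : X ==> z i : A" "!!i. i : X ==> w i : A"
  and inner: "(\<Oplus>.A c\<in>X. y c *.A z c) = (if P then \<one>.A else \<zero>.A)"
  and outer: "(\<Oplus>.A d\<in>X. x d *.A w d) = (if Q then \<one>.A else \<zero>.A)"
 shows "(\<Oplus>.A v\<in>X\<times>X. x (snd v) *.A y (fst v) *.A (z (fst v) *.A w (snd v))) = (if P \<and> Q then \<one>.A else \<zero>.A)"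
proof -
 have "(\<Oplus>.A v\<in>X\<times>X. x (snd v) *.A y (fst v) *.A (z (fst v) *.A w (snd v)))
   = (\<Oplus>.A c\<in>X. \<Oplus>.A d\<in>X. x d *.A y c *.A (z c *.A w d))"
  using M.finsum_prod[of X X "%c d. x d *.A y c *.A (z c *.A w d)"] fin by (simp add: case_prod_unfold)
 also have "... = (\<Oplus>.A d\<in>X. \<Oplus>.A c\<in>X. x d *.A y c *.A (z c *.A w d))"
  by (rule M.finsum_swap) (use fin in auto)
 also have "... = (\<Oplus>.A d\<in>X. x d *.A ((\<Oplus>.A c\<in>X. y c *.A z c) *.A w d))"
 proof (rule M.finsum_eqI)
  fix d assume d: "d : X"
  have "(\<Oplus>.A c\<in>X. x d *.A y c *.A (z c *.A w d)) = (\<Oplus>.A c\<in>X. x d *.A (y c *.A z c *.A w d))"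
   using d by (intro M.finsum_eqI) (auto simp: A.m_assoc)
  also have "... = x d *.A ((\<Oplus>.A c\<in>X. y c *.A z c) *.A w d)"
   using d by (subst finsum_mult_right, simp, simp, subst finsum_mult_left) auto
  finally show "(\<Oplus>.A c\<in>X. x d *.A y c *.A (z c *.A w d)) = x d *.A ((\<Oplus>.A c\<in>X. y c *.A z c) *.A w d)" .
 qed (auto intro!: M.finsum_closedI A.m_closed)
 also have "... = (\<Oplus>.A d\<in>X. if P then x d *.A w d else \<zero>.A)"
  unfolding inner by (rule M.finsum_eqI) auto
 also have "... = (if P \<and> Q then \<one>.A else \<zero>.A)" using outer by (cases P) simp_all
 finally show ?thesis .
qed

context ybe_data begin

definition "NN u w = NA (fst u) (fst w) *.\<A> NA (snd u) (snd w)"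

lemma NN_closed [simp]: "u : Y ==> w : Y ==> NN u w : \<A>" by (auto simp: NN_def)

lemma NN_inverse:
 assumes u: "u : Y" and w: "w : Y"
 shows "(\<Oplus>.\<A> v\<in>Y. LL \<A> LA u v *.\<A> NN v w) = unit_mat \<A> u w"
  "(\<Oplus>.\<A> v\<in>Y. NN u v *.\<A> LL \<A> LA v w) = unit_mat \<A> u w"
proof -
 have X: "fst u : X" "snd u : X" "fst w : X" "snd w : X" using u w by auto
 have "(\<Oplus>.\<A> v\<in>Y. LL \<A> LA u v *.\<A> NN v w) = (if fst u = fst w \<and> snd u = snd w then \<one>.\<A> else \<zero>.\<A>)"
  unfolding LL_def NN_def
  by (rule \<A>.nested_kron_sum[of X "%d. LA (snd u) d" "%c. LA (fst u) c" "%c. NA c (fst w)" "%d. NA d (snd w)"])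
    (use X finX LN in auto)
 then show "(\<Oplus>.\<A> v\<in>Y. LL \<A> LA u v *.\<A> NN v w) = unit_mat \<A> u w"
  by (simp add: prod_eq_iff)
 have "(\<Oplus>.\<A> v\<in>Y. NN u (prod.swap v) *.\<A> LL \<A> LA (prod.swap v) w) = (if snd u = snd w \<and> fst u = fst w then \<one>.\<A> else \<zero>.\<A>)"
  unfolding LL_def NN_def fst_swap snd_swap
  by (rule \<A>.nested_kron_sum[of X "%d. NA (fst u) d" "%c. NA (snd u) c" "%c. LA c (snd w)" "%d. LA d (fst w)"])
    (use X finX NL in auto)
 moreover have "(\<Oplus>.\<A> v\<in>Y. NN u (prod.swap v) *.\<A> LL \<A> LA (prod.swap v) w) = (\<Oplus>.\<A> v\<in>prod.swap ` Y. NN u v *.\<A> LL \<A> LA v w)"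
  by (rule \<A>.M.finsum_reindex[symmetric]) (use u w in auto)
 moreover have "prod.swap ` Y = Y" by (rule product_swap)
 ultimately show "(\<Oplus>.\<A> v\<in>Y. NN u v *.\<A> LL \<A> LA v w) = unit_mat \<A> u w"
  by (simp add: prod_eq_iff conj_commute)
qed

lemma inv_deg: "a : X ==> deg a (inv_into UNIV (deg a) \<kappa>) = \<kappa>" "a : X ==> inv_into UNIV (deg a) (deg a \<kappa>) = \<kappa>"
 using deg_bij[of a] by (auto simp: bij_is_inj bij_is_surj surj_f_inv_f)

text \<open>Here the vanishing of \<open>\<sigma>\<close> off the degree-preserving entries is used: where \<open>\<Sigma> w u\<close> does not
 vanish, the permutations attached to the pairs \<open>w\<close> and \<open>u\<close> agree.\<close>

lemma Sigma_shift:
 assumes w: "w : Y" and u: "u : Y"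
 shows "Tr (snd w) (Tr (fst w) (Ti (fst u) (Ti (snd u) (\<Sigma> w u)))) = \<Sigma> w u"
proof
 fix \<kappa>
 let ?a = "%v \<kappa>. deg (fst v) (deg (snd v) \<kappa>)"
 let ?k = "inv_into UNIV (deg (snd u)) (inv_into UNIV (deg (fst u)) (?a w \<kappa>))"
 have X: "fst u : X" "snd u : X" "fst w : X" "snd w : X" using u w by auto
 have au: "?a u ?k = ?a w \<kappa>" using X by (simp add: inv_deg)
 have "?k = \<kappa>" if "?a w \<kappa> = ?a u \<kappa>" using that X by (simp add: inv_deg)
 moreover have "?k = \<kappa>" if "?a w ?k = ?a u ?k"
 proof -
  have "?a w ?k = ?a w \<kappa>" using that au by simp
  then show ?thesis using X inv_deg(2)[of "fst w"] inv_deg(2)[of "snd w"] by metis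
 qed
 ultimately have "\<Sigma> w u ?k = \<Sigma> w u \<kappa>" using Sigma_zero[OF w u, of \<kappa>] Sigma_zero[OF w u, of ?k] by metis
 then show "Tr (snd w) (Tr (fst w) (Ti (fst u) (Ti (snd u) (\<Sigma> w u)))) \<kappa> = \<Sigma> w u \<kappa>" by (simp add: shift_def)
qed

lemma tA_LL_NN:
 assumes k: "k : Y" and w: "w : Y" and u: "u : Y" and r: "r : Y"
 shows "tA (\<Sigma> w u) *.\<A> LL \<A> LA k u *.\<A> NN w r = LL \<A> LA k u *.\<A> (NN w r *.\<A> tA (\<Sigma> w u))"
proof -
 have X: "fst u : X" "snd u : X" "fst w : X" "snd w : X" "fst k : X" "snd k : X" "fst r : X" "snd r : X" using assms by auto
 let ?f = "Ti (fst u) (Ti (snd u) (\<Sigma> w u))"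
 have f: "?f : M" using u w by simp
 have "tA (Tr (snd u) (Tr (fst u) ?f)) *.\<A> LA (snd k) (snd u) *.\<A> LA (fst k) (fst u) = LA (snd k) (snd u) *.\<A> LA (fst k) (fst u) *.\<A> tA ?f"
  using X f by (simp add: tL \<A>.A.m_assoc)
 moreover have "Tr (snd u) (Tr (fst u) ?f) = \<Sigma> w u" using X by (simp add: Tr_Ti)
 ultimately have L: "tA (\<Sigma> w u) *.\<A> LL \<A> LA k u = LL \<A> LA k u *.\<A> tA ?f"
  using X u w by (simp add: LL_def \<A>.A.m_assoc)
 have "tA ?f *.\<A> NN w r = tA ?f *.\<A> NA (fst w) (fst r) *.\<A> NA (snd w) (snd r)"
  unfolding NN_def using X f by (simp add: \<A>.A.m_assoc)
 also have "... = NA (fst w) (fst r) *.\<A> (tA (Tr (fst w) ?f) *.\<A> NA (snd w) (snd r))"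
  using X f by (subst tN) (simp_all add: \<A>.A.m_assoc)
 also have "... = NN w r *.\<A> tA (Tr (snd w) (Tr (fst w) ?f))"
  unfolding NN_def using X f by (subst tN) (simp_all add: \<A>.A.m_assoc)
 also have "... = NN w r *.\<A> tA (\<Sigma> w u)" by (simp only: Sigma_shift[OF w u])
 finally show ?thesis using assms f L by (simp add: \<A>.A.m_assoc)
qed

text \<open>The exchange relation, multiplied by the inverse of the matrix \<open>LL\<close> from both sides.\<close>

lemma RLL_NN:
 assumes p: "p : Y" and r: "r : Y"
 shows "(\<Oplus>.\<A> k\<in>Y. NN p k *.\<A> sA (\<Sigma> r k)) = (\<Oplus>.\<A> w\<in>Y. NN w r *.\<A> tA (\<Sigma> w p))"
proof -
 let ?L = "LL \<A> LA"
 have finY: "finite Y" using finX by simp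
 let ?G = "%u. \<Oplus>.\<A> w\<in>Y. NN w r *.\<A> tA (\<Sigma> w u)"
 have G: "?G u : \<A>" if "u : Y" for u using that r by (intro \<A>.M.finsum_closedI) auto
 have "(\<Oplus>.\<A> k\<in>Y. NN p k *.\<A> sA (\<Sigma> r k)) = (\<Oplus>.\<A> k\<in>Y. NN p k *.\<A> (\<Oplus>.\<A> u\<in>Y. ?L k u *.\<A> ?G u))"
 proof (rule \<A>.M.finsum_eqI)
  fix k assume k: "k : Y"
  have "sA (\<Sigma> r k) = (\<Oplus>.\<A> u\<in>Y. sA (\<Sigma> u k) *.\<A> (unit_mat \<A> u r))"
   by (rule \<A>.kron_sum_right[symmetric]) (use k r finY in auto)
  also have "... = (\<Oplus>.\<A> u\<in>Y. sA (\<Sigma> u k) *.\<A> (\<Oplus>.\<A> w\<in>Y. ?L u w *.\<A> NN w r))"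
   by (rule \<A>.M.finsum_eqI) (use k r in "auto simp: NN_inverse")
  also have "... = (\<Oplus>.\<A> w\<in>Y. (\<Oplus>.\<A> u\<in>Y. sA (\<Sigma> u k) *.\<A> ?L u w) *.\<A> NN w r)"
   by (rule \<A>.matrix_assoc[symmetric]) (use k r finY in auto)
  also have "... = (\<Oplus>.\<A> w\<in>Y. \<Oplus>.\<A> u\<in>Y. ?L k u *.\<A> (NN w r *.\<A> tA (\<Sigma> w u)))"
  proof (rule \<A>.M.finsum_eqI)
   fix w assume w: "w : Y"
   show "(\<Oplus>.\<A> u\<in>Y. sA (\<Sigma> u k) *.\<A> ?L u w) *.\<A> NN w r = (\<Oplus>.\<A> u\<in>Y. ?L k u *.\<A> (NN w r *.\<A> tA (\<Sigma> w u)))"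
    unfolding RLL_A[OF k w] using k w r
    by (subst \<A>.finsum_mult_right, simp, simp, intro \<A>.M.finsum_eqI tA_LL_NN) simp_all
  qed (use k r in \<open>auto intro!: \<A>.M.finsum_closedI\<close>)
  also have "... = (\<Oplus>.\<A> u\<in>Y. \<Oplus>.\<A> w\<in>Y. ?L k u *.\<A> (NN w r *.\<A> tA (\<Sigma> w u)))"
   by (rule \<A>.M.finsum_swap) (use k r finY in auto)
  also have "... = (\<Oplus>.\<A> u\<in>Y. ?L k u *.\<A> ?G u)"
   by (rule \<A>.M.finsum_eqI, rule \<A>.finsum_mult_left[symmetric]) (use k r G in auto)
  finally show "NN p k *.\<A> sA (\<Sigma> r k) = NN p k *.\<A> (\<Oplus>.\<A> u\<in>Y. ?L k u *.\<A> ?G u)" by simp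
 qed (use p G in \<open>auto intro!: \<A>.M.finsum_closedI \<A>.A.m_closed\<close>)
 also have "... = (\<Oplus>.\<A> u\<in>Y. (\<Oplus>.\<A> k\<in>Y. NN p k *.\<A> ?L k u) *.\<A> ?G u)"
  by (rule \<A>.matrix_assoc[symmetric]) (use p G finY in auto)
 also have "... = (\<Oplus>.\<A> u\<in>Y. (unit_mat \<A> p u) *.\<A> ?G u)"
  by (rule \<A>.M.finsum_eqI) (use p G in \<open>auto simp: NN_inverse intro!: \<A>.A.m_closed\<close>)
 also have "... = ?G p"
  by (rule \<A>.kron_sum_left) (use p G finY in auto)
 finally show ?thesis .
qed

lemma nak_shift: "a : X ==> f : M ==> FM.nak (Tr a f) = Tr a (FM.nak f)"
 by (rule FM.nak_commute[OF shift_lin[of "deg a"] shift_lin[of "inv_into UNIV (deg a)"] shift_mult]) (simp_all add: Tr_Ti shift_psi_X)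

lemma nak_Sigma: "u : Y ==> k : Y ==> FM.nak (\<Sigma> u k) = \<Sigma> u k"
 by (rule FM.nak_central) (auto intro: Sigma_central)

context
 fixes x :: "'x \<Rightarrow> 'x \<Rightarrow> ('k, 'r, 'l, 'x) A_elt"
 assumes x_closed [simp]: "!!a b. a : X ==> b : X ==> x a b : \<A>"
  and Nx: "!!a b. a : X ==> b : X ==> (\<Oplus>.\<A> c\<in>X. NA c b *.\<A> x a c) = krA a b"
  and xN: "!!a b. a : X ==> b : X ==> (\<Oplus>.\<A> c\<in>X. x c b *.\<A> NA a c) = krA a b"
begin

text \<open>The antipode as a homomorphism to the opposite algebra.  The inverse \<open>x\<close> of the image of \<open>L\<close> exists
  by rigidity.  As the values of \<open>\<sigma>\<close> are central, \<open>nak\<close> fixes them, and \<open>RLL_NN\<close> is the required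
  exchange relation.\<close>

lemma S_target: "A_target K R \<psi> JR pR qR e X deg \<sigma> (op_alg \<A>) \<one>.\<A> (%f. tA (FM.nak f)) sA (%a b. NA a b) x"
proof -
 interpret O: k_algebra K "op_alg \<A>" by (rule \<A>.op_k_algebra)
 have Nx': "(\<Oplus>\<^bsub>op_alg \<A>\<^esub>c\<in>X. x a c \<otimes>\<^bsub>op_alg \<A>\<^esub> NA c b) = (if a = b then \<one>.\<A> else \<zero>\<^bsub>op_alg \<A>\<^esub>)"
  "(\<Oplus>\<^bsub>op_alg \<A>\<^esub>c\<in>X. NA a c \<otimes>\<^bsub>op_alg \<A>\<^esub> x c b) = (if a = b then \<one>.\<A> else \<zero>\<^bsub>op_alg \<A>\<^esub>)"
  if "a : X" "b : X" for a b using Nx[OF that] xN[OF that] by simp_all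
 show ?thesis
 proof (intro A_target.intro rll_target.intro rll_target_axioms.intro A_target_axioms.intro ybe_data_axioms O.k_algebra_axioms, goal_cases)
  case 1 show ?case using lin_comp[OF FM.nak_lin Ab.t_lin] by simp
 next
  case 2 show ?case using Ab.s_lin by simp
 next
  case (17 a b) then show ?case using xN[of a b] by simp
 next
  case (18 a b) then show ?case using Nx[of a b] by simp
 next
  case (11 a b f) then show ?case by (simp add: nak_shift tN)
 next
  case (12 a b f) then show ?case by (simp add: sN)
 next
  case (19 a b f)
  show ?case
   by (rule O.inverse_row_commute[of X "%a b. NA a b" x x "\<one>.\<A>" a b "tA (FM.nak f)" "%c. tA (FM.nak (Tr c f))", OF finX _ _ _ _ Nx'])
     (use 19 in "simp_all add: nak_shift tN")
 next
  case (20 a b f)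
  have "sA (Ti a (Tr a f)) \<otimes>\<^bsub>op_alg \<A>\<^esub> x a b = x a b \<otimes>\<^bsub>op_alg \<A>\<^esub> sA (Tr a f)"
   by (rule O.inverse_column_commute[of X "%a b. NA a b" x x "\<one>.\<A>" a b "sA (Tr a f)" "%c. sA (Ti c (Tr a f))", OF finX _ _ _ _ Nx'])
     (use 20 in "simp_all add: Ti_N")
  then show ?case using 20 by (simp add: Tr_Ti)
 next
  case (13 k w)
  have "LL (op_alg \<A>) (%a b. NA a b) u v = NN u v" for u v by (simp add: LL_def NN_def)
  moreover have "(\<Oplus>.\<A> u\<in>Y. NN u w *.\<A> tA (FM.nak (\<Sigma> u k))) = (\<Oplus>.\<A> u\<in>Y. NN u w *.\<A> tA (\<Sigma> u k))"
  proof (rule \<A>.M.finsum_eqI)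
   fix u assume "u : Y"
   then show "NN u w *.\<A> tA (FM.nak (\<Sigma> u k)) = NN u w *.\<A> tA (\<Sigma> u k)" using 13 by (simp only: nak_Sigma)
  qed (use 13 in simp)
  ultimately show ?case using RLL_NN[of k w] 13 by simp
 qed (auto simp: FM.nak_mult FM.nak_one Ab.s_mult Ab.t_mult Ab.s_one Ab.t_one Ab.ts_comm)
qed

lemma AB_antipode: "\<exists>S. is_weak_hopf_antipode K AB S"
proof -
 interpret ST: A_target K R \<psi> JR pR qR e X deg \<sigma> "op_alg \<A>" "\<one>.\<A>" "%f. tA (FM.nak f)" sA "%a b. NA a b" x
  by (rule S_target)
 have "is_weak_hopf_antipode K AB ST.FA"
 proof (rule AG.antipode_criterion, goal_cases)
  case 1 show ?case using ST.FA_lin by simp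
 next
  case (5 i a b)
  then show ?case using NL[of a b] xN[of b a] by (cases i; cases "a = b") (simp_all add: ST.FA_L ST.FA_N cong: \<A>.M.finsum_cong)
 next
  case (6 i a b)
  then show ?case using LN[of a b] Nx[of b a] by (cases i; cases "a = b") (simp_all add: ST.FA_L ST.FA_N cong: \<A>.M.finsum_cong)
 qed (simp_all add: ST.FA_mult ST.FA_s ST.FA_t)
 then show ?thesis by blast
qed

end

theorem rigid_weak_hopf:
 assumes "rigid K R X deg \<sigma>"
 shows "weak_hopf_algebra K AB"
proof -
 from assms obtain x y where xy: "\<forall>a\<in>X. \<forall>b\<in>X. x a b : \<A> \<and> y a b : \<A>"
  "\<forall>a\<in>X. \<forall>b\<in>X. let d = krA a b in
    (\<Oplus>.\<A> c\<in>X. NA c b *.\<A> x a c) = d \<and> (\<Oplus>.\<A> c\<in>X. x c b *.\<A> NA a c) = d \<and>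
    (\<Oplus>.\<A> c\<in>X. LA c b *.\<A> y a c) = d \<and> (\<Oplus>.\<A> c\<in>X. y c b *.\<A> LA a c) = d"
  unfolding rigid_def by (elim exE conjE)
 have "\<exists>S. is_weak_hopf_antipode K AB S"
 proof (rule AB_antipode[of x])
  fix a b assume ab: "a : X" "b : X"
  show "x a b : \<A>" using xy(1) ab by blast
  note * = xy(2)[rule_format, OF ab, unfolded Let_def]
  show "(\<Oplus>.\<A> c\<in>X. NA c b *.\<A> x a c) = krA a b" "(\<Oplus>.\<A> c\<in>X. x c b *.\<A> NA a c) = krA a b"
   by (rule *[THEN conjunct1], rule *[THEN conjunct2, THEN conjunct1])
 qed
 then show ?thesis unfolding weak_hopf_algebra_def using AG.weak_bialg by (rule conjI[rotated])
qed

end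

section \<open>Paths and the algebra \<open>\<GG>(Q)\<close>\<close>

context ybe_data begin

abbreviation "chain \<equiv> is_chain X deg"
abbreviation "pt \<equiv> path_target deg"

definition path_pairs :: "(('l, 'x) path \<times> ('l, 'x) path) set" where
 "path_pairs = {(p, q). chain (fst p) (snd p) \<and> chain (fst q) (snd q) \<and> length (snd p) = length (snd q)}"

abbreviation "mG \<equiv> (%(p, q) (p', q'). if pt p = path_source p' \<and> pt q = path_source q'
 then Some (path_concat p p', path_concat q q') else None)"

lemma path_pairs_eq: "(\<Union>m. paths X deg m \<times> paths X deg m) = path_pairs"
 by (auto simp: path_pairs_def paths_def)

lemma pt_simps [simp]: "pt (\<kappa>, []) = \<kappa>" "pt (\<kappa>, q # qs) = pt (deg (snd q) (fst q), qs)"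
 by (auto simp: path_target_def split: prod.split)

lemma chain_append: "chain \<kappa> qs ==> chain (pt (\<kappa>, qs)) qs' ==> chain \<kappa> (qs @ qs')"
 by (induction qs arbitrary: \<kappa>) auto

lemma pt_concat: "pt p = fst p' ==> pt (path_concat p p') = pt p'"
 by (auto simp: path_concat_def path_target_def)

lemma concat_pairs: "(p, q) : path_pairs ==> (p', q') : path_pairs ==> pt p = fst p' ==> pt q = fst q' ==>
  (path_concat p p', path_concat q q') : path_pairs"
 using chain_append[of "fst p" "snd p" "snd p'"] chain_append[of "fst q" "snd q" "snd q'"]
 by (auto simp: path_pairs_def path_concat_def)

lemma concat_assoc: "path_concat (path_concat p p') p'' = path_concat p (path_concat p' p'')"
 by (simp add: path_concat_def)

lemma paths_0: "paths X deg 0 = range (%\<kappa>. (\<kappa>, []))"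
 by (auto simp: paths_def)

abbreviation \<G> :: "('k, ('k, 'l, 'x) G_elt) module" where "\<G> \<equiv> G_alg K X deg"

lemma Gg_eq: "\<G> = basis_alg K path_pairs mG (paths X deg 0 \<times> paths X deg 0)"
 by (simp add: G_alg_def path_pairs_eq)

lemma Gg_k_algebra: "k_algebra K \<G>"
 unfolding Gg_eq
proof (rule R.basis_k_algebra)
 fix y z x assume "y : path_pairs" "z : path_pairs" "mG y z = Some x"
 then show "x : path_pairs" by (cases y; cases z) (auto simp: path_source_def concat_pairs split: if_splits)
next
 show "finite (paths X deg 0 \<times> paths X deg 0)" by (simp add: paths_0)
 show "paths X deg 0 \<times> paths X deg 0 \<subseteq> path_pairs" by (auto simp: paths_0 path_pairs_def)
next
 fix x y z assume "x : path_pairs" "y : path_pairs" "z : path_pairs"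
 obtain p q p' q' p'' q'' where "x = (p, q)" "y = (p', q')" "z = (p'', q'')" by (cases x; cases y; cases z)
 then show "(case mG x y of None \<Rightarrow> None | Some u \<Rightarrow> mG u z) = (case mG y z of None \<Rightarrow> None | Some u \<Rightarrow> mG x u)"
  by (auto simp: path_source_def pt_concat concat_assoc) (auto simp: path_concat_def)
next
 fix z assume "z : path_pairs"
 obtain p q where z: "z = (p, q)" by (cases z)
 have "path_concat (fst p, []) p = p" "path_concat (fst q, []) q = q" by (simp_all add: path_concat_def)
 then show "\<exists>u\<in>paths X deg 0 \<times> paths X deg 0. mG u z = Some z \<and> (\<forall>u'\<in>paths X deg 0 \<times> paths X deg 0. u' ~= u \<longrightarrow> mG u' z = None)"
  unfolding z by (intro bexI[of _ "((fst p, []), (fst q, []))"]) (auto simp: paths_0 path_source_def)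
 have "path_concat p (pt p, []) = p" "path_concat q (pt q, []) = q" by (simp_all add: path_concat_def)
 then show "\<exists>u\<in>paths X deg 0 \<times> paths X deg 0. mG z u = Some z \<and> (\<forall>u'\<in>paths X deg 0 \<times> paths X deg 0. u' ~= u \<longrightarrow> mG z u' = None)"
  unfolding z by (intro bexI[of _ "((pt p, []), (pt q, []))"]) (auto simp: paths_0 path_source_def)
qed

sublocale \<G>: k_algebra K \<G> by (rule Gg_k_algebra)

abbreviation "eb p q \<equiv> basis_elt K (p, q)"

lemma eb_closed [simp]: "(p, q) : path_pairs ==> eb p q : \<G>"
 unfolding Gg_eq by (rule R.basis_elt_closed)

lemma eb_mult: "eb p q *.\<G> eb p' q' = (if pt p = fst p' \<and> pt q = fst q' then eb (path_concat p p') (path_concat q q') else \<zero>.\<G>)"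
 unfolding Gg_eq by (simp add: R.basis_elt_mult path_source_def)

lemma Gg_lin_eq:
 assumes "f : lin_maps K \<G> V" "g : lin_maps K \<G> V" "module K V"
  and "!!p q. (p, q) : path_pairs ==> f (eb p q) = g (eb p q)" and "u : \<G>"
 shows "f u = g u"
 by (rule R.basis_lin_eq[of f path_pairs _ _ V g u]) (use assms in "auto simp: Gg_eq")

section \<open>The algebra \<open>\<AA>(w\<^sub>\<sigma>)\<close>\<close>

abbreviation Rr :: "('k, (('r \<times> 'r) \<Rightarrow> 'k) set) module" where "Rr \<equiv> tensor K R (op_alg R)"
abbreviation \<H> :: "('k, ('k, 'r, 'l, 'x) H_elt) module" where "\<H> \<equiv> H_alg K R X deg"
abbreviation "ht \<equiv> H_tens K R X deg"
abbreviation rt :: "'r \<Rightarrow> 'r \<Rightarrow> (('r \<times> 'r) \<Rightarrow> 'k) set" where "rt \<equiv> tens K R (op_alg R)"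

sublocale Rop: k_algebra K "op_alg R" by (rule R.op_k_algebra)
sublocale Rp: alg_pair K R "op_alg R" ..
sublocale Rr: k_algebra K Rr by (rule Rp.tensor_k_algebra)
sublocale Hp: alg_pair K Rr \<G> ..
lemma Hh_eq: "\<H> = tensor K Rr \<G>" by (simp add: H_alg_def)
sublocale \<H>: k_algebra K \<H> unfolding Hh_eq by (rule Hp.tensor_k_algebra)

lemma ht_eq: "ht r r' g = tens K Rr \<G> (rt r r') g" by (simp add: H_tens_def)

lemma rt_closed [simp]: "r : R ==> r' : R ==> rt r r' : Rr"
 by (rule Rp.tens_closed) auto

lemma ht_closed [simp]: "r : R ==> r' : R ==> g : \<G> ==> ht r r' g : \<H>"
 by (simp add: ht_eq Hh_eq)

lemma ht_mult:
 assumes "r : R" "r' : R" "g : \<G>" "s : R" "s' : R" "h : \<G>"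
 shows "ht r r' g *.\<H> ht s s' h = ht (r *.R s) (s' *.R r') (g *.\<G> h)"
 using assms by (simp add: ht_eq Hh_eq Hp.tens_mult Rp.tens_mult)

lemma ht_lin:
 "r' : R ==> g : \<G> ==> (%r. ht r r' g) : lin_maps K R \<H>"
 "r : R ==> g : \<G> ==> (%r'. ht r r' g) : lin_maps K R \<H>"
 "r : R ==> r' : R ==> (%g. ht r r' g) : lin_maps K \<G> \<H>"
proof -
 show "r' : R ==> g : \<G> ==> (%r. ht r r' g) : lin_maps K R \<H>"
  unfolding ht_eq Hh_eq using lin_comp[OF bilin_left[OF Rp.tens_bilin] bilin_left[OF Hp.tens_bilin]] by simp
 show "r : R ==> g : \<G> ==> (%r'. ht r r' g) : lin_maps K R \<H>"
  unfolding ht_eq Hh_eq using lin_comp[OF bilin_right[OF Rp.tens_bilin, simplified] bilin_left[OF Hp.tens_bilin]] by simp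
 show "r : R ==> r' : R ==> (%g. ht r r' g) : lin_maps K \<G> \<H>"
  unfolding ht_eq Hh_eq by (rule bilin_right[OF Hp.tens_bilin]) simp
qed

lemma Hh_lin_eq:
 assumes f: "f : lin_maps K \<H> V" and g: "g : lin_maps K \<H> V" and V: "module K V"
  and eq: "!!r r' p q. r : R ==> r' : R ==> (p, q) : path_pairs ==> f (ht r r' (eb p q)) = g (ht r r' (eb p q))"
  and u: "u : \<H>"
 shows "f u = g u"
proof -
 have 1: "f (ht r r' x) = g (ht r r' x)" if "r : R" "r' : R" "x : \<G>" for r r' x
  by (rule Gg_lin_eq[OF lin_comp[OF ht_lin(3) f] lin_comp[OF ht_lin(3) g] V]) (use that eq in auto)
 have 2: "f (tens K Rr \<G> w x) = g (tens K Rr \<G> w x)" if w: "w : Rr" and x: "x : \<G>" for w x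
  by (rule Rp.tensor_lin_eq[OF lin_comp[OF bilin_left[OF Hp.tens_bilin x] f[unfolded Hh_eq]] lin_comp[OF bilin_left[OF Hp.tens_bilin x] g[unfolded Hh_eq]] _ w])
    (use 1 x in "simp add: ht_eq")
 show ?thesis
  by (rule Hp.tensor_lin_eq[OF f[unfolded Hh_eq] g[unfolded Hh_eq] _ u[unfolded Hh_eq]]) (rule 2)
qed

text \<open>A path of length two is given by its source and a pair of elements of \<open>X\<close>, written in the
 order used for the entries of \<open>\<Sigma>\<close>.\<close>

definition path2 :: "'l \<Rightarrow> 'x \<times> 'x \<Rightarrow> ('l, 'x) path" where
 "path2 \<kappa> u = (\<kappa>, [(\<kappa>, snd u), (deg (snd u) \<kappa>, fst u)])"

definition arrows2 :: "'l \<Rightarrow> 'x \<times> 'x \<Rightarrow> ('l \<times> 'x) \<times> ('l \<times> 'x)" where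
 "arrows2 \<kappa> u = ((\<kappa>, snd u), (deg (snd u) \<kappa>, fst u))"

lemma arrow_pairs_eq: "arrow_pairs X deg = {arrows2 \<kappa> u |\<kappa> u. u : Y}"
 by (force simp: arrow_pairs_def arrows2_def)

lemma path2_pairs [simp]: "u : Y ==> w : Y ==> (path2 \<kappa> u, path2 \<mu> w) : path_pairs"
 by (auto simp: path2_def path_pairs_def)

lemma arrow_sum:
 assumes V: "abelian_monoid V" and g: "!!u. u : Y ==> g u : V"
  and f: "!!\<kappa>' u. u : Y ==> f (arrows2 \<kappa>' u) = (if \<kappa>' = \<kappa> then g u else \<zero>.V)"
 shows "finsum V f (arrow_pairs X deg) = finsum V g Y"
proof -
 interpret V: abelian_monoid V by fact
 have fin: "finite (arrow_pairs X deg)"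
  by (rule finite_subset[of _ "(UNIV \<times> X) \<times> (UNIV \<times> X)"]) (use finX in "auto simp: arrow_pairs_def")
 have sub: "arrows2 \<kappa> ` Y \<subseteq> arrow_pairs X deg" by (auto simp: arrow_pairs_eq)
 have "finsum V f (arrows2 \<kappa> ` Y) = finsum V f (arrow_pairs X deg)"
  by (rule V.add.finprod_mono_neutral_cong_left[OF fin sub]) (use f g in "auto simp: arrow_pairs_eq")
 moreover have "finsum V f (arrows2 \<kappa> ` Y) = (\<Oplus>.V u\<in>Y. f (arrows2 \<kappa> u))"
  by (rule V.finsum_reindex) (use f g in "auto simp: inj_on_def arrows2_def prod_eq_iff")
 moreover have "... = finsum V g Y" by (rule V.finsum_eqI) (use f g in auto)
 ultimately show ?thesis by simp
qed

abbreviation "Frels \<equiv> frakA_rels K R X deg \<sigma>"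

lemma M_app [simp]: "u : Y ==> k : Y ==> \<Sigma> u k \<kappa> : R"
 by (rule M_closed[OF Sigma_closed])

lemma frakA_rels_eq: "Frels = {(\<Oplus>.\<H> u\<in>Y. ht (\<Sigma> u k \<kappa>) \<one>.R (eb (path2 \<kappa> u) (path2 \<mu> w)))
  \<ominus>.\<H> (\<Oplus>.\<H> u\<in>Y. ht \<one>.R (\<Sigma> w u \<mu>) (eb (path2 \<kappa> k) (path2 \<mu> u))) |\<kappa> \<mu> k w. k : Y \<and> w : Y}"
proof -
 let ?l = "%\<kappa> k \<mu> w. finsum \<H> (%(x, y). ht (w_sigma R \<sigma> x y (fst (arrows2 \<kappa> k)) (snd (arrows2 \<kappa> k))) \<one>.R
      (eb (arrow_path x) (arrow_path (fst (arrows2 \<mu> w))) *.\<G> eb (arrow_path y) (arrow_path (snd (arrows2 \<mu> w))))) (arrow_pairs X deg)"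
 let ?r = "%\<kappa> k \<mu> w. finsum \<H> (%(x, y). ht \<one>.R (w_sigma R \<sigma> (fst (arrows2 \<mu> w)) (snd (arrows2 \<mu> w)) x y)
      (eb (arrow_path (fst (arrows2 \<kappa> k))) (arrow_path x) *.\<G> eb (arrow_path (snd (arrows2 \<kappa> k))) (arrow_path y))) (arrow_pairs X deg)"
 let ?l' = "%\<kappa> k \<mu> w. (\<Oplus>.\<H> u\<in>Y. ht (\<Sigma> u k \<kappa>) \<one>.R (eb (path2 \<kappa> u) (path2 \<mu> w)))" and ?r' = "%\<kappa> k \<mu> w. (\<Oplus>.\<H> u\<in>Y. ht \<one>.R (\<Sigma> w u \<mu>) (eb (path2 \<kappa> k) (path2 \<mu> u)))"
 let ?Z = "{?l' \<kappa> k \<mu> w \<ominus>.\<H> ?r' \<kappa> k \<mu> w |\<kappa> \<mu> k w. k : Y \<and> w : Y}"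
 have zl: "ht \<zero>.R \<one>.R g = \<zero>.\<H>" "ht \<one>.R \<zero>.R g = \<zero>.\<H>" if "g : \<G>" for g
  using lin_zero[OF ht_lin(1) R.md \<H>.md] lin_zero[OF ht_lin(2) R.md \<H>.md] that by auto
 have e: "eb (arrow_path (fst (arrows2 \<kappa> u))) (arrow_path (fst (arrows2 \<mu> w))) *.\<G>
   eb (arrow_path (snd (arrows2 \<kappa> u))) (arrow_path (snd (arrows2 \<mu> w))) = eb (path2 \<kappa> u) (path2 \<mu> w)" for \<kappa> u \<mu> w
  by (simp add: eb_mult arrow_path_def arrows2_def path2_def path_concat_def)
 have l: "?l \<kappa> k \<mu> w
   = ?l' \<kappa> k \<mu> w" if kw: "k : Y" "w : Y" for k w \<kappa> \<mu>
 proof (rule arrow_sum[OF \<H>.M.abelian_monoid_axioms, of _ _ \<kappa>])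
  fix \<kappa>' u assume u: "u : Y"
  have "w_sigma R \<sigma> (fst (arrows2 \<kappa>' u)) (snd (arrows2 \<kappa>' u)) (fst (arrows2 \<kappa> k)) (snd (arrows2 \<kappa> k)) = (if \<kappa>' = \<kappa> then \<Sigma> u k \<kappa> else \<zero>.R)"
   by (simp add: w_sigma_def arrows2_def \<Sigma>_def)
  then show "(case arrows2 \<kappa>' u of (x, y) \<Rightarrow> ht (w_sigma R \<sigma> x y (fst (arrows2 \<kappa> k)) (snd (arrows2 \<kappa> k))) \<one>.R
      (eb (arrow_path x) (arrow_path (fst (arrows2 \<mu> w))) *.\<G> eb (arrow_path y) (arrow_path (snd (arrows2 \<mu> w)))))
    = (if \<kappa>' = \<kappa> then ht (\<Sigma> u k \<kappa>) \<one>.R (eb (path2 \<kappa> u) (path2 \<mu> w)) else \<zero>.\<H>)"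
   using u kw zl by (simp add: case_prod_unfold e)
 qed (use kw in simp)
 have r: "?r \<kappa> k \<mu> w
   = ?r' \<kappa> k \<mu> w" if kw: "k : Y" "w : Y" for k w \<kappa> \<mu>
 proof (rule arrow_sum[OF \<H>.M.abelian_monoid_axioms, of _ _ \<mu>])
  fix \<kappa>' u assume u: "u : Y"
  have "w_sigma R \<sigma> (fst (arrows2 \<mu> w)) (snd (arrows2 \<mu> w)) (fst (arrows2 \<kappa>' u)) (snd (arrows2 \<kappa>' u)) = (if \<kappa>' = \<mu> then \<Sigma> w u \<mu> else \<zero>.R)"
   by (simp add: w_sigma_def arrows2_def \<Sigma>_def)
  then show "(case arrows2 \<kappa>' u of (x, y) \<Rightarrow> ht \<one>.R (w_sigma R \<sigma> (fst (arrows2 \<mu> w)) (snd (arrows2 \<mu> w)) x y)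
      (eb (arrow_path (fst (arrows2 \<kappa> k))) (arrow_path x) *.\<G> eb (arrow_path (snd (arrows2 \<kappa> k))) (arrow_path y)))
    = (if \<kappa>' = \<mu> then ht \<one>.R (\<Sigma> w u \<mu>) (eb (path2 \<kappa> k) (path2 \<mu> u)) else \<zero>.\<H>)"
   using u kw zl by (simp add: case_prod_unfold e)
 qed (use kw in simp)
 have ap: "(a, b) : arrow_pairs X deg \<longleftrightarrow> (\<exists>\<kappa> u. u : Y \<and> a = fst (arrows2 \<kappa> u) \<and> b = snd (arrows2 \<kappa> u))" for a b
  unfolding arrow_pairs_eq by (auto simp: prod_eq_iff)
 show ?thesis
 proof (intro equalityI subsetI)
  fix z assume "z : Frels"
  then obtain \<kappa> k \<mu> w where "k : Y" "w : Y" "z = ?l \<kappa> k \<mu> w \<ominus>.\<H>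
     ?r \<kappa> k \<mu> w"
   unfolding frakA_rels_def ap by blast
  then show "z : ?Z"
   unfolding l[OF \<open>k : Y\<close> \<open>w : Y\<close>] r[OF \<open>k : Y\<close> \<open>w : Y\<close>] by blast
 next
  fix z assume "z : ?Z"
  then obtain \<kappa> \<mu> k w where kw: "k : Y" "w : Y" and z: "z = ?l' \<kappa> k \<mu> w
   \<ominus>.\<H> ?r' \<kappa> k \<mu> w" by blast
  show "z : Frels" unfolding z l[OF kw, symmetric] r[OF kw, symmetric] frakA_rels_def ap using kw by blast
 qed
qed

lemma Frels_closed: "Frels \<subseteq> carrier \<H>"
 unfolding frakA_rels_eq by (auto intro!: \<H>.M.minus_closed \<H>.M.finsum_closedI simp del: mem_Times_iff)

abbreviation "FI \<equiv> frakA_ideal K R X deg \<sigma>"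
abbreviation "\<AA> \<equiv> frakA_alg K R X deg \<sigma>"
abbreviation "fcls \<equiv> frakA_cls K R X deg \<sigma>"
abbreviation "gen \<equiv> frakA_gen K R X deg \<sigma>"

lemma FI_ideal: "ideal FI \<H>"
 unfolding frakA_ideal_def by (rule \<H>.A.genideal_ideal[OF Frels_closed])

sublocale FI: quotient_algebra K \<H> FI
 by (intro quotient_algebra.intro \<H>.k_algebra_axioms FI_ideal)

lemma Fa_eq: "\<AA> = FI.Q" by (simp add: frakA_alg_def)
lemma fcls_eq: "fcls = FI.cls" by (simp add: frakA_cls_def fun_eq_iff)

sublocale \<AA>: k_algebra K \<AA> unfolding Fa_eq by (rule FI.quot_k_algebra)

lemma fcls_closed [simp]: "u : \<H> ==> fcls u : \<AA>" by (simp add: fcls_eq Fa_eq)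
lemma fcls_lin: "fcls : lin_maps K \<H> \<AA>" unfolding fcls_eq Fa_eq by (rule FI.cls_lin)
lemma fcls_mult: "u : \<H> ==> v : \<H> ==> fcls (u *.\<H> v) = fcls u *.\<AA> fcls v"
 by (simp add: fcls_eq Fa_eq FI.cls_mult)
lemma fcls_cases: "a : \<AA> ==> (!!u. u : \<H> ==> a = fcls u ==> P) ==> P"
 unfolding fcls_eq Fa_eq by (rule FI.cls_cases)

lemma gen_closed [simp]: "r : R ==> r' : R ==> (p, q) : path_pairs ==> gen r r' p q : \<AA>"
 by (simp add: frakA_gen_def)

lemma gen_lin:
 "r' : R ==> (p, q) : path_pairs ==> (%r. gen r r' p q) : lin_maps K R \<AA>"
 "r : R ==> (p, q) : path_pairs ==> (%r'. gen r r' p q) : lin_maps K R \<AA>"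
 unfolding frakA_gen_def by (auto intro: lin_comp[OF ht_lin(1) fcls_lin] lin_comp[OF ht_lin(2) fcls_lin])

lemma gen_mult:
 assumes "r : R" "r' : R" "s : R" "s' : R" "(p, q) : path_pairs" "(p', q') : path_pairs"
 shows "gen r r' p q *.\<AA> gen s s' p' q' = (if pt p = fst p' \<and> pt q = fst q'
  then gen (r *.R s) (s' *.R r') (path_concat p p') (path_concat q q') else \<zero>.\<AA>)"
proof -
 have "fcls \<zero>.\<H> = \<zero>.\<AA>" by (rule lin_zero[OF fcls_lin \<H>.md \<AA>.md])
 moreover have "ht (r *.R s) (s' *.R r') \<zero>.\<G> = \<zero>.\<H>"
  by (rule lin_zero[OF ht_lin(3) \<G>.md \<H>.md]) (use assms in auto)
 ultimately show ?thesis
  using assms by (simp add: frakA_gen_def fcls_mult[symmetric] ht_mult eb_mult)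
qed

lemma Fa_lin_eq:
 assumes f: "f : lin_maps K \<AA> V" and g: "g : lin_maps K \<AA> V" and V: "module K V"
  and eq: "!!r r' p q. r : R ==> r' : R ==> (p, q) : path_pairs ==> f (gen r r' p q) = g (gen r r' p q)"
  and a: "a : \<AA>"
 shows "f a = g a"
proof -
 obtain u where u: "u : \<H>" "a = fcls u" using a by (rule fcls_cases)
 have "f (fcls u) = g (fcls u)"
  by (rule Hh_lin_eq[OF lin_comp[OF fcls_lin f] lin_comp[OF fcls_lin g] V _ u(1)]) (use eq in "simp add: frakA_gen_def")
 then show ?thesis using u by simp
qed

lemma Fa_induct [consumes 1, case_names gen add]:
 assumes a: "a : \<AA>"
  and g: "!!r r' p q. r : R ==> r' : R ==> (p, q) : path_pairs ==> P (gen r r' p q)"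
  and p: "!!x y. x : \<AA> ==> y : \<AA> ==> P x ==> P y ==> P (x \<oplus>.\<AA> y)"
 shows "P a"
proof -
 obtain u where u: "u : \<H>" "a = fcls u" using a by (rule fcls_cases)
 have 0: "P (fcls (tens K Rr \<G> w \<zero>.\<G>))" if "w : Rr" for w
 proof -
  have "(((undefined, []), (undefined, [])) :: ('l, 'x) path \<times> ('l, 'x) path) : path_pairs" by (simp add: path_pairs_def)
  then have "P (gen \<zero>.R \<one>.R (undefined, []) (undefined, []))" by (rule g[rotated 2]) auto
  moreover have "gen \<zero>.R \<one>.R (undefined, []) (undefined, []) = \<zero>.\<AA>"
   by (rule lin_zero[OF gen_lin(1) R.md \<AA>.md]) (simp_all add: path_pairs_def)
  moreover have "fcls (tens K Rr \<G> w \<zero>.\<G>) = \<zero>.\<AA>"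
   using lin_zero[OF bilin_right[OF Hp.tens_bilin that] \<G>.md Hp.tensor_k_algebra[THEN k_algebra.axioms(1)]]
    lin_zero[OF fcls_lin \<H>.md \<AA>.md] by (simp add: Hh_eq)
  ultimately show ?thesis by simp
 qed
 have 1: "P (fcls (ht r r' (k \<odot>.\<G> eb p q)))" if "r : R" "r' : R" "k : K" "(p, q) : path_pairs" for r r' k p q
 proof -
  have "ht r r' (k \<odot>.\<G> eb p q) = ht (k \<odot>.R r) r' (eb p q)"
   using that by (simp add: lin_smult[OF ht_lin(1)] lin_smult[OF ht_lin(3)])
  then show ?thesis using that g[of "k \<odot>.R r" r' p q] by (simp add: frakA_gen_def)
 qed
 have 2: "P (fcls (ht r r' h))" if r: "r : R" "r' : R" and h: "h : \<G>" for r r' h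
  using h unfolding Gg_eq
 proof (induction h rule: R.basis_induct)
  case zero show ?case using 0[of "rt r r'"] r by (simp add: Gg_eq ht_eq)
 next
  case (step k s h)
  obtain a b where s: "s = (a, b)" by (cases s)
  then have c: "(a, b) : path_pairs" "h : \<G>" "k : K" "P (fcls (ht r r' h))" using step by (simp_all add: Gg_eq)
  have "P (fcls (ht r r' (k \<odot>.\<G> eb a b)) \<oplus>.\<AA> fcls (ht r r' h))"
   using c r by (intro p 1) simp_all
  moreover have "fcls (ht r r' (k \<odot>.\<G> eb a b \<oplus>.\<G> h)) = fcls (ht r r' (k \<odot>.\<G> eb a b)) \<oplus>.\<AA> fcls (ht r r' h)"
   using c r by (simp add: lin_add[OF ht_lin(3)] lin_add[OF fcls_lin])
  ultimately show ?case by (simp add: Gg_eq s)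
 qed
 have 3: "P (fcls (tens K Rr \<G> w h))" if w: "w : Rr" and h: "h : \<G>" for w h
  using w
 proof (induction w rule: Rp.tensor_induct)
  case (tens r r') then show ?case using 2[of r r' h] h by (simp add: ht_eq)
 next
  case (add x y)
  have "fcls (tens K Rr \<G> (x \<oplus>\<^bsub>Rr\<^esub> y) h) = fcls (tens K Rr \<G> x h) \<oplus>.\<AA> fcls (tens K Rr \<G> y h)"
   using add h lin_add[OF lin_comp[OF bilin_left[OF Hp.tens_bilin h] fcls_lin[unfolded Hh_eq]]] by simp
  then show ?case using add h p[OF fcls_closed fcls_closed] by (simp add: Hh_eq)
 qed
 have "P (fcls u)" using u(1) unfolding Hh_eq
 proof (induction u rule: Hp.tensor_induct)
  case (tens a b) then show ?case by (rule 3)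
 next
  case (add x y)
  then show ?case using p[OF fcls_closed fcls_closed, of x y] lin_add[OF fcls_lin, of x y] by (simp add: Hh_eq)
 qed
 then show ?thesis using u by simp
qed

end

context ybe_data begin

abbreviation "sF \<equiv> frakA_source K R X deg \<sigma>"
abbreviation "tF \<equiv> frakA_target K R X deg \<sigma>"

text \<open>The elements that \<open>\<Phi>\<close> sends to \<open>L\<^sub>a\<^sub>b\<close>.\<close>

definition ell :: "'x \<Rightarrow> 'x \<Rightarrow> ('k, 'r, 'l, 'x) frakA_elt" where
 "ell a b = finsum \<AA> (%(\<kappa>, \<mu>). gen \<one>.R \<one>.R (\<kappa>, [(\<kappa>, a)]) (\<mu>, [(\<mu>, b)])) UNIV"

lemma short_pairs [simp]:
 "((\<kappa>, []), (\<mu>, [])) : path_pairs"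
 "a : X ==> b : X ==> ((\<kappa>, [(\<kappa>, a)]), (\<mu>, [(\<mu>, b)])) : path_pairs"
 by (simp_all add: path_pairs_def)

lemma sF_closed [simp]: "f : M ==> sF f : \<AA>"
 unfolding frakA_source_def using M_closed by (intro \<AA>.M.finsum_closedI) auto
lemma tF_closed [simp]: "f : M ==> tF f : \<AA>"
 unfolding frakA_target_def using M_closed by (intro \<AA>.M.finsum_closedI) auto
lemma ell_closed [simp]: "a : X ==> b : X ==> ell a b : \<AA>"
 unfolding ell_def by (intro \<AA>.M.finsum_closedI) auto

lemma tF_eq: "f : M ==> tF f = finsum \<AA> (%(\<kappa>, \<mu>). gen \<one>.R (f \<mu>) (\<kappa>, []) (\<mu>, [])) UNIV"
proof -
 assume f: "f : M"
 have "finsum \<AA> (%(\<kappa>, \<mu>). gen \<one>.R (f \<mu>) (\<kappa>, []) (\<mu>, [])) (prod.swap ` UNIV) = (\<Oplus>.\<AA> z\<in>UNIV. (%(\<kappa>, \<mu>). gen \<one>.R (f \<mu>) (\<kappa>, []) (\<mu>, [])) (prod.swap z))"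
  by (rule \<AA>.M.finsum_reindex) (use M_closed[OF f] in auto)
 then show ?thesis by (simp add: frakA_target_def case_prod_unfold)
qed

text \<open>In a product with a generator, exactly one term of a sum over all vertices survives.\<close>

lemma vertex_sum:
 assumes "x (\<kappa>0, \<mu>0) = y" "y : \<AA>" "!!\<kappa> \<mu>. (\<kappa>, \<mu>) ~= (\<kappa>0, \<mu>0) ==> x (\<kappa>, \<mu>) = \<zero>.\<AA>"
 shows "finsum \<AA> x (UNIV :: ('l \<times> 'l) set) = y"
proof -
 have "finsum \<AA> x UNIV = (\<Oplus>.\<AA> z\<in>(UNIV :: ('l \<times> 'l) set). if z = (\<kappa>0, \<mu>0) then y else \<zero>.\<AA>)"
  using assms by (intro \<AA>.M.finsum_eqI) (auto split: if_splits)
 then show ?thesis using assms(2) by (subst (asm) \<AA>.M.finsum_delta) auto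
qed

lemma
 assumes f: "f : M" and g: "r : R" "r' : R" "(p, q) : path_pairs"
 shows s_gen: "sF f *.\<AA> gen r r' p q = gen (f (fst p) *.R r) r' p q"
  and t_gen: "tF f *.\<AA> gen r r' p q = gen r (r' *.R f (fst q)) p q"
  and gen_s: "gen r r' p q *.\<AA> sF f = gen (r *.R f (pt p)) r' p q"
  and gen_t: "gen r r' p q *.\<AA> tF f = gen r (f (pt q) *.R r') p q"
proof -
 note [simp] = M_closed[OF f]
 have c: "path_concat (fst p, []) p = p" "path_concat (fst q, []) q = q" "path_concat v (\<kappa>, []) = v" for \<kappa> and v :: "('l, 'x) path"
  by (simp_all add: path_concat_def)
 show "sF f *.\<AA> gen r r' p q = gen (f (fst p) *.R r) r' p q"
  unfolding frakA_source_def using g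
  by (subst \<AA>.finsum_mult_right, simp, (auto)[1], intro vertex_sum[of _ "fst p" "fst q"]) (auto simp: gen_mult c)
 show "tF f *.\<AA> gen r r' p q = gen r (r' *.R f (fst q)) p q"
  unfolding tF_eq[OF f] using g
  by (subst \<AA>.finsum_mult_right, simp, (auto)[1], intro vertex_sum[of _ "fst p" "fst q"]) (auto simp: gen_mult c)
 show "gen r r' p q *.\<AA> sF f = gen (r *.R f (pt p)) r' p q"
  unfolding frakA_source_def using g
  by (subst \<AA>.finsum_mult_left, simp, (auto)[1], intro vertex_sum[of _ "pt p" "pt q"]) (auto simp: gen_mult c)
 show "gen r r' p q *.\<AA> tF f = gen r (f (pt q) *.R r') p q"
  unfolding tF_eq[OF f] using g
  by (subst \<AA>.finsum_mult_left, simp, (auto)[1], intro vertex_sum[of _ "pt p" "pt q"]) (auto simp: gen_mult c)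
qed

lemma M_one [simp]: "\<one>.M \<kappa> = \<one>.R" by (simp add: map_alg_simps)
lemma M_mult: "(f *.M g) \<kappa> = f \<kappa> *.R g \<kappa>" by (simp add: map_alg_simps)

lemma sF_one: "sF \<one>.M = \<one>.\<AA>" and tF_one: "tF \<one>.M = \<one>.\<AA>"
proof -
 have "sF \<one>.M *.\<AA> \<one>.\<AA> = \<one>.\<AA>"
  by (rule Fa_lin_eq[OF \<AA>.mult_left_lin \<AA>.id_lin \<AA>.md]) (simp_all add: s_gen)
 then show "sF \<one>.M = \<one>.\<AA>" by simp
 have "tF \<one>.M *.\<AA> \<one>.\<AA> = \<one>.\<AA>"
  by (rule Fa_lin_eq[OF \<AA>.mult_left_lin \<AA>.id_lin \<AA>.md]) (simp_all add: t_gen)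
 then show "tF \<one>.M = \<one>.\<AA>" by simp
qed

lemma sF_lin: "sF : lin_maps K M \<AA>"
 unfolding frakA_source_def[abs_def] case_prod_unfold
 by (intro lin_finsum_fun \<AA>.md lin_comp[OF eval_lin gen_lin(1)]) simp_all
lemma tF_lin: "tF : lin_maps K M \<AA>"
 unfolding frakA_target_def[abs_def] case_prod_unfold
 by (intro lin_finsum_fun \<AA>.md lin_comp[OF eval_lin gen_lin(2)]) simp_all

lemma
 assumes x: "x : \<AA>" and y: "!!\<kappa> \<mu>. y \<kappa> \<mu> : \<AA>"
 shows gen_mult_sum: "(!!\<kappa> \<mu>. x *.\<AA> y \<kappa> \<mu> = z \<kappa> \<mu>) ==>
   x *.\<AA> finsum \<AA> (%(\<kappa>, \<mu>). y \<kappa> \<mu>) (UNIV :: ('l \<times> 'l) set) = finsum \<AA> (%(\<kappa>, \<mu>). z \<kappa> \<mu>) UNIV"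
  and mult_gen_sum: "(!!\<kappa> \<mu>. y \<kappa> \<mu> *.\<AA> x = z \<kappa> \<mu>) ==>
   finsum \<AA> (%(\<kappa>, \<mu>). y \<kappa> \<mu>) (UNIV :: ('l \<times> 'l) set) *.\<AA> x = finsum \<AA> (%(\<kappa>, \<mu>). z \<kappa> \<mu>) UNIV"
proof -
 assume z: "!!\<kappa> \<mu>. x *.\<AA> y \<kappa> \<mu> = z \<kappa> \<mu>"
 show "x *.\<AA> finsum \<AA> (%(\<kappa>, \<mu>). y \<kappa> \<mu>) (UNIV :: ('l \<times> 'l) set) = finsum \<AA> (%(\<kappa>, \<mu>). z \<kappa> \<mu>) UNIV"
  using x y by (subst \<AA>.finsum_mult_left) (auto simp: z[symmetric] intro!: \<AA>.M.finsum_eqI)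
next
 assume z: "!!\<kappa> \<mu>. y \<kappa> \<mu> *.\<AA> x = z \<kappa> \<mu>"
 show "finsum \<AA> (%(\<kappa>, \<mu>). y \<kappa> \<mu>) (UNIV :: ('l \<times> 'l) set) *.\<AA> x = finsum \<AA> (%(\<kappa>, \<mu>). z \<kappa> \<mu>) UNIV"
  using x y by (subst \<AA>.finsum_mult_right) (auto simp: z[symmetric] intro!: \<AA>.M.finsum_eqI)
qed

lemma shift_app: "shift \<alpha> f \<kappa> = f (\<alpha> \<kappa>)" by (simp add: shift_def)
lemma const_app: "const_map r \<kappa> = r" by (simp add: const_map_def)
lemma fst_path2 [simp]: "fst (path2 \<kappa> u) = \<kappa>" by (simp add: path2_def)

lemma base_F: "base_maps K \<AA> M \<psi>M JM pM qM sF tF"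
proof
 show "sF : lin_maps K M \<AA>" by (rule sF_lin)
 show "tF : lin_maps K M \<AA>" by (rule tF_lin)
 show "sF \<one>.M = \<one>.\<AA>" by (rule sF_one)
 show "tF \<one>.M = \<one>.\<AA>" by (rule tF_one)
 fix f g assume fg: "f : M" "g : M"
 note [simp] = M_closed[OF fg(1)] M_closed[OF fg(2)]
 show "sF (f *.M g) = sF f *.\<AA> sF g"
  unfolding frakA_source_def[of _ _ _ _ _ g] frakA_source_def[of _ _ _ _ _ "f *.M g"]
  using fg by (intro gen_mult_sum[symmetric]) (simp_all add: s_gen M_mult)
 show "tF (f *.M g) = tF g *.\<AA> tF f"
  unfolding tF_eq[OF fg(1)] tF_eq[OF M.A.m_closed[OF fg]]
  using fg by (intro gen_mult_sum[symmetric]) (simp_all add: t_gen M_mult)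
 have "tF g *.\<AA> sF f = finsum \<AA> (%(\<kappa>, \<mu>). gen (f \<kappa>) (g \<mu>) (\<kappa>, []) (\<mu>, [])) UNIV"
  unfolding frakA_source_def using fg by (intro gen_mult_sum) (simp_all add: t_gen)
 moreover have "sF f *.\<AA> tF g = finsum \<AA> (%(\<kappa>, \<mu>). gen (f \<kappa>) (g \<mu>) (\<kappa>, []) (\<mu>, [])) UNIV"
  unfolding tF_eq[OF fg(2)] using fg by (intro gen_mult_sum) (simp_all add: s_gen)
 ultimately show "tF g *.\<AA> sF f = sF f *.\<AA> tF g" by simp
qed

sublocale Fb: base_maps K \<AA> M \<psi>M JM pM qM sF tF by (rule base_F)

lemma ell_gen:
 assumes ab: "a : X" "b : X" and g: "r : R" "r' : R" "((deg a \<kappa>, qs), (deg b \<mu>, qs')) : path_pairs"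
 shows "ell a b *.\<AA> gen r r' (deg a \<kappa>, qs) (deg b \<mu>, qs') = gen r r' (\<kappa>, (\<kappa>, a) # qs) (\<mu>, (\<mu>, b) # qs')"
proof -
 have "((\<kappa>, (\<kappa>, a) # qs), (\<mu>, (\<mu>, b) # qs')) : path_pairs" using ab g(3) by (simp add: path_pairs_def)
 moreover have "deg a \<kappa>' = deg a \<kappa> \<longleftrightarrow> \<kappa>' = \<kappa>" "deg b \<mu>' = deg b \<mu> \<longleftrightarrow> \<mu>' = \<mu>" for \<kappa>' \<mu>'
  using deg_bij ab by (auto simp: bij_is_inj inj_eq)
 ultimately show ?thesis
  unfolding ell_def using ab g
  by (subst \<AA>.finsum_mult_right, simp, (auto)[1], intro vertex_sum[of _ \<kappa> \<mu>]) (auto simp: gen_mult path_concat_def)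
qed

lemma sF_ell: "a : X ==> b : X ==> f : M ==> sF (Tr a f) *.\<AA> ell a b = ell a b *.\<AA> sF f"
proof -
 assume ab: "a : X" "b : X" and f: "f : M"
 note [simp] = M_closed[OF f]
 have "sF (Tr a f) *.\<AA> ell a b = finsum \<AA> (%(\<kappa>, \<mu>). gen (f (deg a \<kappa>)) \<one>.R (\<kappa>, [(\<kappa>, a)]) (\<mu>, [(\<mu>, b)])) UNIV"
  unfolding ell_def using ab f by (intro gen_mult_sum) (simp_all add: s_gen shift_app)
 moreover have "ell a b *.\<AA> sF f = finsum \<AA> (%(\<kappa>, \<mu>). gen (f (deg a \<kappa>)) \<one>.R (\<kappa>, [(\<kappa>, a)]) (\<mu>, [(\<mu>, b)])) UNIV"
  unfolding ell_def using ab f by (intro mult_gen_sum) (simp_all add: gen_s)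
 ultimately show ?thesis by simp
qed

lemma tF_ell: "a : X ==> b : X ==> f : M ==> tF (Tr b f) *.\<AA> ell a b = ell a b *.\<AA> tF f"
proof -
 assume ab: "a : X" "b : X" and f: "f : M"
 note [simp] = M_closed[OF f]
 have "tF (Tr b f) *.\<AA> ell a b = finsum \<AA> (%(\<kappa>, \<mu>). gen \<one>.R (f (deg b \<mu>)) (\<kappa>, [(\<kappa>, a)]) (\<mu>, [(\<mu>, b)])) UNIV"
  unfolding ell_def using ab f by (intro gen_mult_sum) (simp_all add: t_gen shift_app)
 moreover have "ell a b *.\<AA> tF f = finsum \<AA> (%(\<kappa>, \<mu>). gen \<one>.R (f (deg b \<mu>)) (\<kappa>, [(\<kappa>, a)]) (\<mu>, [(\<mu>, b)])) UNIV"
  unfolding ell_def using ab f by (intro mult_gen_sum) (simp_all add: gen_t)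
 ultimately show ?thesis by simp
qed

lemma LL_ell:
 assumes u: "u : Y" and w: "w : Y"
 shows "LL \<AA> ell u w = finsum \<AA> (%(\<kappa>, \<mu>). gen \<one>.R \<one>.R (path2 \<kappa> u) (path2 \<mu> w)) UNIV"
proof -
 have X: "fst u : X" "snd u : X" "fst w : X" "snd w : X" using u w by auto
 let ?h = "map_prod (deg (snd u)) (deg (snd w))"
 let ?g = "%(\<kappa>, \<mu>). gen \<one>.R \<one>.R (\<kappa>, [(\<kappa>, fst u)]) (\<mu>, [(\<mu>, fst w)])"
 have b: "bij (deg (snd u))" "bij (deg (snd w))" using X deg_bij by auto
 then have h: "inj ?h" "?h ` UNIV = UNIV" by (simp_all add: bij_def prod.inj_map map_prod_surj)
 have "ell (fst u) (fst w) = finsum \<AA> ?g (?h ` UNIV)" unfolding h by (simp add: ell_def)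
 also have "... = (\<Oplus>.\<AA> z\<in>UNIV. ?g (?h z))"
  using h X by (intro \<AA>.M.finsum_reindex) auto
 finally have e: "ell (fst u) (fst w) = finsum \<AA> (%(\<kappa>, \<mu>). gen \<one>.R \<one>.R (deg (snd u) \<kappa>, [(deg (snd u) \<kappa>, fst u)]) (deg (snd w) \<mu>, [(deg (snd w) \<mu>, fst w)])) UNIV"
  by (simp add: case_prod_unfold map_prod_def)
 show ?thesis
  unfolding LL_def e using X by (intro gen_mult_sum) (simp_all add: ell_gen path2_def)
qed

lemma RLL_gen:
 assumes k: "k : Y" and w: "w : Y"
 shows "(\<Oplus>.\<AA> u\<in>Y. gen (\<Sigma> u k \<kappa>) \<one>.R (path2 \<kappa> u) (path2 \<mu> w)) = (\<Oplus>.\<AA> u\<in>Y. gen \<one>.R (\<Sigma> w u \<mu>) (path2 \<kappa> k) (path2 \<mu> u))"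
proof -
 let ?a = "\<Oplus>.\<H> u\<in>Y. ht (\<Sigma> u k \<kappa>) \<one>.R (eb (path2 \<kappa> u) (path2 \<mu> w))"
 let ?b = "\<Oplus>.\<H> u\<in>Y. ht \<one>.R (\<Sigma> w u \<mu>) (eb (path2 \<kappa> k) (path2 \<mu> u))"
 have c: "?a : \<H>" "?b : \<H>" using k w by (auto intro!: \<H>.M.finsum_closedI simp del: mem_Times_iff)
 have "?a \<ominus>.\<H> ?b : Frels" unfolding frakA_rels_eq using k w by blast
 then have "?a \<ominus>.\<H> ?b : FI" unfolding frakA_ideal_def by (rule subsetD[OF \<H>.A.genideal_self[OF Frels_closed]])
 then have "fcls ?a = fcls ?b" unfolding fcls_eq using FI.cls_eq_iff[OF c] by simp
 then show ?thesis
  using k w by (subst (asm) (1 2) lin_finsum[OF fcls_lin \<H>.md \<AA>.md])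
   (auto simp: frakA_gen_def simp del: mem_Times_iff)
qed

lemma RLL_F:
 assumes k: "k : Y" and w: "w : Y"
 shows "(\<Oplus>.\<AA> u\<in>Y. sF (\<Sigma> u k) *.\<AA> LL \<AA> ell u w) = (\<Oplus>.\<AA> u\<in>Y. tF (\<Sigma> w u) *.\<AA> LL \<AA> ell k u)"
proof -
 let ?U = "UNIV :: ('l \<times> 'l) set"
 have finY: "finite Y" using finX by simp
 have "(\<Oplus>.\<AA> u\<in>Y. sF (\<Sigma> u k) *.\<AA> LL \<AA> ell u w) = (\<Oplus>.\<AA> u\<in>Y. \<Oplus>.\<AA> z\<in>?U. gen (\<Sigma> u k (fst z)) \<one>.R (path2 (fst z) u) (path2 (snd z) w))"
 proof (rule \<AA>.M.finsum_eqI)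
  fix u assume u: "u : Y"
  show "sF (\<Sigma> u k) *.\<AA> LL \<AA> ell u w = (\<Oplus>.\<AA> z\<in>?U. gen (\<Sigma> u k (fst z)) \<one>.R (path2 (fst z) u) (path2 (snd z) w))"
   unfolding LL_ell[OF u w] case_prod_unfold[symmetric] using u k w
   by (subst gen_mult_sum[where z = "%\<kappa> \<mu>. gen (\<Sigma> u k \<kappa>) \<one>.R (path2 \<kappa> u) (path2 \<mu> w)"])
     (simp_all add: s_gen case_prod_unfold del: mem_Times_iff)
 qed (use k w in \<open>auto intro!: \<AA>.M.finsum_closedI simp del: mem_Times_iff\<close>)
 also have "... = (\<Oplus>.\<AA> z\<in>?U. \<Oplus>.\<AA> u\<in>Y. gen (\<Sigma> u k (fst z)) \<one>.R (path2 (fst z) u) (path2 (snd z) w))"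
  by (rule \<AA>.M.finsum_swap) (use k w finY in "auto simp del: mem_Times_iff")
 also have "... = (\<Oplus>.\<AA> z\<in>?U. \<Oplus>.\<AA> u\<in>Y. gen \<one>.R (\<Sigma> w u (snd z)) (path2 (fst z) k) (path2 (snd z) u))"
  by (rule \<AA>.M.finsum_eqI, rule RLL_gen) (use k w in \<open>auto intro!: \<AA>.M.finsum_closedI simp del: mem_Times_iff\<close>)
 also have "... = (\<Oplus>.\<AA> u\<in>Y. \<Oplus>.\<AA> z\<in>?U. gen \<one>.R (\<Sigma> w u (snd z)) (path2 (fst z) k) (path2 (snd z) u))"
  by (rule \<AA>.M.finsum_swap) (use k w finY in "auto simp del: mem_Times_iff")
 also have "... = (\<Oplus>.\<AA> u\<in>Y. tF (\<Sigma> w u) *.\<AA> LL \<AA> ell k u)"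
 proof (rule \<AA>.M.finsum_eqI)
  fix u assume u: "u : Y"
  show "(\<Oplus>.\<AA> z\<in>?U. gen \<one>.R (\<Sigma> w u (snd z)) (path2 (fst z) k) (path2 (snd z) u)) = tF (\<Sigma> w u) *.\<AA> LL \<AA> ell k u"
   unfolding LL_ell[OF k u] using u k w
   by (subst gen_mult_sum[where z = "%\<kappa> \<mu>. gen \<one>.R (\<Sigma> w u \<mu>) (path2 \<kappa> k) (path2 \<mu> u)"])
     (simp_all add: t_gen case_prod_unfold del: mem_Times_iff)
 qed (use k w in \<open>auto intro!: \<AA>.A.m_closed \<AA>.M.finsum_closedI simp: LL_ell simp del: mem_Times_iff\<close>)
 finally show ?thesis .
qed

lemma F_rll: "rll_algebra K R \<psi> JR pR qR e X deg \<sigma> \<AA> sF tF ell"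
 by (intro rll_algebra.intro rll_target.intro ybe_data_axioms \<AA>.k_algebra_axioms rll_target_axioms.intro)
   (simp_all add: Fb.s_lin Fb.t_lin Fb.s_mult Fb.t_mult Fb.s_one Fb.t_one Fb.ts_comm sF_ell tF_ell RLL_F)

abbreviation "dM \<equiv> delta_map R :: 'l \<Rightarrow> 'l \<Rightarrow> 'r"

lemma M_maps [simp]: "r : R ==> const_map r : M" "dM \<kappa> : M"
 by (auto simp: map_alg_simps const_map_def delta_map_def)

lemma gen_scalars: "r : R ==> r' : R ==> (p, q) : path_pairs ==>
  gen r r' p q = sF (const_map r) *.\<AA> (tF (const_map r') *.\<AA> gen \<one>.R \<one>.R p q)"
 by (simp add: s_gen t_gen const_app)

lemma gen_vertex: "gen \<one>.R \<one>.R (\<kappa>, []) (\<mu>, []) = sF (dM \<kappa>) *.\<AA> tF (dM \<mu>)"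
proof -
 have z: "gen \<zero>.R r (\<kappa>', []) (\<mu>', []) = \<zero>.\<AA>" "gen r \<zero>.R (\<kappa>', []) (\<mu>', []) = \<zero>.\<AA>" if "r : R" for r \<kappa>' \<mu>'
  using lin_zero[OF gen_lin(1) R.md \<AA>.md] lin_zero[OF gen_lin(2) R.md \<AA>.md] that by auto
 have d [simp]: "dM \<kappa>' \<mu>' : R" for \<kappa>' \<mu>' by (simp add: delta_map_def)
 have "sF (dM \<kappa>) *.\<AA> tF (dM \<mu>) = finsum \<AA> (%(\<kappa>', \<mu>'). gen (dM \<kappa> \<kappa>') (dM \<mu> \<mu>') (\<kappa>', []) (\<mu>', [])) UNIV"
  unfolding tF_eq[OF M_maps(2)] by (intro gen_mult_sum) (simp_all add: s_gen)
 also have "... = gen \<one>.R \<one>.R (\<kappa>, []) (\<mu>, [])"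
  by (rule vertex_sum[of _ \<kappa> \<mu>]) (auto simp: delta_map_def z)
 finally show ?thesis by simp
qed

text \<open>The generator at a pair of paths is a product of vertex idempotents, elements of the base and
  entries \<open>ell a b\<close>.\<close>

lemma F_gen:
 assumes a: "a : \<AA>" and one: "P \<one>.\<AA>"
  and add: "!!x y. x : \<AA> ==> y : \<AA> ==> P x ==> P y ==> P (x \<oplus>.\<AA> y)"
  and s: "!!f x. f : M ==> x : \<AA> ==> P x ==> P (sF f *.\<AA> x)"
  and t: "!!f x. f : M ==> x : \<AA> ==> P x ==> P (tF f *.\<AA> x)"
  and l: "!!a b x. a : X ==> b : X ==> x : \<AA> ==> P x ==> P (ell a b *.\<AA> x)"
 shows "P a"
 using a
proof (induction a rule: Fa_induct)
 case (gen r r' p q)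
 have "P (gen \<one>.R \<one>.R (\<kappa>, qs) (\<mu>, qs'))" if "((\<kappa>, qs), (\<mu>, qs')) : path_pairs" for \<kappa> \<mu> qs qs'
  using that
 proof (induction qs arbitrary: \<kappa> \<mu> qs')
  case Nil
  then have "qs' = []" by (simp add: path_pairs_def)
  then show ?case using s[OF M_maps(2) tF_closed[OF M_maps(2)]] t[OF M_maps(2) \<AA>.A.one_closed one] by (simp add: gen_vertex)
 next
  case (Cons x qs)
  then obtain a b qs'' where x: "x = (\<kappa>, a)" "qs' = (\<mu>, b) # qs''" "a : X" "b : X"
   and pp: "((deg a \<kappa>, qs), (deg b \<mu>, qs'')) : path_pairs"
   by (cases x; cases qs') (auto simp: path_pairs_def)
  then show ?case using Cons.IH[OF pp] l[of a b "gen \<one>.R \<one>.R (deg a \<kappa>, qs) (deg b \<mu>, qs'')"] by (simp add: ell_gen)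
 qed
 then have "P (gen \<one>.R \<one>.R p q)" using gen(3) by (cases p; cases q) auto
 then show ?case using gen by (subst gen_scalars) (simp_all add: s t)
next
 case (add x y)
 then show ?case by (simp add: assms(3))
qed

end

section \<open>The universal property of \<open>\<AA>(w\<^sub>\<sigma>)\<close>\<close>

context ybe_data begin

abbreviation "okz xs \<equiv> \<forall>z\<in>set xs. snd (fst z) : X \<and> snd (snd z) : X"

lemma chain_letters: "chain \<kappa> qs ==> q : set qs ==> snd q : X"
 by (induction qs arbitrary: \<kappa>) auto

lemma okz_pairs: "(p, q) : path_pairs ==> okz (zip (snd p) (snd q))"
proof
 fix z assume pq: "(p, q) : path_pairs" and z: "z : set (zip (snd p) (snd q))"
 have "fst z : set (snd p)" "snd z : set (snd q)"
  using set_zip_leftD[of "fst z" "snd z"] set_zip_rightD[of "fst z" "snd z"] z by auto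
 moreover have "chain (fst p) (snd p)" "chain (fst q) (snd q)" using pq by (auto simp: path_pairs_def)
 ultimately show "snd (fst z) : X \<and> snd (snd z) : X" using chain_letters by blast
qed

text \<open>Moving \<open>s f\<close> or \<open>t f\<close> leftwards through the generators along a path replaces \<open>f\<close> by \<open>move qs f\<close>,
  whose value at the source of the path is the value of \<open>f\<close> at its target.\<close>

definition move :: "('l \<times> 'x) list \<Rightarrow> ('l \<Rightarrow> 'r) \<Rightarrow> 'l \<Rightarrow> 'r" where
 "move qs f = foldr (%q. Tr (snd q)) qs f"

lemma move_simps [simp]: "move [] f = f" "move (q # qs) f = Tr (snd q) (move qs f)"
 by (simp_all add: move_def)

lemma move_closed [simp]: "f : M ==> move qs f : M"
 by (induction qs) auto

lemma move_app: "chain \<kappa> qs ==> move qs f \<kappa> = f (pt (\<kappa>, qs))"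
 by (induction qs arbitrary: \<kappa>) (auto simp: shift_app)

lemma move_const: "move qs (const_map r) = const_map r"
 by (induction qs) (auto simp: shift_def const_map_def)

lemma delta_mult: "f : M ==> dM \<kappa> *.M f = const_map (f \<kappa>) *.M dM \<kappa>"
  "f : M ==> f *.M dM \<kappa> = dM \<kappa> *.M f"
 by (auto simp: fun_eq_iff map_alg_simps const_map_def delta_map_def)

lemma delta_move: "chain \<kappa> qs ==> dM \<kappa> *.M move qs (dM \<kappa>') = (if pt (\<kappa>, qs) = \<kappa>' then dM \<kappa> else \<zero>.M)"
proof
 fix \<mu> assume "chain \<kappa> qs"
 then have "move qs (dM \<kappa>') \<kappa> = dM \<kappa>' (pt (\<kappa>, qs))" by (rule move_app)
 moreover have "move qs (dM \<kappa>') \<mu> : R" by (rule M_closed) simp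
 ultimately show "(dM \<kappa> *.M move qs (dM \<kappa>')) \<mu> = (if pt (\<kappa>, qs) = \<kappa>' then dM \<kappa> else \<zero>.M) \<mu>"
  by (auto simp: map_alg_simps delta_map_def)
qed

lemma const_one: "const_map \<one>.R = \<one>.M" by (rule ext) (simp add: const_map_def)

lemma const_lin: "const_map : lin_maps K R M"
 by (rule lin_mapsI) (auto simp: map_alg_simps const_map_def fun_eq_iff)

lemma sum_delta: "f : M ==> (\<Oplus>.M \<kappa>\<in>UNIV. const_map (f \<kappa>) *.M dM \<kappa>) = f"
proof
 fix \<mu> assume f: "f : M"
 note [simp] = M_closed[OF f]
 have "(\<Oplus>.M \<kappa>\<in>UNIV. const_map (f \<kappa>) *.M dM \<kappa>) \<mu> = (\<Oplus>.R \<kappa>\<in>UNIV. (const_map (f \<kappa>) *.M dM \<kappa>) \<mu>)"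
  by (rule eval_finsum) simp
 also have "... = (\<Oplus>.R \<kappa>\<in>UNIV. if \<kappa> = \<mu> then f \<mu> else \<zero>.R)"
  by (rule R.M.finsum_eqI) (auto simp: map_alg_simps const_map_def delta_map_def)
 also have "... = f \<mu>" by (subst R.M.finsum_delta) auto
 finally show "(\<Oplus>.M \<kappa>\<in>UNIV. const_map (f \<kappa>) *.M dM \<kappa>) \<mu> = f \<mu>" .
qed

end

context rll_target begin

definition "Lw xs = foldr (%(x, y) v. l (snd x) (snd y) *.B v) xs E"

definition "gB p q = s (dM (fst p)) *.B (t (dM (fst q)) *.B Lw (zip (snd p) (snd q)))"

lemma Lw_simps [simp]: "Lw [] = E" "Lw (z # xs) = l (snd (fst z)) (snd (snd z)) *.B Lw xs"
 by (simp_all add: Lw_def case_prod_unfold)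

lemma Lw_closed [simp]: "okz xs ==> Lw xs : B"
 by (induction xs) auto

lemma E_Lw: "okz xs ==> E *.B Lw xs = Lw xs"
 by (cases xs) (auto simp: EE l_unit B.A.m_assoc[symmetric])

lemma Lw_append: "okz xs ==> okz ys ==> Lw (xs @ ys) = Lw xs *.B Lw ys"
 by (induction xs) (auto simp: E_Lw B.A.m_assoc)

lemma Lw_s: "length qs = length qs' ==> okz (zip qs qs') ==> f : M ==>
  Lw (zip qs qs') *.B s f = s (move qs f) *.B Lw (zip qs qs')"
proof (induction qs qs' rule: list_induct2)
 case (Cons x xs y ys)
 have "l (snd x) (snd y) *.B (Lw (zip xs ys) *.B s f) = (l (snd x) (snd y) *.B s (move xs f)) *.B Lw (zip xs ys)"
  using Cons by (simp add: B.A.m_assoc)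
 also have "... = s (Tr (snd x) (move xs f)) *.B (l (snd x) (snd y) *.B Lw (zip xs ys))"
  using Cons by (simp add: B.A.m_assoc sl[symmetric])
 finally show ?case using Cons by (simp add: B.A.m_assoc)
qed (simp add: s_E)

lemma Lw_t: "length qs = length qs' ==> okz (zip qs qs') ==> f : M ==>
  Lw (zip qs qs') *.B t f = t (move qs' f) *.B Lw (zip qs qs')"
proof (induction qs qs' rule: list_induct2)
 case (Cons x xs y ys)
 have "l (snd x) (snd y) *.B (Lw (zip xs ys) *.B t f) = (l (snd x) (snd y) *.B t (move ys f)) *.B Lw (zip xs ys)"
  using Cons by (simp add: B.A.m_assoc)
 also have "... = t (Tr (snd y) (move ys f)) *.B (l (snd x) (snd y) *.B Lw (zip xs ys))"
  using Cons by (simp add: B.A.m_assoc tl[symmetric])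
 finally show ?case using Cons by (simp add: B.A.m_assoc)
qed (simp add: s_E)

lemma s_zero: "s \<zero>.M = \<zero>.B" and t_zero: "t \<zero>.M = \<zero>.B"
 by (rule lin_zero[OF s_lin M.md B.md], rule lin_zero[OF t_lin M.md B.md])

lemma gB_closed [simp]: "(p, q) : path_pairs ==> gB p q : B"
 using okz_pairs[of p q] by (simp add: gB_def)

text \<open>The function \<open>\<delta>\<close> at the source of the second path, moved to the front, tests whether the first path
  ends there.\<close>

lemma gB_mult:
 assumes pq: "(p, q) : path_pairs" and pq': "(p', q') : path_pairs"
 shows "gB p q *.B gB p' q' = (if pt p = fst p' \<and> pt q = fst q' then gB (path_concat p p') (path_concat q q') else \<zero>.B)"
proof -
 let ?w = "Lw (zip (snd p) (snd q))" and ?w' = "Lw (zip (snd p') (snd q'))"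
 let ?m1 = "move (snd p) (dM (fst p'))" and ?m2 = "move (snd q) (dM (fst q'))"
 have len: "length (snd p) = length (snd q)" and ch: "chain (fst p) (snd p)" "chain (fst q) (snd q)" using pq by (auto simp: path_pairs_def)
 note ok = okz_pairs[OF pq] and ok' = okz_pairs[OF pq']
 have "?w *.B (s (dM (fst p')) *.B (t (dM (fst q')) *.B ?w')) = (?w *.B s (dM (fst p'))) *.B (t (dM (fst q')) *.B ?w')"
  using ok ok' by (simp add: B.A.m_assoc)
 also have "... = s ?m1 *.B ((?w *.B t (dM (fst q'))) *.B ?w')"
  unfolding Lw_s[OF len ok M_maps(2)] using ok ok' by (simp add: B.A.m_assoc)
 also have "... = s ?m1 *.B (t ?m2 *.B (?w *.B ?w'))"
  unfolding Lw_t[OF len ok M_maps(2)] using ok ok' by (simp add: B.A.m_assoc)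
 finally have w: "?w *.B (s (dM (fst p')) *.B (t (dM (fst q')) *.B ?w')) = s ?m1 *.B (t ?m2 *.B (?w *.B ?w'))" .
 have "gB p q *.B gB p' q' = s (dM (fst p)) *.B (t (dM (fst q)) *.B (?w *.B (s (dM (fst p')) *.B (t (dM (fst q')) *.B ?w'))))"
  unfolding gB_def using ok ok' by (simp add: B.A.m_assoc)
 also have "... = s (dM (fst p)) *.B ((t (dM (fst q)) *.B s ?m1) *.B (t ?m2 *.B (?w *.B ?w')))"
  unfolding w using ok ok' by (simp add: B.A.m_assoc)
 also have "t (dM (fst q)) *.B s ?m1 = s ?m1 *.B t (dM (fst q))" by (rule ts_comm) simp_all
 also have "s (dM (fst p)) *.B ((s ?m1 *.B t (dM (fst q))) *.B (t ?m2 *.B (?w *.B ?w')))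
   = (s (dM (fst p)) *.B s ?m1) *.B ((t (dM (fst q)) *.B t ?m2) *.B (?w *.B ?w'))"
  using ok ok' by (simp add: B.A.m_assoc)
 also have "s (dM (fst p)) *.B s ?m1 = s (if pt p = fst p' then dM (fst p) else \<zero>.M)"
  using delta_move[OF ch(1), of "fst p'"] by (simp add: s_mult[symmetric])
 also have "t (dM (fst q)) *.B t ?m2 = t (if pt q = fst q' then dM (fst q) else \<zero>.M)"
  using delta_move[OF ch(2), of "fst q'"] by (simp add: t_mult[symmetric] delta_mult(2))
 also have "?w *.B ?w' = Lw (zip (snd p @ snd p') (snd q @ snd q'))"
  using len ok ok' by (simp add: Lw_append)
 finally show ?thesis
  using len ok ok' by (auto simp: gB_def path_concat_def s_zero t_zero Lw_append)
qed

definition "GB = (lin_ext K B (%(p, q). gB p q) :: ('k, 'l, 'x) G_elt \<Rightarrow> 'b)"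

lemma GB_lin: "GB : lin_maps K \<G> B"
 unfolding GB_def Gg_eq by (rule R.lin_ext_lin[OF B.md]) auto
lemma GB_eb: "(p, q) : path_pairs ==> GB (eb p q) = gB p q"
 unfolding GB_def by (subst R.lin_ext_basis_elt[OF B.md]) auto
lemmas GB_closed [simp] = lin_closed[OF GB_lin]
lemma GB_zero: "GB \<zero>.\<G> = \<zero>.B" by (rule lin_zero[OF GB_lin \<G>.md B.md])

lemma GB_mult: "u : \<G> ==> v : \<G> ==> GB (u *.\<G> v) = GB u *.B GB v"
proof -
 assume u: "u : \<G>" and v: "v : \<G>"
 have 1: "GB (eb p q *.\<G> v) = GB (eb p q) *.B GB v" if w: "(p, q) : path_pairs" for p q
  by (rule Gg_lin_eq[OF lin_comp[OF \<G>.mult_left_lin GB_lin] lin_comp[OF GB_lin B.mult_left_lin] B.md _ v])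
    (use w in "simp_all add: eb_mult GB_eb gB_mult GB_zero concat_pairs")
 show ?thesis
  by (rule Gg_lin_eq[OF lin_comp[OF \<G>.mult_right_lin GB_lin] lin_comp[OF GB_lin B.mult_right_lin] B.md _ u])
    (use v in "simp_all add: 1")
qed

definition "CB = tensor_lift K B (%r r'. s (const_map r) *.B t (const_map r'))"

lemma CB_bilin: "bilin K R (op_alg R) B (%r r'. s (const_map r) *.B t (const_map r'))"
 using bilin_comp[OF B.mult_bilin lin_comp[OF const_lin s_lin] lin_comp[OF const_lin t_lin] B.id_lin] by simp

lemma CB_lin: "CB : lin_maps K Rr B"
 unfolding CB_def by (rule Rp.tensor_lift_lin[OF CB_bilin B.md])
lemma CB_rt: "r : R ==> r' : R ==> CB (rt r r') = s (const_map r) *.B t (const_map r')"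
 unfolding CB_def by (subst Rp.tensor_lift_tens[OF CB_bilin B.md]) auto
lemmas CB_closed [simp] = lin_closed[OF CB_lin]

lemma const_mult: "r : R ==> r' : R ==> const_map (r *.R r') = const_map r *.M const_map r'"
 by (auto simp: map_alg_simps const_map_def fun_eq_iff)

lemma st_mult:
 assumes c: "f : M" "g : M" "f' : M" "g' : M"
 shows "s (f *.M f') *.B t (g' *.M g) = s f *.B t g *.B (s f' *.B t g')"
proof -
 have "s f *.B s f' *.B (t g *.B t g') = s f *.B (s f' *.B t g) *.B t g'"
  using c by (simp add: B.A.m_assoc)
 also have "... = s f *.B (t g *.B s f') *.B t g'"
  by (simp only: ts_comm[OF c(3,2)])
 also have "... = s f *.B t g *.B (s f' *.B t g')"
  using c by (simp add: B.A.m_assoc)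
 finally show ?thesis using c by (simp add: s_mult t_mult)
qed

lemma CB_mult: "u : Rr ==> v : Rr ==> CB (u \<otimes>\<^bsub>Rr\<^esub> v) = CB u *.B CB v"
proof (rule Rp.lin_mult_multiplicative[OF B.k_algebra_axioms CB_lin])
 fix r r' q q' assume "r : R" "r' : carrier (op_alg R)" "q : R" "q' : carrier (op_alg R)"
 then show "CB (rt (r *.R q) (r' \<otimes>\<^bsub>op_alg R\<^esub> q')) = CB (rt r r') *.B CB (rt q q')"
  by (simp add: CB_rt const_mult st_mult)
qed

lemma comm_mult:
 assumes "z : B" "x : B" "y : B" "z *.B x = x *.B z" "z *.B y = y *.B z"
 shows "z *.B (x *.B y) = x *.B y *.B z" "x *.B y *.B z = z *.B (x *.B y)"
proof -
 have "z *.B (x *.B y) = x *.B z *.B y" using assms(1-3) by (simp add: assms(4)[symmetric] B.A.m_assoc)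
 also have "... = x *.B y *.B z" using assms(1-3) by (simp add: assms(5) B.A.m_assoc)
 finally show "z *.B (x *.B y) = x *.B y *.B z" .
 then show "x *.B y *.B z = z *.B (x *.B y)" by simp
qed

lemma gB_const:
 assumes pq: "(p, q) : path_pairs" and r: "r : R"
 shows "s (const_map r) *.B gB p q = gB p q *.B s (const_map r)" "t (const_map r) *.B gB p q = gB p q *.B t (const_map r)"
proof -
 have len: "length (snd p) = length (snd q)" using pq by (auto simp: path_pairs_def)
 note ok = okz_pairs[OF pq]
 have c: "const_map r : M" using r by simp
 have d: "const_map r *.M dM \<kappa> = dM \<kappa> *.M const_map r" for \<kappa> by (rule delta_mult(2)[OF c])
 show "s (const_map r) *.B gB p q = gB p q *.B s (const_map r)"
  unfolding gB_def using ok c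
  by (intro comm_mult(1)) (simp_all add: ts_comm Lw_s[OF len ok] move_const s_mult[symmetric] d)
 show "t (const_map r) *.B gB p q = gB p q *.B t (const_map r)"
  unfolding gB_def using ok c
  by (intro comm_mult(1)) (simp_all add: ts_comm Lw_t[OF len ok] move_const t_mult[symmetric] d)
qed

lemma CB_GB: "v : Rr ==> g : \<G> ==> CB v *.B GB g = GB g *.B CB v"
proof -
 assume v: "v : Rr" and g: "g : \<G>"
 have 1: "CB v *.B GB (eb p q) = GB (eb p q) *.B CB v" if pq: "(p, q) : path_pairs" for p q
  by (rule Rp.tensor_lin_eq[OF lin_comp[OF CB_lin B.mult_right_lin] lin_comp[OF CB_lin B.mult_left_lin] _ v])
    (use pq in "simp_all add: CB_rt GB_eb comm_mult(2) gB_const")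
 show ?thesis
  by (rule Gg_lin_eq[OF lin_comp[OF GB_lin B.mult_left_lin] lin_comp[OF GB_lin B.mult_right_lin] B.md _ g])
    (use v 1 in simp_all)
qed

definition "HB = tensor_lift K B (%u g. CB u *.B GB g)"

lemma HB_bilin: "bilin K Rr \<G> B (%u g. CB u *.B GB g)"
 by (rule bilin_comp[OF B.mult_bilin CB_lin GB_lin B.id_lin])
lemma HB_lin: "HB : lin_maps K \<H> B"
 unfolding HB_def Hh_eq by (rule Hp.tensor_lift_lin[OF HB_bilin B.md])
lemma HB_tens: "u : Rr ==> g : \<G> ==> HB (tens K Rr \<G> u g) = CB u *.B GB g"
 unfolding HB_def by (rule Hp.tensor_lift_tens[OF HB_bilin B.md])
lemmas HB_closed [simp] = lin_closed[OF HB_lin]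

lemma HB_ht: "r : R ==> r' : R ==> (p, q) : path_pairs ==>
  HB (ht r r' (eb p q)) = s (const_map r) *.B t (const_map r') *.B gB p q"
 by (simp add: ht_eq HB_tens CB_rt GB_eb)

lemma HB_mult: "u : \<H> ==> v : \<H> ==> HB (u *.\<H> v) = HB u *.B HB v"
 unfolding Hh_eq
proof (rule Hp.lin_mult_multiplicative[OF B.k_algebra_axioms HB_lin[unfolded Hh_eq]])
 fix u g v h assume c: "u : Rr" "g : \<G>" "v : Rr" "h : \<G>"
 have "HB (tens K Rr \<G> (u \<otimes>\<^bsub>Rr\<^esub> v) (g *.\<G> h)) = CB u *.B ((CB v *.B GB g) *.B GB h)"
  using c by (simp add: HB_tens CB_mult GB_mult B.A.m_assoc)
 also have "... = CB u *.B GB g *.B (CB v *.B GB h)"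
  unfolding CB_GB[OF c(3,2)] using c by (simp add: B.A.m_assoc)
 finally show "HB (tens K Rr \<G> (u \<otimes>\<^bsub>Rr\<^esub> v) (g *.\<G> h)) = HB (tens K Rr \<G> u g) *.B HB (tens K Rr \<G> v h)"
  using c by (simp add: HB_tens)
qed

lemma LLt_closed [simp]: "u : Y ==> w : Y ==> LL B l u w : B"
 by (auto simp: LL_def)

lemma gB_path2: "u : Y ==> w : Y ==> gB (path2 \<kappa> u) (path2 \<mu> w) = s (dM \<kappa>) *.B (t (dM \<mu>) *.B LL B l u w)"
 by (auto simp: gB_def path2_def LL_def l_unit)

lemma HB_path2:
 assumes u: "u : Y" and w: "w : Y" and f: "f : M"
 shows "HB (ht (f \<kappa>) \<one>.R (eb (path2 \<kappa> u) (path2 \<mu> w))) = s (dM \<kappa>) *.B t (dM \<mu>) *.B (s f *.B LL B l u w)"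
  "HB (ht \<one>.R (f \<mu>) (eb (path2 \<kappa> u) (path2 \<mu> w))) = s (dM \<kappa>) *.B t (dM \<mu>) *.B (t f *.B LL B l u w)"
proof -
 note one = const_one
 note [simp] = M_closed[OF f] and c = f M_maps
 note st = st_mult[where g = "dM \<mu>" and f' = f and g' = "\<one>.M" and f = "dM \<kappa>", OF M_maps(2) M_maps(2) f M.A.one_closed]
  st_mult[where g = "dM \<mu>" and f' = "\<one>.M" and g' = f and f = "dM \<kappa>", OF M_maps(2) M_maps(2) M.A.one_closed f]
  st_mult[where f' = "dM \<kappa>" and g' = "dM \<mu>" and f = "const_map (f \<kappa>)" and g = "\<one>.M"]
  st_mult[where f' = "dM \<kappa>" and g' = "dM \<mu>" and f = "\<one>.M" and g = "const_map (f \<mu>)"]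
 have 1: "s (const_map (f \<kappa>)) *.B t \<one>.M *.B (s (dM \<kappa>) *.B t (dM \<mu>)) = s (dM \<kappa>) *.B t (dM \<mu>) *.B (s f *.B t \<one>.M)"
  using st(1,3) delta_mult(1)[OF f] by simp
 have 2: "s \<one>.M *.B t (const_map (f \<mu>)) *.B (s (dM \<kappa>) *.B t (dM \<mu>)) = s (dM \<kappa>) *.B t (dM \<mu>) *.B (s \<one>.M *.B t f)"
  using st(2,4) delta_mult(1)[OF f, of \<mu>] delta_mult(2)[OF f, of \<mu>] delta_mult(2)[of "const_map (f \<mu>)" \<mu>] by simp
 show "HB (ht (f \<kappa>) \<one>.R (eb (path2 \<kappa> u) (path2 \<mu> w))) = s (dM \<kappa>) *.B t (dM \<mu>) *.B (s f *.B LL B l u w)"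
  using arg_cong[OF 1, of "%z. z *.B LL B l u w"] u w f
  by (simp add: HB_ht gB_path2 one t_one s_E B.A.m_assoc del: mem_Times_iff)
 show "HB (ht \<one>.R (f \<mu>) (eb (path2 \<kappa> u) (path2 \<mu> w))) = s (dM \<kappa>) *.B t (dM \<mu>) *.B (t f *.B LL B l u w)"
  using arg_cong[OF 2, of "%z. z *.B LL B l u w"] u w f
  by (simp add: HB_ht gB_path2 one s_one s_E B.A.m_assoc del: mem_Times_iff)
qed

lemma Frels_kernel: "Frels \<subseteq> {u \<in> \<H>. HB u = \<zero>.B}"
proof
 fix z assume z: "z : Frels"
 then obtain \<kappa> \<mu> k w where kw: "k : Y" "w : Y" and ze: "z = (\<Oplus>.\<H> u\<in>Y. ht (\<Sigma> u k \<kappa>) \<one>.R (eb (path2 \<kappa> u) (path2 \<mu> w)))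
   \<ominus>.\<H> (\<Oplus>.\<H> u\<in>Y. ht \<one>.R (\<Sigma> w u \<mu>) (eb (path2 \<kappa> k) (path2 \<mu> u)))" (is "z = ?a \<ominus>.\<H> ?b")
  unfolding frakA_rels_eq by blast
 let ?d = "s (dM \<kappa>) *.B t (dM \<mu>)"
 have c: "?a : \<H>" "?b : \<H>" using kw by (auto intro!: \<H>.M.finsum_closedI simp del: mem_Times_iff)
 note fin = lin_finsum[OF HB_lin \<H>.md B.md]
 have "HB ?a = (\<Oplus>.B u\<in>Y. ?d *.B (s (\<Sigma> u k) *.B LL B l u w))"
  using kw by (subst fin) (simp_all add: HB_path2 del: mem_Times_iff cong: B.M.finsum_cong)
 also have "... = ?d *.B (\<Oplus>.B u\<in>Y. s (\<Sigma> u k) *.B LL B l u w)"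
  using kw by (intro B.finsum_mult_left[symmetric]) (simp_all del: mem_Times_iff)
 also have "... = ?d *.B (\<Oplus>.B u\<in>Y. t (\<Sigma> w u) *.B LL B l k u)" by (simp only: RLL[OF kw])
 also have "... = (\<Oplus>.B u\<in>Y. ?d *.B (t (\<Sigma> w u) *.B LL B l k u))"
  using kw by (intro B.finsum_mult_left) (simp_all del: mem_Times_iff)
 also have "... = HB ?b"
  using kw by (subst fin) (simp_all add: HB_path2 del: mem_Times_iff cong: B.M.finsum_cong)
 finally have "HB z = \<zero>.B"
  unfolding ze using lin_minus[OF HB_lin \<H>.md B.md c] HB_closed[OF c(1)] HB_closed[OF c(2)] B.M.minus_zero_iff[of "HB ?a" "HB ?b"] by simp
 then show "z : {u \<in> \<H>. HB u = \<zero>.B}" using z Frels_closed by auto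
qed

lemma HB_kernel: "n : FI ==> HB n = \<zero>.B"
proof -
 have "ideal {u \<in> \<H>. HB u = \<zero>.B} \<H>"
  by (rule kernel_ideal[OF \<H>.k_algebra_axioms B.k_algebra_axioms HB_lin]) (rule HB_mult)
 then show "n : FI ==> HB n = \<zero>.B"
  using \<H>.A.genideal_minimal[OF _ Frels_kernel] by (auto simp: frakA_ideal_def)
qed

definition "FF = induced HB"

lemma FF_lin: "FF : lin_maps K \<AA> B"
 unfolding FF_def Fa_eq by (rule FI.induced_lin[OF HB_lin B.md HB_kernel])
lemma FF_cls: "u : \<H> ==> FF (fcls u) = HB u"
 unfolding FF_def fcls_eq by (rule FI.induced_cls[OF HB_lin B.md HB_kernel])
lemma FF_mult: "x : \<AA> ==> y : \<AA> ==> FF (x *.\<AA> y) = FF x *.B FF y"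
 by (elim fcls_cases) (simp add: fcls_mult[symmetric] FF_cls HB_mult)
lemma FF_gen: "r : R ==> r' : R ==> (p, q) : path_pairs ==>
  FF (gen r r' p q) = s (const_map r) *.B t (const_map r') *.B gB p q"
 by (simp add: frakA_gen_def FF_cls HB_ht)

lemma vertices_sum:
 assumes x: "x : B" and f: "f : M" and g: "g : M"
 shows "(\<Oplus>.B z\<in>(UNIV :: ('l \<times> 'l) set). s (const_map (f (fst z)) *.M dM (fst z)) *.B t (const_map (g (snd z)) *.M dM (snd z)) *.B x)
   = s f *.B t g *.B x"
proof -
 let ?s = "%\<kappa>. s (const_map (f \<kappa>) *.M dM \<kappa>)" and ?t = "%\<mu>. t (const_map (g \<mu>) *.M dM \<mu>)"
 note [simp] = M_closed[OF f] M_closed[OF g]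
 have "finsum B ?s UNIV = s f" "finsum B ?t UNIV = t g"
  using lin_finsum[OF s_lin M.md B.md, of UNIV "%\<kappa>. const_map (f \<kappa>) *.M dM \<kappa>"]
   lin_finsum[OF t_lin M.md B.md, of UNIV "%\<kappa>. const_map (g \<kappa>) *.M dM \<kappa>"] by (simp_all add: sum_delta f g)
 then have "s f *.B t g = (\<Oplus>.B \<kappa>\<in>UNIV. \<Oplus>.B \<mu>\<in>UNIV. ?s \<kappa> *.B ?t \<mu>)"
  using B.finsum_mult_finsum[of UNIV ?s UNIV ?t] by simp
 also have "... = (\<Oplus>.B z\<in>UNIV. ?s (fst z) *.B ?t (snd z))"
  using B.M.finsum_prod[of UNIV UNIV "%\<kappa> \<mu>. ?s \<kappa> *.B ?t \<mu>"] by (simp add: case_prod_unfold)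
 finally have st: "s f *.B t g = (\<Oplus>.B z\<in>(UNIV :: ('l \<times> 'l) set). ?s (fst z) *.B ?t (snd z))" .
 show ?thesis unfolding st by (rule B.finsum_mult_right[symmetric]) (use x in simp_all)
qed

lemma FF_s: "f : M ==> FF (sF f) = s f"
proof -
 assume f: "f : M"
 note [simp] = M_closed[OF f]
 have "FF (sF f) = (\<Oplus>.B z\<in>(UNIV :: ('l \<times> 'l) set). FF (gen (f (fst z)) \<one>.R (fst z, []) (snd z, [])))"
  unfolding frakA_source_def case_prod_unfold by (rule lin_finsum[OF FF_lin \<AA>.md B.md]) simp
 also have "... = (\<Oplus>.B z\<in>(UNIV :: ('l \<times> 'l) set). s (const_map (f (fst z)) *.M dM (fst z)) *.B t (const_map (\<one>.M (snd z)) *.M dM (snd z)) *.B E)"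
  by (rule B.M.finsum_eqI) (simp_all add: FF_gen gB_def s_E const_one t_one s_mult t_mult B.A.m_assoc)
 also have "... = s f" unfolding vertices_sum[OF Ec f M.A.one_closed] using f by (simp add: t_one s_E)
 finally show ?thesis .
qed

lemma FF_t: "f : M ==> FF (tF f) = t f"
proof -
 assume f: "f : M"
 note [simp] = M_closed[OF f]
 have "FF (tF f) = (\<Oplus>.B z\<in>(UNIV :: ('l \<times> 'l) set). FF (gen \<one>.R (f (snd z)) (fst z, []) (snd z, [])))"
  unfolding tF_eq[OF f] case_prod_unfold by (rule lin_finsum[OF FF_lin \<AA>.md B.md]) simp
 also have "... = (\<Oplus>.B z\<in>(UNIV :: ('l \<times> 'l) set). s (const_map (\<one>.M (fst z)) *.M dM (fst z)) *.B t (const_map (f (snd z)) *.M dM (snd z)) *.B E)"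
 proof (rule B.M.finsum_eqI)
  fix z :: "'l \<times> 'l"
  have c: "const_map (f (snd z)) : M" by simp
  show "FF (gen \<one>.R (f (snd z)) (fst z, []) (snd z, [])) = s (const_map (\<one>.M (fst z)) *.M dM (fst z)) *.B t (const_map (f (snd z)) *.M dM (snd z)) *.B E"
   using st_mult[of "\<one>.M" "const_map (f (snd z))" "dM (fst z)" "dM (snd z)"] delta_mult(2)[OF c]
   by (simp add: FF_gen gB_def s_E const_one s_one B.A.m_assoc)
 qed simp
 also have "... = t f" unfolding vertices_sum[OF Ec M.A.one_closed f] using f by (simp add: s_one s_E)
 finally show ?thesis .
qed

lemma FF_one: "FF \<one>.\<AA> = E"
 using FF_s[OF M.A.one_closed] by (simp add: sF_one s_one)

lemma FF_ell: "a : X ==> b : X ==> FF (ell a b) = l a b"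
proof -
 assume ab: "a : X" "b : X"
 have "FF (ell a b) = (\<Oplus>.B z\<in>(UNIV :: ('l \<times> 'l) set). FF (gen \<one>.R \<one>.R (fst z, [(fst z, a)]) (snd z, [(snd z, b)])))"
  unfolding ell_def case_prod_unfold by (rule lin_finsum[OF FF_lin \<AA>.md B.md]) (use ab in simp)
 also have "... = (\<Oplus>.B z\<in>(UNIV :: ('l \<times> 'l) set). s (const_map (\<one>.M (fst z)) *.M dM (fst z)) *.B t (const_map (\<one>.M (snd z)) *.M dM (snd z)) *.B l a b)"
  by (rule B.M.finsum_eqI) (use ab in "simp_all add: FF_gen gB_def s_E const_one s_one t_one l_unit EE B.A.m_assoc[symmetric]")
 also have "... = l a b" unfolding vertices_sum[OF lc[OF ab] M.A.one_closed M.A.one_closed] using ab by (simp add: s_one t_one EE l_unit)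
 finally show ?thesis .
qed

end

section \<open>\<open>\<AA>(w\<^sub>\<sigma>)\<close> as a weak bialgebra\<close>

lemma lin_maps_cong:
 assumes f: "f : lin_maps K P V" and P: "module K P" and eq: "!!x. x : P ==> g x = f x"
 shows "g : lin_maps K P V"
proof -
 interpret P: module K P by fact
 show ?thesis by (rule lin_mapsI) (simp_all add: eq lin_closed[OF f] lin_add[OF f] lin_smult[OF f])
qed

context ybe_data begin

text \<open>A map defined by its values on generators agrees with any linear map on \<open>\<H>\<close> that has these values
  and vanishes on the ideal.\<close>

lemma frakA_lift_eq:
 assumes \<Theta>: "\<Theta> : lin_maps K \<H> V" and V: "module K V" and ker: "!!n. n : FI ==> \<Theta> n = \<zero>.V"
  and \<beta>: "!!r r' p q. r : R ==> r' : R ==> (p, q) : path_pairs ==> \<Theta> (ht r r' (eb p q)) = \<beta> r r' p q"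
  and u: "u : \<H>"
 shows "frakA_lift K V \<beta> (fcls u) = \<Theta> u"
proof -
 interpret V: module K V by fact
 note \<Theta>t = \<Theta>[unfolded Hh_eq]
 have 1: "lin_ext K V (%(p, q). \<beta> r r' p q) g = \<Theta> (ht r r' g)" if r: "r : R" "r' : R" and g: "g : \<G>" for r r' g
 proof (rule Gg_lin_eq[OF _ lin_comp[OF ht_lin(3)[OF r] \<Theta>] V _ g])
  have c: "\<beta> r r' p q : V" if "(p, q) : path_pairs" for p q
   using \<beta>[OF r that] lin_closed[OF \<Theta>, of "ht r r' (eb p q)"] r that by simp
  show "lin_ext K V (%(p, q). \<beta> r r' p q) : lin_maps K \<G> V"
   unfolding Gg_eq by (rule R.lin_ext_lin[OF V]) (use c in auto)
  fix p q assume pq: "(p, q) : path_pairs"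
  show "lin_ext K V (%(p, q). \<beta> r r' p q) (eb p q) = \<Theta> (ht r r' (eb p q))"
   using R.lin_ext_basis_elt[OF V, of "%(p, q). \<beta> r r' p q" "(p, q)"] c[OF pq] \<beta>[OF r pq] by simp
 qed
 have 2: "tensor_lift K V (%r r'. lin_ext K V (%(p, q). \<beta> r r' p q) g) w = \<Theta> (tens K Rr \<G> w g)" if w: "w : Rr" and g: "g : \<G>" for w g
 proof -
  note l = lin_comp[OF bilin_left[OF Hp.tens_bilin g] \<Theta>t]
  have b: "bilin K R (op_alg R) V (%r r'. \<Theta> (ht r r' g))"
   unfolding ht_eq by (rule bilin_comp[OF Rp.tens_bilin R.id_lin Rop.id_lin l])
  have "tensor_lift K V (%r r'. lin_ext K V (%(p, q). \<beta> r r' p q) g) w = tensor_lift K V (%r r'. \<Theta> (ht r r' g)) w"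
   by (rule Rp.tensor_lift_cong[OF b V w, symmetric]) (use 1 g in simp)
  also have "... = \<Theta> (tens K Rr \<G> w g)" by (rule Rp.tensor_lift_eqI[OF b V l w]) (simp add: ht_eq)
  finally show ?thesis .
 qed
 let ?h = "tensor_lift K V (%u g. tensor_lift K V (%r r'. lin_ext K V (%(p, q). \<beta> r r' p q) g) u)"
 have 3: "?h w = \<Theta> w" if w: "w : \<H>" for w
 proof -
  have b: "bilin K Rr \<G> V (%w g. \<Theta> (tens K Rr \<G> w g))"
   by (rule bilin_comp[OF Hp.tens_bilin Rr.id_lin \<G>.id_lin \<Theta>t])
  have "?h w = tensor_lift K V (%w g. \<Theta> (tens K Rr \<G> w g)) w"
   by (rule Hp.tensor_lift_cong[OF b V w[unfolded Hh_eq], symmetric]) (simp add: 2)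
  also have "... = \<Theta> w" by (rule Hp.tensor_lift_eqI[OF b V \<Theta>t w[unfolded Hh_eq]]) simp
  finally show ?thesis .
 qed
 have "induced ?h (FI.cls u) = ?h u"
  by (rule FI.induced_cls[OF lin_maps_cong[OF \<Theta> \<H>.md 3] V _ u])
    (use 3 ker ideal.Icarr[OF FI_ideal] in auto)
 then show ?thesis unfolding frakA_lift_def fcls_eq using 3[OF u] by simp
qed

interpretation Fl: rll_algebra K R \<psi> JR pR qR e X deg \<sigma> \<AA> sF tF ell by (rule F_rll)

abbreviation "\<TT> \<equiv> Fb.T"
abbreviation "tf \<equiv> Fb.tt"
abbreviation "EF \<equiv> Fb.E"

interpretation FD: rll_target K R \<psi> JR pR qR e X deg \<sigma> \<TT> EF "%f. Fl.sDl f" "%f. Fl.tDl f" Fl.lDl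
 by (rule Fl.D_rll)

interpretation FX: rll_target K R \<psi> JR pR qR e X deg \<sigma> \<E> "\<one>.\<E>" sX tX lX by (rule chi_rll)

abbreviation "pth m \<equiv> paths X deg m"

lemma finite_paths: "finite (pth m)"
proof (rule finite_subset)
 have "qs : {qs. set qs \<subseteq> UNIV \<times> X \<and> length qs = m}" if "chain \<kappa> qs" "length qs = m" for \<kappa> qs
  using chain_letters[OF that(1)] that(2) by auto
 then show "pth m \<subseteq> UNIV \<times> {qs. set qs \<subseteq> UNIV \<times> X \<and> length qs = m}" by (auto simp: paths_def)
 show "finite ((UNIV :: 'l set) \<times> {qs. set qs \<subseteq> (UNIV :: 'l set) \<times> X \<and> length qs = m})"
  by (intro finite_cartesian_product finite_lists_length_eq) (use finX in auto)
qed

text \<open>The inverse of a permutation extends a path by an arrow at its source.\<close>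

definition extend :: "'x \<Rightarrow> ('l, 'x) path \<Rightarrow> ('l, 'x) path" where
 "extend c u = (let \<nu> = inv_into UNIV (deg c) (fst u) in (\<nu>, (\<nu>, c) # snd u))"

lemma extend_bij: "bij_betw (%(c, u). extend c u) (X \<times> pth m) (pth (Suc m))"
proof (rule bij_betwI')
 fix z z' assume z: "z : X \<times> pth m" "z' : X \<times> pth m"
 obtain c \<kappa> qs c' \<kappa>' qs' where e: "z = (c, (\<kappa>, qs))" "z' = (c', (\<kappa>', qs'))" by (metis prod.exhaust)
 then have c: "c : X" "c' : X" using z by auto
 show "((%(c, u). extend c u) z = (%(c, u). extend c u) z') = (z = z')"
 proof -
  have "extend c (\<kappa>, qs) = extend c' (\<kappa>', qs') \<longleftrightarrow> inv_into UNIV (deg c) \<kappa> = inv_into UNIV (deg c') \<kappa>' \<and> c = c' \<and> qs = qs'"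
   by (simp add: extend_def Let_def conj_ac)
  then show ?thesis unfolding e prod.case prod.inject using inv_deg(1)[OF c(1), of \<kappa>] inv_deg(1)[OF c(2), of \<kappa>'] by metis
 qed
next
 fix z assume "z : X \<times> pth m"
 then show "(%(c, u). extend c u) z : pth (Suc m)" by (auto simp: extend_def Let_def paths_def inv_deg)
next
 fix v assume "v : pth (Suc m)"
 then obtain \<nu> c qs where v: "v = (\<nu>, (\<nu>, c) # qs)" "c : X" "chain (deg c \<nu>) qs" "length qs = m"
  by (auto simp: paths_def length_Suc_conv)
 then have "v = extend c (deg c \<nu>, qs)" by (simp add: extend_def inv_deg)
 then show "\<exists>z\<in>X \<times> pth m. v = (%(c, u). extend c u) z" using v by (intro bexI[of _ "(c, (deg c \<nu>, qs))"]) (auto simp: paths_def)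
qed

lemma
 assumes a: "a : X" and c: "c : X"
 shows ell_extend: "((deg a \<kappa>, qs), u) : path_pairs ==>
   ell a c *.\<AA> gen \<one>.R \<one>.R (deg a \<kappa>, qs) u = gen \<one>.R \<one>.R (\<kappa>, (\<kappa>, a) # qs) (extend c u)"
  and extend_ell: "(u, (deg a \<kappa>, qs)) : path_pairs ==>
   ell c a *.\<AA> gen \<one>.R \<one>.R u (deg a \<kappa>, qs) = gen \<one>.R \<one>.R (extend c u) (\<kappa>, (\<kappa>, a) # qs)"
proof -
 let ?\<nu> = "inv_into UNIV (deg c) (fst u)"
 have u: "(deg c ?\<nu>, snd u) = u" using c by (simp add: inv_deg)
 show "((deg a \<kappa>, qs), u) : path_pairs ==>
   ell a c *.\<AA> gen \<one>.R \<one>.R (deg a \<kappa>, qs) u = gen \<one>.R \<one>.R (\<kappa>, (\<kappa>, a) # qs) (extend c u)"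
  using ell_gen[OF a c R.A.one_closed R.A.one_closed, of \<kappa> qs ?\<nu> "snd u"] unfolding u by (simp only: extend_def Let_def)
 show "(u, (deg a \<kappa>, qs)) : path_pairs ==>
   ell c a *.\<AA> gen \<one>.R \<one>.R u (deg a \<kappa>, qs) = gen \<one>.R \<one>.R (extend c u) (\<kappa>, (\<kappa>, a) # qs)"
  using ell_gen[OF c a R.A.one_closed R.A.one_closed, of ?\<nu> "snd u" \<kappa> qs] unfolding u by (simp only: extend_def Let_def)
qed

abbreviation "split_sum p q \<equiv> \<Oplus>.\<TT> u\<in>pth (length (snd p)). tf (gen \<one>.R \<one>.R p u) (gen \<one>.R \<one>.R u q)"

lemma pairs_paths: "(p, q) : path_pairs ==> u : pth (length (snd p)) ==> (p, u) : path_pairs \<and> (u, q) : path_pairs"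
 by (auto simp: path_pairs_def paths_def)

lemma split_sum_closed [simp]: "(p, q) : path_pairs ==> split_sum p q : \<TT>"
 by (intro Fb.T.M.finsum_closedI Fb.BB.tens_closed gen_closed) (auto dest: pairs_paths)

lemma sum_dM: "(\<Oplus>.M \<kappa>\<in>UNIV. dM \<kappa>) = \<one>.M"
 using sum_delta[OF M.A.one_closed] by (simp add: const_one)

lemma FD_vertex: "FD.FF (gen \<one>.R \<one>.R (\<kappa>, []) (\<mu>, [])) = EF *.\<TT> split_sum (\<kappa>, []) (\<mu>, [])"
proof -
 let ?g = "gen \<one>.R \<one>.R" and ?st = "%\<kappa> \<mu>. sF (dM \<kappa>) *.\<AA> tF (dM \<mu>)"
 have idem: "dM \<nu> *.M dM \<nu> = dM \<nu>" for \<nu> by (auto simp: fun_eq_iff map_alg_simps delta_map_def)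
 have "split_sum (\<kappa>, []) (\<mu>, []) = (\<Oplus>.\<TT> \<nu>\<in>UNIV. tf (?st \<kappa> \<nu>) (?st \<nu> \<mu>))"
  unfolding list.size snd_conv paths_0
  by (subst Fb.T.M.finsum_reindex) (auto simp: inj_on_def gen_vertex)
 then have "EF *.\<TT> split_sum (\<kappa>, []) (\<mu>, []) = (\<Oplus>.\<TT> \<nu>\<in>UNIV. EF *.\<TT> tf (?st \<kappa> \<nu>) (?st \<nu> \<mu>))"
  by (simp add: Fb.T.finsum_mult_left)
 also have "... = (\<Oplus>.\<TT> \<nu>\<in>UNIV. EF *.\<TT> tf (sF (dM \<kappa>)) (?st \<nu> \<mu>))"
 proof (rule Fb.T.M.finsum_eqI)
  fix \<nu>
  have "?st \<kappa> \<nu> = tF (dM \<nu>) *.\<AA> sF (dM \<kappa>)" by (simp add: Fb.ts_comm)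
  then show "EF *.\<TT> tf (?st \<kappa> \<nu>) (?st \<nu> \<mu>) = EF *.\<TT> tf (sF (dM \<kappa>)) (?st \<nu> \<mu>)"
   using Fb.E_balance[of "dM \<nu>" "sF (dM \<kappa>)" "?st \<nu> \<mu>"] by (simp add: \<AA>.A.m_assoc[symmetric] Fb.s_mult[symmetric] idem)
 qed simp
 also have "... = EF *.\<TT> tf (sF (dM \<kappa>)) (\<Oplus>.\<AA> \<nu>\<in>UNIV. ?st \<nu> \<mu>)"
  by (simp add: Fb.tt_finsum_right Fb.T.finsum_mult_left)
 also have "(\<Oplus>.\<AA> \<nu>\<in>UNIV. ?st \<nu> \<mu>) = sF (\<Oplus>.M \<nu>\<in>UNIV. dM \<nu>) *.\<AA> tF (dM \<mu>)"
  by (subst lin_finsum[OF Fb.s_lin M.md \<AA>.md], simp) (simp add: \<AA>.finsum_mult_right)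
 also have "... = tF (dM \<mu>)" by (simp add: sum_dM Fb.s_one)
 finally have 1: "EF *.\<TT> split_sum (\<kappa>, []) (\<mu>, []) = EF *.\<TT> tf (sF (dM \<kappa>)) (tF (dM \<mu>))" .
 have "FD.FF (?g (\<kappa>, []) (\<mu>, [])) = Fl.sDl (dM \<kappa>) *.\<TT> Fl.tDl (dM \<mu>)"
  by (simp add: gen_vertex FD.FF_mult FD.FF_s FD.FF_t)
 also have "... = EF *.\<TT> tf (sF (dM \<kappa>)) (tF (dM \<mu>))"
  by (rule Fl.EB_mult) (simp_all add: Fl.st_comm Fb.BB.tens_mult)
 finally show ?thesis using 1 by simp
qed

text \<open>An arrow is put in front of a splitting of the path; \<open>extend\<close> is a bijection from the pairs of a new
  middle arrow and a middle path to the longer middle paths.\<close>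

lemma Dl_split:
 assumes ab: "a : X" "b : X" and pq: "((deg a \<kappa>, qs), (deg b \<mu>, qs')) : path_pairs"
 shows "Fl.Dl a b *.\<TT> split_sum (deg a \<kappa>, qs) (deg b \<mu>, qs') = split_sum (\<kappa>, (\<kappa>, a) # qs) (\<mu>, (\<mu>, b) # qs')"
proof -
 let ?m = "length qs" and ?g = "gen \<one>.R \<one>.R"
 let ?p = "(\<kappa>, (\<kappa>, a) # qs)" and ?q = "(\<mu>, (\<mu>, b) # qs')"
 have pp: "((deg a \<kappa>, qs), u) : path_pairs" "(u, (deg b \<mu>, qs')) : path_pairs" if "u : pth ?m" for u
  using pairs_paths[OF pq] that by auto
 have pq': "(?p, ?q) : path_pairs" using pq ab by (simp add: path_pairs_def)
 have ext: "extend c u : pth (Suc ?m)" if "c : X" "u : pth ?m" for c u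
  using bij_betw_apply[OF extend_bij[of ?m], of "(c, u)"] that by simp
 have pe: "(?p, extend c u) : path_pairs" "(extend c u, ?q) : path_pairs" if "c : X" "u : pth ?m" for c u
  using pairs_paths[OF pq', of "extend c u"] ext[OF that] by auto
 have "Fl.Dl a b *.\<TT> split_sum (deg a \<kappa>, qs) (deg b \<mu>, qs')
   = (\<Oplus>.\<TT> c\<in>X. \<Oplus>.\<TT> u\<in>pth ?m. tf (ell a c) (ell c b) *.\<TT> tf (?g (deg a \<kappa>, qs) u) (?g u (deg b \<mu>, qs')))"
  unfolding Fl.Dl_def snd_conv using ab pp by (intro Fb.T.finsum_mult_finsum) auto
 also have "... = (\<Oplus>.\<TT> c\<in>X. \<Oplus>.\<TT> u\<in>pth ?m. tf (?g ?p (extend c u)) (?g (extend c u) ?q))"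
 proof (intro Fb.T.M.finsum_eqI)
  fix c u assume c: "c : X" and u: "u : pth ?m"
  show "tf (ell a c) (ell c b) *.\<TT> tf (?g (deg a \<kappa>, qs) u) (?g u (deg b \<mu>, qs')) = tf (?g ?p (extend c u)) (?g (extend c u) ?q)"
   using c ab pp[OF u] ell_extend[OF ab(1) c pp(1)[OF u]] extend_ell[OF ab(2) c pp(2)[OF u]]
   by (simp add: Fb.BB.tens_mult)
 qed (use pe in "auto intro!: Fb.T.M.finsum_closedI")
 also have "... = (\<Oplus>.\<TT> z\<in>X \<times> pth ?m. tf (?g ?p ((%(c, u). extend c u) z)) (?g ((%(c, u). extend c u) z) ?q))"
  using Fb.T.M.finsum_prod[of X "pth ?m" "%c u. tf (?g ?p (extend c u)) (?g (extend c u) ?q)"] finX finite_paths pe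
  by (simp add: case_prod_unfold)
 also have "... = (\<Oplus>.\<TT> v\<in>(%(c, u). extend c u) ` (X \<times> pth ?m). tf (?g ?p v) (?g v ?q))"
  by (rule Fb.T.M.finsum_reindex[symmetric]) (use extend_bij[of ?m] pairs_paths[OF pq'] in "auto simp: bij_betw_def")
 also have "(%(c, u). extend c u) ` (X \<times> pth ?m) = pth (Suc ?m)" using extend_bij[of ?m] by (simp add: bij_betw_def)
 finally show ?thesis by simp
qed

text \<open>By induction on the length, the universal map into the corner has the values prescribed for the
  comultiplication of \<open>\<AA>(w\<^sub>\<sigma>)\<close>.\<close>

lemma FD_path: "((\<kappa>, qs), (\<mu>, qs')) : path_pairs ==>
  FD.FF (gen \<one>.R \<one>.R (\<kappa>, qs) (\<mu>, qs')) = EF *.\<TT> split_sum (\<kappa>, qs) (\<mu>, qs')"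
proof (induction qs arbitrary: \<kappa> \<mu> qs')
 case Nil
 then have "qs' = []" by (simp add: path_pairs_def)
 then show ?case using FD_vertex by simp
next
 case (Cons x qs)
 then obtain a b qs'' where x: "x = (\<kappa>, a)" "qs' = (\<mu>, b) # qs''" "a : X" "b : X"
  and pp: "((deg a \<kappa>, qs), (deg b \<mu>, qs'')) : path_pairs"
  by (cases x; cases qs') (auto simp: path_pairs_def)
 have "FD.FF (gen \<one>.R \<one>.R (\<kappa>, x # qs) (\<mu>, qs')) = FD.FF (ell a b *.\<AA> gen \<one>.R \<one>.R (deg a \<kappa>, qs) (deg b \<mu>, qs''))"
  using x pp by (simp add: ell_gen)
 also have "... = Fl.lDl a b *.\<TT> (EF *.\<TT> split_sum (deg a \<kappa>, qs) (deg b \<mu>, qs''))"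
  using x pp Cons.IH[OF pp] by (simp only: FD.FF_mult FD.FF_ell ell_closed gen_closed R.A.one_closed)
 also have "... = EF *.\<TT> split_sum (\<kappa>, x # qs) (\<mu>, qs')"
  unfolding x using x split_sum_closed[OF pp] by (intro Fl.EB_mult Fl.Dl_comm Dl_split pp) simp_all
 finally show ?case .
qed

lemma FD_gen:
 assumes r: "r : R" "r' : R" and pq: "(p, q) : path_pairs"
 shows "FD.FF (gen r r' p q) = EF *.\<TT> (\<Oplus>.\<TT> u\<in>pth (length (snd p)). tf (gen r \<one>.R p u) (gen \<one>.R r' u q))"
proof -
 have c: "const_map r : M" "const_map r' : M" using r by simp_all
 have "FD.FF (gen r r' p q) = Fl.sDl (const_map r) *.\<TT> (Fl.tDl (const_map r') *.\<TT> (EF *.\<TT> split_sum p q))"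
  using r pq c FD_path[of "fst p" "snd p" "fst q" "snd q"]
  by (subst gen_scalars) (simp_all add: FD.FF_mult FD.FF_s FD.FF_t)
 also have "Fl.tDl (const_map r') *.\<TT> (EF *.\<TT> split_sum p q) = EF *.\<TT> (tf \<one>.\<AA> (tF (const_map r')) *.\<TT> split_sum p q)"
  by (intro Fl.EB_mult Fl.st_comm c refl) (use c pq split_sum_closed in simp_all)
 also have "Fl.sDl (const_map r) *.\<TT> ... = EF *.\<TT> (tf (sF (const_map r)) \<one>.\<AA> *.\<TT> (tf \<one>.\<AA> (tF (const_map r')) *.\<TT> split_sum p q))"
  by (intro Fl.EB_mult Fl.st_comm c refl) (use c pq split_sum_closed in simp_all)
 also have "tf (sF (const_map r)) \<one>.\<AA> *.\<TT> (tf \<one>.\<AA> (tF (const_map r')) *.\<TT> split_sum p q)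
   = tf (sF (const_map r)) (tF (const_map r')) *.\<TT> split_sum p q"
  using c pq split_sum_closed by (simp add: Fb.T.A.m_assoc[symmetric] Fb.BB.tens_mult)
 also have "... = (\<Oplus>.\<TT> u\<in>pth (length (snd p)). tf (gen r \<one>.R p u) (gen \<one>.R r' u q))"
 proof -
  have "tf (sF (const_map r)) (tF (const_map r')) *.\<TT> tf (gen \<one>.R \<one>.R p u) (gen \<one>.R \<one>.R u q) = tf (gen r \<one>.R p u) (gen \<one>.R r' u q)"
   if "u : pth (length (snd p))" for u
   using pairs_paths[OF pq that] r c by (simp add: Fb.BB.tens_mult s_gen t_gen const_app)
  then show ?thesis using pairs_paths[OF pq] r c by (subst Fb.T.finsum_mult_left) (auto intro!: Fb.T.M.finsum_eqI)
 qed
 finally show ?thesis .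
qed

abbreviation "Fbd \<equiv> frakA_bialgebroid K R X deg \<sigma>"
abbreviation "FB \<equiv> weak_bialg_of K Fbd \<psi>M (map_e K R e)"

lemma Fbd_simps: "carrier Fbd = carrier \<AA>" "mult Fbd = mult \<AA>" "one Fbd = one \<AA>" "zero Fbd = zero \<AA>"
 "add Fbd = add \<AA>" "smult Fbd = smult \<AA>" "source Fbd = sF" "target Fbd = tF"
 "lcounit Fbd = frakA_lift K M (%r r' p q. if p = q then const_map (r *.R r') *.M delta_map R (path_source q) else \<zero>.M)"
 "lcomult Fbd = frakA_lift K (quot_alg \<TT> (balancing_rels K \<AA> M sF tF)) (%r r' p q. balanced_class K \<AA> M sF tF
   (\<Oplus>.\<TT> u\<in>pth (length (snd p)). tf (gen r \<one>.R p u) (gen \<one>.R r' u q)))"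
 by (simp_all add: frakA_bialgebroid_def module.defs left_bialgebroid.defs)

lemma FB_simps [simp]: "carrier FB = carrier \<AA>" "mult FB = mult \<AA>" "one FB = one \<AA>" "zero FB = zero \<AA>"
 "add FB = add \<AA>" "smult FB = smult \<AA>"
 by (simp_all add: weak_bialg_of_simps Fbd_simps)

lemma FB_tensor [simp]: "tensor K FB FB = \<TT>" "tens K FB FB = tf"
 by (rule tensor_ext; simp)+

lemma FB_ext [simp]: "lin_maps K FB V = lin_maps K \<AA> V" "lin_maps K V FB = lin_maps K V \<AA>" "finsum FB = finsum \<AA>"
 by (rule lin_maps_ext; simp)+ (rule a_minus_ext; simp)

lemma FB_k_algebra: "k_algebra K FB"
 by (rule k_algebra_ext[OF \<AA>.k_algebra_axioms]) simp_all

lemma EF_FF: "a : \<AA> ==> EF *.\<TT> FD.FF a = FD.FF a"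
 using FD.FF_mult[of "\<one>.\<AA>" a] by (simp add: FD.FF_one)

lemma FB_comult: "a : \<AA> ==> comult FB a = FD.FF a"
proof (elim fcls_cases)
 fix u assume u: "u : \<H>" and a: "a = fcls u"
 let ?\<Theta> = "%u. Fb.N.cls (FD.HB u)"
 have t: "tensor K Fbd Fbd = \<TT>" "tens K Fbd Fbd = tf"
  by (rule tensor_ext; simp add: Fbd_simps)+
 have c: "(\<Oplus>.\<TT> u\<in>pth (length (snd p)). tf (gen r \<one>.R p u) (gen \<one>.R r' u q)) : \<TT>"
  if "r : R" "r' : R" "(p, q) : path_pairs" for r r' p q
  using pairs_paths[OF that(3)] that by (intro Fb.T.M.finsum_closedI) simp
 have "lcomult Fbd (fcls u) = ?\<Theta> u"
  unfolding Fbd_simps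
 proof (rule frakA_lift_eq[OF lin_comp[OF FD.HB_lin Fb.N.cls_lin] Fb.N.quot_module _ _ u])
  fix n assume "n : FI"
  then show "?\<Theta> n = \<zero>\<^bsub>Fb.N.Q\<^esub>" using Fb.N.cls_zero by (simp add: FD.HB_kernel)
 next
  fix r r' p q assume r: "r : R" "r' : R" and pq: "(p, q) : path_pairs"
  have "FD.HB (ht r r' (eb p q)) = FD.FF (gen r r' p q)" using r pq by (simp add: frakA_gen_def FD.FF_cls)
  then show "?\<Theta> (ht r r' (eb p q)) = balanced_class K \<AA> M sF tF (\<Oplus>.\<TT> u\<in>pth (length (snd p)). tf (gen r \<one>.R p u) (gen \<one>.R r' u q))"
   using Fb.N_E[OF c[OF r pq]] by (simp only: FD_gen[OF r pq] balanced_class_def)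
 qed
 then have l: "lcomult Fbd (fcls u) = balanced_class K \<AA> M sF tF (FD.HB u)" by (simp add: balanced_class_def)
 have "comult FB (fcls u) = EF *.\<TT> FD.HB u"
  unfolding weak_bialg_of_simps(8) l unfolding Fbd_simps t
  by (rule Fb.weak_comult_eq[OF map_e_eq FD.HB_closed[OF u]])
 then show "comult FB a = FD.FF a" using EF_FF[of "fcls u"] u a by (simp add: FD.FF_cls)
qed

lemma FX_path: "((\<kappa>, qs), (\<mu>, qs')) : path_pairs ==>
  FX.FF (gen \<one>.R \<one>.R (\<kappa>, qs) (\<mu>, qs')) \<one>.M = (if (\<kappa>, qs) = (\<mu>, qs') then dM \<mu> else \<zero>.M)"
proof (induction qs arbitrary: \<kappa> \<mu> qs')
 case Nil
 then have "qs' = []" by (simp add: path_pairs_def)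
 moreover have "dM \<kappa> *.M dM \<mu> = (if \<kappa> = \<mu> then dM \<mu> else \<zero>.M)"
  by (auto simp: fun_eq_iff map_alg_simps delta_map_def)
 moreover have "FX.FF (gen \<one>.R \<one>.R (\<kappa>, []) (\<mu>, [])) = sX (dM \<kappa>) *.\<E> tX (dM \<mu>)"
  by (simp add: gen_vertex FX.FF_mult FX.FF_s FX.FF_t)
 moreover have "(sX (dM \<kappa>) *.\<E> tX (dM \<mu>)) \<one>.M = dM \<kappa> *.M dM \<mu>"
  using X_app(2)[OF M.A.one_closed, of "dM \<mu>"] X_app(1)[OF M_maps(2), of "dM \<kappa>" \<mu>] by (simp only: end_alg_simps(2)[OF M.A.one_closed] M.A.l_one[OF M_maps(2)])
 ultimately show ?case by (simp only: prod.inject simp_thms)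
next
 case (Cons x qs)
 then obtain a b qs'' where x: "x = (\<kappa>, a)" "qs' = (\<mu>, b) # qs''" "a : X" "b : X"
  and pp: "((deg a \<kappa>, qs), (deg b \<mu>, qs'')) : path_pairs"
  by (cases x; cases qs') (auto simp: path_pairs_def)
 have inj: "deg a \<kappa> = deg a \<mu> \<longleftrightarrow> \<kappa> = \<mu>" using deg_bij[OF x(3)] by (auto simp: bij_is_inj inj_eq)
 have "gen \<one>.R \<one>.R (\<kappa>, x # qs) (\<mu>, qs') = ell a b *.\<AA> gen \<one>.R \<one>.R (deg a \<kappa>, qs) (deg b \<mu>, qs'')"
  using x pp by (simp add: ell_gen)
 then have "FX.FF (gen \<one>.R \<one>.R (\<kappa>, x # qs) (\<mu>, qs')) \<one>.M = lX a b (if (deg a \<kappa>, qs) = (deg b \<mu>, qs'') then dM (deg b \<mu>) else \<zero>.M)"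
  using x pp Cons.IH[OF pp] by (simp add: FX.FF_mult FX.FF_ell end_alg_simps(2) del: M_one)
 also have "... = (if (\<kappa>, x # qs) = (\<mu>, qs') then dM \<mu> else \<zero>.M)"
 proof (cases "a = b")
  case True
  have "Tr a (dM (deg a \<mu>)) = dM \<mu>" using deg_bij[OF x(3)] by (auto simp: fun_eq_iff shift_def delta_map_def bij_is_inj inj_eq)
  moreover have "Tr a \<zero>.M = \<zero>.M" by (rule lin_zero[OF shift_lin M.md M.md])
  ultimately show ?thesis using True x inj by (auto simp: X_app)
 next
  case False then show ?thesis using x by (auto simp: X_app)
 qed
 finally show ?case .
qed

lemma FX_gen:
 assumes r: "r : R" "r' : R" and pq: "(p, q) : path_pairs"
 shows "FX.FF (gen r r' p q) \<one>.M = (if p = q then const_map (r *.R r') *.M delta_map R (path_source q) else \<zero>.M)"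
proof -
 have c: "const_map r : M" "const_map r' : M" using r by simp_all
 let ?v = "if p = q then dM (fst q) else \<zero>.M"
 have "FX.FF (gen r r' p q) \<one>.M = const_map r *.M (?v *.M const_map r')"
  using r pq c FX_path[of "fst p" "snd p" "fst q" "snd q"]
  by (subst gen_scalars) (simp_all add: FX.FF_mult FX.FF_s FX.FF_t end_alg_simps(2) X_app prod_eq_iff)
 also have "... = (if p = q then const_map (r *.R r') *.M delta_map R (path_source q) else \<zero>.M)"
  using c r delta_mult(2)[OF c(2), of "fst q"] by (simp add: path_source_def M.A.m_assoc FX.const_mult)
 finally show ?thesis .
qed

lemma FB_comult_facts:
 "comult FB : lin_maps K \<AA> \<TT>"
 "!!a b. a : \<AA> ==> b : \<AA> ==> comult FB (a *.\<AA> b) = comult FB a *.\<TT> comult FB b"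
 "comult FB \<one>.\<AA> = EF"
 "!!f. f : M ==> comult FB (sF f) = EF *.\<TT> tf (sF f) \<one>.\<AA>"
 "!!f. f : M ==> comult FB (tF f) = EF *.\<TT> tf \<one>.\<AA> (tF f)"
 "!!a b. a : X ==> b : X ==> comult FB (ell a b) = EF *.\<TT> (\<Oplus>.\<TT> c\<in>X. tf (ell a c) (ell c b))"
proof -
 show "comult FB : lin_maps K \<AA> \<TT>" by (rule lin_maps_cong[OF FD.FF_lin \<AA>.md FB_comult])
 fix a b assume ab: "a : X" "b : X"
 then have "comult FB (ell a b) = Fl.lDl a b" by (simp add: FB_comult FD.FF_ell)
 then show "comult FB (ell a b) = EF *.\<TT> (\<Oplus>.\<TT> c\<in>X. tf (ell a c) (ell c b))" by (simp only: Fl.Dl_def)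
qed (simp_all add: FB_comult FD.FF_mult FD.FF_one FD.FF_s FD.FF_t)

abbreviation "chiF a \<equiv> FX.FF a"

lemma FB_counit: "a : \<AA> ==> counit FB a = \<psi>M (chiF a \<one>.M)"
proof (elim fcls_cases)
 fix u assume u: "u : \<H>" and a: "a = fcls u"
 have "lcounit Fbd (fcls u) = FX.HB u \<one>.M"
  unfolding Fbd_simps
 proof (rule frakA_lift_eq[OF lin_comp[OF FX.HB_lin end_eval_lin] M.md _ _ u])
  fix n assume "n : FI"
  then show "FX.HB n \<one>.M = \<zero>.M" by (simp add: FX.HB_kernel end_alg_simps(4))
 next
  fix r r' p q assume r: "r : R" "r' : R" and pq: "(p, q) : path_pairs"
  have "FX.HB (ht r r' (eb p q)) = FX.FF (gen r r' p q)" using r pq by (simp add: frakA_gen_def FX.FF_cls)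
  then show "FX.HB (ht r r' (eb p q)) \<one>.M = (if p = q then const_map (r *.R r') *.M delta_map R (path_source q) else \<zero>.M)"
   using FX_gen[OF r pq] by simp
 qed simp
 then show "counit FB a = \<psi>M (chiF a \<one>.M)" using u a by (simp add: weak_bialg_of_simps(7) FX.FF_cls)
qed

lemma F_gen_bialg: "gen_bialg K FB M \<psi>M JM pM qM sF tF (%a. chiF a) {True} X (%i. ell) (%i a. tau i a) (%i a. tau' i a)"
proof (intro gen_bialg.intro FB_k_algebra FM.frob_sys_axioms gen_bialg_axioms.intro)
 show "finite X" by (rule finX)
 show "comult FB : lin_maps K FB (tensor K FB FB)"
  using FB_comult_facts(1) by simp
 fix P a
 assume *: "a : FB" "P \<one>\<^bsub>FB\<^esub>" "!!x y. x : FB ==> y : FB ==> P x ==> P y ==> P (x \<oplus>\<^bsub>FB\<^esub> y)"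
  "!!k x. k : K ==> x : FB ==> P x ==> P (k \<odot>\<^bsub>FB\<^esub> x)"
  "!!f x. f : M ==> x : FB ==> P x ==> P (sF f \<otimes>\<^bsub>FB\<^esub> x)"
  "!!f x. f : M ==> x : FB ==> P x ==> P (tF f \<otimes>\<^bsub>FB\<^esub> x)"
  "!!i a b x. i : {True} ==> a : X ==> b : X ==> x : FB ==> P x ==> P (ell a b \<otimes>\<^bsub>FB\<^esub> x)"
 show "P a" by (rule F_gen[of a P]) (use * in simp_all)
next
 note c = lin_closed[OF FX.FF_lin]
 note lin = end_app_lin[OF c] and app = end_app_closed[OF c]
 fix a assume "a : FB"
 then have a: "a : \<AA>" by simp
 show "chiF a : lin_maps K M M" by (rule lin[OF a])
 show "counit FB a = \<psi>M (chiF a \<one>.M)" by (rule FB_counit[OF a])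
 fix b h assume "b : FB" "h : M"
 then show "chiF (a \<otimes>\<^bsub>FB\<^esub> b) h = chiF a (chiF b h)" using a by (simp add: FX.FF_mult end_alg_simps(2))
next
 fix h assume h: "h : M"
 show "(%a. chiF a h) : lin_maps K FB M" using lin_comp[OF FX.FF_lin end_eval_lin[OF h]] by simp
qed (auto simp: Fb.s_lin Fb.t_lin Fb.s_mult Fb.t_mult Fb.s_one Fb.t_one Fb.ts_comm shift_lin shift_mult shift_one Tr_Ti shift_psi_X
   sF_ell tF_ell FB_comult_facts FX.FF_s FX.FF_t FX.FF_ell X_app Fb.E_def)

sublocale FG: gen_bialg K FB M \<psi>M JM pM qM sF tF "%a. chiF a" "{True}" X "%i. ell" "%i a. tau i a" "%i a. tau' i a"
 by (rule F_gen_bialg)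

end

section \<open>The Hopf closure\<close>

context ybe_data begin

lemma A_target_rll: "rll_target K R \<psi> JR pR qR e X deg \<sigma> \<A> \<one>.\<A> sA tA (%a b. LA a b)"
 using A_rll by (rule rll_algebra.axioms)

interpretation FP: rll_target K R \<psi> JR pR qR e X deg \<sigma> \<A> "\<one>.\<A>" sA tA "%a b. LA a b" by (rule A_target_rll)

abbreviation "PhiA \<equiv> Phi K R X deg \<sigma>"

text \<open>\<open>\<Phi>\<close> is the universal map for the data \<open>s\<close>, \<open>t\<close>, \<open>L\<close> in \<open>A\<^sub>\<sigma>\<close>.\<close>

lemma Phi_eq: "a : \<AA> ==> PhiA a = FP.FF a"
proof (elim fcls_cases)
 fix u assume u: "u : \<H>" and a: "a = fcls u"
 have "PhiA (fcls u) = FP.HB u"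
  unfolding Phi_def
 proof (rule frakA_lift_eq[OF FP.HB_lin \<A>.md FP.HB_kernel _ u])
  fix r r' p q assume r: "r : R" "r' : R" and pq: "(p, q) : path_pairs"
  have c: "const_map r : M" "const_map r' : M" using r by simp_all
  let ?w = "%zs. foldr (%(x, y) v. lt (Lgen (snd x) (snd y)) *.\<F> v) zs \<one>.\<F>"
  have w: "?w zs : \<F> \<and> cls (?w zs) = FP.Lw zs" if "okz zs" for zs
   using that by (induction zs) (auto simp: cls_one cls_mult)
  note w = w[OF okz_pairs[OF pq]]
  have cfc: "cf (const_map r) (const_map r') : CA" "cf (dM (fst p)) (dM (fst q)) : CA" using c by simp_all
  have "cc (cf (const_map r) (const_map r') \<otimes>\<^bsub>CA\<^esub> cf (dM (fst p)) (dM (fst q)))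
    = (sA (const_map r) *.\<A> tA (const_map r')) *.\<A> (sA (dM (fst p)) *.\<A> tA (dM (fst q)))"
   using c cfc by (simp only: cc_mult cc_coef M_maps)
  then have "cls (lt (Coef (cf (const_map r) (const_map r') \<otimes>\<^bsub>CA\<^esub> cf (dM (fst p)) (dM (fst q)))) *.\<F> ?w (zip (snd p) (snd q)))
    = (sA (const_map r) *.\<A> tA (const_map r')) *.\<A> (sA (dM (fst p)) *.\<A> tA (dM (fst q))) *.\<A> FP.Lw (zip (snd p) (snd q))"
   using w cfc by (subst cls_mult) simp_all
  also have "... = FP.HB (ht r r' (eb p q))"
   using c r pq okz_pairs[OF pq] by (simp add: FP.HB_ht FP.gB_def \<A>.A.m_assoc)
  finally show "FP.HB (ht r r' (eb p q)) = cls (lt (Coef (cf (const_map r) (const_map r') \<otimes>\<^bsub>CA\<^esub>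
    cf (delta_map R (path_source p)) (delta_map R (path_source q)))) *.\<F> ?w (zip (snd p) (snd q)))"
   by (simp only: path_source_def)
 qed
 then show "PhiA a = FP.FF a" using u a by (simp add: FP.FF_cls)
qed

lemma Phi_localisation: "localisation K FB AB M \<psi>M JM pM qM sF tF (%a. chiF a) sA tA chiA X (%i. ell) (%i a b. vA i a b) (%i a. tau i a) (%i a. tau' i a) PhiA"
proof (intro localisation.intro F_gen_bialg A_gen_bialg localisation_axioms.intro)
 show "PhiA : alg_homs K FB AB"
  by (rule alg_homsI) (simp_all add: lin_maps_cong[OF FP.FF_lin \<AA>.md Phi_eq] Phi_eq FP.FF_mult FP.FF_one)
qed (simp_all add: LN NL Phi_eq FP.FF_s FP.FF_t FP.FF_ell)

text \<open>The antipode of the homomorphism supplies the inverse of the image of the matrix, and the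
  semilinearity of the inverse follows from that of the matrix.\<close>

lemma closure_exists:
 fixes W :: "('k, 'w) weak_bialg"
 assumes W: "weak_bialgebra K W" and fp: "fp : weak_bialg_homs K FB W" and fm: "is_antipode_of K FB W fp fm"
 obtains F where "F : alg_homs K AB W" "!!f. f : M ==> F (sA f) = fp (sF f)" "!!f. f : M ==> F (tA f) = fp (tF f)"
  "!!a b. a : X ==> b : X ==> F (LA a b) = fp (ell a b)" "!!a b. a : X ==> b : X ==> F (NA a b) = fm (ell a b)"
proof -
 interpret antipode_hom K FB M \<psi>M JM pM qM sF tF "%a. chiF a" "{True}" X "%i. ell" "%i a. tau i a" "%i a. tau' i a" W fp fm
  by (intro antipode_hom.intro F_gen_bialg W antipode_hom_axioms.intro fp fm)
 note fpl = fp_lin[simplified] and fpm = fp_mult[simplified] and fp1 = fp_one[simplified]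
 note fpc' [simp] = lin_closed[OF fpl] and fmc' [simp] = lin_closed[OF fm_lin[simplified]]
 have ml: "(\<Oplus>.W c\<in>X. fm (ell a c) *.W fp (ell c b)) = unit_mat W a b"
  and lm: "(\<Oplus>.W c\<in>X. fp (ell a c) *.W fm (ell c b)) = unit_mat W a b" if "a : X" "b : X" for a b
  using m_l[of True a b] l_m[of True a b] that by auto
 have sl: "fp (sF (Tr a f)) *.W fp (ell a b) = fp (ell a b) *.W fp (sF f)"
  and tl: "fp (tF (Tr b f)) *.W fp (ell a b) = fp (ell a b) *.W fp (tF f)" if "a : X" "b : X" "f : M" for a b f
  using that by (simp_all add: fpm[symmetric] sF_ell tF_ell)
 have "A_target K R \<psi> JR pR qR e X deg \<sigma> W \<one>.W (%f. fp (sF f)) (%f. fp (tF f)) (%a b. fp (ell a b)) (%a b. fm (ell a b))"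
 proof (intro A_target.intro rll_target.intro rll_target_axioms.intro A_target_axioms.intro ybe_data_axioms W.k_algebra_axioms)
  show "(%f. fp (sF f)) : lin_maps K M W" "(%f. fp (tF f)) : lin_maps K M W"
   by (rule lin_comp[OF sF_lin fpl], rule lin_comp[OF tF_lin fpl])
 next
  fix k w assume kw: "k : Y" "w : Y"
  have L: "LL W (%a b. fp (ell a b)) u v = fp (LL \<AA> ell u v)" if "u : Y" "v : Y" for u v
   using that by (auto simp: LL_def fpm)
  have Lc: "LL \<AA> ell u v : \<AA>" if "u : Y" "v : Y" for u v using that by (auto simp: LL_def)
  note fin = lin_finsum[OF fpl \<AA>.md W.md]
  have "(\<Oplus>.W u\<in>Y. fp (sF (\<Sigma> u k)) *.W LL W (%a b. fp (ell a b)) u w) = fp (\<Oplus>.\<AA> u\<in>Y. sF (\<Sigma> u k) *.\<AA> LL \<AA> ell u w)"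
   using kw by (subst fin) (auto simp: L fpm Lc simp del: mem_Times_iff intro!: W.M.finsum_eqI)
  also have "... = fp (\<Oplus>.\<AA> u\<in>Y. tF (\<Sigma> w u) *.\<AA> LL \<AA> ell k u)" by (simp only: RLL_F[OF kw])
  also have "... = (\<Oplus>.W u\<in>Y. fp (tF (\<Sigma> w u)) *.W LL W (%a b. fp (ell a b)) k u)"
   using kw by (subst fin) (auto simp: L fpm Lc simp del: mem_Times_iff intro!: W.M.finsum_eqI)
  finally show "(\<Oplus>.W u\<in>Y. fp (sF (\<Sigma> u k)) *.W LL W (%a b. fp (ell a b)) u w) = (\<Oplus>.W u\<in>Y. fp (tF (\<Sigma> w u)) *.W LL W (%a b. fp (ell a b)) k u)" .
 next
  fix a b f assume ab: "a : X" "b : X" and f: "f : M"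
  show "fp (sF f) *.W fm (ell a b) = fm (ell a b) *.W fp (sF (Tr b f))"
   by (rule W.inverse_row_commute[of X "%a b. fp (ell a b)" "%a b. fm (ell a b)" "%a b. fm (ell a b)" "\<one>.W" a b "fp (sF f)" "%c. fp (sF (Tr c f))",
      OF finX _ _ _ _ ml lm]) (use ab f in "simp_all add: sl")
  (* The relation for columns is stated for an element on the right, hence f is written as Ti a (Tr a f). *)
  have "fp (tF (Ti a (Tr a f))) *.W fm (ell a b) = fm (ell a b) *.W fp (tF (Tr a f))"
  proof (rule W.inverse_column_commute[of X "%a b. fp (ell a b)" "%a b. fm (ell a b)" "%a b. fm (ell a b)" "\<one>.W" a b "fp (tF (Tr a f))" "%c. fp (tF (Ti c (Tr a f)))",
      OF finX _ _ _ _ ml lm])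
   fix c d assume "c : X" "d : X"
   then show "fp (tF (Tr a f)) *.W fp (ell c d) = fp (ell c d) *.W fp (tF (Ti d (Tr a f)))"
    using tl[of c d "Ti d (Tr a f)"] f by (simp add: Tr_Ti)
  qed (use ab f in simp_all)
  then show "fp (tF f) *.W fm (ell a b) = fm (ell a b) *.W fp (tF (Tr a f))" using ab by (simp add: Tr_Ti)
 qed (simp_all add: fpm[symmetric] Fb.s_mult Fb.t_mult Fb.ts_comm sF_one tF_one fp1 sF_ell tF_ell lm ml)
 then interpret WT: A_target K R \<psi> JR pR qR e X deg \<sigma> W "\<one>.W" "%f. fp (sF f)" "%f. fp (tF f)" "%a b. fp (ell a b)" "%a b. fm (ell a b)" .
 show thesis
 proof (rule that[of WT.FA])
  show "WT.FA : alg_homs K AB W" by (rule alg_homsI) (simp_all add: WT.FA_lin WT.FA_mult WT.FA_one)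
 qed (simp_all add: WT.FA_s WT.FA_t WT.FA_L WT.FA_N)
qed

theorem A_hopf_closure:
 assumes rigid: "rigid K R X deg \<sigma>"
 shows "hopf_closure TYPE('w) K FB AB PhiA"
proof -
 interpret Lo: localisation K FB AB M \<psi>M JM pM qM sF tF "%a. chiF a" sA tA chiA X "%i. ell" "%i a b. vA i a b" "%i a. tau i a" "%i a. tau' i a" PhiA
  by (rule Phi_localisation)
 show ?thesis
  unfolding hopf_closure_def
 proof (intro conjI allI impI; (elim conjE)?)
  show "weak_bialgebra K FB" by (rule FG.weak_bialg)
  show "weak_hopf_algebra K AB" by (rule rigid_weak_hopf[OF rigid])
  show "PhiA : weak_bialg_homs K FB AB" by (rule Lo.Phi_hom)
 next
  fix W :: "('k, 'w) weak_bialg" and fp fm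
  assume W: "weak_bialgebra K W" and fp: "fp : weak_bialg_homs K FB W" and fm: "is_antipode_of K FB W fp fm"
  obtain F where F: "F : alg_homs K AB W" "!!f. f : M ==> F (sA f) = fp (sF f)" "!!f. f : M ==> F (tA f) = fp (tF f)"
   "!!a b. a : X ==> b : X ==> F (LA a b) = fp (ell a b)" "!!a b. a : X ==> b : X ==> F (NA a b) = fm (ell a b)"
   by (rule closure_exists[OF W fp fm]) blast
  have u: "F : weak_bialg_homs K AB W" "!!h. h : FB ==> F (PhiA h) = fp h"
   by (rule Lo.universal[OF W fp fm F(1)]; simp add: F)+
  show "\<exists>F\<in>weak_bialg_homs K AB W. (\<forall>h\<in>carrier FB. F (PhiA h) = fp h) \<and>
   (\<forall>F'\<in>weak_bialg_homs K AB W. (\<forall>h\<in>carrier FB. F' (PhiA h) = fp h) \<longrightarrow> (\<forall>c\<in>carrier AB. F' c = F c))"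
  proof (intro bexI[OF _ u(1)] conjI ballI impI)
   fix h assume "h : FB" then show "F (PhiA h) = fp h" by (rule u(2))
  next
   fix F' c assume F': "F' : weak_bialg_homs K AB W" "\<forall>h\<in>carrier FB. F' (PhiA h) = fp h" and c: "c : AB"
   have "F' : alg_homs K AB W" using F'(1) by (simp add: in_weak_bialg_homs)
   then show "F' c = F c"
    by (rule Lo.universal_unique[OF weak_bialgebra.axioms(1)[OF W] _ F(1) _ c]) (use F'(2) u(2) in simp)
  qed
 qed
qed

end

theorem corollary5p9:
  fixes K :: "('k, 'm) ring_scheme"
    and R :: "('k, 'r) module"
    and \<psi> :: "'r \<Rightarrow> 'k"
    and e :: "(('r \<times> 'r) \<Rightarrow> 'k) set"
    and X :: "'x set"
    and deg :: "'x \<Rightarrow> 'l::finite \<Rightarrow> 'l"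
    and \<sigma> :: "'x \<Rightarrow> 'x \<Rightarrow> 'x \<Rightarrow> 'x \<Rightarrow> 'l \<Rightarrow> 'r"
  assumes "field K"
    and "k_algebra K R"
    and "idempotent_frobenius_system K R \<psi> e"
    and "finite X"
    and "\<And>a. a \<in> X \<Longrightarrow> bij (deg a)"
    and "\<And>a b c d \<kappa>. \<lbrakk>a \<in> X; b \<in> X; c \<in> X; d \<in> X\<rbrakk> \<Longrightarrow> \<sigma> a b c d \<kappa> \<in> ring_center R"
    and "\<And>a b c d \<kappa>. \<lbrakk>a \<in> X; b \<in> X; c \<in> X; d \<in> X; deg b (deg d \<kappa>) \<noteq> deg a (deg c \<kappa>)\<rbrakk>
           \<Longrightarrow> \<sigma> b d a c \<kappa> = \<zero>\<^bsub>R\<^esub>"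
    and "rigid K R X deg \<sigma>"
  shows "hopf_closure TYPE('b) K
           (weak_bialg_of K (frakA_bialgebroid K R X deg \<sigma>) (map_psi K \<psi>) (map_e K R e))
           (weak_bialg_of K (A_bialgebroid K R X deg \<sigma>) (map_psi K \<psi>) (map_e K R e))
           (Phi K R X deg \<sigma>)"
proof -
 interpret R: k_algebra K R by fact
 interpret RR: alg_pair K R R ..
 have \<psi>: "\<psi> : lin_maps K R (scalars K)" and e: "e : carrier (tensor K R R)"
  and d: "!!l. l : carrier R ==> tensor_lift K R (%x y. \<psi> (l *.R x) \<odot>.R y) e = l"
   "!!l. l : carrier R ==> tensor_lift K R (%x y. \<psi> (y *.R l) \<odot>.R x) e = l"
  and sep: "tensor_lift K R (%x y. x *.R y) e = \<one>.R"
  using assms(3) by (simp_all add: idempotent_frobenius_system_def)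
 obtain n :: nat and p q where p: "p : {..<n} \<rightarrow> carrier R" and q: "q : {..<n} \<rightarrow> carrier R"
  and eq: "e = (\<Oplus>\<^bsub>tensor K R R\<^esub>j\<in>{..<n}. tens K R R (p j) (q j))"
  using e by (rule RR.tensor_finsum)
 have pc: "p j : carrier R" and qc: "q j : carrier R" if "j : {..<n}" for j using that p q by auto
 have lift: "tensor_lift K R \<beta> e = (\<Oplus>.R j\<in>{..<n}. \<beta> (p j) (q j))" if b: "bilin K R R R \<beta>" for \<beta>
 proof -
  have "tensor_lift K R \<beta> e = (\<Oplus>.R j\<in>{..<n}. tensor_lift K R \<beta> (tens K R R (p j) (q j)))"
   unfolding eq using pc qc
   by (intro lin_finsum[OF RR.tensor_lift_lin[OF b R.md] k_algebra.axioms(1)[OF RR.tensor_k_algebra] R.md]) simp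
  also have "... = (\<Oplus>.R j\<in>{..<n}. \<beta> (p j) (q j))"
   using pc qc by (intro R.M.finsum_eqI) (simp_all add: RR.tensor_lift_tens[OF b R.md] bilin_closed[OF b])
  finally show ?thesis .
 qed
 have \<psi>s [simp]: "\<psi> x : carrier K" if "x : carrier R" for x using lin_closed[OF \<psi> that] by simp
 note \<psi>l = lin_add[OF \<psi>, simplified] lin_smult[OF \<psi>, simplified]
 have b1: "bilin K R R R (%x y. \<psi> (l *.R x) \<odot>.R y)" and b2: "bilin K R R R (%x y. \<psi> (y *.R l) \<odot>.R x)" if l: "l : carrier R" for l
  by (rule bilinI; use l in "simp add: \<psi>l R.A.r_distr R.A.l_distr R.smult_mult_left R.smult_mult_right R.smult_l_distr R.smult_r_distr
   R.smult_assoc1[symmetric] R.R.m_comm")+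
 interpret ybe_data K R \<psi> "{..<n}" p q e X deg \<sigma>
 proof (intro ybe_data.intro frob_sys.intro frob_sys_axioms.intro ybe_data_axioms.intro)
  fix l assume l: "l : carrier R"
  show "(\<Oplus>.R j\<in>{..<n}. \<psi> (l *.R p j) \<odot>.R q j) = l" using lift[OF b1[OF l]] d(1)[OF l] by simp
  show "(\<Oplus>.R j\<in>{..<n}. \<psi> (q j *.R l) \<odot>.R p j) = l" using lift[OF b2[OF l]] d(2)[OF l] by simp
 next
  show "(\<Oplus>.R j\<in>{..<n}. p j *.R q j) = \<one>.R" using lift[OF R.mult_bilin] sep by simp
 qed (fact assms \<psi> pc qc eq finite_lessThan)+
 show ?thesis by (rule A_hopf_closure[OF assms(8)])
qed

end
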